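(* Let $T>0$, let $X$ be a Banach space and let $(w_s)_{s\in[0,T]}$ be a Brownian motion on the filtered probability space $(\Omega,\mathcal{A},\mathbb{P},\mathcal{F})$. Let $\Phi,\Psi:[0,T]\to X$ be $Bi_1^\star$-integrable with respect to $(w_t)_t$, and suppose that each $\Xi\in\{\Phi,\Psi\}$ is strongly measurable, differentiable on $[0,T]$, and such that for every $x^*\in X^*$ one has $\langle x^*,\Xi(\cdot)\rangle\in L^2([0,T])$ and $\frac{d}{dt}\langle x^*,\Xi(t)\rangle=\langle x^*,\Xi'(t)\rangle$. Let $C:[0,T]\times\Omega\to X$ be the stochastic process $$C_t=(Bi_1)\int_0^t\Psi(s)\,ds+(Bi_1^\star)\int_0^t\Phi(s)\,dw_s\qquad(\text{under }\mathbb{P}).$$ Suppose there exists $r:[0,T]\to\mathbb{R}$ in $L^2([0,T])$ such that $\Psi(t)=r(t)\Phi(t)$ for every $t\in[0,T]$ and such that the process $$y_t=\exp\Big\{-\frac12\int_0^t r^2(s)\,ds-\int_0^t r(s)\,dw_s\Big\}$$ is a martingale with respect to $\mathcal{F}$. Let $Q^\circ(A)=\int_A y_T\,d\mathbb{P}$ for $A\in\mathcal{A}$ and $\tilde w_t=w_t+\int_0^t r(s)\,ds$. Then $$C_t=(Bi_1^\star)\int_0^t\Phi(s)\,d\tilde w_s\qquad(\text{under }Q^\circ),\quad t\in[0,T].$$ Therefore the process $(C_t)_t$ is a martingale under $Q^\circ$.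
   Context: A partition of a measurable space is a finite or countable family of non-empty, pairwise disjoint measurable sets covering it; $P$ is finer than $P'$ if every $U\in P$ is contained in some $U'\in P'$. First type Birkhoff integral: for a scalar countably additive measure $\nu$ on $(\Omega,\mathcal{A})$, $\Phi:\Omega\to X$ is in $Bi_1(\Omega,\nu)$ if there is $\mathcal{I}\in X$ such that for all $\varepsilon>0$ there is a partition $P_\varepsilon$ such that for every countable partition $(U_n)_n$ finer than $P_\varepsilon$ and all $\omega_n\in U_n$, $\limsup_n\|\sum_{k=1}^n\Phi(\omega_k)\nu(U_k)-\mathcal{I}\|<\varepsilon$ (finite partitions are allowed); $\mathcal{I}=(Bi_1)\int_\Omega\Phi\,d\nu$; integrals over measurable subsets are defined by restriction. The integrals $(Bi_1)\int_0^t\cdots ds$ are with respect to Lebesgue measure on $[0,t]$. $\Phi:[0,T]\to X$ is differentiable on $[0,T]$ if at each $t$ it has a Fréchet differential $\Phi'_t\in\mathcal{L}(\mathbb{R},X)$; one writes $\Phi'(t)=\Phi'_t(1)$. $\Phi$ is stochastic $Bi_1$-integrable ($Bi_1^\star$-integrable) with respect to a Brownian motion $w$ if $\Phi$ is differentiable on $[0,T]$ and for every fixed $\omega\in\Omega$ the function $s\mapsto\Phi'(s)w(s)(\omega)$ is $Bi_1$-integrable on $[0,T]$ with respect to Lebesgue measure. Then, for $[a,b]\subset[0,T]$, $$(Bi_1^\star)\int_a^b\Phi(r)\,dw_r:=\Phi(b)w_b-\Phi(a)w_a-(Bi_1)\int_{[a,b]}\Phi'(r)w_r\,dr,$$ an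 $X$-valued random variable, the last integral being taken pathwise. The process $\tilde w$ is a Brownian motion under $Q^\circ$ by the classical Girsanov theorem, and $(Bi_1^\star)\int\Phi\,d\tilde w$ is defined by the same formula. Real stochastic integrals with respect to $w$ are Itô integrals. Conditional expectation of an $X$-valued $\Phi\in Bi_1(\Omega,\nu)$ given $\mathcal{G}\subset\mathcal{A}$: the strongly $\mathcal{G}$-measurable $\Psi\in Bi_1(\Omega,\nu)$ (if it exists) with $(Bi_1)\int_E\Phi\,d\nu=(Bi_1)\int_E\Psi\,d\nu$ for all $E\in\mathcal{G}$. An $X$-valued process $(C_t)$ is a martingale under $Q^\circ$ (with respect to the natural filtration $\mathcal{G}_t=\sigma(\tilde w_u:u\le t)$ of the $Q^\circ$-Brownian motion $\tilde w$) if $\mathbb{E}^{Q^\circ}(C_t|\mathcal{G}_s)=C_s$ for all $s\le t$. *)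

theory Defs
  imports "HOL-Probability.Probability"
begin

section \<open>The first type Birkhoff integral\<close>

text \<open>
  A finite or countable partition is an enumerated family \<open>U k\<close>, where \<open>k\<close> ranges over the
  initial segment \<open>{k. enat k < N}\<close>: finite partitions have \<open>N < \<infinity>\<close>, infinite
  ones have \<open>N = \<infinity>\<close>.
\<close>

definition countable_partition :: "'a measure \<Rightarrow> enat \<Rightarrow> (nat \<Rightarrow> 'a set) \<Rightarrow> bool" where
  "countable_partition M N U \<longleftrightarrow>
     (\<forall>k. enat k < N \<longrightarrow> U k \<in> sets M \<and> U k \<noteq> {}) \<and>
     disjoint_family_on U {k. enat k < N} \<and>
     (\<Union>k\<in>{k. enat k < N}. U k) = space M"

definition finer_partition ::
    "enat \<Rightarrow> (nat \<Rightarrow> 'a set) \<Rightarrow> enat \<Rightarrow> (nat \<Rightarrow> 'a set) \<Rightarrow> bool" where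
  "finer_partition N U N' V \<longleftrightarrow>
     (\<forall>k. enat k < N \<longrightarrow> (\<exists>j. enat j < N' \<and> U k \<subseteq> V j))"

text \<open>
  The scalar measure enters through the real-valued \<open>measure M\<close>, so the notion is meaningful
  for finite measures \<open>M\<close> only. For a finite partition the partial sums are eventually constant.
\<close>

definition has_bi1_integral ::
    "'a measure \<Rightarrow> ('a \<Rightarrow> 'x::real_normed_vector) \<Rightarrow> 'x \<Rightarrow> bool" where
  "has_bi1_integral M f I \<longleftrightarrow>
     (\<forall>\<epsilon>>0. \<exists>N0 P. countable_partition M N0 P \<and>
        (\<forall>N U p. countable_partition M N U \<longrightarrow> finer_partition N U N0 P \<longrightarrow>
           (\<forall>k. enat k < N \<longrightarrow> p k \<in> U k) \<longrightarrow>
           limsup (\<lambda>n. ereal (norm ((\<Sum>k | k < n \<and> enat k < N. measure M (U k) *\<^sub>R f (p k)) - I)))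
             < ereal \<epsilon>))"

definition bi1_integrable :: "'a measure \<Rightarrow> ('a \<Rightarrow> 'x::real_normed_vector) \<Rightarrow> bool" where
  "bi1_integrable M f \<longleftrightarrow> (\<exists>I. has_bi1_integral M f I)"

definition bi1_integral :: "'a measure \<Rightarrow> ('a \<Rightarrow> 'x::real_normed_vector) \<Rightarrow> 'x" where
  "bi1_integral M f = (THE I. has_bi1_integral M f I)"


section \<open>Measurability, conditional expectations and martingales\<close>

text \<open>
  Strong measurability of \<open>f\<close> with respect to a sub-\<open>\<sigma>\<close>-algebra \<open>G\<close> of \<open>M\<close>: \<open>f\<close> is
  an \<open>M\<close>-almost everywhere limit of \<open>G\<close>-measurable simple functions.
\<close>

definition strongly_measurable ::
    "'a measure \<Rightarrow> 'a measure \<Rightarrow> ('a \<Rightarrow> 'x::real_normed_vector) \<Rightarrow> bool" where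
  "strongly_measurable M G f \<longleftrightarrow>
     (\<exists>s. (\<forall>n. simple_function G (s n)) \<and> (AE x in M. (\<lambda>n. s n x) \<longlonglongrightarrow> f x))"

definition square_integrable :: "'a measure \<Rightarrow> ('a \<Rightarrow> real) \<Rightarrow> bool" where
  "square_integrable M f \<longleftrightarrow> f \<in> borel_measurable M \<and> integrable M (\<lambda>x. (f x)\<^sup>2)"

text \<open>\<open>g\<close> is a version of the conditional expectation of \<open>f\<close> given \<open>G\<close>.\<close>

definition is_bi1_cond_exp ::
    "'a measure \<Rightarrow> 'a measure \<Rightarrow> ('a \<Rightarrow> 'x::real_normed_vector) \<Rightarrow> ('a \<Rightarrow> 'x) \<Rightarrow> bool" where
  "is_bi1_cond_exp M G f g \<longleftrightarrow>
     bi1_integrable M f \<and> strongly_measurable M G g \<and> bi1_integrable M g \<and>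
     (\<forall>E\<in>sets G. bi1_integral (restrict_space M E) f = bi1_integral (restrict_space M E) g)"

text \<open>All filtrations and processes are indexed by \<open>{0..T}\<close>; other values are irrelevant.\<close>

definition filtration_upto :: "'w measure \<Rightarrow> (real \<Rightarrow> 'w measure) \<Rightarrow> real \<Rightarrow> bool" where
  "filtration_upto M F T \<longleftrightarrow>
     (\<forall>t\<in>{0..T}. subalgebra M (F t)) \<and>
     (\<forall>s t. 0 \<le> s \<and> s \<le> t \<and> t \<le> T \<longrightarrow> sets (F s) \<subseteq> sets (F t))"

definition natural_filtration :: "'w measure \<Rightarrow> (real \<Rightarrow> 'w \<Rightarrow> real) \<Rightarrow> real \<Rightarrow> 'w measure" where
  "natural_filtration M Y t =
     sigma (space M) (\<Union>u\<in>{0..t}. {Y u -` B \<inter> space M | B. B \<in> sets borel})"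

definition real_martingale ::
    "'w measure \<Rightarrow> (real \<Rightarrow> 'w measure) \<Rightarrow> real \<Rightarrow> (real \<Rightarrow> 'w \<Rightarrow> real) \<Rightarrow> bool" where
  "real_martingale M F T Y \<longleftrightarrow>
     (\<forall>t\<in>{0..T}. Y t \<in> borel_measurable (F t) \<and> integrable M (Y t)) \<and>
     (\<forall>s t. 0 \<le> s \<and> s \<le> t \<and> t \<le> T \<longrightarrow>
        (AE \<omega> in M. real_cond_exp M (F s) (Y t) \<omega> = Y s \<omega>))"

definition bi1_martingale ::
    "'w measure \<Rightarrow> (real \<Rightarrow> 'w measure) \<Rightarrow> real \<Rightarrow> (real \<Rightarrow> 'w \<Rightarrow> 'x::real_normed_vector) \<Rightarrow> bool" where
  "bi1_martingale M G T C \<longleftrightarrow>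
     (\<forall>s t. 0 \<le> s \<and> s \<le> t \<and> t \<le> T \<longrightarrow> is_bi1_cond_exp M (G s) (C t) (C s))"


section \<open>Brownian motion and the Ito integral\<close>

definition brownian_motion ::
    "'w measure \<Rightarrow> (real \<Rightarrow> 'w measure) \<Rightarrow> real \<Rightarrow> (real \<Rightarrow> 'w \<Rightarrow> real) \<Rightarrow> bool" where
  "brownian_motion M F T w \<longleftrightarrow>
     prob_space M \<and> filtration_upto M F T \<and>
     (\<forall>t\<in>{0..T}. w t \<in> borel_measurable (F t)) \<and>
     (AE \<omega> in M. w 0 \<omega> = 0) \<and>
     (AE \<omega> in M. continuous_on {0..T} (\<lambda>t. w t \<omega>)) \<and>
     (\<forall>s t. 0 \<le> s \<and> s < t \<and> t \<le> T \<longrightarrow>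
        distributed M lborel (\<lambda>\<omega>. w t \<omega> - w s \<omega>) (normal_density 0 (sqrt (t - s))) \<and>
        prob_space.indep_set M (sets (F s))
          (sets (vimage_algebra (space M) (\<lambda>\<omega>. w t \<omega> - w s \<omega>) borel)))"

text \<open>
  Elementary integrands on \<open>{0..t}\<close> are given by \<open>n\<close> intervals with endpoints \<open>\<tau> i\<close> and bounded
  coefficients \<open>\<xi> i\<close> that are measurable at the left endpoint.
\<close>

definition elementary_data ::
    "(real \<Rightarrow> 'w measure) \<Rightarrow> real \<Rightarrow> nat \<Rightarrow> (nat \<Rightarrow> real) \<Rightarrow> (nat \<Rightarrow> 'w \<Rightarrow> real) \<Rightarrow> bool" where
  "elementary_data F t n \<tau> \<xi> \<longleftrightarrow>
     (\<forall>i\<le>n. 0 \<le> \<tau> i \<and> \<tau> i \<le> t) \<and> (\<forall>i<n. \<tau> i \<le> \<tau> (Suc i)) \<and>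
     (\<forall>i<n. \<xi> i \<in> borel_measurable (F (\<tau> i)) \<and> bounded (\<xi> i ` space (F (\<tau> i))))"

definition elementary_process ::
    "nat \<Rightarrow> (nat \<Rightarrow> real) \<Rightarrow> (nat \<Rightarrow> 'w \<Rightarrow> real) \<Rightarrow> real \<Rightarrow> 'w \<Rightarrow> real" where
  "elementary_process n \<tau> \<xi> s \<omega> = (\<Sum>i<n. \<xi> i \<omega> * indicator {\<tau> i<..\<tau> (Suc i)} s)"

definition elementary_ito_integral ::
    "(real \<Rightarrow> 'w \<Rightarrow> real) \<Rightarrow> nat \<Rightarrow> (nat \<Rightarrow> real) \<Rightarrow> (nat \<Rightarrow> 'w \<Rightarrow> real) \<Rightarrow> 'w \<Rightarrow> real" where
  "elementary_ito_integral w n \<tau> \<xi> \<omega> = (\<Sum>i<n. \<xi> i \<omega> * (w (\<tau> (Suc i)) \<omega> - w (\<tau> i) \<omega>))"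

text \<open>
  \<open>I\<close> is a version of the Ito integral of \<open>H\<close> over \<open>{0..t}\<close>: the limit in mean square of the
  integrals of elementary integrands that converge to \<open>H\<close> in \<open>L\<^sup>2(ds \<otimes> M)\<close>.
\<close>

definition is_ito_integral ::
    "'w measure \<Rightarrow> (real \<Rightarrow> 'w measure) \<Rightarrow> (real \<Rightarrow> 'w \<Rightarrow> real) \<Rightarrow> real \<Rightarrow>
     (real \<Rightarrow> 'w \<Rightarrow> real) \<Rightarrow> ('w \<Rightarrow> real) \<Rightarrow> bool" where
  "is_ito_integral M F w t H I \<longleftrightarrow>
     (\<lambda>(s, \<omega>). H s \<omega>) \<in> borel_measurable (lebesgue_on {0..t} \<Otimes>\<^sub>M M) \<and>
     I \<in> borel_measurable M \<and>
     (\<exists>n \<tau> \<xi>. (\<forall>k. elementary_data F t (n k) (\<tau> k) (\<xi> k)) \<and>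
        ((\<lambda>k. \<integral>\<^sup>+ (s, \<omega>). ennreal ((elementary_process (n k) (\<tau> k) (\<xi> k) s \<omega> - H s \<omega>)\<^sup>2)
                 \<partial>(lebesgue_on {0..t} \<Otimes>\<^sub>M M)) \<longlonglongrightarrow> 0) \<and>
        ((\<lambda>k. \<integral>\<^sup>+ \<omega>. ennreal ((elementary_ito_integral w (n k) (\<tau> k) (\<xi> k) \<omega> - I \<omega>)\<^sup>2) \<partial>M)
           \<longlonglongrightarrow> 0))"


section \<open>The stochastic Birkhoff integral\<close>

text \<open>The Frechet differential is one-sided at the endpoints of \<open>{0..T}\<close>.\<close>

definition frechet_deriv_on :: "real \<Rightarrow> (real \<Rightarrow> 'x::real_normed_vector) \<Rightarrow> real \<Rightarrow> 'x" where
  "frechet_deriv_on T \<Phi> t = frechet_derivative \<Phi> (at t within {0..T}) 1"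

definition bi1_star_integrable ::
    "'w measure \<Rightarrow> real \<Rightarrow> (real \<Rightarrow> 'w \<Rightarrow> real) \<Rightarrow> (real \<Rightarrow> 'x::real_normed_vector) \<Rightarrow> bool" where
  "bi1_star_integrable M T w \<Phi> \<longleftrightarrow>
     \<Phi> differentiable_on {0..T} \<and>
     (\<forall>\<omega>\<in>space M. bi1_integrable (lebesgue_on {0..T}) (\<lambda>s. w s \<omega> *\<^sub>R frechet_deriv_on T \<Phi> s))"

definition bi1_star_integral ::
    "real \<Rightarrow> (real \<Rightarrow> 'w \<Rightarrow> real) \<Rightarrow> (real \<Rightarrow> 'x::real_normed_vector) \<Rightarrow> real \<Rightarrow> real \<Rightarrow> 'w \<Rightarrow> 'x" where
  "bi1_star_integral T w \<Phi> a b \<omega> =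
     w b \<omega> *\<^sub>R \<Phi> b - w a \<omega> *\<^sub>R \<Phi> a
       - bi1_integral (lebesgue_on {a..b}) (\<lambda>s. w s \<omega> *\<^sub>R frechet_deriv_on T \<Phi> s)"

definition weakly_regular :: "real \<Rightarrow> (real \<Rightarrow> 'x::real_normed_vector) \<Rightarrow> bool" where
  "weakly_regular T \<Xi> \<longleftrightarrow>
     strongly_measurable (lebesgue_on {0..T}) (lebesgue_on {0..T}) \<Xi> \<and>
     \<Xi> differentiable_on {0..T} \<and>
     (\<forall>x' :: 'x \<Rightarrow>\<^sub>L real.
        square_integrable (lebesgue_on {0..T}) (\<lambda>t. x' (\<Xi> t)) \<and>
        (\<forall>t\<in>{0..T}. ((\<lambda>s. x' (\<Xi> s)) has_real_derivative x' (frechet_deriv_on T \<Xi> t))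
                        (at t within {0..T})))"

end

theory Submission
  imports Defs
begin

text \<open>
  Let \<open>\<phi>\<close> be the derivative of \<open>\<Phi>\<close> and \<open>R t\<close> the integral of \<open>r\<close> over \<open>{0..t}\<close>, so that
  \<open>W = w + R\<close>. The formula for \<open>C\<close> then says that \<open>\<Psi>\<close> and \<open>R \<phi>\<close> integrate to \<open>R t \<Phi> t\<close> over
  \<open>{0..t}\<close>, provided that \<open>R \<phi>\<close> is Birkhoff integrable. It is an integration by parts
  (\<open>bi1_integral_by_parts\<close>) although \<open>r\<close> is only square integrable, because \<open>R \<Phi>\<close> is
  differentiable at every point with derivative \<open>\<Psi> + R \<phi>\<close>: where \<open>\<Phi> t \<noteq> 0\<close>, the equation
  \<open>\<Psi> = r \<Phi>\<close> makes \<open>r\<close> continuous at \<open>t\<close>, and where \<open>\<Phi> t = 0\<close>, continuity of \<open>R\<close> suffices.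

  Integrability is handled through one characterisation. On a finite measure space a strongly
  measurable function \<open>f\<close> is Birkhoff integrable iff the scalar functions \<open>x' \<circ> f\<close>, with \<open>x'\<close> in
  the dual unit ball, are uniformly integrable (\<open>scalarly_ui_imp_has_bi1_integral\<close> and
  \<open>has_bi1_integral_imp_scalarly_ui\<close>). The integral is then determined by its scalar images, so
  that by the Hahn-Banach theorem identities between integrals reduce to scalar ones.

  The heart of the proof is \<open>path_ui_imp_sqrt_ui\<close>. What is given is that \<open>w \<omega> \<phi>\<close> is integrable for
  each path; what is needed is control of \<open>\<phi>\<close> itself near \<open>0\<close>, since \<open>\<bar>R s\<bar>\<close> is at most a multiple
  of \<open>sqrt s\<close> by the Cauchy-Schwarz inequality and \<open>\<bar>w s\<bar>\<close> has mean of order \<open>sqrt s\<close>. If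
  \<open>sqrt s \<phi> s\<close> were not scalarly uniformly integrable, there would be sets of measure tending
  to \<open>0\<close> and functionals that carry a fixed amount of mass of \<open>sqrt s \<bar>x' (\<phi> s)\<bar>\<close>. After
  normalisation, and with \<open>\<bar>w s\<bar>\<close> truncated at \<open>sqrt s\<close>, the corresponding path integrals lie
  between \<open>0\<close> and \<open>1\<close> and tend to \<open>0\<close> almost surely, while Brownian scaling gives all of them the
  same positive mean. Dominated convergence forbids this.

  That \<open>W\<close> is a Brownian motion under \<open>Q\<close> is Girsanov's theorem. For elementary integrands the
  exponential factors of the increments have conditional mean one and can be chained. The passage to
  \<open>r\<close> uses the lemma of Scheffe: the densities converge almost surely along a subsequence, and all
  have integral one, for the limit because \<open>y\<close> is a martingale that starts at \<open>1\<close>. The resulting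
  characteristic function of an increment, computed on each event of the past, is Gaussian, and the
  uniqueness theorem of Levy identifies the law and gives independence at once (\<open>girsanov\<close>).

  Finally, for any Brownian motion the stochastic Birkhoff integral is a martingale
  (\<open>bi1_star_integral_martingale\<close>), and this is applied to \<open>W\<close> under \<open>Q\<close>. The path integral of
  \<open>w \<phi>\<close> is an almost sure limit of adapted sums, hence strongly measurable; the bound
  \<open>sqrt s (\<eta> + P A / \<eta>)\<close> for the mean of \<open>\<bar>w s\<bar>\<close> on an event \<open>A\<close> makes it scalarly uniformly
  integrable over the sample space; and after application of a functional the martingale property
  follows from Fubini's theorem, the orthogonality of the increments to the past and the fundamental
  theorem of calculus.
\<close>

section \<open>The Hahn-Banach theorem in normed spaces\<close>

text \<open>
  A linear functional that is defined on a subspace and bounded by the norm, given by its graph: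
  extension becomes inclusion of sets, and the union of a chain is its upper bound.
\<close>

definition dominated_graph :: "('x::real_normed_vector \<times> real) set \<Rightarrow> bool" where
  "dominated_graph G \<longleftrightarrow> subspace G \<and> (\<forall>(v, a)\<in>G. a \<le> norm v)"

text \<open>
  By the triangle inequality every \<open>a - norm (v - x)\<close> lies below every \<open>norm (u + x) - b\<close>, so that
  there is room for a value at the new point \<open>x\<close>; the supremum of the lower bounds is one.
\<close>

lemma dominated_graph_extend:
  fixes G :: "('x::real_normed_vector \<times> real) set"
  assumes G: "dominated_graph G"
  shows "\<exists>c G'. dominated_graph G' \<and> G \<subseteq> G' \<and> (x, c) \<in> G'"
proof -
  have sub: "subspace G" and dom: "\<And>v a. (v, a) \<in> G \<Longrightarrow> a \<le> norm v"
    using G by (auto simp: dominated_graph_def)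
  define L where "L = (\<lambda>(v, a). a - norm (v - x)) ` G"
  define c where "c = Sup L"
  have ne: "L \<noteq> {}" using subspace_0[OF sub] by (auto simp: L_def)
  have le: "a - norm (v - x) \<le> norm (u + x) - b" if "(v, a) \<in> G" "(u, b) \<in> G" for v a u b
  proof -
    have "(v + u, a + b) \<in> G" using subspace_add[OF sub that] by simp
    from dom[OF this] have "a + b \<le> norm ((v - x) + (u + x))" by simp
    also have "\<dots> \<le> norm (v - x) + norm (u + x)" by (rule norm_triangle_ineq)
    finally show ?thesis by simp
  qed
  have z: "(0, 0) \<in> G" using subspace_0[OF sub] by (simp add: zero_prod_def)
  have bdd: "bdd_above L"
    unfolding L_def bdd_above_def using le[OF _ z] by (intro exI[of _ "norm (0 + x) - 0"]) auto
  have lo: "a - c \<le> norm (v - x)" if "(v, a) \<in> G" for v a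
  proof -
    have "a - norm (v - x) \<le> c" unfolding c_def
      by (rule cSup_upper[OF _ bdd]) (use that in \<open>force simp: L_def\<close>)
    then show ?thesis by simp
  qed
  have up: "b + c \<le> norm (u + x)" if "(u, b) \<in> G" for u b
  proof -
    have "c \<le> norm (u + x) - b" unfolding c_def
      by (rule cSup_least[OF ne]) (use le[OF _ that] in \<open>auto simp: L_def\<close>)
    then show ?thesis by simp
  qed
  define G' where "G' = {g + t *\<^sub>R (x, c) | g t. g \<in> G}"
  have "subspace G'"
  proof (rule subspaceI)
    show "0 \<in> G'" unfolding G'_def using subspace_0[OF sub]
      by (intro CollectI exI[of _ 0]) (auto simp: zero_prod_def)
  next
    fix p q assume "p \<in> G'" "q \<in> G'"
    then obtain g t h s where *: "g \<in> G" "h \<in> G" "p = g + t *\<^sub>R (x, c)" "q = h + s *\<^sub>R (x, c)"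
      unfolding G'_def by blast
    have "p + q = (g + h) + (t + s) *\<^sub>R (x, c)" using * by (simp add: algebra_simps)
    then show "p + q \<in> G'" unfolding G'_def using subspace_add[OF sub *(1,2)] by blast
  next
    fix k p assume "p \<in> G'"
    then obtain g t where *: "g \<in> G" "p = g + t *\<^sub>R (x, c)" unfolding G'_def by blast
    have "k *\<^sub>R p = k *\<^sub>R g + (k * t) *\<^sub>R (x, c)" using * by (simp add: algebra_simps)
    then show "k *\<^sub>R p \<in> G'" unfolding G'_def using subspace_scale[OF sub *(1)] by blast
  qed
  moreover have "b \<le> norm u" if "(u, b) \<in> G'" for u b
  proof -
    obtain v a t where *: "(v, a) \<in> G" "u = v + t *\<^sub>R x" "b = a + t * c"
    proof -
      obtain g t where g: "g \<in> G" "(u, b) = g + t *\<^sub>R (x, c)" using \<open>(u, b) \<in> G'\<close> unfolding G'_def by blast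
      obtain v a where "g = (v, a)" by (cases g)
      with g show ?thesis by (intro that[of v a t]) auto
    qed
    consider "t = 0" | "t > 0" | "t < 0" by linarith
    then show ?thesis
    proof cases
      case 1 then show ?thesis using * dom by simp
    next
      case 2
      have "((1/t) *\<^sub>R v, (1/t) * a) \<in> G" using subspace_scale[OF sub *(1), of "1/t"] by simp
      from up[OF this] have "t * ((1/t) * a + c) \<le> t * norm ((1/t) *\<^sub>R v + x)"
        using 2 by (intro mult_left_mono) auto
      also have "\<dots> = norm (t *\<^sub>R ((1/t) *\<^sub>R v + x))" using 2 by simp
      finally show ?thesis using 2 * by (simp add: algebra_simps)
    next
      case 3
      have "((-1/t) *\<^sub>R v, (-1/t) * a) \<in> G" using subspace_scale[OF sub *(1), of "-1/t"] by simp
      from lo[OF this] have "(-t) * ((-1/t) * a - c) \<le> (-t) * norm ((-1/t) *\<^sub>R v - x)"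
        using 3 by (intro mult_left_mono) auto
      also have "\<dots> = norm ((-t) *\<^sub>R ((-1/t) *\<^sub>R v - x))" using 3 by simp
      finally show ?thesis using 3 * by (simp add: algebra_simps)
    qed
  qed
  moreover have "g \<in> G'" if "g \<in> G" for g
    unfolding G'_def using that by (intro CollectI exI[of _ g] exI[of _ 0]) (auto simp: zero_prod_def)
  then have "G \<subseteq> G'" ..
  moreover have "(x, c) \<in> G'" unfolding G'_def
    using subspace_0[OF sub] by (intro CollectI exI[of _ 0] exI[of _ 1]) (auto simp: zero_prod_def)
  ultimately show ?thesis unfolding dominated_graph_def by blast
qed

text \<open>
  A maximal dominated graph is total by the one-point extension. Domination at \<open>0\<close> makes it the graph
  of a function, and domination at \<open>x\<close> and \<open>- x\<close> bounds that function by the norm.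
\<close>

lemma hahn_banach_norming_functional:
  fixes v :: "'x::real_normed_vector"
  obtains x' :: "'x \<Rightarrow>\<^sub>L real" where "norm x' \<le> 1" "blinfun_apply x' v = norm v"
proof -
  define G0 where "G0 = range (\<lambda>t. (t *\<^sub>R v, t * norm v))"
  have G0: "dominated_graph G0"
    unfolding dominated_graph_def
  proof (intro conjI)
    show "subspace G0"
    proof (rule subspaceI)
      show "0 \<in> G0" unfolding G0_def by (rule image_eqI[of _ _ 0]) (auto simp: zero_prod_def)
      show "p + q \<in> G0" if "p \<in> G0" "q \<in> G0" for p q
        using that unfolding G0_def by (auto simp flip: scaleR_add_left distrib_right)
      show "k *\<^sub>R p \<in> G0" if "p \<in> G0" for k p
        using that unfolding G0_def by (auto intro: image_eqI[of _ _ "k * _"])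
    qed
    show "\<forall>(v, a)\<in>G0. a \<le> norm v" unfolding G0_def by (auto intro: mult_right_mono)
  qed
  define \<A> where "\<A> = {G. dominated_graph G \<and> G0 \<subseteq> G}"
  have "\<exists>M\<in>\<A>. \<forall>X\<in>\<A>. M \<subseteq> X \<longrightarrow> X = M"
  proof (rule subset_Zorn_nonempty)
    show "\<A> \<noteq> {}" using G0 by (auto simp: \<A>_def)
  next
    fix \<C> assume ne: "\<C> \<noteq> {}" and ch: "subset.chain \<A> \<C>"
    have mem: "\<And>G. G \<in> \<C> \<Longrightarrow> dominated_graph G \<and> G0 \<subseteq> G"
      using ch by (auto simp: subset.chain_def \<A>_def)
    have tot: "\<And>G H. G \<in> \<C> \<Longrightarrow> H \<in> \<C> \<Longrightarrow> G \<subseteq> H \<or> H \<subseteq> G"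
      using ch by (auto simp: subset.chain_def)
    have "subspace (\<Union>\<C>)"
    proof (rule subspaceI)
      obtain G where "G \<in> \<C>" using ne by blast
      then show "0 \<in> \<Union>\<C>" using mem[of G] subspace_0[of G] by (auto simp: dominated_graph_def)
    next
      fix p q assume "p \<in> \<Union>\<C>" "q \<in> \<Union>\<C>"
      then obtain G where "G \<in> \<C>" "p \<in> G" "q \<in> G" using tot by blast
      then show "p + q \<in> \<Union>\<C>" using mem[of G] subspace_add[of G p q] by (auto simp: dominated_graph_def)
    next
      fix k p assume "p \<in> \<Union>\<C>"
      then obtain G where "G \<in> \<C>" "p \<in> G" by blast
      then show "k *\<^sub>R p \<in> \<Union>\<C>" using mem[of G] subspace_scale[of G p k] by (auto simp: dominated_graph_def)
    qed
    moreover have "a \<le> norm v" if "(v, a) \<in> \<Union>\<C>" for v a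
      using that mem by (auto simp: dominated_graph_def)
    moreover have "G0 \<subseteq> \<Union>\<C>" using mem ne by blast
    ultimately show "\<Union>\<C> \<in> \<A>" unfolding \<A>_def dominated_graph_def by (simp add: split_beta)
  qed
  then obtain M where M': "M \<in> \<A>" and max': "\<forall>X\<in>\<A>. M \<subseteq> X \<longrightarrow> X = M" ..
  have M: "dominated_graph M" "G0 \<subseteq> M" using M' by (simp_all add: \<A>_def)
  have max: "X = M" if "dominated_graph X" "M \<subseteq> X" for X
    using max' M(2) that by (simp add: \<A>_def)
  have sub: "subspace M" and dom: "\<And>v a. (v, a) \<in> M \<Longrightarrow> a \<le> norm v"
    using M by (auto simp: dominated_graph_def)
  have ex: "\<exists>c. (x, c) \<in> M" for x
    using dominated_graph_extend[OF M(1), of x] max by metis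
  have un: "a = b" if "(x, a) \<in> M" "(x, b) \<in> M" for x a b
    using dom[of 0 "a - b"] dom[of 0 "b - a"] subspace_diff[OF sub that] subspace_diff[OF sub that(2,1)]
    by simp
  define f where "f x = (THE c. (x, c) \<in> M)" for x
  have f: "(x, f x) \<in> M" for x unfolding f_def using ex un by (metis theI)
  have fe: "f x = c" if "(x, c) \<in> M" for x c using un f that by blast
  have "f (x + y) = f x + f y" for x y using subspace_add[OF sub f[of x] f[of y]] by (intro fe) simp
  moreover have sc: "f (k *\<^sub>R x) = k *\<^sub>R f x" for k x
    using subspace_scale[OF sub f[of x], of k] by (intro fe) simp
  moreover have ab: "norm (f x) \<le> norm x * 1" for x
    using dom[OF f[of x]] dom[OF f[of "- x"]] sc[of "-1" x] by (simp add: abs_le_iff)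
  ultimately have bl: "bounded_linear f" by (intro bounded_linear_intro[of f 1]) auto
  have "f v = norm v" using M(2) by (intro fe) (auto simp: G0_def intro: range_eqI[of _ _ 1])
  moreover have "norm (Blinfun f) \<le> 1"
    using ab by (intro norm_blinfun_bound) (auto simp: bounded_linear_Blinfun_apply[OF bl])
  ultimately show ?thesis using that[of "Blinfun f"] by (simp add: bounded_linear_Blinfun_apply[OF bl])
qed

text \<open>
  Through this bound, scalar estimates that are uniform over the dual unit ball become estimates in
  norm. This is how all vector integrals below are controlled.
\<close>

lemma norm_le_by_functionals:
  fixes v :: "'x::real_normed_vector"
  assumes "\<And>x' :: 'x \<Rightarrow>\<^sub>L real. norm x' \<le> 1 \<Longrightarrow> \<bar>blinfun_apply x' v\<bar> \<le> K"
  shows "norm v \<le> K"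
  by (metis assms abs_of_nonneg hahn_banach_norming_functional norm_ge_zero)

lemma eq_by_functionals:
  fixes u v :: "'x::real_normed_vector"
  assumes "\<And>x' :: 'x \<Rightarrow>\<^sub>L real. norm x' \<le> 1 \<Longrightarrow> blinfun_apply x' u = blinfun_apply x' v"
  shows "u = v"
  using norm_le_by_functionals[of "u - v" 0] assms by (simp add: blinfun.diff_right)

lemma functional_le_norm:
  fixes x' :: "'x::real_normed_vector \<Rightarrow>\<^sub>L real"
  assumes "norm x' \<le> 1" shows "\<bar>blinfun_apply x' v\<bar> \<le> norm v"
  using norm_blinfun[of x' v] mult_right_mono[OF assms norm_ge_zero[of v]] by simp

section \<open>The Birkhoff integral as a limit along finite sets of cells\<close>

text \<open>
  Partitions as sets of cells, without an enumeration: common refinement, gluing and restriction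
  become plain operations on sets.
\<close>

definition meas_partition :: "'a measure \<Rightarrow> 'a set set \<Rightarrow> bool" where
  "meas_partition M \<U> \<longleftrightarrow> countable \<U> \<and> \<U> \<subseteq> sets M \<and> {} \<notin> \<U> \<and> disjoint \<U> \<and> \<Union>\<U> = space M"

definition refines :: "'a set set \<Rightarrow> 'a set set \<Rightarrow> bool" where
  "refines \<U> \<P> \<longleftrightarrow> (\<forall>U\<in>\<U>. \<exists>V\<in>\<P>. U \<subseteq> V)"

definition bi1_sum :: "'a measure \<Rightarrow> ('a \<Rightarrow> 'x::real_normed_vector) \<Rightarrow> ('a set \<Rightarrow> 'a) \<Rightarrow> 'a set set \<Rightarrow> 'x" where
  "bi1_sum M f p F = (\<Sum>U\<in>F. measure M U *\<^sub>R f (p U))"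

definition tagged_refinement :: "'a measure \<Rightarrow> 'a set set \<Rightarrow> 'a set set \<Rightarrow> ('a set \<Rightarrow> 'a) \<Rightarrow> bool" where
  "tagged_refinement M \<P> \<U> p \<longleftrightarrow> meas_partition M \<U> \<and> refines \<U> \<P> \<and> (\<forall>U\<in>\<U>. p U \<in> U)"

lemma enumerate_meas_partition:
  assumes "meas_partition M \<P>"
  shows "\<exists>N U. countable_partition M N U \<and> inj_on U {k. enat k < N} \<and> U ` {k. enat k < N} = \<P>"
proof -
  have *: "countable \<P>" "\<P> \<subseteq> sets M" "{} \<notin> \<P>" "disjoint \<P>" "\<Union>\<P> = space M"
    using assms by (auto simp: meas_partition_def)
  have "\<exists>N (U :: nat \<Rightarrow> _). bij_betw U {k. enat k < N} \<P>"
  proof (cases "finite \<P>")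
    case True
    then obtain h where "bij_betw h {0..<card \<P>} \<P>" using ex_bij_betw_nat_finite by blast
    then show ?thesis by (intro exI[of _ "enat (card \<P>)"] exI[of _ h]) (simp add: atLeast0LessThan lessThan_def)
  next
    case False
    then show ?thesis using bij_betw_from_nat_into[OF *(1)]
      by (intro exI[of _ \<infinity>] exI[of _ "from_nat_into \<P>"]) simp
  qed
  then obtain N and U :: "nat \<Rightarrow> 'a set" where U: "inj_on U {k. enat k < N}" "U ` {k. enat k < N} = \<P>"
    by (auto simp: bij_betw_def)
  have "disjoint_family_on U {k. enat k < N}"
    unfolding disjoint_family_on_def
  proof (intro ballI impI)
    fix m n assume mn: "m \<in> {k. enat k < N}" "n \<in> {k. enat k < N}" "m \<noteq> n"
    then have "U m \<noteq> U n" using U(1) by (auto dest: inj_onD)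
    then show "U m \<inter> U n = {}" using mn U(2) *(4) by (intro disjointD[of \<P>]) auto
  qed
  then have "countable_partition M N U"
    unfolding countable_partition_def using U(2) * by auto
  then show ?thesis using U by blast
qed

lemma countable_partition_imp_meas_partition:
  assumes "countable_partition M N U"
  shows "meas_partition M (U ` {k. enat k < N})" "inj_on U {k. enat k < N}"
proof -
  have *: "\<And>k. enat k < N \<Longrightarrow> U k \<in> sets M \<and> U k \<noteq> {}" "disjoint_family_on U {k. enat k < N}"
    "(\<Union>k\<in>{k. enat k < N}. U k) = space M"
    using assms by (auto simp: countable_partition_def)
  show "meas_partition M (U ` {k. enat k < N})"
    unfolding meas_partition_def using * by (auto simp: disjoint_family_on_disjoint_image)
  show "inj_on U {k. enat k < N}"
  proof (rule inj_onI)
    fix m n assume mn: "m \<in> {k. enat k < N}" "n \<in> {k. enat k < N}" "U m = U n"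
    show "m = n"
    proof (rule ccontr)
      assume "m \<noteq> n"
      then have "U m \<inter> U n = {}" using *(2) mn by (auto simp: disjoint_family_on_def)
      then show False using mn *(1) by auto
    qed
  qed
qed

text \<open>
  The sets with property \<open>B\<close> are cofinal among the finite subsets, so they can be passed one after the
  other: the list so far, together with the first elements of a fixed enumeration, is enlarged to a
  set with property \<open>B\<close>. The limit of these lists is the enumeration sought.
\<close>

lemma reorder_with_frequent_initial_segments:
  fixes \<U> :: "'a set"
  assumes cnt: "countable \<U>" and inf: "infinite \<U>"
    and bad: "\<And>F0. finite F0 \<Longrightarrow> F0 \<subseteq> \<U> \<Longrightarrow> \<exists>F. finite F \<and> F0 \<subseteq> F \<and> F \<subseteq> \<U> \<and> B F"
  shows "\<exists>e :: nat \<Rightarrow> 'a. bij_betw e UNIV \<U> \<and> (\<forall>m. \<exists>n\<ge>m. B (e ` {..<n}))"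
proof -
  let ?g = "from_nat_into \<U>"
  have g: "bij_betw ?g UNIV \<U>" using bij_betw_from_nat_into[OF cnt inf] .
  define good where "good L \<longleftrightarrow> distinct L \<and> set L \<subseteq> \<U>" for L
  have step: "\<exists>L'. good (L @ L') \<and> ?g ` {..k} \<subseteq> set (L @ L') \<and> B (set (L @ L'))" if L: "good L" for L k
  proof -
    have "set L \<union> ?g ` {..k} \<subseteq> \<U>" using L g by (auto simp: good_def bij_betw_def)
    then obtain F where F: "finite F" "set L \<union> ?g ` {..k} \<subseteq> F" "F \<subseteq> \<U>" "B F"
      using bad[of "set L \<union> ?g ` {..k}"] by auto
    obtain L' where L': "set L' = F - set L" "distinct L'"
      using finite_distinct_list[of "F - set L"] F(1) by auto
    have "set (L @ L') = F" using L' F by auto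
    then show ?thesis using L' F L by (intro exI[of _ L']) (auto simp: good_def)
  qed
  define ext where "ext L k = (SOME L'. good (L @ L') \<and> ?g ` {..k} \<subseteq> set (L @ L') \<and> B (set (L @ L')))" for L k
  have ext: "good (L @ ext L k) \<and> ?g ` {..k} \<subseteq> set (L @ ext L k) \<and> B (set (L @ ext L k))" if "good L" for L k
    unfolding ext_def by (rule someI_ex[OF step[OF that]])
  define Ls where "Ls = rec_nat [] (\<lambda>k L. L @ ext L k)"
  have Ls0: "Ls 0 = []" and LsS: "Ls (Suc k) = Ls k @ ext (Ls k) k" for k by (simp_all add: Ls_def)
  have gd: "good (Ls k)" for k by (induction k) (use ext in \<open>auto simp: Ls0 LsS good_def\<close>)
  have sub: "?g ` {..k} \<subseteq> set (Ls (Suc k))" and BL: "B (set (Ls (Suc k)))" for k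
    using ext[OF gd[of k], of k] unfolding LsS by blast+
  have len: "k < length (Ls (Suc k))" for k
  proof -
    have "card (?g ` {..k}) = Suc k" using g by (subst card_image) (auto simp: bij_betw_def intro: inj_on_subset)
    moreover have "card (?g ` {..k}) \<le> card (set (Ls (Suc k)))" by (intro card_mono sub) simp
    ultimately show ?thesis using gd[of "Suc k"] by (simp add: good_def distinct_card)
  qed
  have pre: "\<exists>L. Ls (j + d) = Ls j @ L" for j d
    by (induction d) (auto simp: LsS)
  have nth: "Ls j ! i = Ls k ! i" if "i < length (Ls j)" "i < length (Ls k)" for i j k
    using that
  proof (induction j k rule: linorder_wlog)
    case (le j k)
    then obtain L where "Ls k = Ls j @ L" using pre[of j "k - j"] by auto
    then show ?case using le by (simp add: nth_append)
  next
    case (sym j k) then show ?case by simp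
  qed
  define e where "e i = Ls (Suc i) ! i" for i
  have e: "e i = Ls k ! i" if "i < length (Ls k)" for i k unfolding e_def by (rule nth[OF len that])
  have im: "e ` {..<length (Ls k)} = set (Ls k)" for k
    using e[of _ k] by (force simp: set_conv_nth)
  have "inj e"
  proof (rule injI)
    fix i j assume "e i = e j"
    let ?k = "Suc (max i j)"
    have l: "i < length (Ls ?k)" "j < length (Ls ?k)" using len[of "max i j"] by auto
    show "i = j" using \<open>e i = e j\<close> gd[of ?k] l unfolding e[OF l(1)] e[OF l(2)]
      by (simp add: good_def nth_eq_iff_index_eq)
  qed
  moreover have "range e = \<U>"
  proof
    show "range e \<subseteq> \<U>"
    proof
      fix x assume "x \<in> range e"
      then obtain i where "x = e i" by blast
      then have "x \<in> set (Ls (Suc i))" unfolding e_def using len[of i] by auto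
      then show "x \<in> \<U>" using gd[of "Suc i"] by (auto simp: good_def)
    qed
    show "\<U> \<subseteq> range e"
    proof
      fix x assume "x \<in> \<U>"
      then obtain k where "x = ?g k" using g by (auto simp: bij_betw_def)
      then have "x \<in> set (Ls (Suc k))" using sub[of k] by auto
      then show "x \<in> range e" using im[of "Suc k"] by blast
    qed
  qed
  moreover have "\<exists>n\<ge>m. B (e ` {..<n})" for m
    using BL[of m] len[of m] by (intro exI[of _ "length (Ls (Suc m))"]) (simp add: im)
  ultimately show ?thesis by (auto simp: bij_betw_def)
qed

lemma refines_enumerated:
  "finer_partition N U N' V \<longleftrightarrow> refines (U ` {k. enat k < N}) (V ` {k. enat k < N'})"
  unfolding finer_partition_def refines_def by auto

text \<open>
  The definition quantifies over all enumerations of a partition. If the sums over finite sets of cells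
  did not come close to \<open>I\<close>, then some enumeration would have infinitely many initial segments with
  distant sums, against the bound on the limes superior. Unordered sums are what makes the algebra of
  the integral, the restriction to subsets and the comparison with scalar integrals manageable.
\<close>

lemma has_bi1_integral_iff_net:
  fixes f :: "'a \<Rightarrow> 'x::real_normed_vector"
  shows "has_bi1_integral M f I \<longleftrightarrow>
    (\<forall>\<epsilon>>0. \<exists>\<P>. meas_partition M \<P> \<and> (\<forall>\<U> p. tagged_refinement M \<P> \<U> p \<longrightarrow>
       (\<forall>\<^sub>F F in finite_subsets_at_top \<U>. norm (bi1_sum M f p F - I) < \<epsilon>)))"
    (is "_ \<longleftrightarrow> ?net")
proof
  assume net: ?net
  show "has_bi1_integral M f I"
    unfolding has_bi1_integral_def
  proof (intro allI impI)
    fix \<epsilon> :: real assume "\<epsilon> > 0"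
    then obtain \<P> where P: "meas_partition M \<P>"
      and ev: "\<And>\<U> p. tagged_refinement M \<P> \<U> p \<Longrightarrow>
         (\<forall>\<^sub>F F in finite_subsets_at_top \<U>. norm (bi1_sum M f p F - I) < \<epsilon> / 2)"
      using net[rule_format, of "\<epsilon> / 2"] by auto
    obtain N0 P0 where P0: "countable_partition M N0 P0" "P0 ` {k. enat k < N0} = \<P>"
      using enumerate_meas_partition[OF P] by blast
    show "\<exists>N0 P. countable_partition M N0 P \<and>
        (\<forall>N U p. countable_partition M N U \<longrightarrow> finer_partition N U N0 P \<longrightarrow>
           (\<forall>k. enat k < N \<longrightarrow> p k \<in> U k) \<longrightarrow>
           limsup (\<lambda>n. ereal (norm ((\<Sum>k | k < n \<and> enat k < N. measure M (U k) *\<^sub>R f (p k)) - I)))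
             < ereal \<epsilon>)"
    proof (intro exI[of _ N0] exI[of _ P0] conjI allI impI P0(1))
      fix N U and p :: "nat \<Rightarrow> 'a"
      assume U: "countable_partition M N U" "finer_partition N U N0 P0" "\<forall>k. enat k < N \<longrightarrow> p k \<in> U k"
      let ?A = "{k. enat k < N}" and ?S = "\<lambda>n. {k. k < n \<and> enat k < N}"
      note U' = countable_partition_imp_meas_partition[OF U(1)]
      define q where "q V = p (the_inv_into ?A U V)" for V
      have q: "q (U k) = p k" if "enat k < N" for k
        using that U'(2) by (simp add: q_def the_inv_into_f_f)
      have "tagged_refinement M \<P> (U ` ?A) q"
        unfolding tagged_refinement_def using U' U q P0(2) by (auto simp: refines_enumerated)
      then have "\<forall>\<^sub>F F in finite_subsets_at_top (U ` ?A). norm (bi1_sum M f q F - I) < \<epsilon> / 2" by (rule ev)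
      then obtain F0 where F0: "finite F0" "F0 \<subseteq> U ` ?A"
        "\<And>F. finite F \<Longrightarrow> F0 \<subseteq> F \<Longrightarrow> F \<subseteq> U ` ?A \<Longrightarrow> norm (bi1_sum M f q F - I) < \<epsilon> / 2"
        unfolding eventually_finite_subsets_at_top by metis
      obtain K where K: "finite K" "K \<subseteq> ?A" "F0 = U ` K" using finite_subset_image[OF F0(1,2)] by auto
      obtain n0 where n0: "K \<subseteq> {..<n0}" using finite_nat_iff_bounded K(1) by auto
      have "norm ((\<Sum>k | k < n \<and> enat k < N. measure M (U k) *\<^sub>R f (p k)) - I) < \<epsilon> / 2" if "n \<ge> n0" for n
      proof -
        have "K \<subseteq> ?S n"
        proof
          fix k assume "k \<in> K"
          then have "k < n0" "enat k < N" using n0 K(2) by auto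
          then show "k \<in> ?S n" using that by simp
        qed
        then have "norm (bi1_sum M f q (U ` ?S n) - I) < \<epsilon> / 2"
          using K(3) by (intro F0(3)) auto
        moreover have "inj_on U (?S n)" using U'(2) by (rule inj_on_subset) auto
        then have "bi1_sum M f q (U ` ?S n) = (\<Sum>k\<in>?S n. measure M (U k) *\<^sub>R f (p k))"
          unfolding bi1_sum_def by (subst sum.reindex) (auto intro!: sum.cong simp: q)
        ultimately show ?thesis by simp
      qed
      then have "limsup (\<lambda>n. ereal (norm ((\<Sum>k | k < n \<and> enat k < N. measure M (U k) *\<^sub>R f (p k)) - I))) \<le> ereal (\<epsilon> / 2)"
        by (intro Limsup_bounded) (auto simp: eventually_sequentially intro!: exI[of _ n0] less_imp_le)
      also have "\<dots> < ereal \<epsilon>" using \<open>\<epsilon> > 0\<close> by simp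
      finally show "limsup (\<lambda>n. ereal (norm ((\<Sum>k | k < n \<and> enat k < N. measure M (U k) *\<^sub>R f (p k)) - I))) < ereal \<epsilon>" .
    qed
  qed
next
  assume H: "has_bi1_integral M f I"
  show ?net
  proof (intro allI impI)
    fix \<epsilon> :: real assume "\<epsilon> > 0"
    from H[unfolded has_bi1_integral_def, rule_format, OF this]
    obtain N0 P0 where P0: "countable_partition M N0 P0"
      and lim: "\<forall>N U p. countable_partition M N U \<longrightarrow> finer_partition N U N0 P0 \<longrightarrow>
           (\<forall>k. enat k < N \<longrightarrow> p k \<in> U k) \<longrightarrow>
           limsup (\<lambda>n. ereal (norm ((\<Sum>k | k < n \<and> enat k < N. measure M (U k) *\<^sub>R f (p k)) - I))) < ereal \<epsilon>"
      by (elim exE conjE)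
    let ?\<P> = "P0 ` {k. enat k < N0}"
    show "\<exists>\<P>. meas_partition M \<P> \<and> (\<forall>\<U> p. tagged_refinement M \<P> \<U> p \<longrightarrow>
       (\<forall>\<^sub>F F in finite_subsets_at_top \<U>. norm (bi1_sum M f p F - I) < \<epsilon>))"
    proof (intro exI[of _ ?\<P>] conjI allI impI countable_partition_imp_meas_partition(1)[OF P0])
      fix \<U> p assume "tagged_refinement M ?\<P> \<U> p"
      then have U: "meas_partition M \<U>" "refines \<U> ?\<P>" "\<And>V. V \<in> \<U> \<Longrightarrow> p V \<in> V"
        by (auto simp: tagged_refinement_def)
      show "\<forall>\<^sub>F F in finite_subsets_at_top \<U>. norm (bi1_sum M f p F - I) < \<epsilon>"
      proof (rule ccontr)
        assume "\<not> ?thesis"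
        then have bad: "\<exists>F. finite F \<and> F0 \<subseteq> F \<and> F \<subseteq> \<U> \<and> \<not> norm (bi1_sum M f p F - I) < \<epsilon>"
          if "finite F0" "F0 \<subseteq> \<U>" for F0
          using that unfolding eventually_finite_subsets_at_top by metis
        have "\<exists>N V. countable_partition M N V \<and> inj_on V {k. enat k < N} \<and> V ` {k. enat k < N} = \<U> \<and>
                (\<forall>m. \<exists>n\<ge>m. \<not> norm (bi1_sum M f p (V ` {k. k < n \<and> enat k < N}) - I) < \<epsilon>)"
        proof (cases "finite \<U>")
          case True
          obtain N V where V: "countable_partition M N V" "inj_on V {k. enat k < N}" "V ` {k. enat k < N} = \<U>"
            using enumerate_meas_partition[OF U(1)] by blast
          have "finite {k. enat k < N}" using True V by (metis finite_image_iff)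
          then obtain n0 where n0: "{k. enat k < N} \<subseteq> {..<n0}" using finite_nat_iff_bounded by auto
          have "{k. k < n \<and> enat k < N} = {k. enat k < N}" if "n \<ge> n0" for n
            using that n0 by auto
          moreover have "\<not> norm (bi1_sum M f p \<U> - I) < \<epsilon>" using bad[OF True order.refl] by auto
          ultimately have "\<exists>n\<ge>m. \<not> norm (bi1_sum M f p (V ` {k. k < n \<and> enat k < N}) - I) < \<epsilon>" for m
            using V(3) by (intro exI[of _ "max m n0"]) simp
          then show ?thesis using V by (intro exI[of _ N] exI[of _ V]) simp
        next
          case False
          obtain e :: "nat \<Rightarrow> _" where e: "bij_betw e UNIV \<U>"
            "\<And>m. \<exists>n\<ge>m. \<not> norm (bi1_sum M f p (e ` {..<n}) - I) < \<epsilon>"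
          proof -
            have cn: "countable \<U>" using U(1) by (simp add: meas_partition_def)
            have "\<exists>e :: nat \<Rightarrow> _. bij_betw e UNIV \<U> \<and> (\<forall>m. \<exists>n\<ge>m. \<not> norm (bi1_sum M f p (e ` {..<n}) - I) < \<epsilon>)"
              by (rule reorder_with_frequent_initial_segments[OF cn False]) (rule bad)
            then obtain e :: "nat \<Rightarrow> _" where "bij_betw e UNIV \<U>" "\<forall>m. \<exists>n\<ge>m. \<not> norm (bi1_sum M f p (e ` {..<n}) - I) < \<epsilon>"
              by (elim exE conjE)
            then show ?thesis by (intro that[of e]) simp_all
          qed
          have ie: "inj e" "range e = \<U>" using e(1) by (auto simp: bij_betw_def)
          have "disjoint_family e"
            unfolding disjoint_family_on_def
          proof (intro ballI impI)
            fix m n :: nat assume "m \<noteq> n"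
            then have "e m \<noteq> e n" using ie(1) by (auto dest: injD)
            then show "e m \<inter> e n = {}" using ie(2) U(1) by (intro disjointD[of \<U>]) (auto simp: meas_partition_def)
          qed
          then have "countable_partition M \<infinity> e"
            unfolding countable_partition_def using ie U(1) by (auto simp: meas_partition_def)
          then show ?thesis using ie e(2) by (intro exI[of _ \<infinity>] exI[of _ e]) (simp add: lessThan_def)
        qed
        then obtain N V where V: "countable_partition M N V" "inj_on V {k. enat k < N}" "V ` {k. enat k < N} = \<U>"
          and fr: "\<forall>m. \<exists>n\<ge>m. \<not> norm (bi1_sum M f p (V ` {k. k < n \<and> enat k < N}) - I) < \<epsilon>"
          by (elim exE conjE)
        have "limsup (\<lambda>n. ereal (norm ((\<Sum>k | k < n \<and> enat k < N. measure M (V k) *\<^sub>R f (p (V k))) - I))) < ereal \<epsilon>"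
          using V U by (intro lim[rule_format]) (auto simp: refines_enumerated)
        from Limsup_lessD[OF this]
        obtain m where m: "\<And>n. n \<ge> m \<Longrightarrow> norm ((\<Sum>k | k < n \<and> enat k < N. measure M (V k) *\<^sub>R f (p (V k))) - I) < \<epsilon>"
          by (auto simp: eventually_sequentially)
        obtain n where n: "n \<ge> m" "\<not> norm (bi1_sum M f p (V ` {k. k < n \<and> enat k < N}) - I) < \<epsilon>"
          using fr by blast
        have "inj_on V {k. k < n \<and> enat k < N}" using V(2) by (rule inj_on_subset) auto
        then have "bi1_sum M f p (V ` {k. k < n \<and> enat k < N}) = (\<Sum>k | k < n \<and> enat k < N. measure M (V k) *\<^sub>R f (p (V k)))"
          unfolding bi1_sum_def by (subst sum.reindex) auto
        then show False using m[OF n(1)] n(2) by simp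
      qed
    qed
  qed
qed

definition common_refinement :: "'a set set \<Rightarrow> 'a set set \<Rightarrow> 'a set set" where
  "common_refinement \<P> \<Q> = (\<lambda>(U, V). U \<inter> V) ` (\<P> \<times> \<Q>) - {{}}"

lemma common_refinement:
  assumes "meas_partition M \<P>" "meas_partition M \<Q>"
  shows "meas_partition M (common_refinement \<P> \<Q>)"
    and "refines (common_refinement \<P> \<Q>) \<P>" "refines (common_refinement \<P> \<Q>) \<Q>"
proof -
  have P: "countable \<P>" "\<P> \<subseteq> sets M" "disjoint \<P>" "\<Union>\<P> = space M"
   and Q: "countable \<Q>" "\<Q> \<subseteq> sets M" "disjoint \<Q>" "\<Union>\<Q> = space M"
    using assms by (auto simp: meas_partition_def)
  have "disjoint (common_refinement \<P> \<Q>)"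
  proof (rule disjointI)
    fix A B assume A: "A \<in> common_refinement \<P> \<Q>" and B: "B \<in> common_refinement \<P> \<Q>" and "A \<noteq> B"
    obtain U V where a: "U \<in> \<P>" "V \<in> \<Q>" "A = U \<inter> V" using A by (auto simp: common_refinement_def)
    obtain U' V' where b: "U' \<in> \<P>" "V' \<in> \<Q>" "B = U' \<inter> V'" using B by (auto simp: common_refinement_def)
    have "U \<noteq> U' \<or> V \<noteq> V'" using a b \<open>A \<noteq> B\<close> by auto
    then show "A \<inter> B = {}" using disjointD[OF P(3) a(1) b(1)] disjointD[OF Q(3) a(2) b(2)] a b by auto
  qed
  moreover have "\<Union>(common_refinement \<P> \<Q>) = space M"
  proof -
    have "\<Union>(common_refinement \<P> \<Q>) = \<Union>\<P> \<inter> \<Union>\<Q>" by (auto simp: common_refinement_def)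
    then show ?thesis using P Q by simp
  qed
  moreover have "countable (common_refinement \<P> \<Q>)"
    unfolding common_refinement_def using P Q by auto
  moreover have "common_refinement \<P> \<Q> \<subseteq> sets M"
    unfolding common_refinement_def using P Q by auto
  moreover have "{} \<notin> common_refinement \<P> \<Q>" by (simp add: common_refinement_def)
  ultimately show "meas_partition M (common_refinement \<P> \<Q>)" by (simp add: meas_partition_def)
  show "refines (common_refinement \<P> \<Q>) \<P>" "refines (common_refinement \<P> \<Q>) \<Q>"
    by (auto simp: refines_def common_refinement_def)
qed

lemma refines_trans: "refines \<U> \<V> \<Longrightarrow> refines \<V> \<W> \<Longrightarrow> refines \<U> \<W>"
  unfolding refines_def by (meson subset_trans)

lemma tagged_refinement_trans:
  "tagged_refinement M \<P> \<U> p \<Longrightarrow> refines \<P> \<Q> \<Longrightarrow> tagged_refinement M \<Q> \<U> p"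
  using refines_trans by (auto simp: tagged_refinement_def)

lemma tagged_refinement_self:
  "meas_partition M \<P> \<Longrightarrow> tagged_refinement M \<P> \<P> (\<lambda>U. SOME x. x \<in> U)"
proof -
  assume P: "meas_partition M \<P>"
  have "(SOME x. x \<in> U) \<in> U" if "U \<in> \<P>" for U
    using P that some_in_eq[of U] by (auto simp: meas_partition_def)
  then show ?thesis using P by (auto simp: tagged_refinement_def refines_def)
qed

lemma has_bi1_netD:
  assumes "has_bi1_integral M f I" "\<epsilon> > 0"
  shows "\<exists>\<P>. meas_partition M \<P> \<and> (\<forall>\<U> p. tagged_refinement M \<P> \<U> p \<longrightarrow>
       (\<forall>\<^sub>F F in finite_subsets_at_top \<U>. norm (bi1_sum M f p F - I) < \<epsilon>))"
  using assms(1)[unfolded has_bi1_integral_iff_net, rule_format, OF assms(2)] .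

lemma has_bi1_netI:
  assumes "\<And>\<epsilon>. \<epsilon> > 0 \<Longrightarrow> \<exists>\<P>. meas_partition M \<P> \<and> (\<forall>\<U> p. tagged_refinement M \<P> \<U> p \<longrightarrow>
       (\<forall>\<^sub>F F in finite_subsets_at_top \<U>. norm (bi1_sum M f p F - I) < \<epsilon>))"
  shows "has_bi1_integral M f I"
  unfolding has_bi1_integral_iff_net using assms by simp

lemma has_bi1_integral_unique:
  assumes "has_bi1_integral M f I" "has_bi1_integral M f J"
  shows "I = J"
proof (rule ccontr)
  assume "I \<noteq> J"
  then have e: "norm (I - J) / 2 > 0" by simp
  obtain \<P> where P: "meas_partition M \<P>"
    "\<forall>\<U> p. tagged_refinement M \<P> \<U> p \<longrightarrow>
       (\<forall>\<^sub>F F in finite_subsets_at_top \<U>. norm (bi1_sum M f p F - I) < norm (I - J) / 2)"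
    using has_bi1_netD[OF assms(1) e] by (elim exE conjE)
  obtain \<Q> where Q: "meas_partition M \<Q>"
    "\<forall>\<U> p. tagged_refinement M \<Q> \<U> p \<longrightarrow>
       (\<forall>\<^sub>F F in finite_subsets_at_top \<U>. norm (bi1_sum M f p F - J) < norm (I - J) / 2)"
    using has_bi1_netD[OF assms(2) e] by (elim exE conjE)
  let ?W = "common_refinement \<P> \<Q>"
  note W = common_refinement[OF P(1) Q(1)]
  note t = tagged_refinement_self[OF W(1)]
  have "\<forall>\<^sub>F F in finite_subsets_at_top ?W. False"
    using P(2)[rule_format, OF tagged_refinement_trans[OF t W(2)]] Q(2)[rule_format, OF tagged_refinement_trans[OF t W(3)]]
  proof eventually_elim
    case (elim F)
    have "norm (I - J) \<le> norm (bi1_sum M f (\<lambda>U. SOME x. x \<in> U) F - J) + norm (bi1_sum M f (\<lambda>U. SOME x. x \<in> U) F - I)"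
      using norm_triangle_ineq4[of "bi1_sum M f (\<lambda>U. SOME x. x \<in> U) F - J" "bi1_sum M f (\<lambda>U. SOME x. x \<in> U) F - I"] by simp
    then show ?case using elim by simp
  qed
  then show False by simp
qed

lemma bi1_integral_eqI: "has_bi1_integral M f I \<Longrightarrow> bi1_integral M f = I"
  unfolding bi1_integral_def using has_bi1_integral_unique by blast

lemma has_bi1_integral_integral: "bi1_integrable M f \<Longrightarrow> has_bi1_integral M f (bi1_integral M f)"
  unfolding bi1_integrable_def using bi1_integral_eqI by blast

lemma bi1_sum_add: "bi1_sum M (\<lambda>x. f x + g x) p F = bi1_sum M f p F + bi1_sum M g p F"
  by (simp add: bi1_sum_def sum.distrib scaleR_add_right)

lemma bi1_sum_scaleR: "bi1_sum M (\<lambda>x. c *\<^sub>R f x) p F = c *\<^sub>R bi1_sum M f p F"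
  by (simp add: bi1_sum_def scaleR_sum_right mult.commute)

lemma has_bi1_integral_add:
  assumes "has_bi1_integral M f I" "has_bi1_integral M g J"
  shows "has_bi1_integral M (\<lambda>x. f x + g x) (I + J)"
proof (rule has_bi1_netI)
  fix \<epsilon> :: real assume "\<epsilon> > 0" then have e: "\<epsilon> / 2 > 0" by simp
  obtain \<P> where P: "meas_partition M \<P>"
    "\<forall>\<U> p. tagged_refinement M \<P> \<U> p \<longrightarrow>
       (\<forall>\<^sub>F F in finite_subsets_at_top \<U>. norm (bi1_sum M f p F - I) < \<epsilon> / 2)"
    using has_bi1_netD[OF assms(1) e] by (elim exE conjE)
  obtain \<Q> where Q: "meas_partition M \<Q>"
    "\<forall>\<U> p. tagged_refinement M \<Q> \<U> p \<longrightarrow>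
       (\<forall>\<^sub>F F in finite_subsets_at_top \<U>. norm (bi1_sum M g p F - J) < \<epsilon> / 2)"
    using has_bi1_netD[OF assms(2) e] by (elim exE conjE)
  note W = common_refinement[OF P(1) Q(1)]
  show "\<exists>\<P>. meas_partition M \<P> \<and> (\<forall>\<U> p. tagged_refinement M \<P> \<U> p \<longrightarrow>
       (\<forall>\<^sub>F F in finite_subsets_at_top \<U>. norm (bi1_sum M (\<lambda>x. f x + g x) p F - (I + J)) < \<epsilon>))"
  proof (intro exI[of _ "common_refinement \<P> \<Q>"] conjI allI impI W(1))
    fix \<U> p assume t: "tagged_refinement M (common_refinement \<P> \<Q>) \<U> p"
    show "\<forall>\<^sub>F F in finite_subsets_at_top \<U>. norm (bi1_sum M (\<lambda>x. f x + g x) p F - (I + J)) < \<epsilon>"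
      using P(2)[rule_format, OF tagged_refinement_trans[OF t W(2)]] Q(2)[rule_format, OF tagged_refinement_trans[OF t W(3)]]
    proof eventually_elim
      case (elim F)
      show ?case using elim norm_triangle_ineq[of "bi1_sum M f p F - I" "bi1_sum M g p F - J"]
        unfolding bi1_sum_add by (simp add: algebra_simps)
    qed
  qed
qed

lemma has_bi1_integral_scaleR:
  assumes "has_bi1_integral M f I"
  shows "has_bi1_integral M (\<lambda>x. c *\<^sub>R f x) (c *\<^sub>R I)"
proof (rule has_bi1_netI)
  fix \<epsilon> :: real assume "\<epsilon> > 0" then have e: "\<epsilon> / (\<bar>c\<bar> + 1) > 0" by simp
  obtain \<P> where P: "meas_partition M \<P>"
    "\<forall>\<U> p. tagged_refinement M \<P> \<U> p \<longrightarrow>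
       (\<forall>\<^sub>F F in finite_subsets_at_top \<U>. norm (bi1_sum M f p F - I) < \<epsilon> / (\<bar>c\<bar> + 1))"
    using has_bi1_netD[OF assms(1) e] by (elim exE conjE)
  show "\<exists>\<P>. meas_partition M \<P> \<and> (\<forall>\<U> p. tagged_refinement M \<P> \<U> p \<longrightarrow>
       (\<forall>\<^sub>F F in finite_subsets_at_top \<U>. norm (bi1_sum M (\<lambda>x. c *\<^sub>R f x) p F - c *\<^sub>R I) < \<epsilon>))"
  proof (intro exI[of _ \<P>] conjI allI impI P(1))
    fix \<U> p assume t: "tagged_refinement M \<P> \<U> p"
    show "\<forall>\<^sub>F F in finite_subsets_at_top \<U>. norm (bi1_sum M (\<lambda>x. c *\<^sub>R f x) p F - c *\<^sub>R I) < \<epsilon>"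
      using P(2)[rule_format, OF t]
    proof eventually_elim
      case (elim F)
      have "\<bar>c\<bar> * norm (bi1_sum M f p F - I) \<le> (\<bar>c\<bar> + 1) * norm (bi1_sum M f p F - I)"
        by (intro mult_right_mono) auto
      also have "\<dots> < \<epsilon>" using elim by (simp add: pos_less_divide_eq mult.commute)
      finally show ?case unfolding bi1_sum_scaleR by (simp flip: scaleR_diff_right)
    qed
  qed
qed

lemma has_bi1_integral_diff:
  assumes "has_bi1_integral M f I" "has_bi1_integral M g J"
  shows "has_bi1_integral M (\<lambda>x. f x - g x) (I - J)"
  using has_bi1_integral_add[OF assms(1) has_bi1_integral_scaleR[OF assms(2), of "-1"]] by simp

lemma has_bi1_integral_zero: "has_bi1_integral M (\<lambda>x. 0) 0"
proof (rule has_bi1_netI)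
  fix \<epsilon> :: real assume "\<epsilon> > 0"
  moreover have "meas_partition M ({space M} - {{}})" by (auto simp: meas_partition_def disjoint_def)
  ultimately show "\<exists>\<P>. meas_partition M \<P> \<and> (\<forall>\<U> p. tagged_refinement M \<P> \<U> p \<longrightarrow>
       (\<forall>\<^sub>F F in finite_subsets_at_top \<U>. norm (bi1_sum M (\<lambda>x. 0) p F - 0) < \<epsilon>))"
    by (intro exI[of _ "{space M} - {{}}"]) (simp add: bi1_sum_def)
qed

lemma has_bi1_integral_sum:
  assumes "finite A" "\<And>i. i \<in> A \<Longrightarrow> has_bi1_integral M (f i) (I i)" 
  shows "has_bi1_integral M (\<lambda>x. \<Sum>i\<in>A. f i x) (\<Sum>i\<in>A. I i)"
  using assms(1,2)
proof (induction A rule: finite_induct)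
  case empty then show ?case by (simp add: has_bi1_integral_zero)
next
  case (insert i A)
  then show ?case using has_bi1_integral_add[of M "f i" "I i"] by simp
qed

text \<open>
  Refining by \<open>N\<close> and its complement makes every cell either null or a set on which the functions
  agree.
\<close>

lemma has_bi1_integral_cong_null:
  assumes f: "has_bi1_integral M f I" and N: "N \<in> null_sets M"
    and eq: "\<And>x. x \<in> space M \<Longrightarrow> x \<notin> N \<Longrightarrow> f x = g x"
  shows "has_bi1_integral M g I"
proof (rule has_bi1_netI)
  fix \<epsilon> :: real assume e: "\<epsilon> > 0"
  obtain \<P> where P: "meas_partition M \<P>"
    "\<forall>\<U> p. tagged_refinement M \<P> \<U> p \<longrightarrow>
       (\<forall>\<^sub>F F in finite_subsets_at_top \<U>. norm (bi1_sum M f p F - I) < \<epsilon>)"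
    using has_bi1_netD[OF f e] by (elim exE conjE)
  have NM: "N \<in> sets M" using N by auto
  have Q: "meas_partition M ({N, space M - N} - {{}})"
    using NM sets.sets_into_space[OF NM] by (auto simp: meas_partition_def disjoint_def)
  note W = common_refinement[OF P(1) Q]
  show "\<exists>\<P>. meas_partition M \<P> \<and> (\<forall>\<U> p. tagged_refinement M \<P> \<U> p \<longrightarrow>
       (\<forall>\<^sub>F F in finite_subsets_at_top \<U>. norm (bi1_sum M g p F - I) < \<epsilon>))"
  proof (intro exI[of _ "common_refinement \<P> ({N, space M - N} - {{}})"] conjI allI impI W(1))
    fix \<U> p assume t: "tagged_refinement M (common_refinement \<P> ({N, space M - N} - {{}})) \<U> p"
    have eqU: "measure M U *\<^sub>R g (p U) = measure M U *\<^sub>R f (p U)" if "U \<in> \<U>" for U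
    proof -
      have U: "U \<subseteq> N \<or> U \<subseteq> space M - N" "p U \<in> U" "U \<in> sets M"
        using tagged_refinement_trans[OF t W(3)] that
        by (auto simp: tagged_refinement_def refines_def meas_partition_def)
      show ?thesis
      proof (cases "U \<subseteq> N")
        case True
        then have "U \<in> null_sets M" using N U(3) null_sets_subset by blast
        then have "measure M U = 0" by (auto simp: measure_def)
        then show ?thesis by simp
      next
        case False then show ?thesis using U eq[of "p U"] by auto
      qed
    qed
    show "\<forall>\<^sub>F F in finite_subsets_at_top \<U>. norm (bi1_sum M g p F - I) < \<epsilon>"
      using P(2)[rule_format, OF tagged_refinement_trans[OF t W(2)]] eventually_finite_subsets_at_top_weakI[of \<U> "\<lambda>F. F \<subseteq> \<U>"]
    proof (rule eventually_elim2)
      fix F assume F: "norm (bi1_sum M f p F - I) < \<epsilon>" "F \<subseteq> \<U>"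
      have "bi1_sum M g p F = bi1_sum M f p F"
        unfolding bi1_sum_def using eqU F(2) by (intro sum.cong) auto
      then show "norm (bi1_sum M g p F - I) < \<epsilon>" using F by simp
    qed
  qed
qed

lemma eventually_prod_finite_subsetsI:
  assumes "\<And>F G. finite F \<Longrightarrow> F1 \<subseteq> F \<Longrightarrow> F \<subseteq> \<U> \<Longrightarrow> finite G \<Longrightarrow> F2 \<subseteq> G \<Longrightarrow> G \<subseteq> \<V> \<Longrightarrow> Q F G"
    and "finite F1" "F1 \<subseteq> \<U>" "finite F2" "F2 \<subseteq> \<V>"
  shows "\<forall>\<^sub>F (F, G) in finite_subsets_at_top \<U> \<times>\<^sub>F finite_subsets_at_top \<V>. Q F G"
proof -
  have "\<forall>\<^sub>F F in finite_subsets_at_top \<U>. finite F \<and> F1 \<subseteq> F \<and> F \<subseteq> \<U>"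
    unfolding eventually_finite_subsets_at_top using assms(2,3) by (intro exI[of _ F1]) simp
  moreover have "\<forall>\<^sub>F F in finite_subsets_at_top \<V>. finite F \<and> F2 \<subseteq> F \<and> F \<subseteq> \<V>"
    unfolding eventually_finite_subsets_at_top using assms(4,5) by (intro exI[of _ F2]) simp
  ultimately show ?thesis
    by (rule eventually_prod_filter[THEN iffD2, OF exI, OF exI, OF conjI, OF _ conjI])
       (simp add: assms(1))
qed

text \<open>
  The two refinements have different cells, so the two sums run over independent nets. Approximate
  values \<open>v n\<close> for the tolerances \<open>1 / (n + 1)\<close> come from unrelated partitions; a common refinement of
  two of them shows that the \<open>v n\<close> form a Cauchy sequence.
\<close>

lemma bi1_integrable_CauchyI:
  fixes f :: "'a \<Rightarrow> 'x::banach"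
  assumes C: "\<And>\<epsilon>. \<epsilon> > 0 \<Longrightarrow> \<exists>\<P>. meas_partition M \<P> \<and>
     (\<forall>\<U> p \<V> q. tagged_refinement M \<P> \<U> p \<longrightarrow> tagged_refinement M \<P> \<V> q \<longrightarrow>
       (\<forall>\<^sub>F (F, G) in finite_subsets_at_top \<U> \<times>\<^sub>F finite_subsets_at_top \<V>.
           norm (bi1_sum M f p F - bi1_sum M f q G) < \<epsilon>))"
  shows "bi1_integrable M f"
proof -
  have "\<forall>n. \<exists>\<P>. meas_partition M \<P> \<and>
     (\<forall>\<U> p \<V> q. tagged_refinement M \<P> \<U> p \<longrightarrow> tagged_refinement M \<P> \<V> q \<longrightarrow>
       (\<forall>\<^sub>F (F, G) in finite_subsets_at_top \<U> \<times>\<^sub>F finite_subsets_at_top \<V>.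
           norm (bi1_sum M f p F - bi1_sum M f q G) < 1 / real (Suc n)))"
    by (intro allI C) simp
  from choice[OF this] obtain \<P> where PP: "\<forall>n. meas_partition M (\<P> n) \<and>
     (\<forall>\<U> p \<V> q. tagged_refinement M (\<P> n) \<U> p \<longrightarrow> tagged_refinement M (\<P> n) \<V> q \<longrightarrow>
       (\<forall>\<^sub>F (F, G) in finite_subsets_at_top \<U> \<times>\<^sub>F finite_subsets_at_top \<V>.
           norm (bi1_sum M f p F - bi1_sum M f q G) < 1 / real (Suc n)))" ..
  note P = PP[rule_format, THEN conjunct1]
  note cl = PP[rule_format, THEN conjunct2, rule_format]
  let ?t = "\<lambda>U. SOME x. x \<in> U"
  have "\<exists>v. \<forall>\<U> p. tagged_refinement M (\<P> n) \<U> p \<longrightarrow>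
           (\<forall>\<^sub>F F in finite_subsets_at_top \<U>. norm (bi1_sum M f p F - v) < 2 / real (Suc n))" for n
  proof -
    note tn = tagged_refinement_self[OF P[of n]]
    obtain PP QQ where PQ: "eventually PP (finite_subsets_at_top (\<P> n))" "eventually QQ (finite_subsets_at_top (\<P> n))"
      "\<And>F G. PP F \<Longrightarrow> QQ G \<Longrightarrow> norm (bi1_sum M f ?t F - bi1_sum M f ?t G) < 1 / real (Suc n)"
      using cl[OF tn tn] unfolding eventually_prod_filter by auto
    obtain G where G: "QQ G" using eventually_happens'[OF finite_subsets_at_top_neq_bot PQ(2)] by blast
    show ?thesis
    proof (intro exI[of _ "bi1_sum M f ?t G"] allI impI)
      fix \<U> p assume t: "tagged_refinement M (\<P> n) \<U> p"
      obtain PP' QQ' where PQ': "eventually PP' (finite_subsets_at_top \<U>)" "eventually QQ' (finite_subsets_at_top (\<P> n))"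
        "\<And>F G. PP' F \<Longrightarrow> QQ' G \<Longrightarrow> norm (bi1_sum M f p F - bi1_sum M f ?t G) < 1 / real (Suc n)"
        using cl[OF t tn] unfolding eventually_prod_filter by auto
      obtain H where H: "PP H" "QQ' H"
        using eventually_happens'[OF finite_subsets_at_top_neq_bot eventually_conj[OF PQ(1) PQ'(2)]] by blast
      show "\<forall>\<^sub>F F in finite_subsets_at_top \<U>. norm (bi1_sum M f p F - bi1_sum M f ?t G) < 2 / real (Suc n)"
        using PQ'(1)
      proof eventually_elim
        case (elim F)
        have "norm (bi1_sum M f p F - bi1_sum M f ?t G) \<le>
          norm (bi1_sum M f p F - bi1_sum M f ?t H) + norm (bi1_sum M f ?t H - bi1_sum M f ?t G)"
          using norm_triangle_ineq[of "bi1_sum M f p F - bi1_sum M f ?t H" "bi1_sum M f ?t H - bi1_sum M f ?t G"] by simp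
        also have "\<dots> < 1 / real (Suc n) + 1 / real (Suc n)"
          using PQ'(3)[OF elim H(2)] PQ(3)[OF H(1) G] by simp
        finally show ?case by simp
      qed
    qed
  qed
  from choice[OF allI[OF this]] obtain v where v': "\<forall>n \<U> p. tagged_refinement M (\<P> n) \<U> p \<longrightarrow>
           (\<forall>\<^sub>F F in finite_subsets_at_top \<U>. norm (bi1_sum M f p F - v n) < 2 / real (Suc n))" ..
  note v = v'[rule_format]
  have vv: "norm (v m - v n) < 2 / real (Suc m) + 2 / real (Suc n)" for m n
  proof -
    note W = common_refinement[OF P[of m] P[of n]]
    note t = tagged_refinement_self[OF W(1)]
    obtain F where F: "norm (bi1_sum M f ?t F - v m) < 2 / real (Suc m)" "norm (bi1_sum M f ?t F - v n) < 2 / real (Suc n)"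
      using eventually_happens'[OF finite_subsets_at_top_neq_bot
          eventually_conj[OF v[OF tagged_refinement_trans[OF t W(2)]] v[OF tagged_refinement_trans[OF t W(3)]]]] by blast
    then show ?thesis
      using norm_triangle_ineq4[of "bi1_sum M f ?t F - v n" "bi1_sum M f ?t F - v m"] by simp
  qed
  have lim0: "(\<lambda>n. 2 / real (Suc n)) \<longlonglongrightarrow> 0"
    using tendsto_mult[OF tendsto_const[of 2] LIMSEQ_inverse_real_of_nat] by (simp add: divide_inverse)
  have "Cauchy v"
  proof (rule CauchyI)
    fix e :: real assume "e > 0"
    then have "\<forall>\<^sub>F n in sequentially. 2 / real (Suc n) < e / 2" using order_tendstoD(2)[OF lim0, of "e / 2"] by simp
    then obtain K where K: "\<And>n. n \<ge> K \<Longrightarrow> 2 / real (Suc n) < e / 2" by (auto simp: eventually_sequentially)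
    show "\<exists>K. \<forall>m\<ge>K. \<forall>n\<ge>K. norm (v m - v n) < e"
      using vv K by (intro exI[of _ K]) (smt (verit) field_sum_of_halves)
  qed
  then obtain I where I: "v \<longlonglongrightarrow> I" using Cauchy_convergent_iff convergent_def by blast
  have "has_bi1_integral M f I"
  proof (rule has_bi1_netI)
    fix e :: real assume "e > 0"
    then have "\<forall>\<^sub>F n in sequentially. 2 / real (Suc n) < e / 2 \<and> dist (v n) I < e / 2"
      using order_tendstoD(2)[OF lim0, of "e / 2"] tendstoD[OF I, of "e / 2"] by (simp add: eventually_conj)
    then obtain n where n: "2 / real (Suc n) < e / 2" "norm (v n - I) < e / 2"
      using eventually_happens'[OF sequentially_bot] by (auto simp: dist_norm)
    show "\<exists>\<P>. meas_partition M \<P> \<and> (\<forall>\<U> p. tagged_refinement M \<P> \<U> p \<longrightarrow>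
       (\<forall>\<^sub>F F in finite_subsets_at_top \<U>. norm (bi1_sum M f p F - I) < e))"
    proof (intro exI[of _ "\<P> n"] conjI allI impI P)
      fix \<U> p assume "tagged_refinement M (\<P> n) \<U> p"
      from v[OF this] show "\<forall>\<^sub>F F in finite_subsets_at_top \<U>. norm (bi1_sum M f p F - I) < e"
      proof eventually_elim
        case (elim F)
        then show ?case using n norm_triangle_ineq[of "bi1_sum M f p F - v n" "v n - I"] by simp
      qed
    qed
  qed
  then show ?thesis unfolding bi1_integrable_def by blast
qed

lemma meas_partition_restrict_space:
  assumes "meas_partition M \<P>" "A \<in> sets M"
  shows "meas_partition (restrict_space M A) ((\<lambda>V. V \<inter> A) ` \<P> - {{}})"
proof -
  have P: "countable \<P>" "\<P> \<subseteq> sets M" "disjoint \<P>" "\<Union>\<P> = space M"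
    using assms by (auto simp: meas_partition_def)
  have A: "A \<subseteq> space M" "A \<inter> space M \<in> sets M" using assms(2) sets.sets_into_space by auto
  have "disjoint ((\<lambda>V. V \<inter> A) ` \<P> - {{}})"
    using P(3) unfolding disjoint_def by blast
  moreover have "\<Union>((\<lambda>V. V \<inter> A) ` \<P> - {{}}) = space (restrict_space M A)"
  proof -
    have "\<Union>((\<lambda>V. V \<inter> A) ` \<P> - {{}}) = \<Union>\<P> \<inter> A" by auto
    then show ?thesis using P(4) A by (auto simp: space_restrict_space)
  qed
  moreover have "V \<inter> A \<in> sets M" if "V \<in> \<P>" for V using that P(2) assms(2) by blast
  ultimately show ?thesis
    using P(1) A unfolding meas_partition_def by (auto simp: sets_restrict_space_iff[OF A(2)])
qed

lemma meas_partition_glue: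
  assumes U: "meas_partition (restrict_space M A) \<U>" and V: "meas_partition (restrict_space M (space M - A)) \<V>"
    and A: "A \<in> sets M"
  shows "meas_partition M (\<U> \<union> \<V>)" "\<U> \<inter> \<V> = {}"
proof -
  have A': "A \<subseteq> space M" "A \<inter> space M \<in> sets M" "(space M - A) \<inter> space M \<in> sets M"
    using A sets.sets_into_space by auto
  have U': "countable \<U>" "\<U> \<subseteq> sets M" "{} \<notin> \<U>" "disjoint \<U>" "\<Union>\<U> = A"
    using U A' by (auto simp: meas_partition_def sets_restrict_space_iff[OF A'(2)] space_restrict_space)
  have V': "countable \<V>" "\<V> \<subseteq> sets M" "{} \<notin> \<V>" "disjoint \<V>" "\<Union>\<V> = space M - A"
    using V A' by (auto simp: meas_partition_def sets_restrict_space_iff[OF A'(3)] space_restrict_space)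
  have "disjoint (\<U> \<union> \<V>)"
    using U'(4) V'(4) by (rule disjoint_union) (use U'(5) V'(5) in auto)
  then show "meas_partition M (\<U> \<union> \<V>)" using U' V' A' by (auto simp: meas_partition_def)
  show "\<U> \<inter> \<V> = {}" 
  proof (rule ccontr)
    assume "\<not> ?thesis"
    then obtain X where X: "X \<in> \<U>" "X \<in> \<V>" by blast
    then have "X \<subseteq> A" "X \<subseteq> space M - A" using U'(5) V'(5) by auto
    then have "X = {}" by auto
    then show False using X U'(3) by simp
  qed
qed

text \<open>
  Every tagged partition of \<open>A\<close> is completed by the same tagged cells outside \<open>A\<close>. The difference of
  two sums over \<open>A\<close> is then a difference of two sums over the whole space, where the Cauchy condition
  is known.
\<close>

lemma bi1_integrable_restrict_space:
  fixes f :: "'a \<Rightarrow> 'x::banach"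
  assumes f: "bi1_integrable M f" and A: "A \<in> sets M"
  shows "bi1_integrable (restrict_space M A) f"
proof (rule bi1_integrable_CauchyI)
  fix \<epsilon> :: real assume "\<epsilon> > 0" then have e: "\<epsilon> / 2 > 0" by simp
  let ?MA = "restrict_space M A" and ?MB = "restrict_space M (space M - A)"
  obtain I where I: "has_bi1_integral M f I" using f by (auto simp: bi1_integrable_def)
  obtain \<P> where P: "meas_partition M \<P>"
    "\<forall>\<U> p. tagged_refinement M \<P> \<U> p \<longrightarrow>
       (\<forall>\<^sub>F F in finite_subsets_at_top \<U>. norm (bi1_sum M f p F - I) < \<epsilon> / 2)"
    using has_bi1_netD[OF I e] by (elim exE conjE)
  have A': "A \<subseteq> space M" "A \<inter> space M \<in> sets M" "(space M - A) \<in> sets M"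
    using A sets.sets_into_space by auto
  define PA where "PA = (\<lambda>V. V \<inter> A) ` \<P> - {{}}"
  define PB where "PB = (\<lambda>V. V \<inter> (space M - A)) ` \<P> - {{}}"
  have PA: "meas_partition ?MA PA" and PB: "meas_partition ?MB PB"
    unfolding PA_def PB_def by (intro meas_partition_restrict_space P A A'(3))+
  let ?t = "\<lambda>U. SOME x. x \<in> U"
  have ref: "refines PA \<P>" "refines PB \<P>" unfolding PA_def PB_def refines_def by auto
  have tB: "\<And>U. U \<in> PB \<Longrightarrow> ?t U \<in> U" using tagged_refinement_self[OF PB] by (auto simp: tagged_refinement_def)
  have ext: "\<exists>F0. finite F0 \<and> F0 \<subseteq> \<U> \<and> (\<exists>K. finite K \<and> K \<subseteq> PB \<and>
      (\<forall>F H. finite F \<longrightarrow> F0 \<subseteq> F \<longrightarrow> F \<subseteq> \<U> \<longrightarrow> finite H \<longrightarrow> K \<subseteq> H \<longrightarrow> H \<subseteq> PB \<longrightarrow>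
        norm (bi1_sum ?MA f p F + bi1_sum M f ?t H - I) < \<epsilon> / 2))"
    if t: "tagged_refinement ?MA PA \<U> p" for \<U> p
  proof -
    have U: "meas_partition ?MA \<U>" "refines \<U> PA" "\<And>U. U \<in> \<U> \<Longrightarrow> p U \<in> U"
      using t by (auto simp: tagged_refinement_def)
    note G = meas_partition_glue[OF U(1) PB A]
    have US: "U \<subseteq> A" if "U \<in> \<U>" for U
      using U(1) that A' by (auto simp: meas_partition_def space_restrict_space)
    define q where "q U = (if U \<in> \<U> then p U else ?t U)" for U
    have "refines (\<U> \<union> PB) \<P>" using refines_trans[OF U(2) ref(1)] ref(2) by (auto simp: refines_def)
    then have "tagged_refinement M \<P> (\<U> \<union> PB) q"
      unfolding tagged_refinement_def using G U(3) tB by (auto simp: q_def)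
    from P(2)[rule_format, OF this] obtain F0 where F0: "finite F0" "F0 \<subseteq> \<U> \<union> PB"
      "\<And>F. finite F \<Longrightarrow> F0 \<subseteq> F \<Longrightarrow> F \<subseteq> \<U> \<union> PB \<Longrightarrow> norm (bi1_sum M f q F - I) < \<epsilon> / 2"
      unfolding eventually_finite_subsets_at_top by (elim exE conjE) simp
    have "norm (bi1_sum ?MA f p F + bi1_sum M f ?t H - I) < \<epsilon> / 2"
      if FH: "finite F" "F0 \<inter> \<U> \<subseteq> F" "F \<subseteq> \<U>" "finite H" "F0 \<inter> PB \<subseteq> H" "H \<subseteq> PB" for F H
    proof -
      have "norm (bi1_sum M f q (F \<union> H) - I) < \<epsilon> / 2" using FH F0(2) by (intro F0(3)) auto
      moreover have "F \<inter> H = {}" using FH G(2) by auto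
      then have "bi1_sum M f q (F \<union> H) = bi1_sum M f q F + bi1_sum M f q H"
        unfolding bi1_sum_def using FH by (intro sum.union_disjoint) auto
      moreover have "bi1_sum M f q F = bi1_sum ?MA f p F"
        unfolding bi1_sum_def
      proof (intro sum.cong refl)
        fix U assume "U \<in> F"
        then have "U \<in> \<U>" using FH by auto
        then have "measure ?MA U = measure M U" using US A' by (intro measure_restrict_space) auto
        then show "measure M U *\<^sub>R f (q U) = measure ?MA U *\<^sub>R f (p U)" using \<open>U \<in> \<U>\<close> by (simp add: q_def)
      qed
      moreover have "bi1_sum M f q H = bi1_sum M f ?t H"
        unfolding bi1_sum_def using FH G(2) by (intro sum.cong refl) (auto simp: q_def)
      ultimately show ?thesis by simp
    qed
    then show ?thesis using F0(1)
      by (intro exI[of _ "F0 \<inter> \<U>"] exI[of _ "F0 \<inter> PB"] conjI allI impI) auto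
  qed
  show "\<exists>\<P>. meas_partition ?MA \<P> \<and>
     (\<forall>\<U> p \<V> q. tagged_refinement ?MA \<P> \<U> p \<longrightarrow> tagged_refinement ?MA \<P> \<V> q \<longrightarrow>
       (\<forall>\<^sub>F (F, G) in finite_subsets_at_top \<U> \<times>\<^sub>F finite_subsets_at_top \<V>.
           norm (bi1_sum ?MA f p F - bi1_sum ?MA f q G) < \<epsilon>))"
  proof (intro exI[of _ PA] conjI allI impI PA)
    fix \<U> p \<V> q assume t: "tagged_refinement ?MA PA \<U> p" "tagged_refinement ?MA PA \<V> q"
    from ext[OF t(1)] obtain F1 K1 where 1: "finite F1" "F1 \<subseteq> \<U>" "finite K1" "K1 \<subseteq> PB"
      "\<And>F H. finite F \<Longrightarrow> F1 \<subseteq> F \<Longrightarrow> F \<subseteq> \<U> \<Longrightarrow> finite H \<Longrightarrow> K1 \<subseteq> H \<Longrightarrow> H \<subseteq> PB \<Longrightarrow>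
        norm (bi1_sum ?MA f p F + bi1_sum M f ?t H - I) < \<epsilon> / 2"
      by (elim exE conjE) simp
    from ext[OF t(2)] obtain F2 K2 where 2: "finite F2" "F2 \<subseteq> \<V>" "finite K2" "K2 \<subseteq> PB"
      "\<And>F H. finite F \<Longrightarrow> F2 \<subseteq> F \<Longrightarrow> F \<subseteq> \<V> \<Longrightarrow> finite H \<Longrightarrow> K2 \<subseteq> H \<Longrightarrow> H \<subseteq> PB \<Longrightarrow>
        norm (bi1_sum ?MA f q F + bi1_sum M f ?t H - I) < \<epsilon> / 2"
      by (elim exE conjE) simp
    have "norm (bi1_sum ?MA f p F - bi1_sum ?MA f q G) < \<epsilon>"
      if "finite F" "F1 \<subseteq> F" "F \<subseteq> \<U>" "finite G" "F2 \<subseteq> G" "G \<subseteq> \<V>" for F G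
    proof -
      have "norm (bi1_sum ?MA f p F + bi1_sum M f ?t (K1 \<union> K2) - I) < \<epsilon> / 2"
        "norm (bi1_sum ?MA f q G + bi1_sum M f ?t (K1 \<union> K2) - I) < \<epsilon> / 2"
        using that 1(1-4) 2(1-4) by (intro 1(5) 2(5); simp)+
      then show ?thesis
        using norm_triangle_ineq4[of "bi1_sum ?MA f p F + bi1_sum M f ?t (K1 \<union> K2) - I"
            "bi1_sum ?MA f q G + bi1_sum M f ?t (K1 \<union> K2) - I"] by simp
    qed
    then show "\<forall>\<^sub>F (F, G) in finite_subsets_at_top \<U> \<times>\<^sub>F finite_subsets_at_top \<V>.
           norm (bi1_sum ?MA f p F - bi1_sum ?MA f q G) < \<epsilon>"
      using 1(1,2) 2(1,2) by (intro eventually_prod_finite_subsetsI[of F1 _ F2])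
  qed
qed

section \<open>Strong measurability\<close>

text \<open>
  Convergence is required at every point, not only almost everywhere: limits of adapted functions are
  then measurable with respect to the given \<open>\<sigma>\<close>-algebra, which need not contain the null sets.
\<close>

definition smeas :: "'a measure \<Rightarrow> ('a \<Rightarrow> 'x::real_normed_vector) \<Rightarrow> bool" where
  "smeas M f \<longleftrightarrow> (\<exists>s. (\<forall>n. simple_function M (s n)) \<and> (\<forall>x\<in>space M. (\<lambda>n. s n x) \<longlonglongrightarrow> f x))"

text \<open>
  The \<open>n\<close>-th approximation of \<open>f x\<close> is the nearest among the first \<open>n + 1\<close> points of a dense sequence;
  ties are broken by the least index, which keeps the choice measurable.
\<close>

lemma smeasI_separable:
  fixes f :: "'a \<Rightarrow> 'x::real_normed_vector"
  assumes f[measurable]: "f \<in> borel_measurable M" and D: "countable D" "f ` space M \<subseteq> closure D"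
  shows "smeas M f"
proof (cases "D = {}")
  case True
  then have "space M = {}" using D by auto
  then show ?thesis unfolding smeas_def by (intro exI[of _ "\<lambda>_ _. 0"]) auto
next
  case False
  define d where "d = from_nat_into D"
  have d: "range d = D" unfolding d_def using False D(1) by (rule range_from_nat_into)
  define idx where "idx n x = (LEAST i. i \<le> n \<and> (\<forall>j\<in>{..n}. dist (f x) (d i) \<le> dist (f x) (d j)))" for n :: nat and x
  have ex: "\<exists>i\<le>n. \<forall>j\<in>{..n}. dist (f x) (d i) \<le> dist (f x) (d j)" for n x
    using arg_min_least[of "{..n}" _ "\<lambda>j. dist (f x) (d j)"] arg_min_if_finite(1)[of "{..n}" "\<lambda>j. dist (f x) (d j)"]
    by (intro exI[of _ "arg_min_on (\<lambda>j. dist (f x) (d j)) {..n}"]) auto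
  have idx: "idx n x \<le> n \<and> (\<forall>j\<in>{..n}. dist (f x) (d (idx n x)) \<le> dist (f x) (d j))" for n x
    unfolding idx_def by (rule LeastI_ex) (use ex in blast)
  have [measurable]: "(\<lambda>x. dist (f x) c) \<in> borel_measurable M" for c
    by (rule measurable_compose[OF f]) (intro borel_measurable_continuous_onI continuous_intros)
  have [measurable]: "idx n \<in> measurable M (count_space UNIV)" for n
    unfolding idx_def[abs_def] by measurable
  have "simple_function M (\<lambda>x. d (idx n x))" for n
  proof -
    have fin: "finite (idx n ` space M)" by (rule finite_subset[of _ "{..n}"]) (use idx in auto)
    have "simple_function M (idx n)"
      unfolding simple_function_def using fin by (auto intro: measurable_sets)
    then show ?thesis by (rule simple_function_compose1)
  qed
  moreover have "(\<lambda>n. d (idx n x)) \<longlonglongrightarrow> f x" if x: "x \<in> space M" for x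
  proof (rule tendstoI)
    fix e :: real assume "e > 0"
    have "f x \<in> closure D" using D(2) x by auto
    then obtain c where "c \<in> D" "dist c (f x) < e" using \<open>e > 0\<close> unfolding closure_approachable by blast
    then obtain i where i: "dist (f x) (d i) < e" using d by (auto simp: dist_commute)
    have "dist (d (idx n x)) (f x) < e" if "n \<ge> i" for n
      using idx[of n x] i that by (auto simp: dist_commute intro: le_less_trans)
    then show "\<forall>\<^sub>F n in sequentially. dist (d (idx n x)) (f x) < e"
      by (auto simp: eventually_sequentially)
  qed
  ultimately show ?thesis unfolding smeas_def by (intro exI[of _ "\<lambda>n x. d (idx n x)"]) simp
qed

lemma smeasD:
  assumes "smeas M f"
  shows "f \<in> borel_measurable M" "\<exists>D. countable D \<and> f ` space M \<subseteq> closure D"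
proof -
  obtain s where s: "\<And>n. simple_function M (s n)" "\<And>x. x \<in> space M \<Longrightarrow> (\<lambda>n. s n x) \<longlonglongrightarrow> f x"
    using assms by (auto simp: smeas_def)
  show "f \<in> borel_measurable M"
  proof (rule borel_measurable_LIMSEQ_metric)
    show "s n \<in> borel_measurable M" for n 
      using measurable_compose[OF measurable_simple_function[OF s(1)], of "\<lambda>x. x" borel] by simp
  qed (rule s(2))
  have "countable (\<Union>n. s n ` space M)"
    using s(1) by (intro countable_UN) (auto simp: simple_function_def intro: countable_finite)
  moreover have "f ` space M \<subseteq> closure (\<Union>n. s n ` space M)"
  proof
    fix y assume "y \<in> f ` space M"
    then obtain x where x: "x \<in> space M" "y = f x" by blast
    show "y \<in> closure (\<Union>n. s n ` space M)"
      unfolding closure_sequential using s(2)[OF x(1)] x by (intro exI[of _ "\<lambda>n. s n x"]) auto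
  qed
  ultimately show "\<exists>D. countable D \<and> f ` space M \<subseteq> closure D" by (intro exI[of _ "\<Union>n. s n ` space M"] conjI)
qed

lemma smeas_limit:
  assumes f: "\<And>n. smeas M (f n)" and lim: "\<And>x. x \<in> space M \<Longrightarrow> (\<lambda>n. f n x) \<longlonglongrightarrow> g x"
  shows "smeas M g"
proof -
  have "\<forall>n. \<exists>D. countable D \<and> f n ` space M \<subseteq> closure D" using smeasD(2)[OF f] by simp
  from choice[OF this] obtain D where D: "\<forall>n. countable (D n) \<and> f n ` space M \<subseteq> closure (D n)" ..
  show ?thesis
  proof (rule smeasI_separable)
    show "g \<in> borel_measurable M" by (rule borel_measurable_LIMSEQ_metric[OF smeasD(1)[OF f] lim])
    show "countable (\<Union>n. D n)" using D by auto
    have mem: "f n x \<in> closure (\<Union>n. D n)" if "x \<in> space M" for n x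
      using D that closure_mono[of "D n" "\<Union>n. D n"] by auto
    have "g x \<in> closure (\<Union>n. D n)" if "x \<in> space M" for x
      by (rule closed_sequentially[OF closed_closure _ lim[OF that]]) (rule mem[OF that])
    then show "g ` space M \<subseteq> closure (\<Union>n. D n)" by auto
  qed
qed

lemma smeas_real:
  fixes f :: "'a \<Rightarrow> real"
  assumes "f \<in> borel_measurable M" shows "smeas M f"
  by (rule smeasI_separable[OF assms countable_rat]) (simp add: Rats_closure_real)

lemma smeas_add:
  assumes "smeas M f" "smeas M g" shows "smeas M (\<lambda>x. f x + g x)"
proof -
  obtain s where s: "\<And>n. simple_function M (s n)" "\<And>x. x \<in> space M \<Longrightarrow> (\<lambda>n. s n x) \<longlonglongrightarrow> f x"
    using assms(1) by (auto simp: smeas_def)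
  obtain t where t: "\<And>n. simple_function M (t n)" "\<And>x. x \<in> space M \<Longrightarrow> (\<lambda>n. t n x) \<longlonglongrightarrow> g x"
    using assms(2) by (auto simp: smeas_def)
  show ?thesis unfolding smeas_def
    using s t by (intro exI[of _ "\<lambda>n x. s n x + t n x"])
      (auto intro!: tendsto_add simple_function_compose2[where h = "(+)"])
qed

lemma smeas_scaleR:
  fixes r :: "'a \<Rightarrow> real"
  assumes "r \<in> borel_measurable M" "smeas M g" shows "smeas M (\<lambda>x. r x *\<^sub>R g x)"
proof -
  obtain s where s: "\<And>n. simple_function M (s n)" "\<And>x. x \<in> space M \<Longrightarrow> (\<lambda>n. s n x) \<longlonglongrightarrow> r x"
    using smeas_real[OF assms(1)] by (auto simp: smeas_def)
  obtain t where t: "\<And>n. simple_function M (t n)" "\<And>x. x \<in> space M \<Longrightarrow> (\<lambda>n. t n x) \<longlonglongrightarrow> g x"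
    using assms(2) by (auto simp: smeas_def)
  show ?thesis unfolding smeas_def
    using s t by (intro exI[of _ "\<lambda>n x. s n x *\<^sub>R t n x"])
      (auto intro!: tendsto_scaleR simple_function_compose2[where h = "(*\<^sub>R)"])
qed

lemma smeas_const [simp]: "smeas M (\<lambda>x. c)"
  unfolding smeas_def by (intro exI[of _ "\<lambda>n x. c"]) auto

lemma smeas_diff:
  assumes "smeas M f" "smeas M g" shows "smeas M (\<lambda>x. f x - g x)"
  using smeas_add[OF assms(1) smeas_scaleR[OF _ assms(2), of "\<lambda>_. -1"]] by simp

lemma smeas_sum:
  assumes "\<And>i. i \<in> A \<Longrightarrow> smeas M (f i)" shows "smeas M (\<lambda>x. \<Sum>i\<in>A. f i x)"
proof (cases "finite A")
  case True then show ?thesis using assms by (induction A rule: finite_induct) (auto intro: smeas_add)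
qed simp

lemma smeas_functional:
  fixes f :: "'a \<Rightarrow> 'x::real_normed_vector" and x' :: "'x \<Rightarrow>\<^sub>L real"
  assumes "smeas M f" shows "(\<lambda>x. blinfun_apply x' (f x)) \<in> borel_measurable M"
  by (rule measurable_compose[OF smeasD(1)[OF assms]])
     (intro borel_measurable_continuous_onI linear_continuous_on blinfun.bounded_linear_right)

lemma smeas_norm:
  assumes "smeas M f" shows "(\<lambda>x. norm (f x)) \<in> borel_measurable M"
  by (rule measurable_compose[OF smeasD(1)[OF assms]])
     (intro borel_measurable_continuous_onI continuous_intros)

lemma smeas_restrict_space:
  assumes "smeas M f" shows "smeas (restrict_space M A) f"
proof -
  obtain D where D: "countable D" "f ` space M \<subseteq> closure D" using smeasD(2)[OF assms] by blast
  show ?thesis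
    by (rule smeasI_separable[OF measurable_restrict_space1[OF smeasD(1)[OF assms]] D(1)])
       (use D(2) in \<open>auto simp: space_restrict_space\<close>)
qed

lemma smeas_subalgebra:
  assumes "subalgebra M G" "smeas G f" shows "smeas M f"
proof -
  obtain D where D: "countable D" "f ` space G \<subseteq> closure D" using smeasD(2)[OF assms(2)] by blast
  show ?thesis
    by (rule smeasI_separable[OF measurable_from_subalg[OF assms(1) smeasD(1)[OF assms(2)]] D(1)])
       (use D(2) assms(1) in \<open>auto simp: subalgebra_def\<close>)
qed

lemma smeas_lebesgue_on_continuous:
  fixes f :: "real \<Rightarrow> 'x::real_normed_vector"
  assumes "continuous_on {a..b} f" shows "smeas (lebesgue_on {a..b}) f"
proof -
  have "f \<in> borel_measurable (restrict_space borel {a..b})"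
    using assms by (rule borel_measurable_continuous_on_restrict)
  then have m: "f \<in> borel_measurable (lebesgue_on {a..b})"
    unfolding measurable_def by (auto simp: space_restrict_space sets_restrict_space) 
  obtain D where D: "countable D" "D \<subseteq> {a..b}" "{a..b} \<subseteq> closure D"
    using separable by blast
  then have cl: "closure D = {a..b}" using closure_minimal[OF D(2)] by auto
  have "f ` closure D \<subseteq> closure (f ` D)"
    by (rule image_closure_subset) (use assms cl closure_subset[of "f ` D"] in auto)
  then show ?thesis using cl D(1) m by (intro smeasI_separable[OF m, of "f ` D"]) auto
qed

text \<open>
  The set where the sequence is Cauchy belongs to the \<open>\<sigma>\<close>-algebra, so the functions can be set to zero
  outside it before the limit is taken.
\<close>

lemma smeas_limit_where_convergent:
  fixes f :: "nat \<Rightarrow> 'a \<Rightarrow> 'x::banach"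
  assumes f: "\<And>n. smeas M (f n)"
  obtains g where "smeas M g" "\<And>x. x \<in> space M \<Longrightarrow> convergent (\<lambda>n. f n x) \<Longrightarrow> (\<lambda>n. f n x) \<longlonglongrightarrow> g x"
proof -
  have [measurable]: "(\<lambda>x. norm (f m x - f n x)) \<in> borel_measurable M" for m n
    by (intro smeas_norm smeas_diff f)
  define A where "A = {x\<in>space M. Cauchy (\<lambda>n. f n x)}"
  have "A = {x\<in>space M. \<forall>k. \<exists>K. \<forall>m\<ge>K. \<forall>n\<ge>K. norm (f m x - f n x) < inverse (real (Suc k))}"
  proof -
    have "Cauchy X \<longleftrightarrow> (\<forall>k. \<exists>K. \<forall>m\<ge>K. \<forall>n\<ge>K. norm (X m - X n) < inverse (real (Suc k)))" for X :: "nat \<Rightarrow> 'x"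
    proof
      assume "Cauchy X"
      then show "\<forall>k. \<exists>K. \<forall>m\<ge>K. \<forall>n\<ge>K. norm (X m - X n) < inverse (real (Suc k))"
        using CauchyD[of X] by simp
    next
      assume X: "\<forall>k. \<exists>K. \<forall>m\<ge>K. \<forall>n\<ge>K. norm (X m - X n) < inverse (real (Suc k))"
      show "Cauchy X"
      proof (rule CauchyI)
        fix e :: real assume "e > 0"
        then obtain k where k: "inverse (real (Suc k)) < e" using reals_Archimedean by blast
        obtain K where "\<forall>m\<ge>K. \<forall>n\<ge>K. norm (X m - X n) < inverse (real (Suc k))" using X by blast
        then show "\<exists>K. \<forall>m\<ge>K. \<forall>n\<ge>K. norm (X m - X n) < e"
          using k by (intro exI[of _ K]) (auto intro: less_trans)
      qed
    qed
    then show ?thesis unfolding A_def by simp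
  qed
  also have "\<dots> \<in> sets M" by measurable
  finally have A: "A \<in> sets M" .
  define g where "g x = lim (\<lambda>n. indicator A x *\<^sub>R f n x)" for x
  have lim: "(\<lambda>n. indicator A x *\<^sub>R f n x) \<longlonglongrightarrow> g x" for x
    unfolding g_def convergent_LIMSEQ_iff[symmetric]
    by (cases "x \<in> A") (auto simp: A_def Cauchy_convergent_iff convergent_const)
  show ?thesis
  proof (rule that[of g])
    show "smeas M g" by (rule smeas_limit[OF _ lim]) (intro smeas_scaleR f borel_measurable_indicator A)
    show "(\<lambda>n. f n x) \<longlonglongrightarrow> g x" if "x \<in> space M" "convergent (\<lambda>n. f n x)" for x
      using lim[of x] that by (simp add: A_def convergent_Cauchy)
  qed
qed

text \<open>
  Balls around a dense sequence of values, pulled back and made disjoint. On such a partition the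
  choice of the tags is immaterial up to \<open>\<epsilon>\<close>, which is what ties Birkhoff sums to integrals.
\<close>

lemma smeas_small_oscillation:
  assumes f: "smeas M f" and "\<epsilon> > 0"
  shows "\<exists>\<P>. meas_partition M \<P> \<and> (\<forall>U\<in>\<P>. \<forall>x\<in>U. \<forall>y\<in>U. norm (f x - f y) \<le> \<epsilon>)"
proof -
  obtain D where D: "countable D" "f ` space M \<subseteq> closure D" using smeasD(2)[OF f] by blast
  show ?thesis
  proof (cases "D = {}")
    case True
    then have "space M = {}" using D by auto
    then show ?thesis by (intro exI[of _ "{}"]) (simp add: meas_partition_def disjoint_def)
  next
    case False
    define d where "d = from_nat_into D"
    have d: "range d = D" unfolding d_def using False D(1) by (rule range_from_nat_into)
    have [measurable]: "(\<lambda>x. norm (f x - c)) \<in> borel_measurable M" for c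
      by (intro smeas_norm smeas_diff f smeas_const)
    define B where "B i = {x\<in>space M. norm (f x - d i) < \<epsilon> / 2}" for i
    have B: "B i \<in> sets M" for i unfolding B_def by measurable
    have cov: "(\<Union>i. B i) = space M"
    proof
      show "(\<Union>i. B i) \<subseteq> space M" by (auto simp: B_def)
      show "space M \<subseteq> (\<Union>i. B i)"
      proof
        fix x assume x: "x \<in> space M"
        then have "f x \<in> closure D" using D(2) by auto
        then obtain c where "c \<in> D" "dist c (f x) < \<epsilon> / 2"
          using \<open>\<epsilon> > 0\<close> unfolding closure_approachable by (meson half_gt_zero)
        then obtain i where "norm (f x - d i) < \<epsilon> / 2" using d by (auto simp: dist_norm norm_minus_commute)
        then show "x \<in> (\<Union>i. B i)" using x by (auto simp: B_def)
      qed
    qed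
    let ?P = "range (disjointed B) - {{}}"
    have "disjoint ?P"
      using disjoint_family_on_disjoint_image[OF disjoint_family_disjointed[of B]]
      unfolding disjoint_def by blast
    moreover have "\<Union>?P = \<Union>(range (disjointed B))" by blast
    then have "\<Union>?P = space M" using UN_disjointed_eq[of B] cov by simp
    moreover have "?P \<subseteq> sets M" using B sets.range_disjointed_sets[of B M] by auto
    ultimately have "meas_partition M ?P" by (auto simp: meas_partition_def)
    moreover have "norm (f x - f y) \<le> \<epsilon>" if U: "U \<in> ?P" "x \<in> U" "y \<in> U" for U x y
    proof -
      obtain i where i: "U = disjointed B i" using U(1) by auto
      have "U \<subseteq> B i" unfolding i by (rule disjointed_subset)
      then have "norm (f x - d i) < \<epsilon> / 2" "norm (f y - d i) < \<epsilon> / 2" using U by (auto simp: B_def)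
      then show ?thesis using norm_triangle_ineq4[of "f x - d i" "f y - d i"] by simp
    qed
    ultimately show ?thesis by blast
  qed
qed

section \<open>Birkhoff integrability as scalar uniform integrability\<close>

text \<open>
  Uniform integrability of the scalar functions \<open>x' \<circ> f\<close> over the dual unit ball. It is written with
  nonnegative integrals, so that it includes the integrability of each of them
  (see \<open>scalarly_ui_integrable\<close>).
\<close>

definition scalarly_ui :: "'a measure \<Rightarrow> ('a \<Rightarrow> 'x::real_normed_vector) \<Rightarrow> bool" where
  "scalarly_ui M f \<longleftrightarrow> (\<forall>\<epsilon>>0. \<exists>\<delta>>0. \<forall>A\<in>sets M. measure M A < \<delta> \<longrightarrow>
     (\<forall>x' :: 'x \<Rightarrow>\<^sub>L real. norm x' \<le> 1 \<longrightarrow> (\<integral>\<^sup>+x\<in>A. ennreal \<bar>blinfun_apply x' (f x)\<bar> \<partial>M) \<le> ennreal \<epsilon>))"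

lemma scalarly_uiD:
  fixes f :: "'a \<Rightarrow> 'x::real_normed_vector"
  assumes "scalarly_ui M f" "\<epsilon> > 0"
  shows "\<exists>\<delta>>0. \<forall>A\<in>sets M. \<forall>x' :: 'x \<Rightarrow>\<^sub>L real. measure M A < \<delta> \<longrightarrow> norm x' \<le> 1 \<longrightarrow>
     (\<integral>\<^sup>+x\<in>A. ennreal \<bar>blinfun_apply x' (f x)\<bar> \<partial>M) \<le> ennreal \<epsilon>"
  using assms(1)[unfolded scalarly_ui_def, rule_format, OF assms(2)] by simp

lemma scalarly_ui_dominated:
  fixes f :: "'a \<Rightarrow> 'x::real_normed_vector" and g :: "'a \<Rightarrow> 'x"
  assumes f: "scalarly_ui M f" and sf: "smeas M f" and "K \<ge> 0"
    and le: "\<And>x (x' :: 'x \<Rightarrow>\<^sub>L real). x \<in> space M \<Longrightarrow> \<bar>blinfun_apply x' (g x)\<bar> \<le> K * \<bar>blinfun_apply x' (f x)\<bar>"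
  shows "scalarly_ui M g"
  unfolding scalarly_ui_def
proof (intro allI impI)
  fix \<epsilon> :: real assume "\<epsilon> > 0"
  then have "\<epsilon> / (K + 1) > 0" using \<open>K \<ge> 0\<close> by simp
  from scalarly_uiD[OF f this] obtain \<delta> where d: "\<delta> > 0" "\<forall>A\<in>sets M. \<forall>x' :: 'x \<Rightarrow>\<^sub>L real. measure M A < \<delta> \<longrightarrow> norm x' \<le> 1 \<longrightarrow>
     (\<integral>\<^sup>+x\<in>A. ennreal \<bar>blinfun_apply x' (f x)\<bar> \<partial>M) \<le> ennreal (\<epsilon> / (K + 1))"
    by (elim exE conjE)
  show "\<exists>\<delta>>0. \<forall>A\<in>sets M. measure M A < \<delta> \<longrightarrow>
     (\<forall>x' :: 'x \<Rightarrow>\<^sub>L real. norm x' \<le> 1 \<longrightarrow> (\<integral>\<^sup>+x\<in>A. ennreal \<bar>blinfun_apply x' (g x)\<bar> \<partial>M) \<le> ennreal \<epsilon>)"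
  proof (intro exI[of _ \<delta>] conjI ballI impI allI d(1))
    fix A and x' :: "'x \<Rightarrow>\<^sub>L real" assume A: "A \<in> sets M" "measure M A < \<delta>" "norm x' \<le> 1"
    have [measurable]: "(\<lambda>x. blinfun_apply x' (f x)) \<in> borel_measurable M" by (rule smeas_functional[OF sf])
    note A(1)[measurable]
    have "(\<integral>\<^sup>+x\<in>A. ennreal \<bar>blinfun_apply x' (g x)\<bar> \<partial>M) \<le> (\<integral>\<^sup>+x. ennreal K * (ennreal \<bar>blinfun_apply x' (f x)\<bar> * indicator A x) \<partial>M)"
      using le \<open>K \<ge> 0\<close> by (intro nn_integral_mono) (auto simp: indicator_def ennreal_mult[symmetric] intro!: ennreal_leI)
    also have "\<dots> = ennreal K * (\<integral>\<^sup>+x\<in>A. ennreal \<bar>blinfun_apply x' (f x)\<bar> \<partial>M)"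
      by (intro nn_integral_cmult) measurable
    also have "\<dots> \<le> ennreal K * ennreal (\<epsilon> / (K + 1))" by (intro mult_left_mono d(2)[rule_format] A) simp
    also have "\<dots> \<le> ennreal \<epsilon>"
    proof -
      have "K * (\<epsilon> / (K + 1)) \<le> (K + 1) * (\<epsilon> / (K + 1))" using \<open>K \<ge> 0\<close> \<open>\<epsilon> > 0\<close> by (intro mult_right_mono) auto
      then have "K * (\<epsilon> / (K + 1)) \<le> \<epsilon>" using \<open>K \<ge> 0\<close> by simp
      then show ?thesis using \<open>K \<ge> 0\<close> \<open>\<epsilon> > 0\<close> by (simp add: ennreal_mult[symmetric] ennreal_leI)
    qed
    finally show "(\<integral>\<^sup>+x\<in>A. ennreal \<bar>blinfun_apply x' (g x)\<bar> \<partial>M) \<le> ennreal \<epsilon>" .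
  qed
qed

lemma scalarly_ui_bounded:
  fixes f :: "'a \<Rightarrow> 'x::real_normed_vector"
  assumes "finite_measure M" and b: "\<And>x. x \<in> space M \<Longrightarrow> norm (f x) \<le> K"
  shows "scalarly_ui M f"
  unfolding scalarly_ui_def
proof (intro allI impI)
  interpret finite_measure M by fact
  fix \<epsilon> :: real assume e: "\<epsilon> > 0"
  show "\<exists>\<delta>>0. \<forall>A\<in>sets M. measure M A < \<delta> \<longrightarrow>
     (\<forall>x' :: 'x \<Rightarrow>\<^sub>L real. norm x' \<le> 1 \<longrightarrow> (\<integral>\<^sup>+x\<in>A. ennreal \<bar>blinfun_apply x' (f x)\<bar> \<partial>M) \<le> ennreal \<epsilon>)"
  proof (intro exI[of _ "\<epsilon> / (\<bar>K\<bar> + 1)"] conjI ballI impI allI)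
    show "\<epsilon> / (\<bar>K\<bar> + 1) > 0" using e by simp
    fix A and x' :: "'x \<Rightarrow>\<^sub>L real" assume A: "A \<in> sets M" "measure M A < \<epsilon> / (\<bar>K\<bar> + 1)" "norm x' \<le> 1"
    have "(\<integral>\<^sup>+x\<in>A. ennreal \<bar>blinfun_apply x' (f x)\<bar> \<partial>M) \<le> (\<integral>\<^sup>+x. ennreal (\<bar>K\<bar> + 1) * indicator A x \<partial>M)"
    proof (intro nn_integral_mono mult_right_mono ennreal_leI)
      fix x assume "x \<in> space M"
      then show "\<bar>blinfun_apply x' (f x)\<bar> \<le> \<bar>K\<bar> + 1" using functional_le_norm[OF A(3), of "f x"] b[of x] by simp
    qed simp
    also have "\<dots> = ennreal (\<bar>K\<bar> + 1) * ennreal (measure M A)" using A(1) by (simp add: nn_integral_cmult_indicator emeasure_eq_measure)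
    also have "\<dots> = ennreal ((\<bar>K\<bar> + 1) * measure M A)" by (simp add: ennreal_mult)
    also have "\<dots> \<le> ennreal \<epsilon>" using A(2) by (intro ennreal_leI) (simp add: pos_less_divide_eq mult.commute less_imp_le)
    finally show "(\<integral>\<^sup>+x\<in>A. ennreal \<bar>blinfun_apply x' (f x)\<bar> \<partial>M) \<le> ennreal \<epsilon>" .
  qed
qed

lemma scalarly_ui_restrict_space:
  fixes f :: "'a \<Rightarrow> 'x::real_normed_vector"
  assumes f: "scalarly_ui M f" and B: "B \<in> sets M"
  shows "scalarly_ui (restrict_space M B) f"
  unfolding scalarly_ui_def
proof (intro allI impI)
  fix \<epsilon> :: real assume "\<epsilon> > 0"
  from scalarly_uiD[OF f this] obtain \<delta> where d: "\<delta> > 0" "\<forall>A\<in>sets M. \<forall>x' :: 'x \<Rightarrow>\<^sub>L real. measure M A < \<delta> \<longrightarrow> norm x' \<le> 1 \<longrightarrow>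
     (\<integral>\<^sup>+x\<in>A. ennreal \<bar>blinfun_apply x' (f x)\<bar> \<partial>M) \<le> ennreal \<epsilon>"
    by (elim exE conjE)
  have B': "B \<inter> space M \<in> sets M" "B \<subseteq> space M" using B sets.sets_into_space by auto
  show "\<exists>\<delta>>0. \<forall>A\<in>sets (restrict_space M B). measure (restrict_space M B) A < \<delta> \<longrightarrow>
     (\<forall>x' :: 'x \<Rightarrow>\<^sub>L real. norm x' \<le> 1 \<longrightarrow> (\<integral>\<^sup>+x\<in>A. ennreal \<bar>blinfun_apply x' (f x)\<bar> \<partial>restrict_space M B) \<le> ennreal \<epsilon>)"
  proof (intro exI[of _ \<delta>] conjI ballI impI allI d(1))
    fix A and x' :: "'x \<Rightarrow>\<^sub>L real"
    assume A: "A \<in> sets (restrict_space M B)" "measure (restrict_space M B) A < \<delta>" "norm x' \<le> 1"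
    have AM: "A \<subseteq> B" "A \<in> sets M" using A(1) B' by (auto simp: sets_restrict_space_iff[OF B'(1)])
    have "measure (restrict_space M B) A = measure M A" using B' AM by (intro measure_restrict_space) auto
    moreover have "(\<integral>\<^sup>+x\<in>A. ennreal \<bar>blinfun_apply x' (f x)\<bar> \<partial>restrict_space M B) = (\<integral>\<^sup>+x\<in>A. ennreal \<bar>blinfun_apply x' (f x)\<bar> \<partial>M)"
      using AM B' by (subst nn_integral_restrict_space) (auto intro!: nn_integral_cong simp: indicator_def)
    ultimately show "(\<integral>\<^sup>+x\<in>A. ennreal \<bar>blinfun_apply x' (f x)\<bar> \<partial>restrict_space M B) \<le> ennreal \<epsilon>"
      using d(2)[rule_format, OF AM(2) _ A(3)] A(2) by simp
  qed
qed

text \<open>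
  The set where \<open>norm f\<close> exceeds \<open>n\<close> is small for large \<open>n\<close>, and off this set all the scalar functions
  are bounded by \<open>n\<close>.
\<close>

lemma scalarly_ui_bounded_integrals:
  fixes f :: "'a \<Rightarrow> 'x::real_normed_vector"
  assumes M: "finite_measure M" and f: "scalarly_ui M f" and sf: "smeas M f"
  shows "\<exists>K\<ge>0. \<forall>x' :: 'x \<Rightarrow>\<^sub>L real. norm x' \<le> 1 \<longrightarrow>
     (\<integral>\<^sup>+x. ennreal \<bar>blinfun_apply x' (f x)\<bar> \<partial>M) \<le> ennreal K"
proof -
  interpret finite_measure M by fact
  from scalarly_uiD[OF f zero_less_one] obtain \<delta> where d: "\<delta> > 0" "\<forall>A\<in>sets M. \<forall>x' :: 'x \<Rightarrow>\<^sub>L real. measure M A < \<delta> \<longrightarrow> norm x' \<le> 1 \<longrightarrow>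
     (\<integral>\<^sup>+x\<in>A. ennreal \<bar>blinfun_apply x' (f x)\<bar> \<partial>M) \<le> ennreal 1"
    by (elim exE conjE)
  note [measurable] = smeas_norm[OF sf]
  define A where "A n = {x\<in>space M. real n < norm (f x)}" for n
  have Am: "A n \<in> sets M" for n unfolding A_def by measurable
  have "(\<lambda>n. measure M (A n)) \<longlonglongrightarrow> measure M (\<Inter>n. A n)"
    using Am by (intro finite_Lim_measure_decseq) (auto simp: A_def decseq_def)
  also have "(\<Inter>n. A n) = {}"
  proof -
    have "x \<notin> (\<Inter>n. A n)" for x
      using reals_Archimedean2[of "norm (f x)"] by (auto simp: A_def intro: less_asym)
    then show ?thesis by auto
  qed
  finally have "\<forall>\<^sub>F n in sequentially. measure M (A n) < \<delta>" using d(1) by (intro order_tendstoD(2)) auto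
  then obtain n where n: "measure M (A n) < \<delta>" using eventually_happens'[OF sequentially_bot] by blast
  show ?thesis
  proof (intro exI[of _ "1 + real n * measure M (space M)"] conjI allI impI)
    fix x' :: "'x \<Rightarrow>\<^sub>L real" assume x': "norm x' \<le> 1"
    have [measurable]: "(\<lambda>x. blinfun_apply x' (f x)) \<in> borel_measurable M" by (rule smeas_functional[OF sf])
    note Am[measurable]
    have "(\<integral>\<^sup>+x. ennreal \<bar>blinfun_apply x' (f x)\<bar> \<partial>M)
        \<le> (\<integral>\<^sup>+x. ennreal \<bar>blinfun_apply x' (f x)\<bar> * indicator (A n) x + ennreal (real n) \<partial>M)"
    proof (rule nn_integral_mono)
      fix x assume x: "x \<in> space M"
      show "ennreal \<bar>blinfun_apply x' (f x)\<bar> \<le> ennreal \<bar>blinfun_apply x' (f x)\<bar> * indicator (A n) x + ennreal (real n)"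
      proof (cases "x \<in> A n")
        case False
        then have "\<bar>blinfun_apply x' (f x)\<bar> \<le> real n" using functional_le_norm[OF x', of "f x"] x by (auto simp: A_def)
        then show ?thesis using False by (simp add: ennreal_leI)
      qed (simp add: add_increasing2)
    qed
    also have "\<dots> = (\<integral>\<^sup>+x\<in>A n. ennreal \<bar>blinfun_apply x' (f x)\<bar> \<partial>M) + ennreal (real n) * emeasure M (space M)"
      by (subst nn_integral_add) auto
    also have "\<dots> \<le> ennreal 1 + ennreal (real n) * emeasure M (space M)"
      by (intro add_right_mono d(2)[rule_format] Am n x')
    also have "\<dots> = ennreal (1 + real n * measure M (space M))"
      by (simp add: emeasure_eq_measure ennreal_mult ennreal_plus ennreal_of_nat_eq_real_of_nat)
    finally show "(\<integral>\<^sup>+x. ennreal \<bar>blinfun_apply x' (f x)\<bar> \<partial>M) \<le> ennreal (1 + real n * measure M (space M))" .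
  qed simp
qed

lemma functional_scale:
  fixes x' :: "'x::real_normed_vector \<Rightarrow>\<^sub>L real"
  obtains y' :: "'x \<Rightarrow>\<^sub>L real" and c :: real where "norm y' \<le> 1" "c > 0" "x' = c *\<^sub>R y'"
proof -
  have "x' = (norm x' + 1) *\<^sub>R ((1 / (norm x' + 1)) *\<^sub>R x')"
    using norm_ge_zero[of x'] by (simp add: add_nonneg_eq_0_iff)
  moreover have "norm ((1 / (norm x' + 1)) *\<^sub>R x') \<le> 1"
    using norm_ge_zero[of x'] by (simp add: divide_le_eq not_less add_nonneg_nonneg)
  ultimately show ?thesis using that[of "(1 / (norm x' + 1)) *\<^sub>R x'" "norm x' + 1"] norm_ge_zero[of x'] by linarith
qed

lemma scalarly_ui_integrable:
  fixes f :: "'a \<Rightarrow> 'x::real_normed_vector" and x' :: "'x \<Rightarrow>\<^sub>L real"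
  assumes M: "finite_measure M" and f: "scalarly_ui M f" and sf: "smeas M f"
  shows "integrable M (\<lambda>x. blinfun_apply x' (f x))"
proof -
  obtain y' :: "'x \<Rightarrow>\<^sub>L real" and c where y: "norm y' \<le> 1" "c > 0" "x' = c *\<^sub>R y'" by (rule functional_scale)
  obtain K where "\<And>x' :: 'x \<Rightarrow>\<^sub>L real. norm x' \<le> 1 \<Longrightarrow>
     (\<integral>\<^sup>+x. ennreal \<bar>blinfun_apply x' (f x)\<bar> \<partial>M) \<le> ennreal K"
    using scalarly_ui_bounded_integrals[OF M f sf] by blast
  from this[OF y(1)] have "(\<integral>\<^sup>+x. ennreal (norm (blinfun_apply y' (f x))) \<partial>M) < \<infinity>"
    using ennreal_less_top le_less_trans by (fastforce simp: real_norm_def)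
  then have "integrable M (\<lambda>x. blinfun_apply y' (f x))"
    by (intro integrableI_bounded smeas_functional sf)
  then show ?thesis unfolding y(3) by (simp add: scaleR_blinfun.rep_eq)
qed

lemma meas_partition_exhausts:
  assumes "finite_measure M" and P: "meas_partition M \<U>" and "\<delta> > 0"
  shows "\<exists>F0. finite F0 \<and> F0 \<subseteq> \<U> \<and> measure M (space M - \<Union>F0) < \<delta>"
proof -
  interpret finite_measure M by fact
  have U: "countable \<U>" "\<U> \<subseteq> sets M" "\<Union>\<U> = space M" using P by (auto simp: meas_partition_def)
  show ?thesis
  proof (cases "\<U> = {}")
    case True then show ?thesis using U \<open>\<delta> > 0\<close> by (intro exI[of _ "{}"]) simp
  next
    case False
    let ?g = "from_nat_into \<U>"
    have g: "range ?g = \<U>" using False U(1) by (rule range_from_nat_into)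
    have gm: "?g i \<in> sets M" for i using g U(2) by blast
    define A where "A n = space M - (\<Union>i<n. ?g i)" for n
    have "(\<lambda>n. measure M (A n)) \<longlonglongrightarrow> measure M (\<Inter>n. A n)"
      using gm by (intro finite_Lim_measure_decseq) (auto simp: A_def decseq_def)
    moreover have "(\<Inter>n. A n) = {}"
    proof -
      have "\<exists>n. x \<notin> A n" for x
      proof (cases "x \<in> space M")
        case True
        then obtain i where "x \<in> ?g i" using U(3) g by blast
        then show ?thesis by (intro exI[of _ "Suc i"]) (auto simp: A_def)
      qed (auto simp: A_def)
      then show ?thesis by auto
    qed
    ultimately have "\<forall>\<^sub>F n in sequentially. measure M (A n) < \<delta>" using \<open>\<delta> > 0\<close> by (intro order_tendstoD(2)) auto
    then obtain n where "measure M (A n) < \<delta>" using eventually_happens'[OF sequentially_bot] by blast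
    then show ?thesis using g by (intro exI[of _ "?g ` {..<n}"]) (auto simp: A_def)
  qed
qed

lemma abs_integral_le:
  fixes f g :: "'a \<Rightarrow> real"
  assumes "integrable M f" "integrable M g" "\<And>x. x \<in> space M \<Longrightarrow> \<bar>f x\<bar> \<le> g x"
  shows "\<bar>\<integral>x. f x \<partial>M\<bar> \<le> (\<integral>x. g x \<partial>M)"
proof -
  have "\<bar>\<integral>x. f x \<partial>M\<bar> \<le> (\<integral>x. \<bar>f x\<bar> \<partial>M)" using integral_norm_bound[of M f] by simp
  also have "\<dots> \<le> (\<integral>x. g x \<partial>M)" using assms by (intro integral_mono) auto
  finally show ?thesis .
qed

text \<open>
  On a partition of small oscillation, a sum over finitely many cells differs little from the integral
  over their union; what remains of the space has small measure, so uniform integrability bounds the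
  integral over it. Neither estimate depends on the functional.
\<close>

lemma bi1_sum_approximates_weak_integrals:
  fixes f :: "'a \<Rightarrow> 'x::banach"
  assumes M: "finite_measure M" and f: "scalarly_ui M f" and sf: "smeas M f" and "\<epsilon> > 0"
  shows "\<exists>\<P>. meas_partition M \<P> \<and> (\<forall>\<U> p. tagged_refinement M \<P> \<U> p \<longrightarrow>
       (\<forall>\<^sub>F F in finite_subsets_at_top \<U>. \<forall>x' :: 'x \<Rightarrow>\<^sub>L real. norm x' \<le> 1 \<longrightarrow>
          \<bar>blinfun_apply x' (bi1_sum M f p F) - (\<integral>x. blinfun_apply x' (f x) \<partial>M)\<bar> \<le> \<epsilon>))"
proof -
  interpret finite_measure M by fact
  define \<eta> where "\<eta> = \<epsilon> / (2 * (measure M (space M) + 1))"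
  have pos: "measure M (space M) + 1 > 0" using measure_nonneg[of M "space M"] by linarith
  have \<eta>: "\<eta> > 0" "\<eta> * measure M (space M) \<le> \<epsilon> / 2"
  proof -
    show "\<eta> > 0" unfolding \<eta>_def using \<open>\<epsilon> > 0\<close> pos by simp
    then have "\<eta> * measure M (space M) \<le> \<eta> * (measure M (space M) + 1)" by simp
    also have "\<dots> = \<epsilon> / 2" unfolding \<eta>_def using pos by (simp add: field_simps)
    finally show "\<eta> * measure M (space M) \<le> \<epsilon> / 2" .
  qed
  from smeas_small_oscillation[OF sf \<eta>(1)]
  obtain \<P> where P: "meas_partition M \<P>" "\<forall>U\<in>\<P>. \<forall>x\<in>U. \<forall>y\<in>U. norm (f x - f y) \<le> \<eta>" by (elim exE conjE)
  have "\<epsilon> / 2 > 0" using \<open>\<epsilon> > 0\<close> by simp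
  from scalarly_uiD[OF f this] obtain \<delta> where d: "\<delta> > 0"
    "\<forall>A\<in>sets M. \<forall>x' :: 'x \<Rightarrow>\<^sub>L real. measure M A < \<delta> \<longrightarrow> norm x' \<le> 1 \<longrightarrow>
     (\<integral>\<^sup>+x\<in>A. ennreal \<bar>blinfun_apply x' (f x)\<bar> \<partial>M) \<le> ennreal (\<epsilon> / 2)"
    by (elim exE conjE)
  show ?thesis
  proof (intro exI[of _ \<P>] conjI allI impI P(1))
    fix \<U> p assume t: "tagged_refinement M \<P> \<U> p"
    then have U: "meas_partition M \<U>" "refines \<U> \<P>" "\<And>U. U \<in> \<U> \<Longrightarrow> p U \<in> U"
      by (auto simp: tagged_refinement_def)
    from meas_partition_exhausts[OF M U(1) d(1)] obtain F0
      where F0: "finite F0" "F0 \<subseteq> \<U>" "measure M (space M - \<Union>F0) < \<delta>" by (elim exE conjE)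
    show "\<forall>\<^sub>F F in finite_subsets_at_top \<U>. \<forall>x' :: 'x \<Rightarrow>\<^sub>L real. norm x' \<le> 1 \<longrightarrow>
          \<bar>blinfun_apply x' (bi1_sum M f p F) - (\<integral>x. blinfun_apply x' (f x) \<partial>M)\<bar> \<le> \<epsilon>"
      unfolding eventually_finite_subsets_at_top
    proof (intro exI[of _ F0] conjI allI impI F0(1,2))
      fix F and x' :: "'x \<Rightarrow>\<^sub>L real" assume "finite F \<and> F0 \<subseteq> F \<and> F \<subseteq> \<U>" and x': "norm x' \<le> 1"
      then have F: "finite F" "F0 \<subseteq> F" "F \<subseteq> \<U>" by auto
      let ?h = "\<lambda>x. blinfun_apply x' (f x)"
      have h: "integrable M ?h" by (rule scalarly_ui_integrable[OF M f sf])
      have FM: "U \<in> sets M" if "U \<in> F" for U using that F U(1) by (auto simp: meas_partition_def)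
      have uF: "\<Union>F \<in> sets M" using FM F(1) by (intro sets.finite_Union) auto
      have disj: "disjoint F" using U(1) F(3) unfolding meas_partition_def disjoint_def by blast
      define R where "R = space M - \<Union>F"
      have R: "R \<in> sets M" using uF by (auto simp: R_def)
      \<comment> \<open>The integral is split over the cells in \<open>F\<close> and the rest \<open>R\<close> of the space.\<close>
      have ind: "(\<Sum>U\<in>F. indicator U x) + indicator R x = (1::real)" if "x \<in> space M" for x
      proof (cases "x \<in> R")
        case True
        then have "(\<Sum>U\<in>F. indicator U x) = (0::real)" by (intro sum.neutral) (auto simp: R_def indicator_def)
        then show ?thesis using True by simp
      next
        case False
        then obtain V where V: "V \<in> F" "x \<in> V" using \<open>x \<in> space M\<close> by (auto simp: R_def)
        have "x \<notin> U" if "U \<in> F" "U \<noteq> V" for U using disjointD[OF disj that(1) V(1) that(2)] V(2) by auto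
        then have "(\<Sum>U\<in>F. indicator U x) = (\<Sum>U\<in>F. if U = V then 1 else (0::real))"
          using V by (intro sum.cong) (auto simp: indicator_def)
        then show ?thesis using V F(1) False by simp
      qed
      have hi: "integrable M (\<lambda>x. indicator A x * ?h x)" if "A \<in> sets M" for A
        using integrable_mult_indicator[OF that h] by simp
      have "(\<integral>x. ?h x \<partial>M) = (\<integral>x. (\<Sum>U\<in>F. indicator U x * ?h x) + indicator R x * ?h x \<partial>M)"
      proof (rule Bochner_Integration.integral_cong[OF refl])
        fix x assume "x \<in> space M"
        then have "?h x = ((\<Sum>U\<in>F. indicator U x) + indicator R x) * ?h x" using ind by simp
        then show "?h x = (\<Sum>U\<in>F. indicator U x * ?h x) + indicator R x * ?h x"
          by (simp add: sum_distrib_right distrib_right)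
      qed
      also have "\<dots> = (\<Sum>U\<in>F. \<integral>x. indicator U x * ?h x \<partial>M) + (\<integral>x. indicator R x * ?h x \<partial>M)"
        using hi FM R by (subst Bochner_Integration.integral_add) (auto simp: Bochner_Integration.integral_sum)
      finally have int: "(\<integral>x. ?h x \<partial>M) = (\<Sum>U\<in>F. \<integral>x. indicator U x * ?h x \<partial>M) + (\<integral>x. indicator R x * ?h x \<partial>M)" .
      have "measure M R \<le> measure M (space M - \<Union>F0)"
        using R F(2) F0(1) F U(1) unfolding R_def
        by (intro finite_measure_mono) (auto simp: meas_partition_def intro!: sets.Diff sets.finite_Union)
      then have "measure M R < \<delta>" using F0(3) by simp
      then have "(\<integral>\<^sup>+x\<in>R. ennreal \<bar>?h x\<bar> \<partial>M) \<le> ennreal (\<epsilon> / 2)" using d(2) R x' by blast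
      moreover have "ennreal \<bar>?h x\<bar> * indicator R x = ennreal (norm (indicator R x * ?h x))" for x
        by (simp add: indicator_def)
      ultimately have "(\<integral>\<^sup>+x. ennreal (norm (indicator R x * ?h x)) \<partial>M) \<le> ennreal (\<epsilon> / 2)" by simp
      with integral_norm_bound_ennreal[OF hi[OF R]]
      have "ennreal (norm (\<integral>x. indicator R x * ?h x \<partial>M)) \<le> ennreal (\<epsilon> / 2)" by (rule order_trans)
      then have r1: "\<bar>\<integral>x. indicator R x * ?h x \<partial>M\<bar> \<le> \<epsilon> / 2"
        using \<open>\<epsilon> > 0\<close> by (simp add: ennreal_le_iff)
      have cell: "\<bar>measure M U * ?h (p U) - (\<integral>x. indicator U x * ?h x \<partial>M)\<bar> \<le> \<eta> * measure M U" if UF: "U \<in> F" for U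
      proof -
        have UU: "U \<in> \<U>" using UF F(3) by blast
        have Um: "U \<in> sets M" and pU: "p U \<in> U" by (rule FM[OF UF], rule U(3)[OF UU])
        obtain V where V: "V \<in> \<P>" "U \<subseteq> V" using U(2) UU by (auto simp: refines_def)
        have "measure M U * ?h (p U) = (\<integral>x. indicator U x * ?h (p U) \<partial>M)" using Um by (simp add: sets.sets_into_space Int_absorb1)
        then have "measure M U * ?h (p U) - (\<integral>x. indicator U x * ?h x \<partial>M) = (\<integral>x. indicator U x * ?h (p U) - indicator U x * ?h x \<partial>M)"
          using hi[OF Um] Um by (subst Bochner_Integration.integral_diff) (auto simp: less_top[symmetric])
        also have "\<bar>\<dots>\<bar> \<le> (\<integral>x. \<eta> * indicator U x \<partial>M)"
        proof (rule abs_integral_le)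
          show "integrable M (\<lambda>x. indicator U x * ?h (p U) - indicator U x * ?h x)"
            using hi[OF Um] Um by (intro Bochner_Integration.integrable_diff) (auto simp: less_top[symmetric])
          show "integrable M (\<lambda>x. \<eta> * indicator U x)" using Um by (auto simp: less_top[symmetric])
          fix x assume "x \<in> space M"
          show "\<bar>indicator U x * ?h (p U) - indicator U x * ?h x\<bar> \<le> \<eta> * indicator U x"
          proof (cases "x \<in> U")
            case True
            have "\<bar>?h (p U) - ?h x\<bar> \<le> norm (f (p U) - f x)"
              using functional_le_norm[OF x', of "f (p U) - f x"] by (simp add: blinfun.diff_right)
            also have "\<dots> \<le> \<eta>" using P(2) V True pU by blast
            finally show ?thesis using True by simp
          qed simp
        qed
        also have "\<dots> = \<eta> * measure M U" using Um by (simp add: sets.sets_into_space Int_absorb1)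
        finally show ?thesis .
      qed
      have sumU: "(\<Sum>U\<in>F. measure M U) \<le> measure M (space M)"
      proof -
        have "(\<Sum>U\<in>F. measure M U) = measure M (\<Union>F)"
          using FM F(1) disj by (subst measure_Union') (auto simp: disjoint_def pairwise_def disjnt_def fmeasurable_eq_sets)
        also have "\<dots> \<le> measure M (space M)" by (rule bounded_measure)
        finally show ?thesis .
      qed
      have "blinfun_apply x' (bi1_sum M f p F) - (\<integral>x. ?h x \<partial>M) =
          (\<Sum>U\<in>F. measure M U * ?h (p U) - (\<integral>x. indicator U x * ?h x \<partial>M)) - (\<integral>x. indicator R x * ?h x \<partial>M)"
        unfolding int bi1_sum_def by (simp add: blinfun.sum_right blinfun.scaleR_right sum_subtractf)
      also have "\<bar>\<dots>\<bar> \<le> (\<Sum>U\<in>F. \<bar>measure M U * ?h (p U) - (\<integral>x. indicator U x * ?h x \<partial>M)\<bar>) + \<epsilon> / 2"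
        by (rule order_trans[OF abs_triangle_ineq4]) (intro add_mono sum_abs r1)
      also have "\<dots> \<le> (\<Sum>U\<in>F. \<eta> * measure M U) + \<epsilon> / 2"
        by (intro add_right_mono sum_mono cell)
      also have "\<dots> \<le> \<eta> * measure M (space M) + \<epsilon> / 2"
        unfolding sum_distrib_left[symmetric] using sumU \<eta>(1) by (simp add: mult_left_mono)
      also have "\<dots> \<le> \<epsilon>" using \<eta>(2) by simp
      finally show "\<bar>blinfun_apply x' (bi1_sum M f p F) - (\<integral>x. ?h x \<partial>M)\<bar> \<le> \<epsilon>" .
    qed
  qed
qed

text \<open>
  Birkhoff sums approximate all scalar integrals simultaneously, so sums of increasing accuracy form a
  Cauchy sequence in norm. Its limit represents the scalar integrals, and therefore all fine sums are
  close to it.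
\<close>

theorem scalarly_ui_imp_has_bi1_integral:
  fixes f :: "'a \<Rightarrow> 'x::banach"
  assumes M: "finite_measure M" and f: "scalarly_ui M f" and sf: "smeas M f"
  shows "\<exists>I. has_bi1_integral M f I \<and> (\<forall>x' :: 'x \<Rightarrow>\<^sub>L real. blinfun_apply x' I = (\<integral>x. blinfun_apply x' (f x) \<partial>M))"
proof -
  let ?t = "\<lambda>U. SOME x. x \<in> U"
  have "\<forall>n. \<exists>v. \<forall>x' :: 'x \<Rightarrow>\<^sub>L real. norm x' \<le> 1 \<longrightarrow>
          \<bar>blinfun_apply x' v - (\<integral>x. blinfun_apply x' (f x) \<partial>M)\<bar> \<le> 1 / real (Suc n)"
  proof
    fix n
    have "1 / real (Suc n) > 0" by simp
    from bi1_sum_approximates_weak_integrals[OF M f sf this]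
    obtain \<P> where P: "meas_partition M \<P>" and ev: "\<forall>\<U> p. tagged_refinement M \<P> \<U> p \<longrightarrow>
       (\<forall>\<^sub>F F in finite_subsets_at_top \<U>. \<forall>x' :: 'x \<Rightarrow>\<^sub>L real. norm x' \<le> 1 \<longrightarrow>
          \<bar>blinfun_apply x' (bi1_sum M f p F) - (\<integral>x. blinfun_apply x' (f x) \<partial>M)\<bar> \<le> 1 / real (Suc n))"
      by (elim exE conjE)
    from eventually_happens'[OF finite_subsets_at_top_neq_bot ev[rule_format, OF tagged_refinement_self[OF P]]]
    obtain F where "\<forall>x' :: 'x \<Rightarrow>\<^sub>L real. norm x' \<le> 1 \<longrightarrow>
          \<bar>blinfun_apply x' (bi1_sum M f ?t F) - (\<integral>x. blinfun_apply x' (f x) \<partial>M)\<bar> \<le> 1 / real (Suc n)"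
      by (elim exE)
    then show "\<exists>v. \<forall>x' :: 'x \<Rightarrow>\<^sub>L real. norm x' \<le> 1 \<longrightarrow>
          \<bar>blinfun_apply x' v - (\<integral>x. blinfun_apply x' (f x) \<partial>M)\<bar> \<le> 1 / real (Suc n)" by (rule exI)
  qed
  from choice[OF this] obtain v where v: "\<forall>n. \<forall>x' :: 'x \<Rightarrow>\<^sub>L real. norm x' \<le> 1 \<longrightarrow>
          \<bar>blinfun_apply x' (v n) - (\<integral>x. blinfun_apply x' (f x) \<partial>M)\<bar> \<le> 1 / real (Suc n)" ..
  have lim0: "(\<lambda>n. 1 / real (Suc n)) \<longlonglongrightarrow> 0"
    using LIMSEQ_inverse_real_of_nat by (simp add: divide_inverse)
  have vv: "norm (v m - v n) \<le> 1 / real (Suc m) + 1 / real (Suc n)" for m n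
  proof (rule norm_le_by_functionals)
    fix x' :: "'x \<Rightarrow>\<^sub>L real" assume "norm x' \<le> 1"
    from v[rule_format, OF this, of m] v[rule_format, OF this, of n]
    show "\<bar>blinfun_apply x' (v m - v n)\<bar> \<le> 1 / real (Suc m) + 1 / real (Suc n)"
      unfolding blinfun.diff_right by linarith
  qed
  have "Cauchy v"
  proof (rule CauchyI)
    fix e :: real assume "e > 0"
    then have "\<forall>\<^sub>F n in sequentially. 1 / real (Suc n) < e / 2" using order_tendstoD(2)[OF lim0, of "e / 2"] by simp
    then obtain K where K: "\<And>n. n \<ge> K \<Longrightarrow> 1 / real (Suc n) < e / 2" by (auto simp: eventually_sequentially)
    have "norm (v m - v n) < e" if "m \<ge> K" "n \<ge> K" for m n
      using vv[of m n] K[OF that(1)] K[OF that(2)] by linarith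
    then show "\<exists>K. \<forall>m\<ge>K. \<forall>n\<ge>K. norm (v m - v n) < e" by blast
  qed
  then obtain I where I: "v \<longlonglongrightarrow> I" using Cauchy_convergent_iff convergent_def by blast
  have wI1: "blinfun_apply x' I = (\<integral>x. blinfun_apply x' (f x) \<partial>M)" if "norm x' \<le> 1" for x' :: "'x \<Rightarrow>\<^sub>L real"
  proof -
    have "(\<lambda>n. \<bar>blinfun_apply x' (v n) - (\<integral>x. blinfun_apply x' (f x) \<partial>M)\<bar>) \<longlonglongrightarrow> \<bar>blinfun_apply x' I - (\<integral>x. blinfun_apply x' (f x) \<partial>M)\<bar>"
      by (intro tendsto_intros I)
    moreover have "(\<lambda>n. \<bar>blinfun_apply x' (v n) - (\<integral>x. blinfun_apply x' (f x) \<partial>M)\<bar>) \<longlonglongrightarrow> 0"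
      by (rule tendsto_sandwich[OF _ _ tendsto_const lim0]) (use v that in auto)
    ultimately show ?thesis using LIMSEQ_unique by fastforce
  qed
  have wI: "blinfun_apply x' I = (\<integral>x. blinfun_apply x' (f x) \<partial>M)" for x' :: "'x \<Rightarrow>\<^sub>L real"
  proof -
    obtain y' :: "'x \<Rightarrow>\<^sub>L real" and c where y: "norm y' \<le> 1" "c > 0" "x' = c *\<^sub>R y'" by (rule functional_scale)
    show ?thesis unfolding y(3) using wI1[OF y(1)] by (simp add: scaleR_blinfun.rep_eq)
  qed
  have "has_bi1_integral M f I"
  proof (rule has_bi1_netI)
    fix \<epsilon> :: real assume "\<epsilon> > 0" then have "\<epsilon> / 2 > 0" by simp
    from bi1_sum_approximates_weak_integrals[OF M f sf this]
    obtain \<P> where P: "meas_partition M \<P>" and ev: "\<forall>\<U> p. tagged_refinement M \<P> \<U> p \<longrightarrow>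
       (\<forall>\<^sub>F F in finite_subsets_at_top \<U>. \<forall>x' :: 'x \<Rightarrow>\<^sub>L real. norm x' \<le> 1 \<longrightarrow>
          \<bar>blinfun_apply x' (bi1_sum M f p F) - (\<integral>x. blinfun_apply x' (f x) \<partial>M)\<bar> \<le> \<epsilon> / 2)"
      by (elim exE conjE)
    show "\<exists>\<P>. meas_partition M \<P> \<and> (\<forall>\<U> p. tagged_refinement M \<P> \<U> p \<longrightarrow>
       (\<forall>\<^sub>F F in finite_subsets_at_top \<U>. norm (bi1_sum M f p F - I) < \<epsilon>))"
    proof (intro exI[of _ \<P>] conjI allI impI P)
      fix \<U> p assume "tagged_refinement M \<P> \<U> p"
      from ev[rule_format, OF this]
      show "\<forall>\<^sub>F F in finite_subsets_at_top \<U>. norm (bi1_sum M f p F - I) < \<epsilon>"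
      proof eventually_elim
        case (elim F)
        have "norm (bi1_sum M f p F - I) \<le> \<epsilon> / 2"
          by (rule norm_le_by_functionals) (use elim wI in \<open>simp add: blinfun.diff_right\<close>)
        then show ?case using \<open>\<epsilon> > 0\<close> by simp
      qed
    qed
  qed
  then show ?thesis using wI by blast
qed

lemma sum_abs_le_of_subset_sums:
  fixes a :: "'i \<Rightarrow> real"
  assumes "finite G" and *: "\<And>H. H \<subseteq> G \<Longrightarrow> \<bar>\<Sum>i\<in>H. a i\<bar> \<le> K"
  shows "(\<Sum>i\<in>G. \<bar>a i\<bar>) \<le> 2 * K"
proof -
  have "(\<Sum>i\<in>G. \<bar>a i\<bar>) = (\<Sum>i\<in>{i\<in>G. a i \<ge> 0}. \<bar>a i\<bar>) + (\<Sum>i\<in>G - {i\<in>G. a i \<ge> 0}. \<bar>a i\<bar>)"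
    using assms(1) by (subst sum.subset_diff[of "{i\<in>G. a i \<ge> 0}" G]) (auto simp: add.commute)
  also have "(\<Sum>i\<in>{i\<in>G. a i \<ge> 0}. \<bar>a i\<bar>) = (\<Sum>i\<in>{i\<in>G. a i \<ge> 0}. a i)" by (intro sum.cong) auto
  also have "(\<Sum>i\<in>G - {i\<in>G. a i \<ge> 0}. \<bar>a i\<bar>) = - (\<Sum>i\<in>G - {i\<in>G. a i \<ge> 0}. a i)"
    unfolding sum_negf[symmetric] by (intro sum.cong) auto
  also have "(\<Sum>i\<in>{i\<in>G. a i \<ge> 0}. a i) \<le> K" using *[of "{i\<in>G. a i \<ge> 0}"] by auto
  also have "- (\<Sum>i\<in>G - {i\<in>G. a i \<ge> 0}. a i) \<le> K" using *[of "G - {i\<in>G. a i \<ge> 0}"] by auto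
  finally show ?thesis by simp
qed

text \<open>
  Finitely many cells \<open>F0\<close> already give a sum close to \<open>I\<close>, and so does \<open>F0\<close> together with any finite
  block of further cells; hence every such block contributes little. Applied to the cells on which
  \<open>x' \<circ> f\<close> is positive, respectively negative, this bounds the sum of the absolute values, and small
  oscillation turns the bound into one for the integral off \<open>F0\<close>. On the finitely many cells of \<open>F0\<close>
  the function is bounded.
\<close>

theorem has_bi1_integral_imp_scalarly_ui:
  fixes f :: "'a \<Rightarrow> 'x::banach"
  assumes M: "finite_measure M" and sf: "smeas M f" and I: "has_bi1_integral M f I"
  shows "scalarly_ui M f"
  unfolding scalarly_ui_def
proof (intro allI impI)
  interpret finite_measure M by fact
  fix \<epsilon> :: real assume \<epsilon>: "\<epsilon> > 0"
  \<comment> \<open>A block of cells has norm at most \<open>2 e\<close>, and the splitting by sign doubles this to \<open>4 e\<close>.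
    Together with the oscillation error this makes \<open>\<epsilon> / 2\<close>; the other half is for \<open>F0\<close>.\<close>
  define e where "e = \<epsilon> / 16"
  have e: "e > 0" using \<epsilon> by (simp add: e_def)
  define \<eta> where "\<eta> = \<epsilon> / (4 * (measure M (space M) + 1))"
  have pos: "measure M (space M) + 1 > 0" using measure_nonneg[of M "space M"] by linarith
  have \<eta>: "\<eta> > 0" "\<eta> * measure M (space M) \<le> \<epsilon> / 4"
  proof -
    show "\<eta> > 0" unfolding \<eta>_def using \<epsilon> pos by simp
    then have "\<eta> * measure M (space M) \<le> \<eta> * (measure M (space M) + 1)" by simp
    also have "\<dots> = \<epsilon> / 4" unfolding \<eta>_def using pos by (simp add: field_simps)
    finally show "\<eta> * measure M (space M) \<le> \<epsilon> / 4" .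
  qed
  from has_bi1_netD[OF I e] obtain \<P> where P: "meas_partition M \<P>"
    and ev: "\<forall>\<U> p. tagged_refinement M \<P> \<U> p \<longrightarrow>
       (\<forall>\<^sub>F F in finite_subsets_at_top \<U>. norm (bi1_sum M f p F - I) < e)" by (elim exE conjE)
  from smeas_small_oscillation[OF sf \<eta>(1)]
  obtain \<Q> where Q: "meas_partition M \<Q>" "\<forall>U\<in>\<Q>. \<forall>x\<in>U. \<forall>y\<in>U. norm (f x - f y) \<le> \<eta>" by (elim exE conjE)
  define W where "W = common_refinement \<P> \<Q>"
  have W: "meas_partition M W" "refines W \<P>" "refines W \<Q>"
    unfolding W_def by (intro common_refinement[OF P Q(1)])+
  define t where "t = (\<lambda>U :: 'a set. SOME x. x \<in> U)"
  have tW: "tagged_refinement M W W t" unfolding t_def by (rule tagged_refinement_self[OF W(1)])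
  have tU: "t U \<in> U" if "U \<in> W" for U using tW that by (auto simp: tagged_refinement_def)
  have cW: "countable W" "\<And>U. U \<in> W \<Longrightarrow> U \<in> sets M" "disjoint W" "\<Union>W = space M"
    using W(1) by (auto simp: meas_partition_def)
  from ev[rule_format, OF tagged_refinement_trans[OF tW W(2)]]
  obtain F0 where F0: "finite F0" "F0 \<subseteq> W" "\<forall>F. finite F \<and> F0 \<subseteq> F \<and> F \<subseteq> W \<longrightarrow> norm (bi1_sum M f t F - I) < e"
    unfolding eventually_finite_subsets_at_top by (elim exE conjE)
  have osc: "\<bar>blinfun_apply x' (f x)\<bar> \<le> \<bar>blinfun_apply x' (f (t U))\<bar> + \<eta>"
    if x': "norm x' \<le> 1" and U: "U \<in> W" and x: "x \<in> U" for x' :: "'x \<Rightarrow>\<^sub>L real" and U x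
  proof -
    obtain V where "V \<in> \<Q>" "U \<subseteq> V" using W(3) U by (auto simp: refines_def)
    then have "norm (f x - f (t U)) \<le> \<eta>" using Q(2) x tU[OF U] by blast
    then show ?thesis using functional_le_norm[OF x', of "f x - f (t U)"] unfolding blinfun.diff_right by linarith
  qed
  define K where "K = (\<Sum>U\<in>F0. norm (f (t U))) + \<eta>"
  have K0: "K > 0" unfolding K_def using \<eta>(1) by (intro add_nonneg_pos sum_nonneg) auto
  have onF0: "\<bar>blinfun_apply x' (f x)\<bar> \<le> K" if x': "norm x' \<le> 1" and x: "x \<in> \<Union>F0" for x' :: "'x \<Rightarrow>\<^sub>L real" and x
  proof -
    obtain U where U: "U \<in> F0" "x \<in> U" using x by blast
    then have "\<bar>blinfun_apply x' (f x)\<bar> \<le> \<bar>blinfun_apply x' (f (t U))\<bar> + \<eta>" using F0(2) by (intro osc x') auto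
    also have "\<bar>blinfun_apply x' (f (t U))\<bar> \<le> norm (f (t U))" by (rule functional_le_norm[OF x'])
    also have "norm (f (t U)) \<le> (\<Sum>U\<in>F0. norm (f (t U)))" using F0(1) U by (intro member_le_sum) auto
    finally show ?thesis by (simp add: K_def)
  qed
  have small: "(\<integral>\<^sup>+x\<in>\<Union>G. ennreal \<bar>blinfun_apply x' (f x)\<bar> \<partial>M) \<le> ennreal (\<epsilon> / 2)"
    if x': "norm x' \<le> 1" and G: "finite G" "G \<subseteq> W - F0" for x' :: "'x \<Rightarrow>\<^sub>L real" and G
  proof -
    have 1: "(\<Sum>U\<in>G. \<bar>measure M U * blinfun_apply x' (f (t U))\<bar>) \<le> 2 * (2 * e)"
    proof (rule sum_abs_le_of_subset_sums[OF G(1)])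
      fix H assume H: "H \<subseteq> G"
      have fH: "finite H" using H G(1) finite_subset by blast
      have "bi1_sum M f t (F0 \<union> H) = bi1_sum M f t F0 + bi1_sum M f t H"
        unfolding bi1_sum_def using F0(1) fH H G(2) by (intro sum.union_disjoint) auto
      moreover have "norm (bi1_sum M f t (F0 \<union> H) - I) < e" using F0 H G fH by (intro F0(3)[rule_format]) auto
      moreover have "norm (bi1_sum M f t F0 - I) < e" using F0 by (intro F0(3)[rule_format]) auto
      ultimately have "norm (bi1_sum M f t H) \<le> 2 * e"
        using norm_triangle_ineq4[of "bi1_sum M f t (F0 \<union> H) - I" "bi1_sum M f t F0 - I"] by simp
      moreover have "(\<Sum>U\<in>H. measure M U * blinfun_apply x' (f (t U))) = blinfun_apply x' (bi1_sum M f t H)"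
        by (simp add: bi1_sum_def blinfun.sum_right blinfun.scaleR_right)
      ultimately show "\<bar>\<Sum>U\<in>H. measure M U * blinfun_apply x' (f (t U))\<bar> \<le> 2 * e"
        using functional_le_norm[OF x', of "bi1_sum M f t H"] by linarith
    qed
    have GM: "U \<in> sets M" if "U \<in> G" for U using that G cW(2) by blast
    have disj: "disjoint G" using cW(3) G(2) unfolding disjoint_def by blast
    have sumG: "(\<Sum>U\<in>G. measure M U) \<le> measure M (space M)"
    proof -
      have "(\<Sum>U\<in>G. measure M U) = measure M (\<Union>G)"
        using GM G(1) disj by (subst measure_Union') (auto simp: disjoint_def pairwise_def disjnt_def fmeasurable_eq_sets)
      also have "\<dots> \<le> measure M (space M)" by (rule bounded_measure)
      finally show ?thesis .
    qed
    have "(\<integral>\<^sup>+x\<in>\<Union>G. ennreal \<bar>blinfun_apply x' (f x)\<bar> \<partial>M)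
        \<le> (\<integral>\<^sup>+x. (\<Sum>U\<in>G. ennreal (\<bar>blinfun_apply x' (f (t U))\<bar> + \<eta>) * indicator U x) \<partial>M)"
    proof (rule nn_integral_mono)
      fix x
      show "ennreal \<bar>blinfun_apply x' (f x)\<bar> * indicator (\<Union>G) x \<le> (\<Sum>U\<in>G. ennreal (\<bar>blinfun_apply x' (f (t U))\<bar> + \<eta>) * indicator U x)"
      proof (cases "x \<in> \<Union>G")
        case True
        then obtain U where U: "U \<in> G" "x \<in> U" by blast
        then have "\<bar>blinfun_apply x' (f x)\<bar> \<le> \<bar>blinfun_apply x' (f (t U))\<bar> + \<eta>" using G(2) by (intro osc x') auto
        then have "ennreal \<bar>blinfun_apply x' (f x)\<bar> \<le> ennreal (\<bar>blinfun_apply x' (f (t U))\<bar> + \<eta>) * indicator U x"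
          using U by (simp add: ennreal_leI)
        also have "\<dots> \<le> (\<Sum>U\<in>G. ennreal (\<bar>blinfun_apply x' (f (t U))\<bar> + \<eta>) * indicator U x)"
          using G(1) U by (intro member_le_sum) auto
        finally show ?thesis using True by simp
      qed simp
    qed
    also have "\<dots> = (\<Sum>U\<in>G. ennreal (\<bar>blinfun_apply x' (f (t U))\<bar> + \<eta>) * emeasure M U)"
      using GM by (subst nn_integral_sum) (auto intro!: sum.cong nn_integral_cmult_indicator)
    also have "\<dots> = (\<Sum>U\<in>G. ennreal (\<bar>measure M U * blinfun_apply x' (f (t U))\<bar> + \<eta> * measure M U))"
      using \<eta>(1) by (intro sum.cong refl) (simp add: emeasure_eq_measure ennreal_mult[symmetric] abs_mult algebra_simps)
    also have "\<dots> = ennreal ((\<Sum>U\<in>G. \<bar>measure M U * blinfun_apply x' (f (t U))\<bar>) + \<eta> * (\<Sum>U\<in>G. measure M U))"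
      using \<eta>(1) by (subst sum_ennreal) (auto simp: sum.distrib sum_distrib_left)
    also have "\<dots> \<le> ennreal (\<epsilon> / 2)"
    proof (rule ennreal_leI)
      have "\<eta> * (\<Sum>U\<in>G. measure M U) \<le> \<eta> * measure M (space M)" using \<eta>(1) sumG by (intro mult_left_mono) auto
      then show "(\<Sum>U\<in>G. \<bar>measure M U * blinfun_apply x' (f (t U))\<bar>) + \<eta> * (\<Sum>U\<in>G. measure M U) \<le> \<epsilon> / 2"
        using 1 \<eta>(2) unfolding e_def by linarith
    qed
    finally show ?thesis .
  qed
  have F0M: "\<Union>F0 \<in> sets M" using F0(1,2) cW(2) by (intro sets.finite_Union) auto
  \<comment> \<open>Monotone convergence extends the bound for finite blocks to all the remaining cells.\<close>
  have tail: "(\<integral>\<^sup>+x\<in>space M - \<Union>F0. ennreal \<bar>blinfun_apply x' (f x)\<bar> \<partial>M) \<le> ennreal (\<epsilon> / 2)"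
    if x': "norm x' \<le> 1" for x' :: "'x \<Rightarrow>\<^sub>L real"
  proof (cases "W = {}")
    case True
    then show ?thesis using cW(4) by (simp add: nn_integral_empty)
  next
    case False
    let ?g = "from_nat_into W"
    have g: "range ?g = W" using False cW(1) by (rule range_from_nat_into)
    define A where "A n = \<Union>(?g ` {..<n} - F0)" for n
    have Am: "A n \<in> sets M" for n unfolding A_def using g cW(2) by (intro sets.finite_Union) auto
    have [measurable]: "(\<lambda>x. blinfun_apply x' (f x)) \<in> borel_measurable M" by (rule smeas_functional[OF sf])
    let ?N = "density M (\<lambda>x. ennreal \<bar>blinfun_apply x' (f x)\<bar>)"
    have N: "emeasure ?N B = (\<integral>\<^sup>+x\<in>B. ennreal \<bar>blinfun_apply x' (f x)\<bar> \<partial>M)" if "B \<in> sets M" for B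
      using that by (intro emeasure_density) auto
    have "(\<Union>n. A n) = space M - \<Union>F0"
    proof
      show "(\<Union>n. A n) \<subseteq> space M - \<Union>F0"
      proof
        fix x assume "x \<in> (\<Union>n. A n)"
        then obtain U where U: "U \<in> W" "U \<notin> F0" "x \<in> U" using g unfolding A_def by blast
        have "x \<notin> V" if "V \<in> F0" for V
          using disjointD[OF cW(3) U(1), of V] F0(2) that U by auto
        then show "x \<in> space M - \<Union>F0" using U cW(4) by auto
      qed
      show "space M - \<Union>F0 \<subseteq> (\<Union>n. A n)"
      proof
        fix x assume x: "x \<in> space M - \<Union>F0"
        then obtain i where i: "x \<in> ?g i" using cW(4) g by blast
        then have "?g i \<notin> F0" using x by auto
        then show "x \<in> (\<Union>n. A n)" using i unfolding A_def by (intro UN_I[of "Suc i"]) auto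
      qed
    qed
    moreover have "incseq A" unfolding A_def incseq_def by (intro allI impI Union_mono) auto
    then have "(SUP n. emeasure ?N (A n)) = emeasure ?N (\<Union>n. A n)"
      using Am by (intro SUP_emeasure_incseq) auto
    moreover have "(SUP n. emeasure ?N (A n)) \<le> ennreal (\<epsilon> / 2)"
    proof (rule SUP_least)
      fix n
      have "?g ` {..<n} - F0 \<subseteq> W - F0" using g by auto
      then show "emeasure ?N (A n) \<le> ennreal (\<epsilon> / 2)"
        unfolding N[OF Am] unfolding A_def by (intro small x') auto
    qed
    ultimately have "emeasure ?N (space M - \<Union>F0) \<le> ennreal (\<epsilon> / 2)" by simp
    then show ?thesis using N[of "space M - \<Union>F0"] F0M by simp
  qed
  show "\<exists>\<delta>>0. \<forall>A\<in>sets M. measure M A < \<delta> \<longrightarrow>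
     (\<forall>x' :: 'x \<Rightarrow>\<^sub>L real. norm x' \<le> 1 \<longrightarrow> (\<integral>\<^sup>+x\<in>A. ennreal \<bar>blinfun_apply x' (f x)\<bar> \<partial>M) \<le> ennreal \<epsilon>)"
  proof (intro exI[of _ "\<epsilon> / (2 * K)"] conjI ballI impI allI)
    show "\<epsilon> / (2 * K) > 0" using \<epsilon> K0 by simp
    fix A and x' :: "'x \<Rightarrow>\<^sub>L real" assume A: "A \<in> sets M" "measure M A < \<epsilon> / (2 * K)" "norm x' \<le> 1"
    have [measurable]: "(\<lambda>x. blinfun_apply x' (f x)) \<in> borel_measurable M" by (rule smeas_functional[OF sf])
    note [measurable] = A(1) F0M
    have "(\<integral>\<^sup>+x\<in>A. ennreal \<bar>blinfun_apply x' (f x)\<bar> \<partial>M)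
        \<le> (\<integral>\<^sup>+x. ennreal K * indicator A x + ennreal \<bar>blinfun_apply x' (f x)\<bar> * indicator (space M - \<Union>F0) x \<partial>M)"
    proof (rule nn_integral_mono)
      fix x assume x: "x \<in> space M"
      show "ennreal \<bar>blinfun_apply x' (f x)\<bar> * indicator A x
         \<le> ennreal K * indicator A x + ennreal \<bar>blinfun_apply x' (f x)\<bar> * indicator (space M - \<Union>F0) x"
      proof (cases "x \<in> \<Union>F0")
        case True
        then show ?thesis using onF0[OF A(3) True] by (auto simp: indicator_def intro: ennreal_leI)
      next
        case False
        then show ?thesis using x by (auto simp: indicator_def)
      qed
    qed
    also have "\<dots> = ennreal K * emeasure M A + (\<integral>\<^sup>+x\<in>space M - \<Union>F0. ennreal \<bar>blinfun_apply x' (f x)\<bar> \<partial>M)"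
      using A(1) by (subst nn_integral_add) (auto simp: nn_integral_cmult_indicator)
    also have "\<dots> \<le> ennreal K * emeasure M A + ennreal (\<epsilon> / 2)" by (intro add_left_mono tail A(3))
    also have "\<dots> = ennreal (K * measure M A + \<epsilon> / 2)"
      using K0 \<epsilon> by (simp add: emeasure_eq_measure ennreal_mult)
    also have "\<dots> \<le> ennreal \<epsilon>"
    proof (rule ennreal_leI)
      have "K * measure M A \<le> K * (\<epsilon> / (2 * K))" using A(2) K0 by (intro mult_left_mono) auto
      then show "K * measure M A + \<epsilon> / 2 \<le> \<epsilon>" using K0 by simp
    qed
    finally show "(\<integral>\<^sup>+x\<in>A. ennreal \<bar>blinfun_apply x' (f x)\<bar> \<partial>M) \<le> ennreal \<epsilon>" .
  qed
qed

section \<open>Gaussian exponentials of Brownian increments\<close>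

text \<open>
  Completing the square: the real part of the exponent moves the mean of the normal density to
  \<open>- c \<sigma>\<^sup>2\<close>, and only a factor of modulus one and a constant remain.
\<close>

lemma exp_gaussian_shift:
  fixes \<kappa> c \<sigma> x :: real
  assumes "\<sigma> > 0"
  shows "of_real (normal_density 0 \<sigma> x) * exp ((\<i> * of_real \<kappa> - of_real c) * of_real x - (\<i> * of_real \<kappa> - of_real c)\<^sup>2 * of_real (\<sigma>\<^sup>2) / 2)
    = of_real (normal_density (- c * \<sigma>\<^sup>2) \<sigma> x) * exp (\<i> * of_real (\<kappa> * (x + c * \<sigma>\<^sup>2))) * of_real (exp (\<kappa>\<^sup>2 * \<sigma>\<^sup>2 / 2))"
proof -
  have 1: "normal_density (- c * \<sigma>\<^sup>2) \<sigma> x = normal_density 0 \<sigma> x * exp (- c * x - c\<^sup>2 * \<sigma>\<^sup>2 / 2)"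
  proof -
    have "- (x - (- c * \<sigma>\<^sup>2))\<^sup>2 / (2 * \<sigma>\<^sup>2) = - (x - 0)\<^sup>2 / (2 * \<sigma>\<^sup>2) + (- c * x - c\<^sup>2 * \<sigma>\<^sup>2 / 2)"
      using assms by (simp add: field_simps power2_eq_square)
    then show ?thesis unfolding normal_density_def by (simp only: exp_add ac_simps)
  qed
  have 2: "(\<i> * of_real \<kappa> - of_real c) * of_real x - (\<i> * of_real \<kappa> - of_real c)\<^sup>2 * of_real (\<sigma>\<^sup>2) / 2
     = of_real (- c * x - c\<^sup>2 * \<sigma>\<^sup>2 / 2) + \<i> * of_real (\<kappa> * (x + c * \<sigma>\<^sup>2)) + of_real (\<kappa>\<^sup>2 * \<sigma>\<^sup>2 / 2)"
    by (simp add: complex_eq_iff power2_eq_square field_simps)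
  show ?thesis unfolding 1 2 exp_add exp_of_real of_real_mult by (simp only: ac_simps)
qed

text \<open>
  With \<open>z = \<i> \<kappa> - c\<close> this is the fact that \<open>exp (z x - z\<^sup>2 \<sigma>\<^sup>2 / 2)\<close> has mean one under the centred
  normal law. The absolute moment does not depend on \<open>c\<close>, so \<open>c\<close> may later be replaced by a random
  coefficient without loss of integrability.
\<close>

lemma exp_gaussian_integral:
  fixes \<kappa> c \<sigma> :: real
  assumes s: "\<sigma> > 0"
  defines "D \<equiv> density lborel (\<lambda>x. ennreal (normal_density 0 \<sigma> x))"
  defines "g \<equiv> (\<lambda>x. exp ((\<i> * of_real \<kappa> - of_real c) * of_real x - (\<i> * of_real \<kappa> - of_real c)\<^sup>2 * of_real (\<sigma>\<^sup>2) / 2))"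
  shows "(\<integral>x. g x \<partial>D) = 1" "(\<integral>\<^sup>+x. norm (g x) \<partial>D) = ennreal (exp (\<kappa>\<^sup>2 * \<sigma>\<^sup>2 / 2))"
proof -
  have [measurable]: "g \<in> borel_measurable borel" unfolding g_def by measurable
  have eq: "normal_density 0 \<sigma> x *\<^sub>R g x = of_real (normal_density (- c * \<sigma>\<^sup>2) \<sigma> x) * exp (\<i> * of_real (\<kappa> * (x + c * \<sigma>\<^sup>2))) * of_real (exp (\<kappa>\<^sup>2 * \<sigma>\<^sup>2 / 2))" for x
    unfolding g_def scaleR_conv_of_real by (rule exp_gaussian_shift[OF s])
  have aff: "of_real (normal_density (- c * \<sigma>\<^sup>2) \<sigma> (- c * \<sigma>\<^sup>2 + \<sigma> * x)) * \<bar>\<sigma>\<bar> = std_normal_density x" for x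
    using s unfolding normal_density_def by (simp add: real_sqrt_mult power_mult_distrib)
  have "(\<integral>x. g x \<partial>D) = (\<integral>x. normal_density 0 \<sigma> x *\<^sub>R g x \<partial>lborel)"
    unfolding D_def by (intro integral_density) auto
  also have "\<dots> = (\<integral>x. of_real (normal_density (- c * \<sigma>\<^sup>2) \<sigma> x) * exp (\<i> * of_real (\<kappa> * (x + c * \<sigma>\<^sup>2))) \<partial>lborel) * of_real (exp (\<kappa>\<^sup>2 * \<sigma>\<^sup>2 / 2))"
    unfolding eq by simp
  also have "(\<integral>x. of_real (normal_density (- c * \<sigma>\<^sup>2) \<sigma> x) * exp (\<i> * of_real (\<kappa> * (x + c * \<sigma>\<^sup>2))) \<partial>lborel)
     = \<bar>\<sigma>\<bar> *\<^sub>R (\<integral>x. of_real (normal_density (- c * \<sigma>\<^sup>2) \<sigma> (- c * \<sigma>\<^sup>2 + \<sigma> * x)) * exp (\<i> * of_real (\<kappa> * ((- c * \<sigma>\<^sup>2 + \<sigma> * x) + c * \<sigma>\<^sup>2))) \<partial>lborel)"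
    using s by (intro lborel_integral_real_affine) auto
  also have "\<dots> = (\<integral>x. std_normal_density x *\<^sub>R iexp (\<kappa> * \<sigma> * x) \<partial>lborel)"
    unfolding integral_scaleR_right[symmetric]
  proof (intro Bochner_Integration.integral_cong refl)
    fix x
    show "\<bar>\<sigma>\<bar> *\<^sub>R (of_real (normal_density (- c * \<sigma>\<^sup>2) \<sigma> (- c * \<sigma>\<^sup>2 + \<sigma> * x)) * exp (\<i> * of_real (\<kappa> * ((- c * \<sigma>\<^sup>2 + \<sigma> * x) + c * \<sigma>\<^sup>2))))
      = std_normal_density x *\<^sub>R iexp (\<kappa> * \<sigma> * x)"
      unfolding aff[of x, symmetric] by (simp add: scaleR_conv_of_real ac_simps)
  qed
  also have "\<dots> = char std_normal_distribution (\<kappa> * \<sigma>)"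
    unfolding char_def by (subst integral_density) auto
  also have "\<dots> = of_real (exp (- (\<kappa> * \<sigma>)\<^sup>2 / 2))" by (simp add: char_std_normal_distribution)
  also have "\<dots> * of_real (exp (\<kappa>\<^sup>2 * \<sigma>\<^sup>2 / 2)) = 1"
    by (simp add: power_mult_distrib exp_minus flip: of_real_mult exp_add)
  finally show "(\<integral>x. g x \<partial>D) = 1" .
  have "(\<integral>\<^sup>+x. norm (g x) \<partial>D) = (\<integral>\<^sup>+x. ennreal (normal_density 0 \<sigma> x) * norm (g x) \<partial>lborel)"
    unfolding D_def by (subst nn_integral_density) auto
  also have "\<dots> = (\<integral>\<^sup>+x. ennreal (normal_density (- c * \<sigma>\<^sup>2) \<sigma> x * exp (\<kappa>\<^sup>2 * \<sigma>\<^sup>2 / 2)) \<partial>lborel)"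
  proof (rule nn_integral_cong)
    fix x
    have "norm (normal_density 0 \<sigma> x *\<^sub>R g x) = normal_density (- c * \<sigma>\<^sup>2) \<sigma> x * exp (\<kappa>\<^sup>2 * \<sigma>\<^sup>2 / 2)"
      unfolding eq by (simp add: norm_mult)
    then show "ennreal (normal_density 0 \<sigma> x) * norm (g x) = ennreal (normal_density (- c * \<sigma>\<^sup>2) \<sigma> x * exp (\<kappa>\<^sup>2 * \<sigma>\<^sup>2 / 2))"
      by (simp add: ennreal_mult[symmetric])
  qed
  also have "\<dots> = ennreal (\<integral>x. normal_density (- c * \<sigma>\<^sup>2) \<sigma> x * exp (\<kappa>\<^sup>2 * \<sigma>\<^sup>2 / 2) \<partial>lborel)"
    using s by (intro nn_integral_eq_integral) auto
  also have "\<dots> = ennreal (exp (\<kappa>\<^sup>2 * \<sigma>\<^sup>2 / 2))" using s by simp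
  finally show "(\<integral>\<^sup>+x. norm (g x) \<partial>D) = ennreal (exp (\<kappa>\<^sup>2 * \<sigma>\<^sup>2 / 2))" .
qed

locale brownian =
  fixes M :: "'w measure" and F T w
  assumes bm: "brownian_motion M F T w"
begin

sublocale prob_space M using bm by (simp add: brownian_motion_def)

lemma filtration: "t \<in> {0..T} \<Longrightarrow> subalgebra M (F t)"
  using bm by (auto simp: brownian_motion_def filtration_upto_def)

lemma filtration_mono: "0 \<le> s \<Longrightarrow> s \<le> t \<Longrightarrow> t \<le> T \<Longrightarrow> subalgebra (F t) (F s)"
  using bm filtration[of s] filtration[of t] by (auto simp: brownian_motion_def filtration_upto_def subalgebra_def)

lemma adapted: "t \<in> {0..T} \<Longrightarrow> w t \<in> borel_measurable (F t)"
  using bm by (auto simp: brownian_motion_def)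

lemma adapted_later: "0 \<le> s \<Longrightarrow> s \<le> t \<Longrightarrow> t \<le> T \<Longrightarrow> w s \<in> borel_measurable (F t)"
  using measurable_from_subalg[OF filtration_mono adapted] by simp

lemma random_variable_w: "t \<in> {0..T} \<Longrightarrow> w t \<in> borel_measurable M"
  using measurable_from_subalg[OF filtration adapted] .

lemma starts_at_0: "AE \<omega> in M. w 0 \<omega> = 0"
  using bm by (auto simp: brownian_motion_def)

lemma continuous_paths: "AE \<omega> in M. continuous_on {0..T} (\<lambda>t. w t \<omega>)"
  using bm by (auto simp: brownian_motion_def)

lemma increment_distributed:
  "0 \<le> s \<Longrightarrow> s < t \<Longrightarrow> t \<le> T \<Longrightarrow> distributed M lborel (\<lambda>\<omega>. w t \<omega> - w s \<omega>) (normal_density 0 (sqrt (t - s)))"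
  using bm by (auto simp: brownian_motion_def)

lemma increment_measurable: "0 \<le> s \<Longrightarrow> s \<le> t \<Longrightarrow> t \<le> T \<Longrightarrow> (\<lambda>\<omega>. w t \<omega> - w s \<omega>) \<in> borel_measurable M"
  by (intro borel_measurable_diff random_variable_w) auto

lemma increment_distr:
  assumes "0 \<le> s" "s < t" "t \<le> T"
  shows "distr M borel (\<lambda>\<omega>. w t \<omega> - w s \<omega>) = density lborel (\<lambda>x. ennreal (normal_density 0 (sqrt (t - s)) x))"
proof -
  have "distr M borel (\<lambda>\<omega>. w t \<omega> - w s \<omega>) = distr M lborel (\<lambda>\<omega>. w t \<omega> - w s \<omega>)"
    by (rule distr_cong) auto
  then show ?thesis using distributed_distr_eq_density[OF increment_distributed[OF assms]] by simp
qed

text \<open>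
  Independence of the past and the increment, as a product of measures; this is the form to which
  Fubini's theorem applies.
\<close>

lemma joint_law:
  assumes st: "0 \<le> s" "s < t" "t \<le> T"
  shows "distr M (F s \<Otimes>\<^sub>M borel) (\<lambda>\<omega>. (\<omega>, w t \<omega> - w s \<omega>))
    = distr M (F s) (\<lambda>\<omega>. \<omega>) \<Otimes>\<^sub>M distr M borel (\<lambda>\<omega>. w t \<omega> - w s \<omega>)"
proof -
  let ?X = "\<lambda>\<omega>. w t \<omega> - w s \<omega>"
  have sub: "subalgebra M (F s)" using st by (intro filtration) auto
  have idm: "(\<lambda>\<omega>. \<omega>) \<in> measurable M (F s)"
    using sub by (auto simp: subalgebra_def measurable_def)
  have Xm[measurable]: "?X \<in> borel_measurable M" using st by (intro increment_measurable) auto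
  interpret A: prob_space "distr M (F s) (\<lambda>\<omega>. \<omega>)" by (rule prob_space_distr[OF idm])
  interpret B: prob_space "distr M borel ?X" by (rule prob_space_distr[OF Xm])
  have pm: "(\<lambda>\<omega>. (\<omega>, ?X \<omega>)) \<in> measurable M (F s \<Otimes>\<^sub>M borel)" using idm Xm by simp
  have ind: "indep_set (sets (F s)) (sets (vimage_algebra (space M) ?X borel))"
    using bm st by (auto simp: brownian_motion_def)
  show ?thesis
  proof (rule pair_measure_eqI[symmetric])
    show "sigma_finite_measure (distr M (F s) (\<lambda>\<omega>. \<omega>))" "sigma_finite_measure (distr M borel ?X)" by unfold_locales
    show "sets (distr M (F s) (\<lambda>\<omega>. \<omega>) \<Otimes>\<^sub>M distr M borel ?X) = sets (distr M (F s \<Otimes>\<^sub>M borel) (\<lambda>\<omega>. (\<omega>, ?X \<omega>)))"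
      by (simp cong: sets_pair_measure_cong)
    fix A B assume "A \<in> sets (distr M (F s) (\<lambda>\<omega>. \<omega>))" "B \<in> sets (distr M borel ?X)"
    then have A: "A \<in> sets (F s)" and B: "B \<in> sets borel" by auto
    have AM: "A \<in> events" "A \<subseteq> space M" using A sub by (auto simp: subalgebra_def dest: sets.sets_into_space)
    have "?X -` B \<inter> space M \<in> sets (vimage_algebra (space M) ?X borel)"
      using B by (rule in_vimage_algebra)
    with ind A have "prob (A \<inter> (?X -` B \<inter> space M)) = prob A * prob (?X -` B \<inter> space M)"
      by (intro indep_setD) auto
    moreover have "(\<lambda>\<omega>. (\<omega>, ?X \<omega>)) -` (A \<times> B) \<inter> space M = A \<inter> (?X -` B \<inter> space M)"
      by auto
    moreover have "(\<lambda>\<omega>. \<omega>) -` A \<inter> space M = A" using AM by auto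
    ultimately show "emeasure (distr M (F s) (\<lambda>\<omega>. \<omega>)) A * emeasure (distr M borel ?X) B =
           emeasure (distr M (F s \<Otimes>\<^sub>M borel) (\<lambda>\<omega>. (\<omega>, ?X \<omega>))) (A \<times> B)"
      using A B AM idm by (simp add: emeasure_distr pm emeasure_eq_measure ennreal_mult[symmetric])
  qed
qed

text \<open>
  The past is frozen and the increment is integrated out first.
\<close>

lemma increment_fubini:
  fixes h :: "'w \<times> real \<Rightarrow> 'b::{banach, second_countable_topology}"
  assumes st: "0 \<le> s" "s < t" "t \<le> T" and h[measurable]: "h \<in> borel_measurable (F s \<Otimes>\<^sub>M borel)"
  defines "D \<equiv> density lborel (\<lambda>x. ennreal (normal_density 0 (sqrt (t - s)) x))"
  assumes fin: "(\<integral>\<^sup>+\<omega>. \<integral>\<^sup>+x. norm (h (\<omega>, x)) \<partial>D \<partial>M) < \<infinity>"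
  shows "integrable M (\<lambda>\<omega>. h (\<omega>, w t \<omega> - w s \<omega>))"
    and "(\<integral>\<omega>. h (\<omega>, w t \<omega> - w s \<omega>) \<partial>M) = (\<integral>\<omega>. (\<integral>x. h (\<omega>, x) \<partial>D) \<partial>M)"
proof -
  let ?X = "\<lambda>\<omega>. w t \<omega> - w s \<omega>" and ?N = "distr M (F s) (\<lambda>\<omega>. \<omega>)"
  have sub: "subalgebra M (F s)" using st by (intro filtration) auto
  have idm: "(\<lambda>\<omega>. \<omega>) \<in> measurable M (F s)"
    using sub by (auto simp: subalgebra_def measurable_def)
  have Xm[measurable]: "?X \<in> borel_measurable M" using st by (intro increment_measurable) auto
  have D: "distr M borel ?X = D" unfolding D_def by (rule increment_distr[OF st])
  interpret A: prob_space ?N by (rule prob_space_distr[OF idm])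
  interpret B: prob_space D unfolding D[symmetric] by (rule prob_space_distr[OF Xm])
  interpret P: pair_sigma_finite ?N D by unfold_locales
  have setsD[measurable_cong]: "sets D = sets borel" by (simp add: D_def)
  have setsN[measurable_cong]: "sets ?N = sets (F s)" by simp
  have pm: "(\<lambda>\<omega>. (\<omega>, ?X \<omega>)) \<in> measurable M (F s \<Otimes>\<^sub>M borel)" using idm Xm by simp
  have J: "distr M (F s \<Otimes>\<^sub>M borel) (\<lambda>\<omega>. (\<omega>, ?X \<omega>)) = ?N \<Otimes>\<^sub>M D" using joint_law[OF st] D by simp
  have hm: "h \<in> borel_measurable (?N \<Otimes>\<^sub>M D)" by measurable
  have gm: "(\<lambda>\<omega>. \<integral>\<^sup>+x. norm (h (\<omega>, x)) \<partial>D) \<in> borel_measurable (F s)" by measurable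
  have "(\<integral>\<^sup>+z. norm (h z) \<partial>(?N \<Otimes>\<^sub>M D)) = (\<integral>\<^sup>+\<omega>. \<integral>\<^sup>+x. norm (h (\<omega>, x)) \<partial>D \<partial>?N)"
    by (subst B.nn_integral_fst[symmetric]) auto
  also have "\<dots> = (\<integral>\<^sup>+\<omega>. \<integral>\<^sup>+x. norm (h (\<omega>, x)) \<partial>D \<partial>M)" by (subst nn_integral_distr[OF idm]) (use gm in auto)
  finally have int: "integrable (?N \<Otimes>\<^sub>M D) h" using fin hm by (intro integrableI_bounded) auto
  then show "integrable M (\<lambda>\<omega>. h (\<omega>, ?X \<omega>))"
    unfolding J[symmetric] by (subst (asm) integrable_distr_eq[OF pm h])
  have "(\<integral>\<omega>. h (\<omega>, ?X \<omega>) \<partial>M) = (\<integral>z. h z \<partial>(?N \<Otimes>\<^sub>M D))"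
    unfolding J[symmetric] by (subst integral_distr[OF pm h]) simp
  also have "\<dots> = (\<integral>\<omega>. (\<integral>x. h (\<omega>, x) \<partial>D) \<partial>?N)" using P.integral_fst'[OF int] by simp
  also have "\<dots> = (\<integral>\<omega>. (\<integral>x. h (\<omega>, x) \<partial>D) \<partial>M)" by (subst integral_distr[OF idm]) auto
  finally show "(\<integral>\<omega>. h (\<omega>, ?X \<omega>) \<partial>M) = (\<integral>\<omega>. (\<integral>x. h (\<omega>, x) \<partial>D) \<partial>M)" .
qed

text \<open>
  Given the past, the new factor has mean one. Measurability of \<open>\<xi>\<close> at time \<open>s\<close> is asked for only if
  \<open>s < t\<close>: the lemma is applied to clamped intervals, and the coefficient of an interval that starts
  later than \<open>s\<close> is measurable only at a later time, but its clamped interval is then empty.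
\<close>

lemma exp_increment_step:
  fixes Z :: "'w \<Rightarrow> complex" and \<xi> :: "'w \<Rightarrow> real" and \<kappa> :: real
  assumes st: "0 \<le> s" "s \<le> t" "t \<le> T" and Z: "Z \<in> borel_measurable (F s)" "integrable M Z"
    and \<xi>: "s < t \<Longrightarrow> \<xi> \<in> borel_measurable (F s)"
  defines "E \<equiv> (\<lambda>\<omega>. exp ((\<i> * of_real \<kappa> - of_real (\<xi> \<omega>)) * of_real (w t \<omega> - w s \<omega>)
                       - (\<i> * of_real \<kappa> - of_real (\<xi> \<omega>))\<^sup>2 * of_real (t - s) / 2))"
  shows "integrable M (\<lambda>\<omega>. Z \<omega> * E \<omega>)" "(\<integral>\<omega>. Z \<omega> * E \<omega> \<partial>M) = (\<integral>\<omega>. Z \<omega> \<partial>M)"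
    "(\<lambda>\<omega>. Z \<omega> * E \<omega>) \<in> borel_measurable (F t)"
proof -
  have "integrable M (\<lambda>\<omega>. Z \<omega> * E \<omega>) \<and> (\<integral>\<omega>. Z \<omega> * E \<omega> \<partial>M) = (\<integral>\<omega>. Z \<omega> \<partial>M) \<and> (\<lambda>\<omega>. Z \<omega> * E \<omega>) \<in> borel_measurable (F t)"
  proof (cases "s = t")
    case True then show ?thesis using Z by (simp add: E_def)
  next
    case False
    then have lt: "s < t" using st by simp
    have sub: "subalgebra (F t) (F s)" using st by (intro filtration_mono) auto
    have ZE: "(\<lambda>\<omega>. Z \<omega> * E \<omega>) \<in> borel_measurable (F t)"
    proof -
      have wt: "w t \<in> borel_measurable (F t)" "w s \<in> borel_measurable (F t)"
        using adapted[of t] adapted_later[OF st] st by auto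
      note [measurable] = measurable_from_subalg[OF sub Z(1)] measurable_from_subalg[OF sub \<xi>[OF lt]] wt
      show ?thesis unfolding E_def by measurable
    qed
    note [measurable] = \<xi>[OF lt] Z(1)
    let ?D = "density lborel (\<lambda>x. ennreal (normal_density 0 (sqrt (t - s)) x))"
    define g where "g \<omega> x = exp ((\<i> * of_real \<kappa> - of_real (\<xi> \<omega>)) * of_real x - (\<i> * of_real \<kappa> - of_real (\<xi> \<omega>))\<^sup>2 * of_real (t - s) / 2)" for \<omega> x
    define h where "h = (\<lambda>(\<omega>, x). Z \<omega> * g \<omega> x)"
    have sq: "(sqrt (t - s))\<^sup>2 = t - s" and pos: "sqrt (t - s) > 0" using lt by auto
    note G = exp_gaussian_integral[OF pos, unfolded sq]
    have hm: "h \<in> borel_measurable (F s \<Otimes>\<^sub>M borel)" unfolding h_def g_def split_beta' by measurable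
    have "(\<integral>\<^sup>+\<omega>. \<integral>\<^sup>+x. norm (h (\<omega>, x)) \<partial>?D \<partial>M) = (\<integral>\<^sup>+\<omega>. ennreal (norm (Z \<omega>)) * ennreal (exp (\<kappa>\<^sup>2 * (t - s) / 2)) \<partial>M)"
    proof (rule nn_integral_cong)
      fix \<omega>
      have "(\<integral>\<^sup>+x. norm (h (\<omega>, x)) \<partial>?D) = (\<integral>\<^sup>+x. ennreal (norm (Z \<omega>)) * ennreal (norm (g \<omega> x)) \<partial>?D)"
        by (simp add: h_def norm_mult ennreal_mult)
      also have "\<dots> = ennreal (norm (Z \<omega>)) * (\<integral>\<^sup>+x. ennreal (norm (g \<omega> x)) \<partial>?D)"
        by (rule nn_integral_cmult) (simp add: g_def)
      also have "(\<integral>\<^sup>+x. ennreal (norm (g \<omega> x)) \<partial>?D) = ennreal (exp (\<kappa>\<^sup>2 * (t - s) / 2))"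
        unfolding g_def by (rule G(2))
      finally show "(\<integral>\<^sup>+x. norm (h (\<omega>, x)) \<partial>?D) = ennreal (norm (Z \<omega>)) * ennreal (exp (\<kappa>\<^sup>2 * (t - s) / 2))" .
    qed
    also have "\<dots> = (\<integral>\<^sup>+\<omega>. ennreal (norm (Z \<omega>)) \<partial>M) * ennreal (exp (\<kappa>\<^sup>2 * (t - s) / 2))"
      using Z(2) by (intro nn_integral_multc) auto
    also have "\<dots> < \<infinity>" using Z(2) by (auto simp: integrable_iff_bounded ennreal_mult_less_top)
    finally have fin: "(\<integral>\<^sup>+\<omega>. \<integral>\<^sup>+x. norm (h (\<omega>, x)) \<partial>?D \<partial>M) < \<infinity>" .
    note fub = increment_fubini[OF st(1) lt st(3) hm fin]
    have hE: "h (\<omega>, w t \<omega> - w s \<omega>) = Z \<omega> * E \<omega>" for \<omega> by (simp add: h_def g_def E_def)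
    have "(\<integral>x. h (\<omega>, x) \<partial>?D) = Z \<omega>" for \<omega>
    proof -
      have "(\<integral>x. h (\<omega>, x) \<partial>?D) = Z \<omega> * (\<integral>x. g \<omega> x \<partial>?D)" by (simp add: h_def)
      also have "(\<integral>x. g \<omega> x \<partial>?D) = 1" unfolding g_def by (rule G(1))
      finally show ?thesis by simp
    qed
    then show ?thesis using fub ZE unfolding hE by simp
  qed
  then show "integrable M (\<lambda>\<omega>. Z \<omega> * E \<omega>)" "(\<integral>\<omega>. Z \<omega> * E \<omega> \<partial>M) = (\<integral>\<omega>. Z \<omega> \<partial>M)"
    "(\<lambda>\<omega>. Z \<omega> * E \<omega>) \<in> borel_measurable (F t)" by auto
qed

lemma exp_increment_chain:
  fixes Z :: "'w \<Rightarrow> complex" and \<xi> :: "nat \<Rightarrow> 'w \<Rightarrow> real" and \<kappa> :: real and \<tau> :: "nat \<Rightarrow> real"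
  assumes \<tau>: "0 \<le> \<tau> 0" "\<And>i. i < n \<Longrightarrow> \<tau> i \<le> \<tau> (Suc i)" "\<tau> n \<le> T"
    and Z: "Z \<in> borel_measurable (F (\<tau> 0))" "integrable M Z"
    and \<xi>: "\<And>i. i < n \<Longrightarrow> \<tau> i < \<tau> (Suc i) \<Longrightarrow> \<xi> i \<in> borel_measurable (F (\<tau> i))"
  defines "e \<equiv> (\<lambda>i \<omega>. (\<i> * of_real \<kappa> - of_real (\<xi> i \<omega>)) * of_real (w (\<tau> (Suc i)) \<omega> - w (\<tau> i) \<omega>)
                       - (\<i> * of_real \<kappa> - of_real (\<xi> i \<omega>))\<^sup>2 * of_real (\<tau> (Suc i) - \<tau> i) / 2)"
  shows "integrable M (\<lambda>\<omega>. Z \<omega> * exp (\<Sum>i<n. e i \<omega>)) \<and> (\<integral>\<omega>. Z \<omega> * exp (\<Sum>i<n. e i \<omega>) \<partial>M) = (\<integral>\<omega>. Z \<omega> \<partial>M)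
    \<and> (\<lambda>\<omega>. Z \<omega> * exp (\<Sum>i<n. e i \<omega>)) \<in> borel_measurable (F (\<tau> n))"
  using \<tau>(2,3) \<xi>
proof (induction n)
  case 0 then show ?case using Z by simp
next
  case (Suc n)
  have \<tau>0: "0 \<le> \<tau> m" if "m \<le> Suc n" for m
    using that
  proof (induction m)
    case 0 show ?case by (rule \<tau>(1))
  next
    case (Suc m)
    then show ?case using Suc.prems Suc.IH \<open>\<And>i. i < Suc n \<Longrightarrow> \<tau> i \<le> \<tau> (Suc i)\<close>[of m] by simp
  qed
  have le: "\<tau> n \<le> \<tau> (Suc n)" using Suc.prems(1)[of n] by simp
  have "integrable M (\<lambda>\<omega>. Z \<omega> * exp (\<Sum>i<n. e i \<omega>)) \<and> (\<integral>\<omega>. Z \<omega> * exp (\<Sum>i<n. e i \<omega>) \<partial>M) = (\<integral>\<omega>. Z \<omega> \<partial>M)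
    \<and> (\<lambda>\<omega>. Z \<omega> * exp (\<Sum>i<n. e i \<omega>)) \<in> borel_measurable (F (\<tau> n))"
  proof (rule Suc.IH)
    show "\<tau> n \<le> T" using le Suc.prems(2) by simp
  qed (use Suc.prems in auto)
  then have IH: "integrable M (\<lambda>\<omega>. Z \<omega> * exp (\<Sum>i<n. e i \<omega>))" "(\<integral>\<omega>. Z \<omega> * exp (\<Sum>i<n. e i \<omega>) \<partial>M) = (\<integral>\<omega>. Z \<omega> \<partial>M)"
    "(\<lambda>\<omega>. Z \<omega> * exp (\<Sum>i<n. e i \<omega>)) \<in> borel_measurable (F (\<tau> n))" by auto
  have eq: "Z \<omega> * exp (\<Sum>i<Suc n. e i \<omega>) = Z \<omega> * exp (\<Sum>i<n. e i \<omega>) * exp (e n \<omega>)" for \<omega>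
    by (simp add: exp_add)
  have en: "e n \<omega> = (\<i> * of_real \<kappa> - of_real (\<xi> n \<omega>)) * of_real (w (\<tau> (Suc n)) \<omega> - w (\<tau> n) \<omega>)
                       - (\<i> * of_real \<kappa> - of_real (\<xi> n \<omega>))\<^sup>2 * of_real (\<tau> (Suc n) - \<tau> n) / 2" for \<omega>
    by (simp add: e_def)
  have "\<xi> n \<in> borel_measurable (F (\<tau> n))" if "\<tau> n < \<tau> (Suc n)"
    using Suc.prems(3)[of n] that by simp
  note step = exp_increment_step[OF \<tau>0[of n] le Suc.prems(2) IH(3,1) this, of \<kappa>, folded en]
  show ?case unfolding eq using step IH(2) by simp
qed

end

text \<open>Splitting time at s and t.\<close>

text \<open>
  The increment of \<open>f\<close> over \<open>{a..b}\<close> is cut into the parts before \<open>s\<close>, between \<open>s\<close> and \<open>t\<close>, and after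
  \<open>t\<close>; clamping the end points expresses the parts uniformly, including the empty ones.
\<close>

lemma clamp_split:
  fixes f :: "real \<Rightarrow> 'b::ab_group_add"
  assumes "s \<le> t"
  shows "(f (min b s) - f (min a s)) + (f (max s (min b t)) - f (max s (min a t))) + (f (max b t) - f (max a t)) = f b - f a"
proof -
  have *: "f (min x s) + f (max s (min x t)) + f (max x t) = f x + f s + f t" for x
  proof -
    consider "x \<le> s" | "s \<le> x" "x \<le> t" | "t \<le> x" by linarith
    then show ?thesis using assms by cases (simp_all add: min_def max_def algebra_simps)
  qed
  have "(f (min b s) - f (min a s)) + (f (max s (min b t)) - f (max s (min a t))) + (f (max b t) - f (max a t))
    = (f (min b s) + f (max s (min b t)) + f (max b t)) - (f (min a s) + f (max s (min a t)) + f (max a t))"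
    by (simp add: algebra_simps)
  also have "\<dots> = f b - f a" unfolding * by simp
  finally show ?thesis .
qed

context brownian begin

text \<open>
  All intervals of the integrand are cut at \<open>s\<close> and \<open>t\<close>. Before \<open>s\<close> and after \<open>t\<close> the factors of the
  density itself are used, which is the case \<open>\<kappa> = 0\<close>; between \<open>s\<close> and \<open>t\<close> the factors also carry the
  character of the increment. All of them have conditional mean one, so the product has the same mean
  on the event \<open>A\<close> as its part before \<open>s\<close>, whatever \<open>\<kappa>\<close> is. The comparison with \<open>\<kappa> = 0\<close> gives the
  result.
\<close>

lemma exponential_martingale_elementary:
  fixes \<kappa> :: real
  assumes st: "0 \<le> s" "s \<le> t" "t \<le> T" and el: "elementary_data F T n \<tau> \<xi>" and A: "A \<in> sets (F s)"
  defines "Y \<equiv> (\<lambda>\<omega>. exp (- elementary_ito_integral w n \<tau> \<xi> \<omega> - (\<Sum>i<n. (\<xi> i \<omega>)\<^sup>2 * (\<tau> (Suc i) - \<tau> i)) / 2))"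
  defines "R \<equiv> (\<lambda>\<omega>. \<Sum>i<n. \<xi> i \<omega> * (max s (min (\<tau> (Suc i)) t) - max s (min (\<tau> i) t)))"
  shows "A = space M \<Longrightarrow> integrable M Y" "A = space M \<Longrightarrow> (\<integral>\<omega>. Y \<omega> \<partial>M) = 1"
    "(\<integral>\<omega>. indicator A \<omega> * (exp (\<i> * of_real (\<kappa> * (w t \<omega> - w s \<omega> + R \<omega>))) * of_real (Y \<omega>)) \<partial>M)
     = exp (- of_real (\<kappa>\<^sup>2 * (t - s) / 2)) * of_real (\<integral>\<omega>. indicator A \<omega> * Y \<omega> \<partial>M)"
    "integrable M (\<lambda>\<omega>. indicator A \<omega> * (exp (\<i> * of_real (\<kappa> * (w t \<omega> - w s \<omega> + R \<omega>))) * of_real (Y \<omega>)))"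
proof -
  have \<tau>: "0 \<le> \<tau> i" "\<tau> i \<le> T" if "i \<le> n" for i using el that by (auto simp: elementary_data_def)
  have mono: "\<tau> i \<le> \<tau> (Suc i)" if "i < n" for i using el that by (auto simp: elementary_data_def)
  have \<xi>m: "\<xi> i \<in> borel_measurable (F (\<tau> i))" if "i < n" for i using el that by (auto simp: elementary_data_def)
  have sub: "subalgebra M (F s)" using st by (intro filtration) auto
  have AM: "A \<in> sets M" using A sub by (auto simp: subalgebra_def)
  let ?c = "\<lambda>x. max s (min x t)"
  define e1 where "e1 \<kappa> i \<omega> = (\<i> * of_real \<kappa> - of_real (\<xi> i \<omega>)) * of_real (w (min (\<tau> (Suc i)) s) \<omega> - w (min (\<tau> i) s) \<omega>)
     - (\<i> * of_real \<kappa> - of_real (\<xi> i \<omega>))\<^sup>2 * of_real (min (\<tau> (Suc i)) s - min (\<tau> i) s) / 2" for \<kappa> i \<omega>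
  define e2 where "e2 \<kappa> i \<omega> = (\<i> * of_real \<kappa> - of_real (\<xi> i \<omega>)) * of_real (w (?c (\<tau> (Suc i))) \<omega> - w (?c (\<tau> i)) \<omega>)
     - (\<i> * of_real \<kappa> - of_real (\<xi> i \<omega>))\<^sup>2 * of_real (?c (\<tau> (Suc i)) - ?c (\<tau> i)) / 2" for \<kappa> i \<omega>
  define e3 where "e3 \<kappa> i \<omega> = (\<i> * of_real \<kappa> - of_real (\<xi> i \<omega>)) * of_real (w (max (\<tau> (Suc i)) t) \<omega> - w (max (\<tau> i) t) \<omega>)
     - (\<i> * of_real \<kappa> - of_real (\<xi> i \<omega>))\<^sup>2 * of_real (max (\<tau> (Suc i)) t - max (\<tau> i) t) / 2" for \<kappa> i \<omega>
  \<comment> \<open>The factor without drift, for the parts of \<open>{s..t}\<close> before the first and after the last interval.\<close>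
  define g where "g \<kappa> a b \<omega> = (\<i> * of_real \<kappa> - of_real 0) * of_real (w b \<omega> - w a \<omega>)
     - (\<i> * of_real \<kappa> - of_real 0)\<^sup>2 * of_real (b - a) / 2" for \<kappa> a b \<omega>
  \<comment> \<open>The product is built in the order of time: the density up to \<open>s\<close> in \<open>Z1\<close>, restricted to \<open>A\<close> in
    \<open>Z2\<close>; the character up to the first interval in \<open>Z3\<close>; density and character on the intervals
    within \<open>{s..t}\<close> in \<open>Z4\<close>; the rest of the character in \<open>Z5\<close>; at last the density after \<open>t\<close>.\<close>
  define Z1 where "Z1 \<omega> = (1::complex) * exp (\<Sum>i<n. e1 0 i \<omega>)" for \<omega>
  have Z1: "integrable M Z1 \<and> (\<integral>\<omega>. Z1 \<omega> \<partial>M) = (\<integral>\<omega>. 1 \<partial>M) \<and> Z1 \<in> borel_measurable (F (min (\<tau> n) s))"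
    unfolding Z1_def[abs_def] e1_def
  proof (rule exp_increment_chain[where \<tau> = "\<lambda>i. min (\<tau> i) s"])
    show "0 \<le> min (\<tau> 0) s" "min (\<tau> n) s \<le> T" using \<tau>[of 0] st by auto
    fix i assume i: "i < n"
    show "min (\<tau> i) s \<le> min (\<tau> (Suc i)) s" using mono[OF i] by auto
    assume "min (\<tau> i) s < min (\<tau> (Suc i)) s"
    then have "min (\<tau> i) s = \<tau> i" by auto
    then show "\<xi> i \<in> borel_measurable (F (min (\<tau> i) s))" using \<xi>m[OF i] by simp
  qed auto
  define Z2 where "Z2 \<omega> = indicator A \<omega> * Z1 \<omega>" for \<omega>
  have Z1s: "Z1 \<in> borel_measurable (F s)"
    by (rule measurable_from_subalg[OF filtration_mono[of "min (\<tau> n) s"]]) (use Z1 \<tau>[of n] st in auto)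
  have Z2: "Z2 \<in> borel_measurable (F s)" "integrable M Z2"
  proof -
    note [measurable] = Z1s A
    show "Z2 \<in> borel_measurable (F s)" unfolding Z2_def by measurable
    have "integrable M (\<lambda>\<omega>. indicator A \<omega> *\<^sub>R Z1 \<omega>)" using Z1 by (intro integrable_mult_indicator AM) auto
    moreover have "indicator A \<omega> *\<^sub>R Z1 \<omega> = Z2 \<omega>" for \<omega> by (cases "\<omega> \<in> A") (auto simp: Z2_def)
    ultimately show "integrable M Z2" by simp
  qed
  have c0: "s \<le> ?c (\<tau> 0)" "?c (\<tau> n) \<le> t" "0 \<le> ?c x" "?c x \<le> T" for x using st by auto
  have main: "integrable M (\<lambda>\<omega>. Z2 \<omega> * exp (g \<kappa> s (?c (\<tau> 0)) \<omega>) * exp (\<Sum>i<n. e2 \<kappa> i \<omega>) * exp (g \<kappa> (?c (\<tau> n)) t \<omega>) * exp (\<Sum>i<n. e3 0 i \<omega>)) \<and>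
     (\<integral>\<omega>. Z2 \<omega> * exp (g \<kappa> s (?c (\<tau> 0)) \<omega>) * exp (\<Sum>i<n. e2 \<kappa> i \<omega>) * exp (g \<kappa> (?c (\<tau> n)) t \<omega>) * exp (\<Sum>i<n. e3 0 i \<omega>) \<partial>M)
     = (\<integral>\<omega>. Z2 \<omega> \<partial>M)" for \<kappa>
  proof -
    define Z3 where "Z3 \<omega> = Z2 \<omega> * exp (g \<kappa> s (?c (\<tau> 0)) \<omega>)" for \<omega>
    have Z3: "integrable M Z3" "(\<integral>\<omega>. Z3 \<omega> \<partial>M) = (\<integral>\<omega>. Z2 \<omega> \<partial>M)" "Z3 \<in> borel_measurable (F (?c (\<tau> 0)))"
      unfolding Z3_def[abs_def] g_def
      by (rule exp_increment_step[OF st(1) c0(1,4) Z2, of "\<lambda>_. 0", OF borel_measurable_const])+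
    define Z4 where "Z4 \<omega> = Z3 \<omega> * exp (\<Sum>i<n. e2 \<kappa> i \<omega>)" for \<omega>
    have Z4: "integrable M Z4 \<and> (\<integral>\<omega>. Z4 \<omega> \<partial>M) = (\<integral>\<omega>. Z3 \<omega> \<partial>M) \<and> Z4 \<in> borel_measurable (F (?c (\<tau> n)))"
      unfolding Z4_def[abs_def] e2_def
    proof (rule exp_increment_chain[where \<tau> = "\<lambda>i. ?c (\<tau> i)", OF c0(3) _ c0(4) Z3(3,1)])
      fix i assume i: "i < n"
      show "?c (\<tau> i) \<le> ?c (\<tau> (Suc i))" using mono[OF i] by auto
      assume lt: "?c (\<tau> i) < ?c (\<tau> (Suc i))"
      have "\<tau> i \<le> ?c (\<tau> i)" using lt by (auto simp: min_def max_def split: if_splits)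
      then show "\<xi> i \<in> borel_measurable (F (?c (\<tau> i)))"
        using \<tau>(1)[of i] i c0(4) by (intro measurable_from_subalg[OF filtration_mono[of "\<tau> i" "?c (\<tau> i)"] \<xi>m[OF i]]) simp_all
    qed
    define Z5 where "Z5 \<omega> = Z4 \<omega> * exp (g \<kappa> (?c (\<tau> n)) t \<omega>)" for \<omega>
    have Z5: "integrable M Z5" "(\<integral>\<omega>. Z5 \<omega> \<partial>M) = (\<integral>\<omega>. Z4 \<omega> \<partial>M)" "Z5 \<in> borel_measurable (F t)"
      unfolding Z5_def[abs_def] g_def
      using exp_increment_step[OF c0(3,2) st(3) Z4[THEN conjunct2, THEN conjunct2] Z4[THEN conjunct1], of "\<lambda>_. 0", OF borel_measurable_const]
      by auto
    have Z5t: "Z5 \<in> borel_measurable (F (max (\<tau> 0) t))"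
      by (rule measurable_from_subalg[OF filtration_mono[of t] Z5(3)]) (use \<tau>[of 0] st in auto)
    have "integrable M (\<lambda>\<omega>. Z5 \<omega> * exp (\<Sum>i<n. e3 0 i \<omega>)) \<and> (\<integral>\<omega>. Z5 \<omega> * exp (\<Sum>i<n. e3 0 i \<omega>) \<partial>M) = (\<integral>\<omega>. Z5 \<omega> \<partial>M)
       \<and> (\<lambda>\<omega>. Z5 \<omega> * exp (\<Sum>i<n. e3 0 i \<omega>)) \<in> borel_measurable (F (max (\<tau> n) t))"
      unfolding e3_def
    proof (rule exp_increment_chain[where \<tau> = "\<lambda>i. max (\<tau> i) t", OF _ _ _ Z5t Z5(1)])
      show "0 \<le> max (\<tau> 0) t" "max (\<tau> n) t \<le> T" using \<tau>[of n] st by auto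
      fix i assume i: "i < n"
      show "max (\<tau> i) t \<le> max (\<tau> (Suc i)) t" using mono[OF i] by auto
      show "\<xi> i \<in> borel_measurable (F (max (\<tau> i) t))"
        using \<tau>[of i] i st by (intro measurable_from_subalg[OF filtration_mono[of "\<tau> i" "max (\<tau> i) t"] \<xi>m[OF i]]) simp_all
    qed
    then show ?thesis using Z5 Z4 Z3 unfolding Z5_def Z4_def Z3_def by simp
  qed
  \<comment> \<open>The exponents add up to the logarithm of the density, the exponent of the character of the
    shifted increment, and the normalising constant.\<close>
  have expo: "(\<Sum>i<n. e1 0 i \<omega>) + g \<kappa> s (?c (\<tau> 0)) \<omega> + (\<Sum>i<n. e2 \<kappa> i \<omega>) + g \<kappa> (?c (\<tau> n)) t \<omega> + (\<Sum>i<n. e3 0 i \<omega>)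
     = of_real (- elementary_ito_integral w n \<tau> \<xi> \<omega> - (\<Sum>i<n. (\<xi> i \<omega>)\<^sup>2 * (\<tau> (Suc i) - \<tau> i)) / 2)
       + \<i> * of_real (\<kappa> * (w t \<omega> - w s \<omega> + R \<omega>)) + of_real (\<kappa>\<^sup>2 * (t - s) / 2)" for \<kappa> \<omega>
  proof -
    define a where "a i = \<xi> i \<omega>" for i
    define dw where "dw i = w (?c (\<tau> (Suc i))) \<omega> - w (?c (\<tau> i)) \<omega>" for i
    define dt where "dt i = ?c (\<tau> (Suc i)) - ?c (\<tau> i)" for i
    have trm: "e1 0 i \<omega> + e2 \<kappa> i \<omega> + e3 0 i \<omega>
       = of_real (- (a i * (w (\<tau> (Suc i)) \<omega> - w (\<tau> i) \<omega>)) - (a i)\<^sup>2 * (\<tau> (Suc i) - \<tau> i) / 2) +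
         \<i> * of_real (\<kappa> * (dw i + a i * dt i)) + of_real (\<kappa>\<^sup>2 * dt i / 2)" for i
      unfolding clamp_split[OF st(2), of "\<lambda>x. w x \<omega>" "\<tau> (Suc i)" "\<tau> i", symmetric]
        clamp_split[OF st(2), of "\<lambda>x. x" "\<tau> (Suc i)" "\<tau> i", symmetric]
      by (simp add: e1_def e2_def e3_def a_def dw_def dt_def complex_eq_iff power2_eq_square field_simps)
    have "(\<Sum>i<n. e1 0 i \<omega>) + (\<Sum>i<n. e2 \<kappa> i \<omega>) + (\<Sum>i<n. e3 0 i \<omega>) = (\<Sum>i<n. e1 0 i \<omega> + e2 \<kappa> i \<omega> + e3 0 i \<omega>)"
      by (simp add: sum.distrib)
    also have "\<dots> = of_real (- (\<Sum>i<n. a i * (w (\<tau> (Suc i)) \<omega> - w (\<tau> i) \<omega>)) - (\<Sum>i<n. (a i)\<^sup>2 * (\<tau> (Suc i) - \<tau> i)) / 2) +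
         \<i> * of_real (\<kappa> * ((\<Sum>i<n. dw i) + (\<Sum>i<n. a i * dt i))) + of_real (\<kappa>\<^sup>2 * (\<Sum>i<n. dt i) / 2)"
      unfolding trm
      by (simp add: sum.distrib sum_subtractf sum_negf sum_divide_distrib sum_distrib_left distrib_left)
    also have "(\<Sum>i<n. dw i) = w (?c (\<tau> n)) \<omega> - w (?c (\<tau> 0)) \<omega>"
      unfolding dw_def by (rule sum_lessThan_telescope)
    also have "(\<Sum>i<n. dt i) = ?c (\<tau> n) - ?c (\<tau> 0)" unfolding dt_def by (rule sum_lessThan_telescope)
    finally have S: "(\<Sum>i<n. e1 0 i \<omega>) + (\<Sum>i<n. e2 \<kappa> i \<omega>) + (\<Sum>i<n. e3 0 i \<omega>)
      = of_real (- (\<Sum>i<n. a i * (w (\<tau> (Suc i)) \<omega> - w (\<tau> i) \<omega>)) - (\<Sum>i<n. (a i)\<^sup>2 * (\<tau> (Suc i) - \<tau> i)) / 2) +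
         \<i> * of_real (\<kappa> * (w (?c (\<tau> n)) \<omega> - w (?c (\<tau> 0)) \<omega> + (\<Sum>i<n. a i * dt i))) + of_real (\<kappa>\<^sup>2 * (?c (\<tau> n) - ?c (\<tau> 0)) / 2)" .
    have G: "g \<kappa> p q \<omega> = \<i> * of_real (\<kappa> * (w q \<omega> - w p \<omega>)) + of_real (\<kappa>\<^sup>2 * (q - p) / 2)" for p q
      by (simp add: g_def complex_eq_iff power2_eq_square)
    have "(\<Sum>i<n. e1 0 i \<omega>) + g \<kappa> s (?c (\<tau> 0)) \<omega> + (\<Sum>i<n. e2 \<kappa> i \<omega>) + g \<kappa> (?c (\<tau> n)) t \<omega> + (\<Sum>i<n. e3 0 i \<omega>)
      = ((\<Sum>i<n. e1 0 i \<omega>) + (\<Sum>i<n. e2 \<kappa> i \<omega>) + (\<Sum>i<n. e3 0 i \<omega>)) + g \<kappa> s (?c (\<tau> 0)) \<omega> + g \<kappa> (?c (\<tau> n)) t \<omega>"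
      by (simp add: add_ac)
    also have "\<dots> = of_real (- (\<Sum>i<n. a i * (w (\<tau> (Suc i)) \<omega> - w (\<tau> i) \<omega>)) - (\<Sum>i<n. (a i)\<^sup>2 * (\<tau> (Suc i) - \<tau> i)) / 2)
       + \<i> * of_real (\<kappa> * (w t \<omega> - w s \<omega> + (\<Sum>i<n. a i * dt i))) + of_real (\<kappa>\<^sup>2 * (t - s) / 2)"
      unfolding S G by (simp add: complex_eq_iff field_simps)
    finally show ?thesis
      unfolding elementary_ito_integral_def R_def a_def dt_def .
  qed
  have prod: "Z2 \<omega> * exp (g \<kappa> s (?c (\<tau> 0)) \<omega>) * exp (\<Sum>i<n. e2 \<kappa> i \<omega>) * exp (g \<kappa> (?c (\<tau> n)) t \<omega>) * exp (\<Sum>i<n. e3 0 i \<omega>)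
     = indicator A \<omega> * (exp (\<i> * of_real (\<kappa> * (w t \<omega> - w s \<omega> + R \<omega>))) * of_real (Y \<omega>)) * of_real (exp (\<kappa>\<^sup>2 * (t - s) / 2))" for \<kappa> \<omega>
  proof -
    have "Z2 \<omega> * exp (g \<kappa> s (?c (\<tau> 0)) \<omega>) * exp (\<Sum>i<n. e2 \<kappa> i \<omega>) * exp (g \<kappa> (?c (\<tau> n)) t \<omega>) * exp (\<Sum>i<n. e3 0 i \<omega>)
      = indicator A \<omega> * exp ((\<Sum>i<n. e1 0 i \<omega>) + g \<kappa> s (?c (\<tau> 0)) \<omega> + (\<Sum>i<n. e2 \<kappa> i \<omega>) + g \<kappa> (?c (\<tau> n)) t \<omega> + (\<Sum>i<n. e3 0 i \<omega>))"
      by (simp add: Z2_def Z1_def exp_add)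
    also have "\<dots> = indicator A \<omega> * (exp (\<i> * of_real (\<kappa> * (w t \<omega> - w s \<omega> + R \<omega>))) * of_real (Y \<omega>)) * of_real (exp (\<kappa>\<^sup>2 * (t - s) / 2))"
      unfolding expo unfolding exp_add exp_of_real Y_def by (simp only: mult_ac)
    finally show ?thesis .
  qed
  define X where "X \<kappa> \<omega> = indicator A \<omega> * (exp (\<i> * of_real (\<kappa> * (w t \<omega> - w s \<omega> + R \<omega>))) * of_real (Y \<omega>))" for \<kappa> \<omega>
  have X: "integrable M (X \<kappa>)" "(\<integral>\<omega>. X \<kappa> \<omega> \<partial>M) * of_real (exp (\<kappa>\<^sup>2 * (t - s) / 2)) = (\<integral>\<omega>. Z2 \<omega> \<partial>M)" for \<kappa>
  proof -
    have h: "integrable M (\<lambda>\<omega>. X \<kappa> \<omega> * of_real (exp (\<kappa>\<^sup>2 * (t - s) / 2)))" using main[of \<kappa>] unfolding prod X_def by blast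
    have "integrable M (\<lambda>\<omega>. X \<kappa> \<omega> * of_real (exp (\<kappa>\<^sup>2 * (t - s) / 2)) * of_real (exp (- (\<kappa>\<^sup>2 * (t - s) / 2))))"
      by (rule Bochner_Integration.integrable_mult_left) (rule h)
    then show "integrable M (X \<kappa>)"
      by (simp only: mult.assoc of_real_mult[symmetric] exp_add[symmetric]) simp
    show "(\<integral>\<omega>. X \<kappa> \<omega> \<partial>M) * of_real (exp (\<kappa>\<^sup>2 * (t - s) / 2)) = (\<integral>\<omega>. Z2 \<omega> \<partial>M)"
      using main[of \<kappa>] unfolding prod X_def by simp
  qed
  have X0: "X 0 \<omega> = of_real (indicator A \<omega> * Y \<omega>)" for \<omega> by (simp add: X_def indicator_def)
  have z2: "(\<integral>\<omega>. Z2 \<omega> \<partial>M) = of_real (\<integral>\<omega>. indicator A \<omega> * Y \<omega> \<partial>M)"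
  proof -
    have "(\<integral>\<omega>. X 0 \<omega> \<partial>M) = of_real (\<integral>\<omega>. indicator A \<omega> * Y \<omega> \<partial>M)"
      unfolding X0 by (rule integral_complex_of_real)
    then show ?thesis using X(2)[of 0] by simp
  qed
  show "integrable M (\<lambda>\<omega>. indicator A \<omega> * (exp (\<i> * of_real (\<kappa> * (w t \<omega> - w s \<omega> + R \<omega>))) * of_real (Y \<omega>)))"
    using X(1)[of \<kappa>] unfolding X_def .
  show "(\<integral>\<omega>. indicator A \<omega> * (exp (\<i> * of_real (\<kappa> * (w t \<omega> - w s \<omega> + R \<omega>))) * of_real (Y \<omega>)) \<partial>M)
     = exp (- of_real (\<kappa>\<^sup>2 * (t - s) / 2)) * of_real (\<integral>\<omega>. indicator A \<omega> * Y \<omega> \<partial>M)"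
  proof -
    let ?q = "\<kappa>\<^sup>2 * (t - s) / 2"
    have "exp (- of_real ?q) * of_real (\<integral>\<omega>. indicator A \<omega> * Y \<omega> \<partial>M)
        = (\<integral>\<omega>. X \<kappa> \<omega> \<partial>M) * (of_real (exp ?q) * exp (- of_real ?q))"
      unfolding z2[symmetric] X(2)[of \<kappa>, symmetric] by (simp only: mult_ac)
    also have "of_real (exp ?q) * exp (- of_real ?q) = (1::complex)"
      unfolding exp_of_real[symmetric] by (rule exp_minus_inverse)
    finally show ?thesis unfolding X_def by simp
  qed
  assume As: "A = space M"
  have "X 0 \<omega> = of_real (Y \<omega>)" if "\<omega> \<in> space M" for \<omega> using that As by (simp add: X0)
  then have "integrable M (\<lambda>\<omega>. complex_of_real (Y \<omega>))"
    using X(1)[of 0] by (simp cong: Bochner_Integration.integrable_cong)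
  then show "integrable M Y" by (simp add: complex_of_real_integrable_eq)
  have "(\<integral>\<omega>. Z2 \<omega> \<partial>M) = (\<integral>\<omega>. Z1 \<omega> \<partial>M)"
    by (intro Bochner_Integration.integral_cong refl) (simp add: Z2_def As)
  also have "\<dots> = 1" using Z1 by (simp add: prob_space)
  finally have "(\<integral>\<omega>. indicator A \<omega> * Y \<omega> \<partial>M) = 1" using z2 by simp
  also have "(\<integral>\<omega>. indicator A \<omega> * Y \<omega> \<partial>M) = (\<integral>\<omega>. Y \<omega> \<partial>M)"
    by (intro Bochner_Integration.integral_cong refl) (simp add: As)
  finally show "(\<integral>\<omega>. Y \<omega> \<partial>M) = 1" .
qed

end

section \<open>Girsanov's theorem for a deterministic drift\<close>

text \<open>
  Convergence in mean gives almost sure convergence along a subsequence; the finitely many terms with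
  possibly infinite integral are skipped first.
\<close>

lemma nn_integral_tendsto_0_AE_subseq:
  fixes V :: "nat \<Rightarrow> 'a \<Rightarrow> ennreal"
  assumes V[measurable]: "\<And>k. V k \<in> borel_measurable M" and lim: "(\<lambda>k. \<integral>\<^sup>+x. V k x \<partial>M) \<longlonglongrightarrow> 0"
  shows "\<exists>\<sigma>. strict_mono \<sigma> \<and> (AE x in M. (\<lambda>j. V (\<sigma> j) x) \<longlonglongrightarrow> 0)"
proof -
  have "\<forall>\<^sub>F k in sequentially. (\<integral>\<^sup>+x. V k x \<partial>M) < 1" using lim by (intro order_tendstoD(2)) auto
  then obtain k0 where k0: "\<And>k. k \<ge> k0 \<Longrightarrow> (\<integral>\<^sup>+x. V k x \<partial>M) < 1" by (auto simp: eventually_sequentially)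
  define u where "u k x = enn2real (V (k + k0) x)" for k x
  have [measurable]: "u k \<in> borel_measurable M" for k unfolding u_def by measurable
  have fin: "(\<integral>\<^sup>+x. V (k + k0) x \<partial>M) < \<infinity>" for k using k0[of "k + k0"] by (simp add: less_top[symmetric]) (metis not_less top_greatest ennreal_one_less_top order_less_trans)
  have AEu: "AE x in M. ennreal (u k x) = V (k + k0) x" for k
    using nn_integral_PInf_AE[OF V, of "k + k0"] fin[of k]
    by (auto simp: u_def less_top elim!: eventually_mono)
  have nn: "(\<integral>\<^sup>+x. ennreal (u k x) \<partial>M) = (\<integral>\<^sup>+x. V (k + k0) x \<partial>M)" for k
    by (intro nn_integral_cong_AE AEu)
  have u0: "0 \<le> u k x" for k x by (simp add: u_def)
  have int: "integrable M (u k)" for k using fin[of k] nn[of k] u0 by (intro integrableI_nonneg) auto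
  have eq: "(\<integral>x. norm (u k x) \<partial>M) = enn2real (\<integral>\<^sup>+x. V (k + k0) x \<partial>M)" for k
    using u0 nn[of k] by (subst integral_eq_nn_integral) auto
  have "(\<lambda>k. \<integral>\<^sup>+x. V (k + k0) x \<partial>M) \<longlonglongrightarrow> ennreal 0"
    using LIMSEQ_ignore_initial_segment[OF lim, of k0] by simp
  then have "(\<lambda>k. enn2real (\<integral>\<^sup>+x. V (k + k0) x \<partial>M)) \<longlonglongrightarrow> 0"
    by (rule tendsto_enn2real) simp
  then have "(\<lambda>k. \<integral>x. norm (u k x) \<partial>M) \<longlonglongrightarrow> 0" unfolding eq by simp
  from tendsto_L1_AE_subseq[OF int this] obtain \<sigma> where \<sigma>: "strict_mono \<sigma>" "AE x in M. (\<lambda>n. u (\<sigma> n) x) \<longlonglongrightarrow> 0" by auto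
  have "AE x in M. \<forall>k. ennreal (u k x) = V (k + k0) x" unfolding AE_all_countable using AEu by simp
  with \<sigma>(2) have "AE x in M. (\<lambda>j. V (\<sigma> j + k0) x) \<longlonglongrightarrow> 0"
  proof eventually_elim
    case (elim x)
    have "(\<lambda>j. ennreal (u (\<sigma> j) x)) \<longlonglongrightarrow> ennreal 0" by (intro tendsto_ennrealI elim)
    then show ?case using elim(2) by simp
  qed
  moreover have "strict_mono (\<lambda>j. \<sigma> j + k0)" using \<sigma>(1) by (simp add: strict_mono_def)
  ultimately show ?thesis by (intro exI[of _ "\<lambda>j. \<sigma> j + k0"]) simp
qed

text \<open>
  Both statements compare integrands whose difference is at most \<open>\<delta> K + (1 + 1 / \<delta>) (f k - r)\<^sup>2\<close> for
  every \<open>\<delta>\<close>, where \<open>K\<close> is integrable: \<open>K = r\<^sup>2\<close> for the squares and \<open>K = 1\<close> for the functions.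
\<close>

lemma L2_convergence_imp_integrals:
  fixes f :: "nat \<Rightarrow> 'a \<Rightarrow> real"
  assumes M: "finite_measure M" and r[measurable]: "r \<in> borel_measurable M" and r2: "integrable M (\<lambda>x. (r x)\<^sup>2)"
    and f[measurable]: "\<And>k. f k \<in> borel_measurable M" and f2: "\<And>k. integrable M (\<lambda>x. (f k x)\<^sup>2)"
    and lim: "(\<lambda>k. \<integral>x. (f k x - r x)\<^sup>2 \<partial>M) \<longlonglongrightarrow> 0"
  shows "(\<lambda>k. \<integral>x. (f k x)\<^sup>2 \<partial>M) \<longlonglongrightarrow> (\<integral>x. (r x)\<^sup>2 \<partial>M)"
    and "B \<in> sets M \<Longrightarrow> (\<lambda>k. \<integral>x. indicator B x * f k x \<partial>M) \<longlonglongrightarrow> (\<integral>x. indicator B x * r x \<partial>M)"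
proof -
  interpret finite_measure M by fact
  let ?d = "\<lambda>k. \<integral>x. (f k x - r x)\<^sup>2 \<partial>M"
  have ri: "integrable M r" by (rule square_integrable_imp_integrable[OF r r2])
  have fi: "integrable M (f k)" for k by (rule square_integrable_imp_integrable[OF f f2])
  have d2: "integrable M (\<lambda>x. (f k x - r x)\<^sup>2)" for k
  proof (rule Bochner_Integration.integrable_bound)
    show "integrable M (\<lambda>x. 2 * (f k x)\<^sup>2 + 2 * (r x)\<^sup>2)" using f2 r2 by auto
    have "(f k x - r x)\<^sup>2 \<le> 2 * (f k x)\<^sup>2 + 2 * (r x)\<^sup>2" for x
      using zero_le_power2[of "f k x + r x"] by (simp add: power2_eq_square algebra_simps)
    then show "AE x in M. norm ((f k x - r x)\<^sup>2) \<le> norm (2 * (f k x)\<^sup>2 + 2 * (r x)\<^sup>2)" by (intro AE_I2) simp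
  qed simp
  have key: "(\<lambda>k. \<integral>x. g k x \<partial>M) \<longlonglongrightarrow> (\<integral>x. h x \<partial>M)"
    if g: "\<And>k. integrable M (g k)" "integrable M h" and K: "integrable M K" "\<And>x. K x \<ge> (0::real)"
      and le: "\<And>k x \<delta>. \<delta> > 0 \<Longrightarrow> \<bar>g k x - h x\<bar> \<le> \<delta> * K x + (1 + 1 / \<delta>) * (f k x - r x)\<^sup>2"
    for g :: "nat \<Rightarrow> 'a \<Rightarrow> real" and h K
  proof (rule LIMSEQ_I)
    fix e :: real assume e: "e > 0"
    define \<delta> where "\<delta> = e / (2 * ((\<integral>x. K x \<partial>M) + 1))"
    have K0: "(\<integral>x. K x \<partial>M) \<ge> 0" using K(2) by simp
    have \<delta>: "\<delta> > 0" "\<delta> * (\<integral>x. K x \<partial>M) < e / 2"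
    proof -
      show "\<delta> > 0" unfolding \<delta>_def using e K0 by simp
      then have "\<delta> * (\<integral>x. K x \<partial>M) < \<delta> * ((\<integral>x. K x \<partial>M) + 1)" by simp
      also have "\<dots> = e / 2" unfolding \<delta>_def using K0 by (simp add: field_simps)
      finally show "\<delta> * (\<integral>x. K x \<partial>M) < e / 2" .
    qed
    have "(\<lambda>k. (1 + 1 / \<delta>) * ?d k) \<longlonglongrightarrow> (1 + 1 / \<delta>) * 0" by (intro tendsto_mult tendsto_const lim)
    then have "\<forall>\<^sub>F k in sequentially. (1 + 1 / \<delta>) * ?d k < e / 2" using e by (intro order_tendstoD(2)) auto
    then obtain k0 where k0: "\<And>k. k \<ge> k0 \<Longrightarrow> (1 + 1 / \<delta>) * ?d k < e / 2" by (auto simp: eventually_sequentially)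
    have "norm ((\<integral>x. g k x \<partial>M) - (\<integral>x. h x \<partial>M)) < e" if "k \<ge> k0" for k
    proof -
      have "\<bar>\<integral>x. g k x - h x \<partial>M\<bar> \<le> (\<integral>x. \<bar>g k x - h x\<bar> \<partial>M)" using integral_norm_bound[of M "\<lambda>x. g k x - h x"] by simp
      also have "\<dots> \<le> (\<integral>x. \<delta> * K x + (1 + 1 / \<delta>) * (f k x - r x)\<^sup>2 \<partial>M)"
        using g K d2 le[OF \<delta>(1)] by (intro integral_mono) auto
      also have "\<dots> = \<delta> * (\<integral>x. K x \<partial>M) + (1 + 1 / \<delta>) * ?d k"
        using K d2 by (subst Bochner_Integration.integral_add) auto
      also have "\<dots> < e" using \<delta>(2) k0[OF that] by linarith
      finally show ?thesis using g by simp
    qed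
    then show "\<exists>no. \<forall>k\<ge>no. norm ((\<integral>x. g k x \<partial>M) - (\<integral>x. h x \<partial>M)) < e" by blast
  qed
  have sq: "2 * \<bar>a\<bar> * \<bar>b\<bar> \<le> \<delta> * a\<^sup>2 + (1 / \<delta>) * b\<^sup>2" if "\<delta> > 0" for a b \<delta> :: real
  proof -
    have "0 \<le> (sqrt \<delta> * \<bar>a\<bar> - \<bar>b\<bar> / sqrt \<delta>)\<^sup>2" by simp
    also have "\<dots> = \<delta> * a\<^sup>2 + (1 / \<delta>) * b\<^sup>2 - 2 * \<bar>a\<bar> * \<bar>b\<bar>"
      using that by (simp add: power2_diff power_mult_distrib power_divide)
    finally show ?thesis by simp
  qed
  show "(\<lambda>k. \<integral>x. (f k x)\<^sup>2 \<partial>M) \<longlonglongrightarrow> (\<integral>x. (r x)\<^sup>2 \<partial>M)"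
  proof (rule key[OF f2 r2 r2])
    fix k x and \<delta> :: real assume d: "\<delta> > 0"
    have "(f k x)\<^sup>2 - (r x)\<^sup>2 = (f k x - r x)\<^sup>2 + 2 * r x * (f k x - r x)" by (simp add: power2_eq_square algebra_simps)
    then have "\<bar>(f k x)\<^sup>2 - (r x)\<^sup>2\<bar> \<le> (f k x - r x)\<^sup>2 + 2 * \<bar>r x\<bar> * \<bar>f k x - r x\<bar>"
      using abs_triangle_ineq[of "(f k x - r x)\<^sup>2" "2 * r x * (f k x - r x)"] by (simp add: abs_mult)
    also have "\<dots> \<le> \<delta> * (r x)\<^sup>2 + (1 + 1 / \<delta>) * (f k x - r x)\<^sup>2"
      using sq[OF d, of "r x" "f k x - r x"] by (simp add: distrib_right)
    finally show "\<bar>(f k x)\<^sup>2 - (r x)\<^sup>2\<bar> \<le> \<delta> * (r x)\<^sup>2 + (1 + 1 / \<delta>) * (f k x - r x)\<^sup>2" .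
  qed simp
  assume B: "B \<in> sets M"
  show "(\<lambda>k. \<integral>x. indicator B x * f k x \<partial>M) \<longlonglongrightarrow> (\<integral>x. indicator B x * r x \<partial>M)"
  proof (rule key[where K = "\<lambda>_. 1"])
    show "integrable M (\<lambda>x. indicator B x * f k x)" for k using integrable_mult_indicator[OF B fi[of k]] by simp
    show "integrable M (\<lambda>x. indicator B x * r x)" using integrable_mult_indicator[OF B ri] by simp
    fix k x and \<delta> :: real assume d: "\<delta> > 0"
    have "\<bar>indicator B x * f k x - indicator B x * r x\<bar> \<le> \<bar>f k x - r x\<bar>" by (simp add: indicator_def)
    also have "\<dots> \<le> 2 * \<bar>1\<bar> * \<bar>f k x - r x\<bar>" by simp
    also have "\<dots> \<le> \<delta> * 1 + (1 / \<delta>) * (f k x - r x)\<^sup>2" using sq[OF d, of 1 "f k x - r x"] by simp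
    also have "\<dots> \<le> \<delta> * 1 + (1 + 1 / \<delta>) * (f k x - r x)\<^sup>2" by (simp add: distrib_right)
    finally show "\<bar>indicator B x * f k x - indicator B x * r x\<bar> \<le> \<delta> * 1 + (1 + 1 / \<delta>) * (f k x - r x)\<^sup>2" .
  qed auto
qed

lemma finite_lebesgue_on: "finite_measure (lebesgue_on {a..b::real})"
  by (rule finite_measureI) (simp add: emeasure_restrict_space space_restrict_space emeasure_lborel_Icc_eq)

lemma measure_lebesgue_on_interval:
  assumes "0 \<le> a" "a \<le> b" "b \<le> T"
  shows "{a<..b} \<in> sets (lebesgue_on {0..T})" "measure (lebesgue_on {0..T}) {a<..b} = b - a"
proof -
  have sub: "{a<..b} \<subseteq> {0..T}" using assms by auto
  show "{a<..b} \<in> sets (lebesgue_on {0..T})" using sub by (simp add: sets_restrict_space_iff)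
  show "measure (lebesgue_on {0..T}) {a<..b} = b - a" using sub assms by (simp add: measure_restrict_space)
qed

lemma elementary_integrals:
  fixes a :: "nat \<Rightarrow> real"
  assumes \<tau>: "\<And>i. i \<le> n \<Longrightarrow> 0 \<le> \<tau> i \<and> \<tau> i \<le> T" "\<And>i. i < n \<Longrightarrow> \<tau> i \<le> \<tau> (Suc i)"
  defines "L \<equiv> lebesgue_on {0..T}"
  defines "e \<equiv> (\<lambda>s. \<Sum>i<n. a i * indicator {\<tau> i<..\<tau> (Suc i)} s)"
  shows "e \<in> borel_measurable L" "integrable L (\<lambda>s. (e s)\<^sup>2)"
    "(\<integral>s. (e s)\<^sup>2 \<partial>L) = (\<Sum>i<n. (a i)\<^sup>2 * (\<tau> (Suc i) - \<tau> i))"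
    "0 \<le> s \<Longrightarrow> s \<le> t \<Longrightarrow> t \<le> T \<Longrightarrow> (\<integral>x. indicator {s<..t} x * e x \<partial>L) = (\<Sum>i<n. a i * (max s (min (\<tau> (Suc i)) t) - max s (min (\<tau> i) t)))"
proof -
  interpret finite_measure L unfolding L_def by (rule finite_lebesgue_on)
  have mono: "\<tau> i \<le> \<tau> j" if "i \<le> j" "j \<le> n" for i j
    using that by (induction j rule: dec_induct) (use \<tau>(2) in \<open>auto intro: order_trans\<close>)
  have I: "{\<tau> i<..\<tau> (Suc i)} \<in> sets L" "measure L {\<tau> i<..\<tau> (Suc i)} = \<tau> (Suc i) - \<tau> i" if "i < n" for i
    unfolding L_def using measure_lebesgue_on_interval[of "\<tau> i" "\<tau> (Suc i)" T] \<tau>(1)[of i] \<tau>(1)[of "Suc i"] \<tau>(2)[of i] that by auto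
  have II: "integrable L (\<lambda>s. indicator {\<tau> i<..\<tau> (Suc i)} s :: real)" if "i < n" for i
    using I[OF that] by (auto simp: less_top[symmetric])
  show "e \<in> borel_measurable L" unfolding e_def using I(1) by (intro borel_measurable_sum borel_measurable_times borel_measurable_indicator) auto
  have sq: "(e s)\<^sup>2 = (\<Sum>i<n. (a i)\<^sup>2 * indicator {\<tau> i<..\<tau> (Suc i)} s)" for s
  proof (cases "\<exists>i<n. s \<in> {\<tau> i<..\<tau> (Suc i)}")
    case True
    then obtain i where i: "i < n" "s \<in> {\<tau> i<..\<tau> (Suc i)}" by blast
    have other: "s \<notin> {\<tau> j<..\<tau> (Suc j)}" if "j < n" "j \<noteq> i" for j
    proof (cases "j < i")
      case True
      then have "\<tau> (Suc j) \<le> \<tau> i" using i by (intro mono) auto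
      then show ?thesis using i by auto
    next
      case False
      then have "\<tau> (Suc i) \<le> \<tau> j" using that by (intro mono) auto
      then show ?thesis using i by auto
    qed
    have *: "(\<Sum>j<n. c j * indicator {\<tau> j<..\<tau> (Suc j)} s) = (c i :: real)" for c
    proof -
      have "(\<Sum>j<n. c j * indicator {\<tau> j<..\<tau> (Suc j)} s) = (\<Sum>j<n. if j = i then c i else 0)"
        using other i by (intro sum.cong) (auto simp: indicator_def)
      then show ?thesis using i by simp
    qed
    show ?thesis unfolding e_def * ..
  next
    case False
    then have "(\<Sum>j<n. c j * indicator {\<tau> j<..\<tau> (Suc j)} s) = (0 :: real)" for c
      by (intro sum.neutral) (auto simp: indicator_def)
    then show ?thesis unfolding e_def by simp
  qed
  show "integrable L (\<lambda>s. (e s)\<^sup>2)" unfolding sq using II by (intro Bochner_Integration.integrable_sum integrable_mult_right) auto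
  show "(\<integral>s. (e s)\<^sup>2 \<partial>L) = (\<Sum>i<n. (a i)\<^sup>2 * (\<tau> (Suc i) - \<tau> i))"
    unfolding sq using II I by (subst Bochner_Integration.integral_sum) (auto intro!: sum.cong)
  assume st: "0 \<le> s" "s \<le> t" "t \<le> T"
  have J: "integrable L (\<lambda>x. indicator {s<..t} x * (a i * indicator {\<tau> i<..\<tau> (Suc i)} x))"
    "(\<integral>x. indicator {s<..t} x * (a i * indicator {\<tau> i<..\<tau> (Suc i)} x) \<partial>L) = a i * (max s (min (\<tau> (Suc i)) t) - max s (min (\<tau> i) t))" if "i < n" for i
  proof -
    let ?p = "max s (min (\<tau> i) t)" and ?q = "max s (min (\<tau> (Suc i)) t)"
    have eq: "indicator {s<..t} x * (a i * indicator {\<tau> i<..\<tau> (Suc i)} x) = a i * indicator {?p<..?q} x" for x :: real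
      using st by (auto simp: indicator_def min_def max_def)
    have pq: "0 \<le> ?p" "?p \<le> ?q" "?q \<le> T" using st \<tau>(2)[OF that] by auto
    note m = measure_lebesgue_on_interval[OF pq, folded L_def]
    show "integrable L (\<lambda>x. indicator {s<..t} x * (a i * indicator {\<tau> i<..\<tau> (Suc i)} x))"
      unfolding eq using m(1) by (auto simp: less_top[symmetric])
    show "(\<integral>x. indicator {s<..t} x * (a i * indicator {\<tau> i<..\<tau> (Suc i)} x) \<partial>L) = a i * (?q - ?p)"
      unfolding eq using m by simp
  qed
  show "(\<integral>x. indicator {s<..t} x * e x \<partial>L) = (\<Sum>i<n. a i * (max s (min (\<tau> (Suc i)) t) - max s (min (\<tau> i) t)))"
    unfolding e_def sum_distrib_left using J by (subst Bochner_Integration.integral_sum) auto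
qed

lemma ennreal_tendsto_0_imp_real:
  assumes "((\<lambda>n. ennreal (a n)) \<longlongrightarrow> 0) G" "\<And>n. 0 \<le> a n"
  shows "(a \<longlongrightarrow> 0) G"
proof -
  have "((\<lambda>n. enn2real (ennreal (a n))) \<longlongrightarrow> 0) G"
    by (rule tendsto_enn2real) (use assms(1) in auto)
  then show ?thesis using assms(2) by simp
qed

lemma char_centered_normal:
  assumes "\<sigma> > 0"
  shows "char (density lborel (\<lambda>x. ennreal (normal_density 0 \<sigma> x))) \<kappa> = of_real (exp (- (\<kappa>\<^sup>2 * \<sigma>\<^sup>2 / 2)))"
proof -
  let ?D = "density lborel (\<lambda>x. ennreal (normal_density 0 \<sigma> x))" and ?q = "\<kappa>\<^sup>2 * \<sigma>\<^sup>2 / 2"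
  have eq: "exp ((\<i> * of_real \<kappa> - of_real 0) * of_real x - (\<i> * of_real \<kappa> - of_real 0)\<^sup>2 * of_real (\<sigma>\<^sup>2) / 2)
    = iexp (\<kappa> * x) * of_real (exp ?q)" for x
  proof -
    have "(\<i> * of_real \<kappa> - of_real 0) * of_real x - (\<i> * of_real \<kappa> - of_real 0)\<^sup>2 * of_real (\<sigma>\<^sup>2) / 2
      = \<i> * of_real (\<kappa> * x) + of_real ?q" by (simp add: complex_eq_iff power2_eq_square)
    then show ?thesis by (simp only: exp_add exp_of_real)
  qed
  have "char ?D \<kappa> * of_real (exp ?q) = (\<integral>x. iexp (\<kappa> * x) * of_real (exp ?q) \<partial>?D)"
    unfolding char_def by simp
  also have "\<dots> = 1" using exp_gaussian_integral(1)[OF assms, of \<kappa> 0] unfolding eq .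
  finally have "char ?D \<kappa> * of_real (exp ?q) * of_real (exp (- ?q)) = of_real (exp (- ?q))" by simp
  moreover have "of_real (exp ?q) * of_real (exp (- ?q)) = (1::complex)"
    by (simp flip: of_real_mult exp_add)
  ultimately show ?thesis by (simp only: mult.assoc mult_1_right)
qed

context brownian begin

text \<open>
  The identity for elementary integrands passes to the limit: along a subsequence the densities
  converge almost surely, and since all integrals equal one they converge in mean by the lemma of
  Scheffe; the characters are bounded and converge almost surely.
\<close>

lemma girsanov_characteristic:
  fixes r :: "real \<Rightarrow> real" and J y :: "'w \<Rightarrow> real"
  assumes r: "square_integrable (lebesgue_on {0..T}) r"
    and J: "is_ito_integral M F w T (\<lambda>s \<omega>. r s) J"
    and y: "\<And>\<omega>. \<omega> \<in> space M \<Longrightarrow> y \<omega> = exp (- (1/2) * (\<integral>s. (r s)\<^sup>2 \<partial>lebesgue_on {0..T}) - J \<omega>)"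
    and yi: "integrable M y" "(\<integral>\<omega>. y \<omega> \<partial>M) = 1"
    and st: "0 \<le> s" "s \<le> t" "t \<le> T" and A: "A \<in> sets (F s)"
  defines "\<rho> \<equiv> \<integral>x. indicator {s<..t} x * r x \<partial>lebesgue_on {0..T}"
  shows "(\<integral>\<omega>. indicator A \<omega> * (exp (\<i> * of_real (\<kappa> * (w t \<omega> - w s \<omega> + \<rho>))) * of_real (y \<omega>)) \<partial>M)
     = exp (- of_real (\<kappa>\<^sup>2 * (t - s) / 2)) * of_real (\<integral>\<omega>. indicator A \<omega> * y \<omega> \<partial>M)"
proof -
  let ?L = "lebesgue_on {0..T}"
  interpret L: finite_measure ?L by (rule finite_lebesgue_on)
  interpret LM: pair_sigma_finite ?L M by unfold_locales
  have r1[measurable]: "r \<in> borel_measurable ?L" and r2: "integrable ?L (\<lambda>x. (r x)\<^sup>2)"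
    using r by (auto simp: square_integrable_def)
  have [measurable]: "J \<in> borel_measurable M" using J by (simp add: is_ito_integral_def)
  from J[unfolded is_ito_integral_def] obtain n \<tau> \<xi> where
    el: "\<forall>k. elementary_data F T (n k) (\<tau> k) (\<xi> k)"
    and lim1: "(\<lambda>k. \<integral>\<^sup>+ (s, \<omega>). ennreal ((elementary_process (n k) (\<tau> k) (\<xi> k) s \<omega> - r s)\<^sup>2) \<partial>(?L \<Otimes>\<^sub>M M)) \<longlonglongrightarrow> 0"
    and lim2: "(\<lambda>k. \<integral>\<^sup>+ \<omega>. ennreal ((elementary_ito_integral w (n k) (\<tau> k) (\<xi> k) \<omega> - J \<omega>)\<^sup>2) \<partial>M) \<longlonglongrightarrow> 0"
    by (elim conjE exE)
  let ?e = "\<lambda>k. elementary_process (n k) (\<tau> k) (\<xi> k)" and ?I = "\<lambda>k. elementary_ito_integral w (n k) (\<tau> k) (\<xi> k)"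
  have \<tau>: "0 \<le> \<tau> k i \<and> \<tau> k i \<le> T" if "i \<le> n k" for i k using el that by (auto simp: elementary_data_def)
  have mono: "\<tau> k i \<le> \<tau> k (Suc i)" if "i < n k" for i k using el that by (auto simp: elementary_data_def)
  have \<xi>m: "\<xi> k i \<in> borel_measurable M" if "i < n k" for i k
  proof (rule measurable_from_subalg)
    show "\<xi> k i \<in> borel_measurable (F (\<tau> k i))" using el that by (auto simp: elementary_data_def)
    show "subalgebra M (F (\<tau> k i))" using \<tau>[of i k] that by (intro filtration) auto
  qed
  have Im[measurable]: "?I k \<in> borel_measurable M" for k
    unfolding elementary_ito_integral_def
    by (intro borel_measurable_sum borel_measurable_times borel_measurable_diff \<xi>m random_variable_w)
       (use \<tau> in \<open>auto simp: Suc_le_eq\<close>)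
  have em[measurable]: "(\<lambda>z. ?e k (fst z) (snd z)) \<in> borel_measurable (?L \<Otimes>\<^sub>M M)" for k
    unfolding elementary_process_def
  proof (intro borel_measurable_sum borel_measurable_times)
    fix i assume "i \<in> {..<n k}"
    then have i: "i < n k" by simp
    show "(\<lambda>z. \<xi> k i (snd z)) \<in> borel_measurable (?L \<Otimes>\<^sub>M M)"
      using \<xi>m[OF i] by (rule measurable_compose[OF measurable_snd])
    have "{\<tau> k i<..\<tau> k (Suc i)} \<in> sets ?L"
      using i \<tau>[of i k] \<tau>[of "Suc i" k] mono[OF i] by (intro measure_lebesgue_on_interval(1)) auto
    then show "(\<lambda>z. indicator {\<tau> k i<..\<tau> k (Suc i)} (fst z) :: real) \<in> borel_measurable (?L \<Otimes>\<^sub>M M)"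
      by (intro measurable_compose[OF measurable_fst] borel_measurable_indicator)
  qed
  \<comment> \<open>Both approximation errors are added, so that one subsequence serves for both.\<close>
  define V where "V k \<omega> = (\<integral>\<^sup>+s. ennreal ((?e k s \<omega> - r s)\<^sup>2) \<partial>?L) + ennreal ((?I k \<omega> - J \<omega>)\<^sup>2)" for k \<omega>
  have dm[measurable]: "(\<lambda>z. ennreal ((?e k (fst z) (snd z) - r (fst z))\<^sup>2)) \<in> borel_measurable (?L \<Otimes>\<^sub>M M)" for k
    by measurable
  have inner: "(\<lambda>\<omega>. \<integral>\<^sup>+s. ennreal ((?e k s \<omega> - r s)\<^sup>2) \<partial>?L) \<in> borel_measurable M" for k
  proof -
    have "(\<lambda>z. ennreal ((?e k (fst (prod.swap z)) (snd (prod.swap z)) - r (fst (prod.swap z)))\<^sup>2)) \<in> borel_measurable (M \<Otimes>\<^sub>M ?L)"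
      by (rule measurable_compose[OF _ dm]) (simp add: measurable_pair_swap prod.swap_def)
    then show ?thesis by (intro L.borel_measurable_nn_integral) (simp add: split_beta')
  qed
  have Vm: "V k \<in> borel_measurable M" for k
    unfolding V_def using inner[of k] by measurable
  have Vi: "(\<integral>\<^sup>+\<omega>. V k \<omega> \<partial>M) = (\<integral>\<^sup>+ (s, \<omega>). ennreal ((?e k s \<omega> - r s)\<^sup>2) \<partial>(?L \<Otimes>\<^sub>M M)) + (\<integral>\<^sup>+ \<omega>. ennreal ((?I k \<omega> - J \<omega>)\<^sup>2) \<partial>M)" for k
  proof -
    have "(\<integral>\<^sup>+\<omega>. V k \<omega> \<partial>M) = (\<integral>\<^sup>+\<omega>. (\<integral>\<^sup>+s. ennreal ((?e k s \<omega> - r s)\<^sup>2) \<partial>?L) \<partial>M) + (\<integral>\<^sup>+ \<omega>. ennreal ((?I k \<omega> - J \<omega>)\<^sup>2) \<partial>M)"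
      unfolding V_def using inner[of k] by (intro nn_integral_add) auto
    then show ?thesis using LM.nn_integral_snd[OF dm[of k]] by (simp add: split_beta')
  qed
  have "(\<lambda>k. \<integral>\<^sup>+\<omega>. V k \<omega> \<partial>M) \<longlonglongrightarrow> 0 + 0" unfolding Vi by (intro tendsto_add lim1 lim2)
  then have "(\<lambda>k. \<integral>\<^sup>+\<omega>. V k \<omega> \<partial>M) \<longlonglongrightarrow> 0" by simp
  from nn_integral_tendsto_0_AE_subseq[OF Vm this]
  obtain \<sigma> where V0: "AE \<omega> in M. (\<lambda>j. V (\<sigma> j) \<omega>) \<longlonglongrightarrow> 0" by auto
  define Y where "Y k \<omega> = exp (- ?I k \<omega> - (\<Sum>i<n k. (\<xi> k i \<omega>)\<^sup>2 * (\<tau> k (Suc i) - \<tau> k i)) / 2)" for k \<omega>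
  define R where "R k \<omega> = (\<Sum>i<n k. \<xi> k i \<omega> * (max s (min (\<tau> k (Suc i)) t) - max s (min (\<tau> k i) t)))" for k \<omega>
  have lims: "AE \<omega> in M. (\<lambda>j. Y (\<sigma> j) \<omega>) \<longlonglongrightarrow> y \<omega> \<and> (\<lambda>j. R (\<sigma> j) \<omega>) \<longlonglongrightarrow> \<rho>"
    using V0 AE_space
  proof eventually_elim
    case (elim \<omega>)
    have V1: "(\<lambda>j. \<integral>\<^sup>+s. ennreal ((?e (\<sigma> j) s \<omega> - r s)\<^sup>2) \<partial>?L) \<longlonglongrightarrow> 0"
      by (rule tendsto_sandwich[OF _ _ tendsto_const elim(1)]) (auto simp: V_def)
    have V2: "(\<lambda>j. ennreal ((?I (\<sigma> j) \<omega> - J \<omega>)\<^sup>2)) \<longlonglongrightarrow> 0"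
      by (rule tendsto_sandwich[OF _ _ tendsto_const elim(1)]) (auto simp: V_def)
    have "(\<lambda>j. (?I (\<sigma> j) \<omega> - J \<omega>)\<^sup>2) \<longlonglongrightarrow> 0" by (rule ennreal_tendsto_0_imp_real[OF V2]) simp
    then have "(\<lambda>j. sqrt ((?I (\<sigma> j) \<omega> - J \<omega>)\<^sup>2)) \<longlonglongrightarrow> sqrt 0" by (rule tendsto_real_sqrt)
    then have I: "(\<lambda>j. ?I (\<sigma> j) \<omega>) \<longlonglongrightarrow> J \<omega>" by (simp add: tendsto_rabs_zero_iff LIM_zero_iff)
    have ep: "?e k s \<omega> = (\<Sum>i<n k. \<xi> k i \<omega> * indicator {\<tau> k i<..\<tau> k (Suc i)} s)" for k s
      by (simp add: elementary_process_def)
    have E: "(\<lambda>s. ?e k s \<omega>) \<in> borel_measurable ?L" "integrable ?L (\<lambda>s. (?e k s \<omega>)\<^sup>2)"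
      "(\<integral>s. (?e k s \<omega>)\<^sup>2 \<partial>?L) = (\<Sum>i<n k. (\<xi> k i \<omega>)\<^sup>2 * (\<tau> k (Suc i) - \<tau> k i))"
      "(\<integral>x. indicator {s<..t} x * ?e k x \<omega> \<partial>?L) = R k \<omega>" for k
    proof -
      show "(\<lambda>s. ?e k s \<omega>) \<in> borel_measurable ?L"
        unfolding ep by (rule elementary_integrals(1)) (erule \<tau>, erule mono)
      show "integrable ?L (\<lambda>s. (?e k s \<omega>)\<^sup>2)"
        unfolding ep by (rule elementary_integrals(2)) (erule \<tau>, erule mono)
      show "(\<integral>s. (?e k s \<omega>)\<^sup>2 \<partial>?L) = (\<Sum>i<n k. (\<xi> k i \<omega>)\<^sup>2 * (\<tau> k (Suc i) - \<tau> k i))"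
        unfolding ep by (rule elementary_integrals(3)) (erule \<tau>, erule mono)
      show "(\<integral>x. indicator {s<..t} x * ?e k x \<omega> \<partial>?L) = R k \<omega>"
        unfolding ep R_def by (rule elementary_integrals(4)) (erule \<tau>, erule mono, rule st, rule st, rule st)
    qed
    have d2: "integrable ?L (\<lambda>s. (?e k s \<omega> - r s)\<^sup>2)" for k
    proof (rule Bochner_Integration.integrable_bound)
      show "integrable ?L (\<lambda>s. 2 * (?e k s \<omega>)\<^sup>2 + 2 * (r s)\<^sup>2)" using E(2)[of k] r2 by auto
      have "(a - b)\<^sup>2 \<le> 2 * a\<^sup>2 + 2 * b\<^sup>2" for a b :: real
        using zero_le_power2[of "a + b"] by (simp add: power2_eq_square algebra_simps)
      then show "AE s in ?L. norm ((?e k s \<omega> - r s)\<^sup>2) \<le> norm (2 * (?e k s \<omega>)\<^sup>2 + 2 * (r s)\<^sup>2)" by (intro AE_I2) simp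
      show "(\<lambda>s. (?e k s \<omega> - r s)\<^sup>2) \<in> borel_measurable ?L"
        by (intro borel_measurable_power borel_measurable_diff E(1) r1)
    qed
    have "(\<lambda>j. ennreal (\<integral>s. (?e (\<sigma> j) s \<omega> - r s)\<^sup>2 \<partial>?L)) \<longlonglongrightarrow> 0"
      using V1 nn_integral_eq_integral[OF d2] by simp
    then have "(\<lambda>j. \<integral>s. (?e (\<sigma> j) s \<omega> - r s)\<^sup>2 \<partial>?L) \<longlonglongrightarrow> 0"
      by (rule ennreal_tendsto_0_imp_real) simp
    note conv = L2_convergence_imp_integrals[OF L.finite_measure_axioms r1 r2 E(1) E(2) this]
    have "(\<lambda>j. \<Sum>i<n (\<sigma> j). (\<xi> (\<sigma> j) i \<omega>)\<^sup>2 * (\<tau> (\<sigma> j) (Suc i) - \<tau> (\<sigma> j) i)) \<longlonglongrightarrow> (\<integral>s. (r s)\<^sup>2 \<partial>?L)"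
      using conv(1) unfolding E(3) .
    then have "(\<lambda>j. Y (\<sigma> j) \<omega>) \<longlonglongrightarrow> exp (- J \<omega> - (\<integral>s. (r s)\<^sup>2 \<partial>?L) / 2)"
      unfolding Y_def by (intro tendsto_intros I) auto
    also have "exp (- J \<omega> - (\<integral>s. (r s)\<^sup>2 \<partial>?L) / 2) = y \<omega>" using y[OF elim(2)] by simp
    finally have "(\<lambda>j. Y (\<sigma> j) \<omega>) \<longlonglongrightarrow> y \<omega>" .
    moreover have B: "{s<..t} \<in> sets ?L" using st by (intro measure_lebesgue_on_interval(1)) auto
    have "(\<lambda>j. R (\<sigma> j) \<omega>) \<longlonglongrightarrow> \<rho>"
      using conv(2)[OF B] unfolding E(4) \<rho>_def .
    ultimately show ?case by simp
  qed
  have F0: "space M \<in> sets (F s)"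
  proof -
    have "space (F s) = space M" using filtration[of s] st by (simp add: subalgebra_def)
    then show ?thesis using sets.top[of "F s"] by simp
  qed
  have Y: "integrable M (Y k)" "(\<integral>\<omega>. Y k \<omega> \<partial>M) = 1" for k
    unfolding Y_def[abs_def]
    using exponential_martingale_elementary(1,2)[OF st el[rule_format, of k] F0] by simp_all
  have X: "(\<integral>\<omega>. indicator A \<omega> * (exp (\<i> * of_real (\<kappa> * (w t \<omega> - w s \<omega> + R k \<omega>))) * of_real (Y k \<omega>)) \<partial>M)
     = exp (- of_real (\<kappa>\<^sup>2 * (t - s) / 2)) * of_real (\<integral>\<omega>. indicator A \<omega> * Y k \<omega> \<partial>M)"
    "integrable M (\<lambda>\<omega>. indicator A \<omega> * (exp (\<i> * of_real (\<kappa> * (w t \<omega> - w s \<omega> + R k \<omega>))) * of_real (Y k \<omega>)))" for k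
    unfolding Y_def R_def
    by (rule exponential_martingale_elementary(3,4)[OF st el[rule_format, of k] A])+
  have Ypos: "0 \<le> Y k \<omega>" for k \<omega> by (simp add: Y_def)
  have [measurable]: "Y k \<in> borel_measurable M" for k using Y(1) by simp
  have [measurable]: "y \<in> borel_measurable M" using yi(1) by simp
  have ypos: "AE \<omega> in M. 0 \<le> y \<omega>" using y by (intro AE_I2) simp
  have AM[measurable]: "A \<in> sets M" using A filtration[of s] st by (auto simp: subalgebra_def)
  have wm[measurable]: "w t \<in> borel_measurable M" "w s \<in> borel_measurable M" using st by (auto intro: random_variable_w)
  have Rm[measurable]: "R k \<in> borel_measurable M" for k
    unfolding R_def[abs_def] by (intro borel_measurable_sum borel_measurable_times \<xi>m) auto
  have nY: "(\<integral>\<^sup>+\<omega>. norm (Y k \<omega>) \<partial>M) = 1" for k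
    using nn_integral_eq_integral[OF Y(1)[of k]] Ypos Y(2)[of k] by simp
  have "(\<integral>\<^sup>+\<omega>. norm (y \<omega>) \<partial>M) = (\<integral>\<^sup>+\<omega>. y \<omega> \<partial>M)" using ypos by (intro nn_integral_cong_AE) auto
  also have "\<dots> = 1" using nn_integral_eq_integral[OF yi(1) ypos] yi(2) by simp
  finally have ny: "(\<integral>\<^sup>+\<omega>. norm (y \<omega>) \<partial>M) = 1" .
  have "(\<lambda>j. \<integral>\<^sup>+\<omega>. norm (Y (\<sigma> j) \<omega> - y \<omega>) \<partial>M) \<longlonglongrightarrow> 0"
    using lims by (intro Scheffe_lemma2 yi) (auto simp: nY[unfolded real_norm_def] ny[unfolded real_norm_def] elim: eventually_mono)
  then have "(\<lambda>j. ennreal (\<integral>\<omega>. norm (Y (\<sigma> j) \<omega> - y \<omega>) \<partial>M)) \<longlonglongrightarrow> 0"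
    using nn_integral_eq_integral[OF integrable_norm[OF Bochner_Integration.integrable_diff[OF Y(1) yi(1)]]] by simp
  then have L1: "(\<lambda>j. \<integral>\<omega>. norm (Y (\<sigma> j) \<omega> - y \<omega>) \<partial>M) \<longlonglongrightarrow> 0"
    by (rule ennreal_tendsto_0_imp_real) simp
  define c where "c k \<omega> = exp (\<i> * of_real (\<kappa> * (w t \<omega> - w s \<omega> + R k \<omega>)))" for k \<omega>
  define c' where "c' \<omega> = exp (\<i> * of_real (\<kappa> * (w t \<omega> - w s \<omega> + \<rho>)))" for \<omega>
  have [measurable]: "c k \<in> borel_measurable M" "c' \<in> borel_measurable M" for k
    unfolding c_def[abs_def] c'_def[abs_def] by measurable
  have nc: "norm (c k \<omega>) = 1" "norm (c' \<omega>) = 1" for k \<omega> unfolding c_def c'_def by (rule norm_exp_i_times)+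
  have cyi: "integrable M (\<lambda>\<omega>. indicator A \<omega> * (c k \<omega> * of_real (y \<omega>)))" for k
    by (rule Bochner_Integration.integrable_bound[OF yi(1)]) (auto simp: norm_mult nc indicator_def intro!: AE_I2)
  \<comment> \<open>First the densities are exchanged, at a cost bounded by their distance in mean; then the
    characters, by dominated convergence.\<close>
  have 1: "(\<lambda>j. (\<integral>\<omega>. indicator A \<omega> * (c (\<sigma> j) \<omega> * of_real (Y (\<sigma> j) \<omega>)) \<partial>M) - (\<integral>\<omega>. indicator A \<omega> * (c (\<sigma> j) \<omega> * of_real (y \<omega>)) \<partial>M)) \<longlonglongrightarrow> 0"
  proof (rule Lim_null_comparison[OF _ L1], intro always_eventually allI)
    fix j
    have "(\<integral>\<omega>. indicator A \<omega> * (c (\<sigma> j) \<omega> * of_real (Y (\<sigma> j) \<omega>)) \<partial>M) - (\<integral>\<omega>. indicator A \<omega> * (c (\<sigma> j) \<omega> * of_real (y \<omega>)) \<partial>M)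
      = (\<integral>\<omega>. indicator A \<omega> * (c (\<sigma> j) \<omega> * of_real (Y (\<sigma> j) \<omega>)) - indicator A \<omega> * (c (\<sigma> j) \<omega> * of_real (y \<omega>)) \<partial>M)"
      using X(2)[of "\<sigma> j", folded c_def] cyi by simp
    also have "norm \<dots> \<le> (\<integral>\<omega>. norm (indicator A \<omega> * (c (\<sigma> j) \<omega> * of_real (Y (\<sigma> j) \<omega>)) - indicator A \<omega> * (c (\<sigma> j) \<omega> * of_real (y \<omega>))) \<partial>M)"
      by (rule integral_norm_bound)
    also have "\<dots> \<le> (\<integral>\<omega>. norm (Y (\<sigma> j) \<omega> - y \<omega>) \<partial>M)"
    proof (rule integral_mono)
      show "integrable M (\<lambda>\<omega>. norm (indicator A \<omega> * (c (\<sigma> j) \<omega> * of_real (Y (\<sigma> j) \<omega>)) - indicator A \<omega> * (c (\<sigma> j) \<omega> * of_real (y \<omega>))))"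
        using X(2)[of "\<sigma> j", folded c_def] cyi by auto
      show "integrable M (\<lambda>\<omega>. norm (Y (\<sigma> j) \<omega> - y \<omega>))" using Y yi by auto
      fix \<omega>
      have "indicator A \<omega> * (c (\<sigma> j) \<omega> * of_real (Y (\<sigma> j) \<omega>)) - indicator A \<omega> * (c (\<sigma> j) \<omega> * of_real (y \<omega>))
        = indicator A \<omega> * (c (\<sigma> j) \<omega> * of_real (Y (\<sigma> j) \<omega> - y \<omega>))" by (simp add: algebra_simps)
      then show "norm (indicator A \<omega> * (c (\<sigma> j) \<omega> * of_real (Y (\<sigma> j) \<omega>)) - indicator A \<omega> * (c (\<sigma> j) \<omega> * of_real (y \<omega>))) \<le> norm (Y (\<sigma> j) \<omega> - y \<omega>)"
        by (simp only: norm_mult nc norm_of_real) (simp add: indicator_def)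
    qed
    finally show "norm ((\<integral>\<omega>. indicator A \<omega> * (c (\<sigma> j) \<omega> * of_real (Y (\<sigma> j) \<omega>)) \<partial>M) - (\<integral>\<omega>. indicator A \<omega> * (c (\<sigma> j) \<omega> * of_real (y \<omega>)) \<partial>M)) \<le> (\<integral>\<omega>. norm (Y (\<sigma> j) \<omega> - y \<omega>) \<partial>M)" .
  qed
  have 2: "(\<lambda>j. \<integral>\<omega>. indicator A \<omega> * (c (\<sigma> j) \<omega> * of_real (y \<omega>)) \<partial>M) \<longlonglongrightarrow> (\<integral>\<omega>. indicator A \<omega> * (c' \<omega> * of_real (y \<omega>)) \<partial>M)"
  proof (rule integral_dominated_convergence[where w = "\<lambda>\<omega>. norm (y \<omega>)"])
    show "integrable M (\<lambda>\<omega>. norm (y \<omega>))" using yi by simp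
    show "AE \<omega> in M. (\<lambda>j. indicator A \<omega> * (c (\<sigma> j) \<omega> * of_real (y \<omega>))) \<longlonglongrightarrow> indicator A \<omega> * (c' \<omega> * of_real (y \<omega>))"
      using lims unfolding c_def c'_def by eventually_elim (intro tendsto_intros, auto)
    show "AE \<omega> in M. norm (indicator A \<omega> * (c (\<sigma> j) \<omega> * of_real (y \<omega>))) \<le> norm (y \<omega>)" for j
      by (intro AE_I2) (simp add: norm_mult nc indicator_def)
  qed auto
  have lhs: "(\<lambda>j. \<integral>\<omega>. indicator A \<omega> * (c (\<sigma> j) \<omega> * of_real (Y (\<sigma> j) \<omega>)) \<partial>M) \<longlonglongrightarrow> (\<integral>\<omega>. indicator A \<omega> * (c' \<omega> * of_real (y \<omega>)) \<partial>M)"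
    using tendsto_add[OF 1 2] by simp
  have ind: "integrable M (\<lambda>\<omega>. indicator A \<omega> * f \<omega>)" if "integrable M f" for f :: "'w \<Rightarrow> real"
    using integrable_mult_indicator[OF AM that] by simp
  have "(\<lambda>j. (\<integral>\<omega>. indicator A \<omega> * Y (\<sigma> j) \<omega> \<partial>M) - (\<integral>\<omega>. indicator A \<omega> * y \<omega> \<partial>M)) \<longlonglongrightarrow> 0"
  proof (rule Lim_null_comparison[OF _ L1], intro always_eventually allI)
    fix j
    have "(\<integral>\<omega>. indicator A \<omega> * Y (\<sigma> j) \<omega> \<partial>M) - (\<integral>\<omega>. indicator A \<omega> * y \<omega> \<partial>M) = (\<integral>\<omega>. indicator A \<omega> * Y (\<sigma> j) \<omega> - indicator A \<omega> * y \<omega> \<partial>M)"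
      using ind Y yi by simp
    also have "norm \<dots> \<le> (\<integral>\<omega>. norm (indicator A \<omega> * Y (\<sigma> j) \<omega> - indicator A \<omega> * y \<omega>) \<partial>M)"
      by (rule integral_norm_bound)
    also have "\<dots> \<le> (\<integral>\<omega>. norm (Y (\<sigma> j) \<omega> - y \<omega>) \<partial>M)"
      using ind Y yi by (intro integral_mono) (auto simp: indicator_def)
    finally show "norm ((\<integral>\<omega>. indicator A \<omega> * Y (\<sigma> j) \<omega> \<partial>M) - (\<integral>\<omega>. indicator A \<omega> * y \<omega> \<partial>M)) \<le> (\<integral>\<omega>. norm (Y (\<sigma> j) \<omega> - y \<omega>) \<partial>M)" .
  qed
  then have "(\<lambda>j. \<integral>\<omega>. indicator A \<omega> * Y (\<sigma> j) \<omega> \<partial>M) \<longlonglongrightarrow> (\<integral>\<omega>. indicator A \<omega> * y \<omega> \<partial>M)" by (simp add: LIM_zero_iff)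
  then have rhs: "(\<lambda>j. exp (- of_real (\<kappa>\<^sup>2 * (t - s) / 2)) * complex_of_real (\<integral>\<omega>. indicator A \<omega> * Y (\<sigma> j) \<omega> \<partial>M))
     \<longlonglongrightarrow> exp (- of_real (\<kappa>\<^sup>2 * (t - s) / 2)) * of_real (\<integral>\<omega>. indicator A \<omega> * y \<omega> \<partial>M)"
    by (intro tendsto_mult tendsto_const tendsto_of_real)
  show ?thesis using LIMSEQ_unique[OF lhs rhs[folded X(1), folded c_def]] unfolding c'_def .
qed

end

lemma lebesgue_on_subinterval:
  assumes "{a..b} \<subseteq> {c..d::real}"
  shows "lebesgue_on {a..b} = restrict_space (lebesgue_on {c..d}) {a..b}"
  using assms by (subst restrict_restrict_space) (auto simp: Int_absorb1 simp del: Int_atLeastAtMost)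

lemma integrable_lebesgue_on_subinterval:
  fixes f :: "real \<Rightarrow> real"
  assumes "{a..b} \<subseteq> {c..d::real}" "integrable (lebesgue_on {c..d}) f"
  shows "integrable (lebesgue_on {a..b}) f"
proof -
  have S: "{a..b} \<inter> space (lebesgue_on {c..d}) \<in> sets (lebesgue_on {c..d})"
    using assms(1) by (auto simp: sets_restrict_space_iff Int_absorb2)
  have S': "{a..b} \<in> sets (lebesgue_on {c..d})" using assms(1) by (auto simp: sets_restrict_space_iff)
  show ?thesis
    unfolding lebesgue_on_subinterval[OF assms(1)] integrable_restrict_space[OF S]
    by (intro integrable_mult_indicator S' assms(2))
qed

lemma integral_lebesgue_on_increment:
  fixes r :: "real \<Rightarrow> real"
  assumes r: "integrable (lebesgue_on {0..T}) r" and st: "0 \<le> s" "s \<le> t" "t \<le> T"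
  shows "(\<integral>x. r x \<partial>lebesgue_on {0..t}) - (\<integral>x. r x \<partial>lebesgue_on {0..s}) = (\<integral>x. indicator {s<..t} x * r x \<partial>lebesgue_on {0..T})"
proof -
  have S: "{0..u} \<in> sets (lebesgue_on {0..T})" "{0..u} \<inter> space (lebesgue_on {0..T}) \<in> sets (lebesgue_on {0..T})" if "u \<le> T" for u
    using that by (auto simp: sets_restrict_space_iff Int_absorb2)
  have eq: "(\<integral>x. r x \<partial>lebesgue_on {0..u}) = (\<integral>x. indicator {0..u} x * r x \<partial>lebesgue_on {0..T})" if "u \<le> T" for u
  proof -
    have "{0..u} \<subseteq> {0..T}" using that by auto
    then show ?thesis unfolding lebesgue_on_subinterval[OF \<open>{0..u} \<subseteq> {0..T}\<close>]
      by (subst integral_restrict_space[OF S(2)[OF that]]) simp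
  qed
  have int: "integrable (lebesgue_on {0..T}) (\<lambda>x. indicator {0..u} x * r x)" if "u \<le> T" for u
    using integrable_mult_indicator[OF S(1)[OF that] r] by simp
  have "(\<integral>x. r x \<partial>lebesgue_on {0..t}) - (\<integral>x. r x \<partial>lebesgue_on {0..s})
    = (\<integral>x. indicator {0..t} x * r x - indicator {0..s} x * r x \<partial>lebesgue_on {0..T})"
    using eq int st by simp
  also have "\<dots> = (\<integral>x. indicator {s<..t} x * r x \<partial>lebesgue_on {0..T})"
    using st by (intro Bochner_Integration.integral_cong) (auto simp: indicator_def)
  finally show ?thesis .
qed

lemma continuous_on_integral_lebesgue_on:
  fixes r :: "real \<Rightarrow> real"
  assumes r: "integrable (lebesgue_on {0..T}) r"
  shows "continuous_on {0..T} (\<lambda>t. \<integral>x. r x \<partial>lebesgue_on {0..t})"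
proof -
  have "r integrable_on {0..T}" using r by (intro integrable_on_lebesgue_on) auto
  then have "continuous_on {0..T} (\<lambda>t. integral {0..t} r)" by (rule indefinite_integral_continuous_1)
  moreover have "integral {0..t} r = (\<integral>x. r x \<partial>lebesgue_on {0..t})" if "t \<in> {0..T}" for t
    using that by (intro lebesgue_integral_eq_integral[symmetric] integrable_lebesgue_on_subinterval[OF _ r]) auto
  ultimately show ?thesis by (rule continuous_on_eq)
qed

lemma sets_natural_filtration:
  "sets (natural_filtration M Y t) = sigma_sets (space M) (\<Union>u\<in>{0..t}. {Y u -` B \<inter> space M | B. B \<in> sets borel})"
  unfolding natural_filtration_def by (intro sets_measure_of) auto

lemma space_natural_filtration: "space (natural_filtration M Y t) = space M"
  unfolding natural_filtration_def by (intro space_measure_of) auto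

lemma sets_natural_filtration_subset:
  assumes "space N = space M" "\<And>u. 0 \<le> u \<Longrightarrow> u \<le> t \<Longrightarrow> Y u \<in> borel_measurable N"
  shows "sets (natural_filtration M Y t) \<subseteq> sets N"
  unfolding sets_natural_filtration assms(1)[symmetric]
  by (rule sets.sigma_sets_subset) (use assms(2) in \<open>auto simp: measurable_sets\<close>)

lemma natural_filtration_mono:
  "s \<le> t \<Longrightarrow> sets (natural_filtration M Y s) \<subseteq> sets (natural_filtration M Y t)"
  unfolding sets_natural_filtration by (intro sigma_sets_mono' UN_mono) auto

lemma measurable_natural_filtration:
  assumes "0 \<le> u" "u \<le> t" shows "Y u \<in> borel_measurable (natural_filtration M Y t)"
proof (rule measurableI)
  fix B :: "real set" assume "B \<in> sets borel"
  then show "Y u -` B \<inter> space (natural_filtration M Y t) \<in> sets (natural_filtration M Y t)"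
    unfolding space_natural_filtration sets_natural_filtration using assms by (intro sigma_sets.Basic UN_I[of u]) auto
qed simp

context brownian begin

text \<open>
  Normalised on \<open>A\<close>, the measure \<open>Q\<close> gives the shifted increment the characteristic function of the
  normal law, which determines the law. Since \<open>A\<close> is an arbitrary event of the past, this contains the
  independence as well.
\<close>

lemma girsanov_increment_law:
  fixes r :: "real \<Rightarrow> real" and J y :: "'w \<Rightarrow> real"
  assumes r: "square_integrable (lebesgue_on {0..T}) r"
    and J: "is_ito_integral M F w T (\<lambda>s \<omega>. r s) J"
    and y: "\<And>\<omega>. \<omega> \<in> space M \<Longrightarrow> y \<omega> = exp (- (1/2) * (\<integral>s. (r s)\<^sup>2 \<partial>lebesgue_on {0..T}) - J \<omega>)"
    and yi: "integrable M y" "(\<integral>\<omega>. y \<omega> \<partial>M) = 1"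
    and st: "0 \<le> s" "s < t" "t \<le> T" and A: "A \<in> sets (F s)" and B: "B \<in> sets borel"
  defines "X \<equiv> (\<lambda>\<omega>. w t \<omega> - w s \<omega> + (\<integral>x. indicator {s<..t} x * r x \<partial>lebesgue_on {0..T}))"
    and "Q \<equiv> density M (\<lambda>\<omega>. ennreal (y \<omega>))"
    and "D \<equiv> density lborel (\<lambda>x. ennreal (normal_density 0 (sqrt (t - s)) x))"
  shows "emeasure Q (A \<inter> (X -` B \<inter> space M)) = emeasure Q A * emeasure D B"
proof -
  have AM[measurable]: "A \<in> sets M" using A filtration[of s] st by (auto simp: subalgebra_def)
  have [measurable]: "w t \<in> borel_measurable M" "w s \<in> borel_measurable M" using st by (auto intro: random_variable_w)
  have Xm[measurable]: "X \<in> borel_measurable M" unfolding X_def by measurable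
  have ym[measurable]: "y \<in> borel_measurable M" using yi(1) by simp
  have ypos: "0 \<le> y \<omega>" if "\<omega> \<in> space M" for \<omega> using y that by simp
  have SB: "X -` B \<inter> space M \<in> sets M" using measurable_sets[OF Xm B] .
  define q where "q = (\<integral>\<omega>. indicator A \<omega> * y \<omega> \<partial>M)"
  have Ayi: "integrable M (\<lambda>\<omega>. indicator A \<omega> * y \<omega>)" using integrable_mult_indicator[OF AM yi(1)] by simp
  have eQ: "emeasure Q E = (\<integral>\<^sup>+\<omega>. ennreal (y \<omega>) * indicator E \<omega> \<partial>M)" if "E \<in> sets M" for E
    unfolding Q_def using that by (intro emeasure_density) auto
  have QA: "emeasure Q A = ennreal q"
  proof -
    have "emeasure Q A = (\<integral>\<^sup>+\<omega>. ennreal (indicator A \<omega> * y \<omega>) \<partial>M)"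
      unfolding eQ[OF AM] by (intro nn_integral_cong) (auto simp: indicator_def)
    also have "\<dots> = ennreal q" unfolding q_def using Ayi ypos
      by (intro nn_integral_eq_integral) (auto intro!: AE_I2 simp: indicator_def)
    finally show ?thesis .
  qed
  have q0: "q \<ge> 0" unfolding q_def using ypos by (intro integral_nonneg_AE AE_I2) auto
  show ?thesis
  proof (cases "q = 0")
    case True
    have "emeasure Q (A \<inter> (X -` B \<inter> space M)) \<le> emeasure Q A"
      by (rule emeasure_mono) (auto simp: Q_def)
    then show ?thesis using QA True by simp
  next
    case False
    then have qpos: "q > 0" using q0 by simp
    define \<mu> where "\<mu> = density M (\<lambda>\<omega>. ennreal (indicator A \<omega> * y \<omega> / q))"
    have em: "emeasure \<mu> E = emeasure Q (A \<inter> E) / ennreal q" if E: "E \<in> sets M" for E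
    proof -
      have "emeasure \<mu> E = (\<integral>\<^sup>+\<omega>. ennreal (indicator A \<omega> * y \<omega> / q) * indicator E \<omega> \<partial>M)"
        unfolding \<mu>_def using E by (intro emeasure_density) auto
      also have "\<dots> = (\<integral>\<^sup>+\<omega>. ennreal (y \<omega>) * indicator (A \<inter> E) \<omega> / ennreal q \<partial>M)"
        using ypos qpos by (intro nn_integral_cong) (auto simp: indicator_def divide_ennreal)
      also have "\<dots> = emeasure Q (A \<inter> E) / ennreal q"
        unfolding eQ[OF sets.Int[OF AM E]] using E by (intro nn_integral_divide) auto
      finally show ?thesis .
    qed
    have "prob_space \<mu>"
    proof (rule prob_spaceI)
      have "emeasure \<mu> (space M) = ennreal q / ennreal q"
        using em[of "space M"] QA sets.sets_into_space[OF AM] by (simp add: Int_absorb2)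
      then show "emeasure \<mu> (space \<mu>) = 1" using qpos by (simp add: \<mu>_def divide_ennreal)
    qed
    then interpret \<mu>: prob_space \<mu> .
    have Xmu: "X \<in> borel_measurable \<mu>" unfolding \<mu>_def by simp
    have pos: "sqrt (t - s) > 0" using st by simp
    have "distr \<mu> borel X = D"
    proof (rule Levy_uniqueness)
      show "real_distribution (distr \<mu> borel X)"
        using \<mu>.prob_space_distr[OF Xmu] by (simp add: real_distribution_def real_distribution_axioms_def)
      show "real_distribution D" unfolding D_def
        using prob_space_normal_density[OF pos] by (simp add: real_distribution_def real_distribution_axioms_def)
      show "char (distr \<mu> borel X) = char D"
      proof
        fix \<kappa>
        have "char (distr \<mu> borel X) \<kappa> = (\<integral>\<omega>. iexp (\<kappa> * X \<omega>) \<partial>\<mu>)"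
          unfolding char_def using Xmu by (subst integral_distr) auto
        also have "\<dots> = (\<integral>\<omega>. (indicator A \<omega> * y \<omega> / q) *\<^sub>R iexp (\<kappa> * X \<omega>) \<partial>M)"
          unfolding \<mu>_def using ypos qpos by (intro integral_density) (auto intro!: AE_I2 divide_nonneg_nonneg mult_nonneg_nonneg)
        also have "\<dots> = (\<integral>\<omega>. indicator A \<omega> * (exp (\<i> * of_real (\<kappa> * X \<omega>)) * of_real (y \<omega>)) / of_real q \<partial>M)"
          by (intro Bochner_Integration.integral_cong refl) (auto simp: scaleR_conv_of_real indicator_def mult_ac)
        also have "\<dots> = (\<integral>\<omega>. indicator A \<omega> * (exp (\<i> * of_real (\<kappa> * X \<omega>)) * of_real (y \<omega>)) \<partial>M) / of_real q" by simp
        also have "(\<integral>\<omega>. indicator A \<omega> * (exp (\<i> * of_real (\<kappa> * X \<omega>)) * of_real (y \<omega>)) \<partial>M) = exp (- of_real (\<kappa>\<^sup>2 * (t - s) / 2)) * of_real q"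
          unfolding X_def q_def using st by (intro girsanov_characteristic[OF r J y yi]) (auto intro: A)
        also have "\<dots> / of_real q = exp (- of_real (\<kappa>\<^sup>2 * (t - s) / 2))" using qpos by simp
        also have "\<dots> = char D \<kappa>" unfolding D_def char_centered_normal[OF pos] using st by (simp flip: exp_of_real)
        finally show "char (distr \<mu> borel X) \<kappa> = char D \<kappa>" .
      qed
    qed
    then have "emeasure D B = emeasure \<mu> (X -` B \<inter> space M)"
      using emeasure_distr[OF Xmu, of B] B by (simp add: \<mu>_def)
    also have "\<dots> = emeasure Q (A \<inter> (X -` B \<inter> space M)) / ennreal q" by (rule em[OF SB])
    finally have "emeasure Q A * emeasure D B = ennreal q * (emeasure Q (A \<inter> (X -` B \<inter> space M)) / ennreal q)" using QA by simp
    also have "\<dots> = emeasure Q (A \<inter> (X -` B \<inter> space M))"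
      using qpos by (simp add: ennreal_times_divide mult.commute[of "ennreal q"] ennreal_mult_divide_eq)
    finally show ?thesis by simp
  qed
qed

theorem girsanov:
  fixes r :: "real \<Rightarrow> real" and J y :: "'w \<Rightarrow> real"
  assumes T0: "0 \<le> T" and r: "square_integrable (lebesgue_on {0..T}) r"
    and J: "is_ito_integral M F w T (\<lambda>s \<omega>. r s) J"
    and y: "\<And>\<omega>. \<omega> \<in> space M \<Longrightarrow> y \<omega> = exp (- (1/2) * (\<integral>s. (r s)\<^sup>2 \<partial>lebesgue_on {0..T}) - J \<omega>)"
    and yi: "integrable M y" "(\<integral>\<omega>. y \<omega> \<partial>M) = 1"
    and W: "\<And>t \<omega>. t \<in> {0..T} \<Longrightarrow> \<omega> \<in> space M \<Longrightarrow> W t \<omega> = w t \<omega> + (\<integral>s. r s \<partial>lebesgue_on {0..t})"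
  defines "Q \<equiv> density M (\<lambda>\<omega>. ennreal (y \<omega>))"
  shows "brownian_motion Q (natural_filtration Q W) T W"
proof -
  interpret L: finite_measure "lebesgue_on {0..T}" by (rule finite_lebesgue_on)
  have ri: "integrable (lebesgue_on {0..T}) r"
    using r unfolding square_integrable_def by (elim conjE) (rule L.square_integrable_imp_integrable)
  have ym[measurable]: "y \<in> borel_measurable M" using yi(1) by simp
  have ypos: "0 \<le> y \<omega>" if "\<omega> \<in> space M" for \<omega> using y that by simp
  have [simp]: "space Q = space M" and setsQ[simp]: "sets Q = sets M" by (auto simp: Q_def)
  have "emeasure Q (space M) = ennreal (\<integral>\<omega>. y \<omega> \<partial>M)"
  proof -
    have "emeasure Q (space M) = (\<integral>\<^sup>+\<omega>. ennreal (y \<omega>) * indicator (space M) \<omega> \<partial>M)"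
      unfolding Q_def by (intro emeasure_density) auto
    also have "\<dots> = (\<integral>\<^sup>+\<omega>. ennreal (y \<omega>) \<partial>M)" by (intro nn_integral_cong) simp
    also have "\<dots> = ennreal (\<integral>\<omega>. y \<omega> \<partial>M)" using yi(1) ypos by (intro nn_integral_eq_integral AE_I2)
    finally show ?thesis .
  qed
  then have Qp: "prob_space Q" using yi(2) by (intro prob_spaceI) simp
  then interpret Q: prob_space Q .
  have AEQ: "AE \<omega> in Q. P \<omega>" if "AE \<omega> in M. P \<omega>" for P
    unfolding Q_def using that by (subst AE_density) (auto elim: eventually_mono)
  have Wm: "W u \<in> borel_measurable (F t)" if "0 \<le> u" "u \<le> t" "t \<le> T" for u t
  proof -
    have sp: "space (F t) = space M" using filtration[of t] that by (auto simp: subalgebra_def)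
    have "(\<lambda>\<omega>. w u \<omega> + (\<integral>s. r s \<partial>lebesgue_on {0..u})) \<in> borel_measurable (F t)"
      using adapted_later[OF that] by measurable
    then show ?thesis by (rule measurable_cong[THEN iffD1, rotated]) (use W that sp in auto)
  qed
  have sub: "sets (natural_filtration Q W t) \<subseteq> sets (F t)" if "0 \<le> t" "t \<le> T" for t
    using that Wm filtration[of t] by (intro sets_natural_filtration_subset) (auto simp: subalgebra_def)
  have subM: "sets (F t) \<subseteq> sets M" if "0 \<le> t" "t \<le> T" for t using filtration[of t] that by (auto simp: subalgebra_def)
  have filt: "filtration_upto Q (natural_filtration Q W) T"
    unfolding filtration_upto_def subalgebra_def space_natural_filtration
  proof (intro conjI ballI allI impI)
    fix t assume "t \<in> {0..T}"
    then show "sets (natural_filtration Q W t) \<subseteq> sets Q" using sub[of t] subM[of t] by auto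
  next
    fix s t assume "0 \<le> s \<and> s \<le> t \<and> t \<le> T"
    then show "sets (natural_filtration Q W s) \<subseteq> sets (natural_filtration Q W t)" by (intro natural_filtration_mono) simp
  qed simp
  have start: "AE \<omega> in Q. W 0 \<omega> = 0"
  proof -
    have z: "(\<integral>s. r s \<partial>lebesgue_on {0..0}) = 0"
      by (rule integral_eq_zero_AE, rule AE_I'[of "{0}"]) (auto simp: null_sets_restrict_space)
    have "AE \<omega> in M. W 0 \<omega> = 0"
      using starts_at_0 AE_space by eventually_elim (use W[of 0] T0 z in auto)
    then show ?thesis by (rule AEQ)
  qed
  have cont: "AE \<omega> in Q. continuous_on {0..T} (\<lambda>t. W t \<omega>)"
  proof (rule AEQ)
    show "AE \<omega> in M. continuous_on {0..T} (\<lambda>t. W t \<omega>)"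
      using continuous_paths AE_space
    proof eventually_elim
      case (elim \<omega>)
      have "continuous_on {0..T} (\<lambda>t. w t \<omega> + (\<integral>s. r s \<partial>lebesgue_on {0..t}))"
        by (intro continuous_on_add elim continuous_on_integral_lebesgue_on ri)
      then show ?case by (rule continuous_on_eq) (use W elim(2) in auto)
    qed
  qed
  have incr: "distributed Q lborel (\<lambda>\<omega>. W t \<omega> - W s \<omega>) (normal_density 0 (sqrt (t - s))) \<and>
        Q.indep_set (sets (natural_filtration Q W s)) (sets (vimage_algebra (space Q) (\<lambda>\<omega>. W t \<omega> - W s \<omega>) borel))"
    if st: "0 \<le> s" "s < t" "t \<le> T" for s t
  proof -
    define X where "X = (\<lambda>\<omega>. w t \<omega> - w s \<omega> + (\<integral>x. indicator {s<..t} x * r x \<partial>lebesgue_on {0..T}))"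
    let ?D = "density lborel (\<lambda>x. ennreal (normal_density 0 (sqrt (t - s)) x))"
    have XW: "W t \<omega> - W s \<omega> = X \<omega>" if "\<omega> \<in> space M" for \<omega>
      using integral_lebesgue_on_increment[OF ri, of s t] W[of t \<omega>] W[of s \<omega>] st that by (simp add: X_def)
    have law: "emeasure Q (A \<inter> (X -` B \<inter> space M)) = emeasure Q A * emeasure ?D B" if "A \<in> sets (F s)" "B \<in> sets borel" for A B
      unfolding Q_def X_def by (rule girsanov_increment_law[OF r J y yi st that])
    have F0: "space M \<in> sets (F s)"
    proof -
      have "space (F s) = space M" using filtration[of s] st by (simp add: subalgebra_def)
      then show ?thesis using sets.top[of "F s"] by simp
    qed
    have Dm: "(\<lambda>\<omega>. W t \<omega> - W s \<omega>) \<in> borel_measurable M"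
      using Wm[of t t] Wm[of s t] st measurable_from_subalg[OF filtration[of t]] by (intro borel_measurable_diff) auto
    have vim: "(\<lambda>\<omega>. W t \<omega> - W s \<omega>) -` B \<inter> space M = X -` B \<inter> space M" for B using XW by auto
    have lawD: "emeasure ?D B = emeasure Q (X -` B \<inter> space M)" if "B \<in> sets borel" for B
    proof -
      have "emeasure Q (space M) = 1" using Q.emeasure_space_1 by simp
      moreover have "space M \<inter> (X -` B \<inter> space M) = X -` B \<inter> space M" by auto
      ultimately show ?thesis using law[OF F0 that] by simp
    qed
    have "distr Q lborel (\<lambda>\<omega>. W t \<omega> - W s \<omega>) = ?D"
    proof (rule measure_eqI)
      fix B assume "B \<in> sets (distr Q lborel (\<lambda>\<omega>. W t \<omega> - W s \<omega>))"
      then have B: "B \<in> sets borel" by simp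
      have "emeasure (distr Q lborel (\<lambda>\<omega>. W t \<omega> - W s \<omega>)) B = emeasure Q ((\<lambda>\<omega>. W t \<omega> - W s \<omega>) -` B \<inter> space M)"
        using B Dm by (subst emeasure_distr) (auto simp: Q_def)
      then show "emeasure (distr Q lborel (\<lambda>\<omega>. W t \<omega> - W s \<omega>)) B = emeasure ?D B"
        using lawD[OF B] vim by simp
    qed simp
    then have 1: "distributed Q lborel (\<lambda>\<omega>. W t \<omega> - W s \<omega>) (normal_density 0 (sqrt (t - s)))"
      unfolding distributed_def using Dm by (auto simp: Q_def)
    have 2: "Q.indep_set (sets (natural_filtration Q W s)) (sets (vimage_algebra (space Q) (\<lambda>\<omega>. W t \<omega> - W s \<omega>) borel))"
      unfolding Q.indep_sets2_eq
    proof (intro conjI ballI)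
      show "sets (natural_filtration Q W s) \<subseteq> Q.events" using sub[of s] subM[of s] st by auto
      have vs: "sets (vimage_algebra (space Q) (\<lambda>\<omega>. W t \<omega> - W s \<omega>) borel) = {(\<lambda>\<omega>. W t \<omega> - W s \<omega>) -` B \<inter> space M | B. B \<in> sets borel}"
        by (subst sets_vimage_algebra2) auto
      show "sets (vimage_algebra (space Q) (\<lambda>\<omega>. W t \<omega> - W s \<omega>) borel) \<subseteq> Q.events"
        unfolding vs using Dm by (auto simp: measurable_sets)
      fix A E assume A: "A \<in> sets (natural_filtration Q W s)" and E: "E \<in> sets (vimage_algebra (space Q) (\<lambda>\<omega>. W t \<omega> - W s \<omega>) borel)"
      obtain B where B: "B \<in> sets borel" "E = X -` B \<inter> space M" using E unfolding vs vim by auto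
      have "A \<in> sets (F s)" using A sub[of s] st by auto
      from law[OF this B(1)] lawD[OF B(1)] have "emeasure Q (A \<inter> E) = emeasure Q A * emeasure Q E" using B(2) by simp
      then show "Q.prob (A \<inter> E) = Q.prob A * Q.prob E"
        by (simp add: Q.emeasure_eq_measure ennreal_mult[symmetric])
    qed
    show ?thesis using 1 2 by simp
  qed
  show ?thesis
    unfolding brownian_motion_def
  proof (intro conjI ballI allI impI)
    fix t assume "t \<in> {0..T}"
    then show "W t \<in> borel_measurable (natural_filtration Q W t)" by (intro measurable_natural_filtration) auto
  qed (use Qp filt start cont incr in auto)
qed

end

section \<open>From integrability along paths to integrability with weight \<open>sqrt s\<close>\<close>

context brownian begin

text \<open>
  Fubini's theorem in time and chance needs joint measurability, which continuous paths provide as the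
  limit of their values at the grid points. The exceptional paths are replaced by \<open>0\<close>, and time is
  clamped to \<open>{0..T}\<close>.
\<close>

lemma jointly_measurable_version:
  assumes T: "0 \<le> T"
  shows "\<exists>N v :: real \<Rightarrow> 'w \<Rightarrow> real. N \<in> null_sets M \<and> (\<forall>s. v s \<in> borel_measurable M) \<and>
    (\<forall>\<omega>. continuous_on UNIV (\<lambda>s. v s \<omega>)) \<and> (\<forall>s\<in>{0..T}. \<forall>\<omega>\<in>space M - N. v s \<omega> = w s \<omega>) \<and>
    (\<lambda>z. v (fst z) (snd z)) \<in> borel_measurable (lebesgue_on {0..T} \<Otimes>\<^sub>M M)"
proof -
  obtain N where N0: "{\<omega>\<in>space M. \<not> continuous_on {0..T} (\<lambda>t. w t \<omega>)} \<subseteq> N" "emeasure M N = 0" "N \<in> sets M"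
    by (rule AE_E[OF continuous_paths])
  then have N: "N \<in> null_sets M" "{\<omega>\<in>space M. \<not> continuous_on {0..T} (\<lambda>t. w t \<omega>)} \<subseteq> N"
    by (auto intro: null_setsI)
  define c where "c s = max 0 (min s T)" for s
  have c: "c s \<in> {0..T}" for s using T by (auto simp: c_def)
  define v where "v s \<omega> = indicator (space M - N) \<omega> * w (c s) \<omega>" for s \<omega>
  have NM: "space M - N \<in> sets M" using N(1) by auto
  have vm: "v s \<in> borel_measurable M" for s
    unfolding v_def by (intro borel_measurable_times borel_measurable_indicator NM random_variable_w c)
  have vc: "continuous_on UNIV (\<lambda>s. v s \<omega>)" for \<omega>
  proof (cases "\<omega> \<in> space M - N")
    case True
    then have "continuous_on {0..T} (\<lambda>t. w t \<omega>)" using N(2) by auto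
    moreover have "continuous_on UNIV c" unfolding c_def by (intro continuous_intros)
    ultimately have "continuous_on UNIV (\<lambda>s. w (c s) \<omega>)"
      using c by (intro continuous_on_compose2[of "{0..T}" "\<lambda>t. w t \<omega>" UNIV c]) auto
    then show ?thesis using True by (simp add: v_def)
  next
    case False
    then have "v s \<omega> = 0" for s by (simp add: v_def)
    then show ?thesis by simp
  qed
  have "(\<lambda>z. v (fst z) (snd z)) \<in> borel_measurable (borel \<Otimes>\<^sub>M M)"
  proof (rule borel_measurable_LIMSEQ_metric)
    fix m :: nat
    show "(\<lambda>z. v (real_of_int \<lfloor>real (Suc m) * fst z\<rfloor> / real (Suc m)) (snd z)) \<in> borel_measurable (borel \<Otimes>\<^sub>M M)"
    proof (rule measurable_compose_countable[where f = "\<lambda>i z. v (real_of_int i / real (Suc m)) (snd z)"])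
      show "(\<lambda>z. v (real_of_int i / real (Suc m)) (snd z)) \<in> borel_measurable (borel \<Otimes>\<^sub>M M)" for i
        by (rule measurable_compose[OF measurable_snd vm])
      show "(\<lambda>z. \<lfloor>real (Suc m) * fst z\<rfloor>) \<in> measurable (borel \<Otimes>\<^sub>M M) (count_space UNIV)"
        by measurable
    qed
  next
    fix z :: "real \<times> 'w"
    have "(\<lambda>m. real_of_int \<lfloor>real (Suc m) * fst z\<rfloor> / real (Suc m)) \<longlonglongrightarrow> fst z"
    proof (rule LIMSEQ_I)
      fix e :: real assume "e > 0"
      then obtain k where k: "inverse (real (Suc k)) < e" using reals_Archimedean by blast
      have "norm (real_of_int \<lfloor>real (Suc m) * fst z\<rfloor> / real (Suc m) - fst z) < e" if "m \<ge> k" for m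
      proof -
        have "real_of_int \<lfloor>real (Suc m) * fst z\<rfloor> / real (Suc m) - fst z = (real_of_int \<lfloor>real (Suc m) * fst z\<rfloor> - real (Suc m) * fst z) / real (Suc m)"
          by (simp add: field_simps)
        also have "\<bar>\<dots>\<bar> \<le> 1 / real (Suc m)"
        proof -
          have "\<bar>real_of_int \<lfloor>real (Suc m) * fst z\<rfloor> - real (Suc m) * fst z\<bar> \<le> 1" by linarith
          then show ?thesis unfolding abs_divide by (intro frac_le) auto
        qed
        also have "\<dots> \<le> 1 / real (Suc k)" using that by (intro divide_left_mono) auto
        finally show ?thesis using k by (simp add: inverse_eq_divide)
      qed
      then show "\<exists>no. \<forall>m\<ge>no. norm (real_of_int \<lfloor>real (Suc m) * fst z\<rfloor> / real (Suc m) - fst z) < e" by blast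
    qed
    then show "(\<lambda>m. v (real_of_int \<lfloor>real (Suc m) * fst z\<rfloor> / real (Suc m)) (snd z)) \<longlonglongrightarrow> v (fst z) (snd z)"
      using vc[of "snd z"] by (intro continuous_on_tendsto_compose[of UNIV "\<lambda>s. v s (snd z)"]) auto
  qed
  moreover have "(\<lambda>z. (fst z, snd z)) \<in> measurable (lebesgue_on {0..T} \<Otimes>\<^sub>M M) (borel \<Otimes>\<^sub>M M)"
  proof (rule measurable_Pair)
    have "(\<lambda>x. x) \<in> measurable (lebesgue_on {0..T}) borel" using id_borel_measurable_lebesgue_on[of "{0..T}"] by (simp add: id_def)
    then show "fst \<in> measurable (lebesgue_on {0..T} \<Otimes>\<^sub>M M) borel" by (rule measurable_compose[OF measurable_fst])
  qed simp
  ultimately have joint: "(\<lambda>z. v (fst z) (snd z)) \<in> borel_measurable (lebesgue_on {0..T} \<Otimes>\<^sub>M M)"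
    using measurable_compose[of "\<lambda>z. (fst z, snd z)" "lebesgue_on {0..T} \<Otimes>\<^sub>M M" "borel \<Otimes>\<^sub>M M" "\<lambda>z. v (fst z) (snd z)" borel] by simp
  have "v s \<omega> = w s \<omega>" if "s \<in> {0..T}" "\<omega> \<in> space M" "\<omega> \<notin> N" for s \<omega>
    using that by (simp add: v_def c_def)
  then show ?thesis using N(1) vm vc joint by (intro exI[of _ N] exI[of _ v]) simp
qed

lemma marginal_distributed:
  assumes "0 < s" "s \<le> T"
  shows "distributed M lborel (w s) (normal_density 0 (sqrt s))"
proof -
  have 0: "distributed M lborel (\<lambda>\<omega>. w s \<omega> - w 0 \<omega>) (normal_density 0 (sqrt (s - 0)))"
    using assms by (intro increment_distributed) auto
  have m: "w s \<in> borel_measurable M" "w 0 \<in> borel_measurable M" using assms by (auto intro: random_variable_w)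
  have "distr M lborel (w s) = distr M lborel (\<lambda>\<omega>. w s \<omega> - w 0 \<omega>)"
    using starts_at_0 m by (intro distr_cong_AE) (auto elim: eventually_mono)
  then show ?thesis using 0 m unfolding distributed_def by auto
qed

lemma second_moment:
  assumes "0 < s" "s \<le> T" shows "integrable M (\<lambda>\<omega>. (w s \<omega>)\<^sup>2)" "(\<integral>\<omega>. (w s \<omega>)\<^sup>2 \<partial>M) = s"
proof -
  note d = marginal_distributed[OF assms]
  have pos: "sqrt s > 0" using assms by simp
  show "integrable M (\<lambda>\<omega>. (w s \<omega>)\<^sup>2)"
    using integrable_normal_moment[OF pos, of 0 2] distributed_integrable[OF d, of "\<lambda>x. x\<^sup>2"] by simp
  have "variance (w s) = (sqrt s)\<^sup>2" by (rule normal_distributed_variance[OF pos d])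
  moreover have "expectation (w s) = 0" by (rule normal_distributed_expectation[OF pos d])
  ultimately show "(\<integral>\<omega>. (w s \<omega>)\<^sup>2 \<partial>M) = s" using assms by simp
qed

text \<open>
  By scaling, \<open>w s\<close> has the law of \<open>sqrt s\<close> times a standard normal variable, so the truncation level
  \<open>sqrt s\<close> leaves a constant fraction of \<open>sqrt s\<close>.
\<close>

lemma truncated_first_moment:
  fixes s :: real
  defines "c \<equiv> \<integral>x. std_normal_density x * min \<bar>x\<bar> 1 \<partial>lborel"
  assumes "0 < s" "s \<le> T"
  shows "(\<integral>\<omega>. min \<bar>w s \<omega>\<bar> (sqrt s) \<partial>M) = c * sqrt s"
proof -
  have pos: "sqrt s > 0" using assms by simp
  have "distributed M lborel (\<lambda>\<omega>. (w s \<omega> - 0) / sqrt s) std_normal_density"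
    using marginal_distributed[OF assms(2,3)] normal_standard_normal_convert[OF pos, of "w s" 0] by simp
  from distributed_integral[OF this, of "\<lambda>x. min \<bar>x\<bar> 1"]
  have "c = (\<integral>\<omega>. min \<bar>w s \<omega> / sqrt s\<bar> 1 \<partial>M)" unfolding c_def by simp
  also have "\<dots> * sqrt s = (\<integral>\<omega>. min \<bar>w s \<omega> / sqrt s\<bar> 1 * sqrt s \<partial>M)" by simp
  also have "\<dots> = (\<integral>\<omega>. min \<bar>w s \<omega>\<bar> (sqrt s) \<partial>M)"
  proof (rule Bochner_Integration.integral_cong[OF refl])
    fix \<omega>
    have "min \<bar>w s \<omega> / sqrt s\<bar> 1 * sqrt s = min (\<bar>w s \<omega> / sqrt s\<bar> * sqrt s) (1 * sqrt s)"
      using pos by (intro min_mult_distrib_right[THEN trans]) auto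
    also have "\<bar>w s \<omega> / sqrt s\<bar> * sqrt s = \<bar>w s \<omega>\<bar>" using pos by (simp add: abs_divide)
    finally show "min \<bar>w s \<omega> / sqrt s\<bar> 1 * sqrt s = min \<bar>w s \<omega>\<bar> (sqrt s)" by simp
  qed
  finally show ?thesis by simp
qed

lemma truncated_constant_pos: "(\<integral>x. std_normal_density x * min \<bar>x\<bar> 1 \<partial>lborel) > 0"
proof -
  let ?f = "\<lambda>x::real. std_normal_density x * min \<bar>x\<bar> 1"
  have int: "integrable lborel ?f"
    by (rule Bochner_Integration.integrable_bound[OF integrable_normal_density[of 1 0]])
       (auto intro!: AE_I2 mult_left_le simp: abs_mult)
  have "(\<integral>x. ?f x \<partial>lborel) \<noteq> 0"
  proof
    assume "(\<integral>x. ?f x \<partial>lborel) = 0"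
    then have "AE x in lborel. ?f x = 0"
      using integral_nonneg_eq_0_iff_AE[OF int] by (simp add: AE_I2)
    then have "AE x in lborel. x = (0::real)"
    proof eventually_elim
      case (elim x)
      have "std_normal_density x \<noteq> 0" using normal_density_pos[of 1 0 x] by simp
      then show ?case using elim by (auto simp: min_def split: if_splits)
    qed
    moreover have "AE x in lborel. x \<noteq> (0::real)" by (rule AE_lborel_singleton)
    ultimately have "AE x::real in lborel. False"
      by (rule eventually_elim2[where P = "\<lambda>x::real. x = 0" and Q = "\<lambda>x. x \<noteq> 0"]) simp
    then have "emeasure lborel (space lborel :: real set) = 0" by (simp add: AE_iff_measurable[of UNIV])
    then show False by simp
  qed
  moreover have "(\<integral>x. ?f x \<partial>lborel) \<ge> 0" by (intro integral_nonneg_AE AE_I2) simp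
  ultimately show ?thesis by linarith
qed

end

lemma ennreal_tendsto_0I:
  assumes "\<And>e::real. e > 0 \<Longrightarrow> \<forall>\<^sub>F k in G. u k \<le> ennreal e"
  shows "(u \<longlongrightarrow> (0::ennreal)) G"
proof (rule order_tendstoI)
  fix a :: ennreal assume "0 < a"
  then obtain b where b: "0 < b" "b < a" using dense by blast
  then have fin: "b \<noteq> \<top>" by auto
  then have "0 < enn2real b" using b(1) by (simp add: enn2real_positive_iff less_top)
  from assms[OF this] show "\<forall>\<^sub>F k in G. u k < a"
    using b(2) fin by (auto elim!: eventually_mono simp: less_top)
qed simp

context brownian begin

text \<open>
  Suppose not. Then there are sets \<open>A k\<close> of measure tending to \<open>0\<close> and functionals \<open>x' k\<close> in the unit
  ball with mass \<open>m k > \<epsilon>\<close> of \<open>sqrt s \<bar>x' k (f s)\<bar>\<close> on \<open>A k\<close>. Let \<open>U k \<omega>\<close> be the integral of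
  \<open>min \<bar>w s \<omega>\<bar> (sqrt s) \<bar>x' k (f s)\<bar> / m k\<close> over \<open>A k\<close>. The truncation gives \<open>U k \<le> 1\<close>; uniform
  integrability along the path gives \<open>U k \<longlonglongrightarrow> 0\<close> almost surely; and the truncated first moment gives
  every \<open>U k\<close> the mean \<open>c > 0\<close>. Dominated convergence yields the contradiction.
\<close>

lemma path_ui_imp_sqrt_ui:
  fixes f :: "real \<Rightarrow> 'x::banach"
  assumes T: "0 < T" and sf: "smeas (lebesgue_on {0..T}) f"
    and ui: "AE \<omega> in M. scalarly_ui (lebesgue_on {0..T}) (\<lambda>s. w s \<omega> *\<^sub>R f s)"
  shows "scalarly_ui (lebesgue_on {0..T}) (\<lambda>s. sqrt s *\<^sub>R f s)"
proof (rule ccontr)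
  let ?L = "lebesgue_on {0..T}"
  interpret L: finite_measure ?L by (rule finite_lebesgue_on)
  interpret LM: pair_sigma_finite ?L M by unfold_locales
  assume "\<not> scalarly_ui ?L (\<lambda>s. sqrt s *\<^sub>R f s)"
  then obtain \<epsilon> where \<epsilon>: "\<epsilon> > 0" and bad: "\<forall>\<delta>>0. \<exists>A\<in>sets ?L. measure ?L A < \<delta> \<and> (\<exists>x' :: 'x \<Rightarrow>\<^sub>L real. norm x' \<le> 1 \<and>
      \<not> (\<integral>\<^sup>+s\<in>A. ennreal \<bar>blinfun_apply x' (sqrt s *\<^sub>R f s)\<bar> \<partial>?L) \<le> ennreal \<epsilon>)"
    unfolding scalarly_ui_def by (simp add: not_le) blast
  obtain N v where N: "N \<in> null_sets M" and vm': "\<forall>s. v s \<in> borel_measurable M"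
    and vw': "\<forall>s\<in>{0..T}. \<forall>\<omega>\<in>space M - N. v s \<omega> = w s \<omega>"
    and joint[measurable]: "(\<lambda>z. v (fst z) (snd z)) \<in> borel_measurable (?L \<Otimes>\<^sub>M M)"
    using jointly_measurable_version[OF less_imp_le[OF T]] by (elim exE conjE)
  have vm[measurable]: "v s \<in> borel_measurable M" for s using vm' by simp
  have vw: "v s \<omega> = w s \<omega>" if "s \<in> {0..T}" "\<omega> \<in> space M" "\<omega> \<notin> N" for s \<omega> using vw' that by simp
  define c where "c = (\<integral>x. std_normal_density x * min \<bar>x\<bar> 1 \<partial>lborel)"
  have c: "c > 0" unfolding c_def by (rule truncated_constant_pos)
  have idL: "(\<lambda>s. s) \<in> borel_measurable ?L" using id_borel_measurable_lebesgue_on[of "{0..T}"] by (simp add: id_def)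
  have [measurable]: "(\<lambda>s. sqrt s) \<in> borel_measurable ?L" using idL by measurable
  have fm[measurable]: "(\<lambda>s. blinfun_apply x' (f s)) \<in> borel_measurable ?L" for x' :: "'x \<Rightarrow>\<^sub>L real" by (rule smeas_functional[OF sf])
  have "\<forall>k. \<exists>A x' n. A \<in> sets ?L \<and> measure ?L A < 1 / real (Suc k) \<and> norm (x' :: 'x \<Rightarrow>\<^sub>L real) \<le> 1 \<and>
      (\<forall>s\<in>A. s \<in> {0..T} \<and> sqrt s * \<bar>blinfun_apply x' (f s)\<bar> \<le> real n) \<and> ennreal \<epsilon> < (\<integral>\<^sup>+s\<in>A. ennreal (sqrt s * \<bar>blinfun_apply x' (f s)\<bar>) \<partial>?L)"
  proof
    fix k :: nat
    have "1 / real (Suc k) > 0" by simp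
    from bad[rule_format, OF this] obtain A and x' :: "'x \<Rightarrow>\<^sub>L real" where A: "A \<in> sets ?L" "measure ?L A < 1 / real (Suc k)" "norm x' \<le> 1"
      and big: "\<not> (\<integral>\<^sup>+s\<in>A. ennreal \<bar>blinfun_apply x' (sqrt s *\<^sub>R f s)\<bar> \<partial>?L) \<le> ennreal \<epsilon>" by (elim bexE exE conjE)
    have sub: "A \<subseteq> {0..T}" using sets.sets_into_space[OF A(1)] by simp
    \<comment> \<open>Shrinking \<open>A\<close> to a set where the integrand is bounded makes the mass finite but still larger than
      \<open>\<epsilon>\<close>.\<close>
    define B where "B n = A \<inter> {s\<in>space ?L. sqrt s * \<bar>blinfun_apply x' (f s)\<bar> \<le> real n}" for n :: nat
    have Bm: "B n \<in> sets ?L" for n unfolding B_def using A(1) by measurable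
    let ?D = "density ?L (\<lambda>s. ennreal (sqrt s * \<bar>blinfun_apply x' (f s)\<bar>))"
    have D: "emeasure ?D E = (\<integral>\<^sup>+s\<in>E. ennreal (sqrt s * \<bar>blinfun_apply x' (f s)\<bar>) \<partial>?L)" if "E \<in> sets ?L" for E
      using that by (intro emeasure_density) auto
    have DA: "(\<integral>\<^sup>+s\<in>A. ennreal \<bar>blinfun_apply x' (sqrt s *\<^sub>R f s)\<bar> \<partial>?L) = emeasure ?D A"
      unfolding D[OF A(1)] by (intro nn_integral_cong) (auto simp: blinfun.scaleR_right abs_mult)
    have AB: "A = (\<Union>n. B n)"
    proof
      show "A \<subseteq> (\<Union>n. B n)"
      proof
        fix s assume s: "s \<in> A"
        obtain n where "sqrt s * \<bar>blinfun_apply x' (f s)\<bar> \<le> real n" using real_arch_simple by blast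
        then show "s \<in> (\<Union>n. B n)" using s sub by (auto simp: B_def)
      qed
    qed (auto simp: B_def)
    have "emeasure ?D (\<Union>n. B n) = (SUP n. emeasure ?D (B n))"
      using Bm by (intro SUP_emeasure_incseq[symmetric]) (auto simp: B_def incseq_def intro: order_trans)
    then have "ennreal \<epsilon> < (SUP n. emeasure ?D (B n))" using big unfolding DA not_le AB[symmetric] by simp
    then obtain n where n: "ennreal \<epsilon> < emeasure ?D (B n)" by (auto simp: less_SUP_iff)
    have "measure ?L (B n) \<le> measure ?L A" using A(1) by (intro L.finite_measure_mono) (auto simp: B_def)
    then show "\<exists>A x' n. A \<in> sets ?L \<and> measure ?L A < 1 / real (Suc k) \<and> norm (x' :: 'x \<Rightarrow>\<^sub>L real) \<le> 1 \<and>
      (\<forall>s\<in>A. s \<in> {0..T} \<and> sqrt s * \<bar>blinfun_apply x' (f s)\<bar> \<le> real n) \<and> ennreal \<epsilon> < (\<integral>\<^sup>+s\<in>A. ennreal (sqrt s * \<bar>blinfun_apply x' (f s)\<bar>) \<partial>?L)"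
      using Bm[of n] A(2,3) n[unfolded D[OF Bm]] sub by (intro exI[of _ "B n"] exI[of _ x'] exI[of _ n]) (auto simp: B_def)
  qed
  from choice[OF this] obtain A where "\<forall>k. \<exists>x' n. A k \<in> sets ?L \<and> measure ?L (A k) < 1 / real (Suc k) \<and> norm (x' :: 'x \<Rightarrow>\<^sub>L real) \<le> 1 \<and>
      (\<forall>s\<in>A k. s \<in> {0..T} \<and> sqrt s * \<bar>blinfun_apply x' (f s)\<bar> \<le> real n) \<and> ennreal \<epsilon> < (\<integral>\<^sup>+s\<in>A k. ennreal (sqrt s * \<bar>blinfun_apply x' (f s)\<bar>) \<partial>?L)" ..
  from choice[OF this] obtain x' :: "nat \<Rightarrow> 'x \<Rightarrow>\<^sub>L real" where "\<forall>k. \<exists>n. A k \<in> sets ?L \<and> measure ?L (A k) < 1 / real (Suc k) \<and> norm (x' k) \<le> 1 \<and>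
      (\<forall>s\<in>A k. s \<in> {0..T} \<and> sqrt s * \<bar>blinfun_apply (x' k) (f s)\<bar> \<le> real n) \<and> ennreal \<epsilon> < (\<integral>\<^sup>+s\<in>A k. ennreal (sqrt s * \<bar>blinfun_apply (x' k) (f s)\<bar>) \<partial>?L)" ..
  then have Ak: "A k \<in> sets ?L" "measure ?L (A k) < 1 / real (Suc k)" "norm (x' k) \<le> 1"
    and bnd: "\<exists>n. \<forall>s\<in>A k. s \<in> {0..T} \<and> sqrt s * \<bar>blinfun_apply (x' k) (f s)\<bar> \<le> real n"
    and big: "ennreal \<epsilon> < (\<integral>\<^sup>+s\<in>A k. ennreal (sqrt s * \<bar>blinfun_apply (x' k) (f s)\<bar>) \<partial>?L)" for k by auto
  note [measurable] = Ak(1)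
  define b where "b k s = indicator (A k) s * \<bar>blinfun_apply (x' k) (f s)\<bar>" for k s
  have [measurable]: "b k \<in> borel_measurable ?L" for k unfolding b_def by measurable
  have b0: "0 \<le> b k s" for k s by (simp add: b_def)
  define m where "m k = (\<integral>s. sqrt s * b k s \<partial>?L)" for k
  have gi: "integrable ?L (\<lambda>s. sqrt s * b k s)" for k
  proof -
    obtain n where n: "\<forall>s\<in>A k. s \<in> {0..T} \<and> sqrt s * \<bar>blinfun_apply (x' k) (f s)\<bar> \<le> real n" using bnd by blast
    show ?thesis
      by (rule L.integrable_const_bound[where B = "real n"]) (use n in \<open>auto simp: b_def indicator_def abs_mult intro!: AE_I2\<close>)
  qed
  have g0: "AE s in ?L. 0 \<le> sqrt s * b k s" for k using b0 by (intro AE_I2) auto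
  have m: "m k > \<epsilon>" for k
  proof -
    have "(\<integral>\<^sup>+s\<in>A k. ennreal (sqrt s * \<bar>blinfun_apply (x' k) (f s)\<bar>) \<partial>?L) = (\<integral>\<^sup>+s. ennreal (sqrt s * b k s) \<partial>?L)"
      by (intro nn_integral_cong) (auto simp: b_def indicator_def)
    also have "\<dots> = ennreal (m k)" unfolding m_def by (rule nn_integral_eq_integral[OF gi g0])
    finally show ?thesis using big[of k] \<epsilon> by (simp add: ennreal_less_iff)
  qed
  then have m0: "m k > 0" for k using \<epsilon> less_trans by blast
  define h where "h k s \<omega> = min \<bar>v s \<omega>\<bar> (sqrt s) * b k s / m k" for k s \<omega>
  have hm[measurable]: "(\<lambda>z. h k (fst z) (snd z)) \<in> borel_measurable (?L \<Otimes>\<^sub>M M)" for k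
  proof -
    have [measurable]: "(\<lambda>z. sqrt (fst z)) \<in> borel_measurable (?L \<Otimes>\<^sub>M M)" "(\<lambda>z. b k (fst z)) \<in> borel_measurable (?L \<Otimes>\<^sub>M M)"
      by (rule measurable_compose[OF measurable_fst]; measurable)+
    show ?thesis unfolding h_def by measurable
  qed
  define U where "U k \<omega> = (\<integral>\<^sup>+s. ennreal (h k s \<omega>) \<partial>?L)" for k \<omega>
  have Um[measurable]: "U k \<in> borel_measurable M" for k
  proof -
    have "(\<lambda>z. ennreal (h k (fst (prod.swap z)) (snd (prod.swap z)))) \<in> borel_measurable (M \<Otimes>\<^sub>M ?L)"
      by (rule measurable_compose[OF _ measurable_compose[OF hm measurable_ennreal]]) (simp add: measurable_pair_swap prod.swap_def)
    then show ?thesis unfolding U_def[abs_def] by (intro L.borel_measurable_nn_integral) (simp add: split_beta')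
  qed
  have U1: "U k \<omega> \<le> 1" for k \<omega>
  proof -
    have "U k \<omega> \<le> (\<integral>\<^sup>+s. ennreal (sqrt s * b k s / m k) \<partial>?L)"
      unfolding U_def h_def using b0 m0 by (intro nn_integral_mono ennreal_leI divide_right_mono mult_right_mono) (auto intro: less_imp_le)
    also have "\<dots> = ennreal (\<integral>s. sqrt s * b k s / m k \<partial>?L)"
      using gi b0 m0[of k] by (intro nn_integral_eq_integral AE_I2) (auto intro!: divide_nonneg_nonneg mult_nonneg_nonneg)
    also have "\<dots> = 1" using m0[of k] by (simp add: m_def[symmetric])
    finally show ?thesis .
  qed
  have U0: "AE \<omega> in M. (\<lambda>k. U k \<omega>) \<longlonglongrightarrow> 0"
    using ui AE_not_in[OF N] AE_space
  proof eventually_elim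
    case (elim \<omega>)
    show ?case
    proof (rule ennreal_tendsto_0I)
      fix e :: real assume e: "e > 0"
      then have "\<epsilon> * e > 0" using \<epsilon> by simp
      from scalarly_uiD[OF elim(1) this] obtain \<delta> where d: "\<delta> > 0" "\<forall>A\<in>sets ?L. \<forall>x' :: 'x \<Rightarrow>\<^sub>L real. measure ?L A < \<delta> \<longrightarrow> norm x' \<le> 1 \<longrightarrow>
        (\<integral>\<^sup>+s\<in>A. ennreal \<bar>blinfun_apply x' (w s \<omega> *\<^sub>R f s)\<bar> \<partial>?L) \<le> ennreal (\<epsilon> * e)" by (elim exE conjE)
      obtain k0 where k0: "inverse (real (Suc k0)) < \<delta>" using reals_Archimedean d(1) by blast
      have "U k \<omega> \<le> ennreal e" if "k \<ge> k0" for k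
      proof -
        have "1 / real (Suc k) \<le> 1 / real (Suc k0)" using that by (intro divide_left_mono) auto
        then have "measure ?L (A k) < \<delta>" using Ak(2)[of k] k0 by (simp add: inverse_eq_divide)
        then have *: "(\<integral>\<^sup>+s\<in>A k. ennreal \<bar>blinfun_apply (x' k) (w s \<omega> *\<^sub>R f s)\<bar> \<partial>?L) \<le> ennreal (\<epsilon> * e)" using d(2) Ak(1,3) by blast
        have "U k \<omega> \<le> (\<integral>\<^sup>+s. ennreal \<bar>blinfun_apply (x' k) (w s \<omega> *\<^sub>R f s)\<bar> * indicator (A k) s / ennreal \<epsilon> \<partial>?L)"
          unfolding U_def
        proof (rule nn_integral_mono)
          fix s assume "s \<in> space ?L"
          then have vs: "v s \<omega> = w s \<omega>" using vw elim by simp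
          have "h k s \<omega> \<le> \<bar>w s \<omega>\<bar> * b k s / \<epsilon>"
            unfolding h_def vs using b0[of k s] m[of k] \<epsilon> by (intro frac_le mult_right_mono mult_nonneg_nonneg) auto
          then have "ennreal (h k s \<omega>) \<le> ennreal (\<bar>w s \<omega>\<bar> * b k s / \<epsilon>)" by (rule ennreal_leI)
          also have "\<dots> = ennreal \<bar>blinfun_apply (x' k) (w s \<omega> *\<^sub>R f s)\<bar> * indicator (A k) s / ennreal \<epsilon>"
            using \<epsilon> by (simp add: divide_ennreal[symmetric] b_def blinfun.scaleR_right abs_mult indicator_def)
          finally show "ennreal (h k s \<omega>) \<le> ennreal \<bar>blinfun_apply (x' k) (w s \<omega> *\<^sub>R f s)\<bar> * indicator (A k) s / ennreal \<epsilon>" .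
        qed
        also have "\<dots> = (\<integral>\<^sup>+s\<in>A k. ennreal \<bar>blinfun_apply (x' k) (w s \<omega> *\<^sub>R f s)\<bar> \<partial>?L) / ennreal \<epsilon>"
        proof (rule nn_integral_divide)
          have "(\<lambda>s. ennreal (\<bar>v s \<omega>\<bar> * \<bar>blinfun_apply (x' k) (f s)\<bar>) * indicator (A k) s) \<in> borel_measurable ?L"
          proof -
            have [measurable]: "(\<lambda>s. v s \<omega>) \<in> borel_measurable ?L"
              using measurable_compose[OF measurable_Pair2'[OF elim(3)] joint] by simp
            show ?thesis by measurable
          qed
          then show "(\<lambda>s. ennreal \<bar>blinfun_apply (x' k) (w s \<omega> *\<^sub>R f s)\<bar> * indicator (A k) s) \<in> borel_measurable ?L"
            by (rule measurable_cong[THEN iffD1, rotated]) (use vw elim in \<open>simp add: blinfun.scaleR_right abs_mult\<close>)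
        qed
        also have "\<dots> \<le> ennreal (\<epsilon> * e) / ennreal \<epsilon>" by (intro divide_right_mono_ennreal *)
        also have "\<dots> = ennreal e" using \<epsilon> e by (simp add: divide_ennreal)
        finally show ?thesis .
      qed
      then show "\<forall>\<^sub>F k in sequentially. U k \<omega> \<le> ennreal e" by (auto simp: eventually_sequentially)
    qed
  qed
  have EU: "(\<integral>\<^sup>+\<omega>. U k \<omega> \<partial>M) = ennreal c" for k
  proof -
    have "(\<integral>\<^sup>+\<omega>. U k \<omega> \<partial>M) = (\<integral>\<^sup>+s. (\<integral>\<^sup>+\<omega>. ennreal (h k s \<omega>) \<partial>M) \<partial>?L)"
      unfolding U_def using LM.Fubini[of "\<lambda>z. ennreal (h k (fst z) (snd z))"] by simp
    also have "\<dots> = (\<integral>\<^sup>+s. ennreal (c * (sqrt s * b k s / m k)) \<partial>?L)"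
    proof (rule nn_integral_cong)
      fix s assume "s \<in> space ?L"
      then have s: "0 \<le> s" "s \<le> T" by auto
      show "(\<integral>\<^sup>+\<omega>. ennreal (h k s \<omega>) \<partial>M) = ennreal (c * (sqrt s * b k s / m k))"
      proof (cases "s = 0")
        case True
        then have "h k s \<omega> = 0" for \<omega> by (simp add: h_def min_absorb2)
        then show ?thesis using True by simp
      next
        case False
        then have s0: "0 < s" using s by simp
        have "(\<integral>\<^sup>+\<omega>. ennreal (h k s \<omega>) \<partial>M) = ennreal (\<integral>\<omega>. h k s \<omega> \<partial>M)"
        proof (rule nn_integral_eq_integral)
          have [measurable]: "h k s \<in> borel_measurable M" unfolding h_def[abs_def] using vm by measurable
          show "integrable M (h k s)"
            by (rule integrable_const_bound[where B = "sqrt s * b k s / m k"])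
               (use b0[of k s] m0[of k] s in \<open>auto simp: h_def abs_mult abs_divide intro!: AE_I2 divide_right_mono mult_right_mono\<close>)
          show "AE \<omega> in M. 0 \<le> h k s \<omega>" using b0[of k s] m0[of k] s by (intro AE_I2) (auto simp: h_def)
        qed
        also have "(\<integral>\<omega>. h k s \<omega> \<partial>M) = (\<integral>\<omega>. min \<bar>v s \<omega>\<bar> (sqrt s) \<partial>M) * b k s / m k" by (simp add: h_def)
        also have "(\<integral>\<omega>. min \<bar>v s \<omega>\<bar> (sqrt s) \<partial>M) = (\<integral>\<omega>. min \<bar>w s \<omega>\<bar> (sqrt s) \<partial>M)"
        proof (rule integral_cong_AE)
          show "AE \<omega> in M. min \<bar>v s \<omega>\<bar> (sqrt s) = min \<bar>w s \<omega>\<bar> (sqrt s)"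
            using AE_not_in[OF N] AE_space by eventually_elim (use vw s in auto)
        qed (use vm random_variable_w[of s] s in auto)
        also have "\<dots> = c * sqrt s" unfolding c_def by (rule truncated_first_moment[OF s0 s(2)])
        finally show ?thesis by (simp add: mult_ac)
      qed
    qed
    also have "\<dots> = ennreal (\<integral>s. c * (sqrt s * b k s / m k) \<partial>?L)"
      using gi[of k] b0 m0[of k] c by (intro nn_integral_eq_integral AE_I2) (auto intro!: divide_nonneg_nonneg mult_nonneg_nonneg)
    also have "(\<integral>s. c * (sqrt s * b k s / m k) \<partial>?L) = c" using m0[of k] by (simp add: m_def[symmetric])
    finally show ?thesis .
  qed
  have "(\<lambda>k. \<integral>\<^sup>+\<omega>. U k \<omega> \<partial>M) \<longlonglongrightarrow> (\<integral>\<^sup>+\<omega>. 0 \<partial>M)"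
    by (rule nn_integral_dominated_convergence[where w = "\<lambda>_. 1"]) (use U1 U0 in \<open>auto simp: emeasure_space_1\<close>)
  then have "(\<lambda>k::nat. ennreal c) \<longlonglongrightarrow> 0" unfolding EU by simp
  then have "ennreal c = 0" by (simp add: LIMSEQ_const_iff)
  then show False using c by simp
qed

end

section \<open>Integration by parts against the drift\<close>

lemma has_vector_derivative_frechet_deriv_on:
  assumes "\<Phi> differentiable_on {0..T}" "t \<in> {0..T}"
  shows "(\<Phi> has_vector_derivative frechet_deriv_on T \<Phi> t) (at t within {0..T})"
proof -
  have "(\<Phi> has_derivative frechet_derivative \<Phi> (at t within {0..T})) (at t within {0..T})"
    using assms by (simp add: differentiable_on_def frechet_derivative_works[symmetric])
  then have "bounded_linear (frechet_derivative \<Phi> (at t within {0..T}))"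
    and d: "(\<Phi> has_derivative frechet_derivative \<Phi> (at t within {0..T})) (at t within {0..T})"
    by (auto dest: has_derivative_bounded_linear)
  then interpret B: bounded_linear "frechet_derivative \<Phi> (at t within {0..T})" by simp
  have "frechet_derivative \<Phi> (at t within {0..T}) x = x *\<^sub>R frechet_deriv_on T \<Phi> t" for x
    using B.scaleR[of x 1] by (simp add: frechet_deriv_on_def)
  then have "frechet_derivative \<Phi> (at t within {0..T}) = (\<lambda>x. x *\<^sub>R frechet_deriv_on T \<Phi> t)" by (rule ext)
  then show ?thesis unfolding has_vector_derivative_def using d by simp
qed

text \<open>
  The derivative is the limit of the right difference quotients, which are continuous in \<open>t\<close> once the
  shifted point is kept in \<open>{0..T}\<close>. The value at \<open>T\<close>, where there is no room to the right, is put in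
  by hand.
\<close>

lemma smeas_frechet_deriv_on:
  fixes \<Phi> :: "real \<Rightarrow> 'x::banach"
  assumes \<Phi>: "\<Phi> differentiable_on {0..T}"
  shows "smeas (lebesgue_on {0..T}) (frechet_deriv_on T \<Phi>)"
proof -
  let ?L = "lebesgue_on {0..T}"
  have cont: "continuous_on {0..T} \<Phi>" by (rule differentiable_imp_continuous_on[OF \<Phi>])
  define g where "g n t = indicator {..<T} t *\<^sub>R (real (Suc n) *\<^sub>R (\<Phi> (min T (t + 1 / real (Suc n))) - \<Phi> t))
      + indicator {T} t *\<^sub>R frechet_deriv_on T \<Phi> T" for n t
  show ?thesis
  proof (rule smeas_limit)
    fix n
    have "continuous_on {0..T} (\<lambda>t. \<Phi> (min T (t + 1 / real (Suc n))))"
      by (rule continuous_on_compose2[OF cont]) (auto intro!: continuous_intros)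
    then have "continuous_on {0..T} (\<lambda>t. real (Suc n) *\<^sub>R (\<Phi> (min T (t + 1 / real (Suc n))) - \<Phi> t))"
      by (intro continuous_intros cont)
    then have 1: "smeas ?L (\<lambda>t. real (Suc n) *\<^sub>R (\<Phi> (min T (t + 1 / real (Suc n))) - \<Phi> t))" by (rule smeas_lebesgue_on_continuous)
    have idL: "(\<lambda>s. s) \<in> borel_measurable ?L" using id_borel_measurable_lebesgue_on[of "{0..T}"] by (simp add: id_def)
    have "(\<lambda>t. indicator {..<T} t :: real) \<in> borel_measurable ?L" "(\<lambda>t. indicator {T} t :: real) \<in> borel_measurable ?L"
      by (rule measurable_compose[OF idL], simp)+
    then show "smeas ?L (g n)" unfolding g_def by (intro smeas_add smeas_scaleR[OF _ 1] smeas_scaleR[OF _ smeas_const])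
  next
    fix t assume "t \<in> space ?L"
    then have t: "t \<in> {0..T}" by simp
    show "(\<lambda>n. g n t) \<longlonglongrightarrow> frechet_deriv_on T \<Phi> t"
    proof (cases "t = T")
      case True then show ?thesis by (simp add: g_def)
    next
      case False
      then have lt: "t < T" using t by simp
      have "((\<lambda>y. (1 / (y - t)) *\<^sub>R (\<Phi> y - \<Phi> t)) \<longlongrightarrow> frechet_deriv_on T \<Phi> t) (at t within {0..T})"
      proof -
        let ?D = "frechet_deriv_on T \<Phi> t"
        have "((\<lambda>y. norm ((\<Phi> y - \<Phi> t) - (y - t) *\<^sub>R ?D) / norm (y - t)) \<longlongrightarrow> 0) (at t within {0..T})"
          using has_vector_derivative_frechet_deriv_on[OF \<Phi> t]
          by (simp add: has_vector_derivative_def has_derivative_iff_norm)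
        moreover have "\<forall>\<^sub>F y in at t within {0..T}. norm ((\<Phi> y - \<Phi> t) - (y - t) *\<^sub>R ?D) / norm (y - t) = norm ((1 / (y - t)) *\<^sub>R (\<Phi> y - \<Phi> t) - ?D)"
          unfolding eventually_at_filter
        proof (intro always_eventually allI impI)
          fix y assume "y \<noteq> t"
          then have "(1 / (y - t)) *\<^sub>R (\<Phi> y - \<Phi> t) - ?D = (1 / (y - t)) *\<^sub>R ((\<Phi> y - \<Phi> t) - (y - t) *\<^sub>R ?D)"
            by (simp add: scaleR_diff_right)
          then show "norm ((\<Phi> y - \<Phi> t) - (y - t) *\<^sub>R ?D) / norm (y - t) = norm ((1 / (y - t)) *\<^sub>R (\<Phi> y - \<Phi> t) - ?D)"
            by simp
        qed
        ultimately have "((\<lambda>y. norm ((1 / (y - t)) *\<^sub>R (\<Phi> y - \<Phi> t) - ?D)) \<longlongrightarrow> 0) (at t within {0..T})"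
          by (rule Lim_transform_eventually)
        then show ?thesis unfolding tendsto_norm_zero_iff by (rule LIM_zero_cancel)
      qed
      moreover have "filterlim (\<lambda>n. min T (t + 1 / real (Suc n))) (at t within {0..T}) sequentially"
      proof -
        have "(\<lambda>n. 1 / real (Suc n)) \<longlonglongrightarrow> 0" using LIMSEQ_inverse_real_of_nat by (simp add: inverse_eq_divide)
        then have "(\<lambda>n. min T (t + 1 / real (Suc n))) \<longlonglongrightarrow> min T (t + 0)" by (intro tendsto_intros)
        then have "(\<lambda>n. min T (t + 1 / real (Suc n))) \<longlonglongrightarrow> t" using lt by simp
        moreover have "min T (t + 1 / real (Suc n)) \<noteq> t" "min T (t + 1 / real (Suc n)) \<in> {0..T}" for n
        proof -
          have "1 / real (Suc n) > 0" by simp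
          then show "min T (t + 1 / real (Suc n)) \<noteq> t" "min T (t + 1 / real (Suc n)) \<in> {0..T}"
            using t lt by (auto simp: min_def simp del: of_nat_Suc)
        qed
        ultimately show ?thesis unfolding filterlim_at by (simp only: simp_thms eventually_True)
      qed
      ultimately have lim: "(\<lambda>n. (1 / (min T (t + 1 / real (Suc n)) - t)) *\<^sub>R (\<Phi> (min T (t + 1 / real (Suc n))) - \<Phi> t)) \<longlonglongrightarrow> frechet_deriv_on T \<Phi> t"
        by (rule filterlim_compose)
      have "\<forall>\<^sub>F n in sequentially. 1 / real (Suc n) < T - t"
        using LIMSEQ_inverse_real_of_nat lt by (intro order_tendstoD(2)[where y = 0]) (auto simp: inverse_eq_divide)
      then have "\<forall>\<^sub>F n in sequentially. (1 / (min T (t + 1 / real (Suc n)) - t)) *\<^sub>R (\<Phi> (min T (t + 1 / real (Suc n))) - \<Phi> t) = g n t"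
        by eventually_elim (use lt in \<open>simp add: g_def min_def\<close>)
      then show ?thesis using lim by (simp add: tendsto_cong)
    qed
  qed
qed

text \<open>
  The Cauchy-Schwarz inequality on \<open>{0..s}\<close>, in the form \<open>\<bar>r\<bar> \<le> sqrt s r\<^sup>2 + 1 / sqrt s\<close>.
\<close>

lemma integral_le_sqrt:
  fixes r :: "real \<Rightarrow> real"
  assumes r: "square_integrable (lebesgue_on {0..T}) r"
  shows "\<exists>K\<ge>0. \<forall>s\<in>{0..T}. \<bar>\<integral>x. r x \<partial>lebesgue_on {0..s}\<bar> \<le> K * sqrt s"
proof -
  interpret L: finite_measure "lebesgue_on {0..T}" by (rule finite_lebesgue_on)
  have r1: "r \<in> borel_measurable (lebesgue_on {0..T})" and r2: "integrable (lebesgue_on {0..T}) (\<lambda>x. (r x)\<^sup>2)"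
    using r by (auto simp: square_integrable_def)
  have ri: "integrable (lebesgue_on {0..T}) r" by (rule L.square_integrable_imp_integrable[OF r1 r2])
  define K where "K = (\<integral>x. (r x)\<^sup>2 \<partial>lebesgue_on {0..T}) + 1"
  have le: "\<bar>\<integral>x. r x \<partial>lebesgue_on {0..s}\<bar> \<le> K * sqrt s" if s: "s \<in> {0..T}" for s
  proof (cases "s = 0")
    case True
    have "(\<integral>x. r x \<partial>lebesgue_on {0..0}) = 0"
      by (rule integral_eq_zero_AE, rule AE_I'[of "{0}"]) (auto simp: null_sets_restrict_space)
    then show ?thesis using True by simp
  next
    case False
    then have pos: "s > 0" using s by simp
    have sub: "{0..s} \<subseteq> {0..T}" using s by auto
    note ris = integrable_lebesgue_on_subinterval[OF sub ri] and r2s = integrable_lebesgue_on_subinterval[OF sub r2]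
    interpret Ls: finite_measure "lebesgue_on {0..s}" by (rule finite_lebesgue_on)
    have mono: "(\<integral>x. (r x)\<^sup>2 \<partial>lebesgue_on {0..s}) \<le> (\<integral>x. (r x)\<^sup>2 \<partial>lebesgue_on {0..T})"
    proof -
      have "(\<integral>x. (r x)\<^sup>2 \<partial>lebesgue_on {0..T}) - (\<integral>x. (r x)\<^sup>2 \<partial>lebesgue_on {0..s}) = (\<integral>x. indicator {s<..T} x * (r x)\<^sup>2 \<partial>lebesgue_on {0..T})"
        using s by (intro integral_lebesgue_on_increment r2) auto
      also have "\<dots> \<ge> 0" by (intro integral_nonneg_AE AE_I2) simp
      finally show ?thesis by simp
    qed
    have pt: "\<bar>r x\<bar> \<le> sqrt s * (r x)\<^sup>2 + 1 / sqrt s" for x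
    proof -
      have "0 \<le> (sqrt s * \<bar>r x\<bar> - 1)\<^sup>2 / sqrt s" using pos by simp
      also have "\<dots> = sqrt s * (r x)\<^sup>2 + 1 / sqrt s - 2 * \<bar>r x\<bar>"
        using pos by (simp add: power2_diff power_mult_distrib field_simps power2_eq_square)
      finally show ?thesis by simp
    qed
    have "\<bar>\<integral>x. r x \<partial>lebesgue_on {0..s}\<bar> \<le> (\<integral>x. sqrt s * (r x)\<^sup>2 + 1 / sqrt s \<partial>lebesgue_on {0..s})"
      by (rule abs_integral_le[OF ris]) (use r2s pt in auto)
    also have "\<dots> = sqrt s * (\<integral>x. (r x)\<^sup>2 \<partial>lebesgue_on {0..s}) + s / sqrt s"
      using r2s pos by (subst Bochner_Integration.integral_add) (auto simp: measure_restrict_space space_restrict_space)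
    also have "\<dots> \<le> K * sqrt s"
      using mono pos mult_left_mono[OF mono, of "sqrt s"] by (simp add: K_def real_div_sqrt algebra_simps)
    finally show ?thesis .
  qed
  moreover have "K \<ge> 0" unfolding K_def by (intro add_nonneg_nonneg integral_nonneg_AE AE_I2) auto
  ultimately show ?thesis by blast
qed

lemma integral_lebesgue_on_0: "(\<integral>x. (r x :: real) \<partial>lebesgue_on {0..0::real}) = 0"
  by (rule integral_eq_zero_AE, rule AE_I'[of "{0}"]) (auto simp: null_sets_restrict_space)

text \<open>
  Where \<open>\<Phi> t \<noteq> 0\<close>, the quotient of \<open>\<Psi>\<close> and \<open>\<Phi>\<close> shows that \<open>r\<close> is continuous at \<open>t\<close>, so its
  primitive is differentiable there and the product rule applies. Where \<open>\<Phi> t = 0\<close>, also \<open>\<Psi> t = 0\<close>;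
  then \<open>\<Phi>\<close> vanishes to first order, and the continuity of the primitive is enough.
\<close>

lemma product_with_primitive_derivative:
  fixes \<Phi> \<Psi> :: "real \<Rightarrow> 'x::banach" and r :: "real \<Rightarrow> real"
  assumes \<Phi>: "\<Phi> differentiable_on {0..T}" and \<Psi>: "continuous_on {0..T} \<Psi>"
    and eq: "\<And>t. t \<in> {0..T} \<Longrightarrow> \<Psi> t = r t *\<^sub>R \<Phi> t" and r: "integrable (lebesgue_on {0..T}) r"
    and t: "t \<in> {0..T}"
  defines "R \<equiv> (\<lambda>t. \<integral>x. r x \<partial>lebesgue_on {0..t})"
  shows "((\<lambda>t. R t *\<^sub>R \<Phi> t) has_vector_derivative (\<Psi> t + R t *\<^sub>R frechet_deriv_on T \<Phi> t)) (at t within {0..T})"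
proof -
  let ?F = "at t within {0..T}" and ?D = "frechet_deriv_on T \<Phi> t"
  have d\<Phi>: "(\<Phi> has_vector_derivative ?D) ?F" by (rule has_vector_derivative_frechet_deriv_on[OF \<Phi> t])
  have cont\<Phi>: "continuous_on {0..T} \<Phi>" by (rule differentiable_imp_continuous_on[OF \<Phi>])
  have Rc: "continuous_on {0..T} R" unfolding R_def by (rule continuous_on_integral_lebesgue_on[OF r])
  have rHK: "r integrable_on {0..T}" using r by (intro integrable_on_lebesgue_on) auto
  have Req: "integral {0..u} r = R u" if "u \<in> {0..T}" for u
    unfolding R_def using that by (intro lebesgue_integral_eq_integral[symmetric] integrable_lebesgue_on_subinterval[OF _ r]) auto
  have lim\<Phi>: "(\<Phi> \<longlongrightarrow> \<Phi> t) ?F" and lim\<Psi>: "(\<Psi> \<longlongrightarrow> \<Psi> t) ?F" and limR: "(R \<longlongrightarrow> R t) ?F"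
    using cont\<Phi> \<Psi> Rc t by (auto simp: continuous_on_def)
  have inS: "\<forall>\<^sub>F y in ?F. y \<in> {0..T}" by (simp add: eventually_at_filter)
  show ?thesis
  proof (cases "\<Phi> t = 0")
    case True
    have 1: "((\<lambda>y. R t *\<^sub>R \<Phi> y) has_vector_derivative R t *\<^sub>R ?D) ?F"
      using bounded_linear.has_vector_derivative[OF bounded_linear_scaleR_right d\<Phi>] .
    have 2: "((\<lambda>y. (R y - R t) *\<^sub>R \<Phi> y) has_vector_derivative 0) ?F"
      unfolding has_vector_derivative_def has_derivative_iff_norm
    proof (intro conjI)
      have n: "((\<lambda>y. norm ((\<Phi> y - \<Phi> t) - (y - t) *\<^sub>R ?D) / norm (y - t)) \<longlongrightarrow> 0) ?F"
        using d\<Phi> by (simp add: has_vector_derivative_def has_derivative_iff_norm)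
      have "((\<lambda>y. \<bar>R y - R t\<bar> * (norm ((\<Phi> y - \<Phi> t) - (y - t) *\<^sub>R ?D) / norm (y - t) + norm ?D)) \<longlongrightarrow> \<bar>R t - R t\<bar> * (0 + norm ?D)) ?F"
        by (intro tendsto_intros limR n)
      then have u: "((\<lambda>y. \<bar>R y - R t\<bar> * (norm ((\<Phi> y - \<Phi> t) - (y - t) *\<^sub>R ?D) / norm (y - t) + norm ?D)) \<longlongrightarrow> 0) ?F" by simp
      show "((\<lambda>y. norm (((R y - R t) *\<^sub>R \<Phi> y - (R t - R t) *\<^sub>R \<Phi> t) - (y - t) *\<^sub>R 0) / norm (y - t)) \<longlongrightarrow> 0) ?F"
      proof (rule tendsto_sandwich[OF _ _ tendsto_const u])
        show "\<forall>\<^sub>F y in ?F. norm (((R y - R t) *\<^sub>R \<Phi> y - (R t - R t) *\<^sub>R \<Phi> t) - (y - t) *\<^sub>R 0) / norm (y - t)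
             \<le> \<bar>R y - R t\<bar> * (norm ((\<Phi> y - \<Phi> t) - (y - t) *\<^sub>R ?D) / norm (y - t) + norm ?D)"
          unfolding eventually_at_filter
        proof (intro always_eventually allI impI)
          fix y assume "y \<noteq> t"
          then have p: "norm (y - t) > 0" by simp
          have "norm (\<Phi> y) \<le> norm ((\<Phi> y - \<Phi> t) - (y - t) *\<^sub>R ?D) + norm (y - t) * norm ?D"
            using norm_triangle_ineq[of "(\<Phi> y - \<Phi> t) - (y - t) *\<^sub>R ?D" "(y - t) *\<^sub>R ?D"] True by simp
          then have "norm (\<Phi> y) / norm (y - t) \<le> norm ((\<Phi> y - \<Phi> t) - (y - t) *\<^sub>R ?D) / norm (y - t) + norm ?D"
            using p by (simp add: field_simps)
          then have "\<bar>R y - R t\<bar> * (norm (\<Phi> y) / norm (y - t)) \<le> \<bar>R y - R t\<bar> * (norm ((\<Phi> y - \<Phi> t) - (y - t) *\<^sub>R ?D) / norm (y - t) + norm ?D)"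
            by (rule mult_left_mono) simp
          then show "norm (((R y - R t) *\<^sub>R \<Phi> y - (R t - R t) *\<^sub>R \<Phi> t) - (y - t) *\<^sub>R 0) / norm (y - t)
             \<le> \<bar>R y - R t\<bar> * (norm ((\<Phi> y - \<Phi> t) - (y - t) *\<^sub>R ?D) / norm (y - t) + norm ?D)" by simp
        qed
      qed simp
    qed (simp add: bounded_linear_zero)
    have "((\<lambda>y. R t *\<^sub>R \<Phi> y + (R y - R t) *\<^sub>R \<Phi> y) has_vector_derivative R t *\<^sub>R ?D + 0) ?F"
      by (rule has_vector_derivative_add[OF 1 2])
    then show ?thesis using eq[OF t] True by (simp add: scaleR_diff_left)
  next
    case False
    have "((\<lambda>y. norm (\<Psi> y - r t *\<^sub>R \<Phi> y) / norm (\<Phi> y)) \<longlongrightarrow> norm (\<Psi> t - r t *\<^sub>R \<Phi> t) / norm (\<Phi> t)) ?F"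
      using False by (intro tendsto_intros lim\<Phi> lim\<Psi>) auto
    then have 0: "((\<lambda>y. norm (\<Psi> y - r t *\<^sub>R \<Phi> y) / norm (\<Phi> y)) \<longlongrightarrow> 0) ?F" using eq[OF t] by simp
    have nz: "\<forall>\<^sub>F y in ?F. \<Phi> y \<noteq> 0" using tendsto_imp_eventually_ne[OF lim\<Phi> False] .
    have "\<forall>\<^sub>F y in ?F. norm (\<Psi> y - r t *\<^sub>R \<Phi> y) / norm (\<Phi> y) = norm (r y - r t)"
      using nz inS
    proof eventually_elim
      case (elim y)
      have "\<Psi> y - r t *\<^sub>R \<Phi> y = (r y - r t) *\<^sub>R \<Phi> y" using eq[OF elim(2)] by (simp add: scaleR_diff_left)
      then show ?case using elim(1) by simp
    qed
    then have "((\<lambda>y. norm (r y - r t)) \<longlongrightarrow> 0) ?F" by (rule Lim_transform_eventually[OF 0])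
    then have "(r \<longlongrightarrow> r t) ?F" unfolding tendsto_norm_zero_iff by (rule LIM_zero_cancel)
    then have "continuous (at t within {0..T} - {}) r" by (simp add: continuous_within)
    from integral_has_vector_derivative_continuous_at[OF rHK _ _ this] t
    have "((\<lambda>u. integral {0..u} r) has_vector_derivative r t) ?F" by simp
    then have "(R has_vector_derivative r t) ?F"
      by (rule has_vector_derivative_transform[OF t, rotated]) (rule Req[symmetric])
    then have "(R has_field_derivative r t) ?F" by (simp add: has_real_derivative_iff_has_vector_derivative)
    from has_vector_derivative_scaleR[OF this d\<Phi>] show ?thesis using eq[OF t] by (simp add: add.commute)
  qed
qed

text \<open>
  The primitive of \<open>r\<close> is at most a multiple of \<open>sqrt s\<close>, so the uniform integrability of
  \<open>sqrt s \<phi> s\<close> carries over to its product with \<open>\<phi>\<close>; \<open>\<Psi>\<close> is continuous, hence bounded. Both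
  integrals exist, and functionals reduce their sum to the fundamental theorem of calculus for the
  product of the primitive with \<open>\<Phi>\<close>, which is differentiable at every point.
\<close>

lemma bi1_integral_by_parts:
  fixes \<Phi> \<Psi> :: "real \<Rightarrow> 'x::banach" and r :: "real \<Rightarrow> real"
  assumes \<Phi>: "\<Phi> differentiable_on {0..T}" and \<Psi>: "continuous_on {0..T} \<Psi>"
    and eq: "\<And>t. t \<in> {0..T} \<Longrightarrow> \<Psi> t = r t *\<^sub>R \<Phi> t" and r: "square_integrable (lebesgue_on {0..T}) r"
    and ui: "scalarly_ui (lebesgue_on {0..T}) (\<lambda>s. sqrt s *\<^sub>R frechet_deriv_on T \<Phi> s)"
  defines "R \<equiv> (\<lambda>t. \<integral>x. r x \<partial>lebesgue_on {0..t})"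
  shows "bi1_integrable (lebesgue_on {0..T}) (\<lambda>s. R s *\<^sub>R frechet_deriv_on T \<Phi> s)"
    and "t \<in> {0..T} \<Longrightarrow> bi1_integral (lebesgue_on {0..t}) \<Psi> + bi1_integral (lebesgue_on {0..t}) (\<lambda>s. R s *\<^sub>R frechet_deriv_on T \<Phi> s) = R t *\<^sub>R \<Phi> t"
proof -
  let ?L = "lebesgue_on {0..T}" and ?\<phi> = "frechet_deriv_on T \<Phi>"
  interpret L: finite_measure ?L by (rule finite_lebesgue_on)
  have ri: "integrable ?L r"
    using r unfolding square_integrable_def by (elim conjE) (rule L.square_integrable_imp_integrable)
  have Rc: "continuous_on {0..T} R" unfolding R_def by (rule continuous_on_integral_lebesgue_on[OF ri])
  have s\<phi>: "smeas ?L ?\<phi>" by (rule smeas_frechet_deriv_on[OF \<Phi>])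
  have idL: "(\<lambda>s. s) \<in> borel_measurable ?L" using id_borel_measurable_lebesgue_on[of "{0..T}"] by (simp add: id_def)
  have sq: "smeas ?L (\<lambda>s. sqrt s *\<^sub>R ?\<phi> s)" using idL by (intro smeas_scaleR s\<phi>) measurable
  have Rm: "R \<in> borel_measurable ?L" using smeasD(1)[OF smeas_lebesgue_on_continuous[OF Rc]] .
  have sR: "smeas ?L (\<lambda>s. R s *\<^sub>R ?\<phi> s)" by (intro smeas_scaleR s\<phi> Rm)
  from integral_le_sqrt[OF r] obtain K where K: "K \<ge> 0" "\<forall>s\<in>{0..T}. \<bar>R s\<bar> \<le> K * sqrt s" unfolding R_def by (elim exE conjE)
  have uR: "scalarly_ui ?L (\<lambda>s. R s *\<^sub>R ?\<phi> s)"
  proof (rule scalarly_ui_dominated[OF ui sq K(1)])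
    fix s and x' :: "'x \<Rightarrow>\<^sub>L real" assume "s \<in> space ?L"
    then have "\<bar>R s\<bar> \<le> K * sqrt s" "0 \<le> s" using K(2) by auto
    then have "\<bar>R s\<bar> * \<bar>blinfun_apply x' (?\<phi> s)\<bar> \<le> (K * sqrt s) * \<bar>blinfun_apply x' (?\<phi> s)\<bar>" by (intro mult_right_mono) auto
    then show "\<bar>blinfun_apply x' (R s *\<^sub>R ?\<phi> s)\<bar> \<le> K * \<bar>blinfun_apply x' (sqrt s *\<^sub>R ?\<phi> s)\<bar>"
      using \<open>0 \<le> s\<close> by (simp add: blinfun.scaleR_right abs_mult mult_ac)
  qed
  show "bi1_integrable ?L (\<lambda>s. R s *\<^sub>R ?\<phi> s)"
    using scalarly_ui_imp_has_bi1_integral[OF L.finite_measure_axioms uR sR] unfolding bi1_integrable_def by blast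
  assume t: "t \<in> {0..T}"
  let ?Lt = "lebesgue_on {0..t}"
  interpret Lt: finite_measure ?Lt by (rule finite_lebesgue_on)
  have sub: "{0..t} \<subseteq> {0..T}" using t by auto
  have tm: "{0..t} \<in> sets ?L" using sub by (simp add: sets_restrict_space_iff)
  have uRt: "scalarly_ui ?Lt (\<lambda>s. R s *\<^sub>R ?\<phi> s)" and sRt: "smeas ?Lt (\<lambda>s. R s *\<^sub>R ?\<phi> s)"
    unfolding lebesgue_on_subinterval[OF sub] using uR sR tm by (auto intro: scalarly_ui_restrict_space smeas_restrict_space)
  have \<Psi>t: "continuous_on {0..t} \<Psi>" by (rule continuous_on_subset[OF \<Psi> sub])
  have s\<Psi>: "smeas ?Lt \<Psi>" by (rule smeas_lebesgue_on_continuous[OF \<Psi>t])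
  have "bounded (\<Psi> ` {0..t})" by (rule compact_imp_bounded[OF compact_continuous_image[OF \<Psi>t]]) simp
  then obtain B where B: "\<forall>s\<in>{0..t}. norm (\<Psi> s) \<le> B" by (auto simp: bounded_iff)
  have u\<Psi>: "scalarly_ui ?Lt \<Psi>" by (rule scalarly_ui_bounded[OF Lt.finite_measure_axioms, of _ B]) (use B in auto)
  from scalarly_ui_imp_has_bi1_integral[OF Lt.finite_measure_axioms uRt sRt]
  obtain I where I: "has_bi1_integral ?Lt (\<lambda>s. R s *\<^sub>R ?\<phi> s) I"
    "\<forall>x' :: 'x \<Rightarrow>\<^sub>L real. blinfun_apply x' I = (\<integral>s. blinfun_apply x' (R s *\<^sub>R ?\<phi> s) \<partial>?Lt)" by (elim exE conjE)
  from scalarly_ui_imp_has_bi1_integral[OF Lt.finite_measure_axioms u\<Psi> s\<Psi>]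
  obtain J where J: "has_bi1_integral ?Lt \<Psi> J"
    "\<forall>x' :: 'x \<Rightarrow>\<^sub>L real. blinfun_apply x' J = (\<integral>s. blinfun_apply x' (\<Psi> s) \<partial>?Lt)" by (elim exE conjE)
  have R0: "R 0 = 0" by (simp only: R_def integral_lebesgue_on_0)
  have "((\<lambda>s. \<Psi> s + R s *\<^sub>R ?\<phi> s) has_integral (R t *\<^sub>R \<Phi> t - R 0 *\<^sub>R \<Phi> 0)) {0..t}"
  proof (rule fundamental_theorem_of_calculus)
    fix s assume s: "s \<in> {0..t}"
    then have "s \<in> {0..T}" using sub by auto
    from product_with_primitive_derivative[OF \<Phi> \<Psi> eq ri this]
    show "((\<lambda>t. R t *\<^sub>R \<Phi> t) has_vector_derivative \<Psi> s + R s *\<^sub>R ?\<phi> s) (at s within {0..t})"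
      unfolding R_def by (rule has_vector_derivative_within_subset[OF _ sub])
  qed (use t in simp)
  then have ftc: "((\<lambda>s. \<Psi> s + R s *\<^sub>R ?\<phi> s) has_integral R t *\<^sub>R \<Phi> t) {0..t}" by (simp add: R0)
  have "J + I = R t *\<^sub>R \<Phi> t"
  proof (rule eq_by_functionals)
    fix x' :: "'x \<Rightarrow>\<^sub>L real"
    have i1: "integrable ?Lt (\<lambda>s. blinfun_apply x' (\<Psi> s))" by (rule scalarly_ui_integrable[OF Lt.finite_measure_axioms u\<Psi> s\<Psi>])
    have i2: "integrable ?Lt (\<lambda>s. blinfun_apply x' (R s *\<^sub>R ?\<phi> s))" by (rule scalarly_ui_integrable[OF Lt.finite_measure_axioms uRt sRt])
    have "blinfun_apply x' (J + I) = (\<integral>s. blinfun_apply x' (\<Psi> s + R s *\<^sub>R ?\<phi> s) \<partial>?Lt)"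
      using I(2) J(2) i1 i2 by (simp add: blinfun.add_right)
    also have "\<dots> = integral {0..t} (\<lambda>s. blinfun_apply x' (\<Psi> s + R s *\<^sub>R ?\<phi> s))"
      using i1 i2 by (intro lebesgue_integral_eq_integral) (auto simp: blinfun.add_right)
    also have "\<dots> = blinfun_apply x' (R t *\<^sub>R \<Phi> t)"
      using has_integral_linear[OF ftc blinfun.bounded_linear_right] by (intro integral_unique) (simp add: o_def)
    finally show "blinfun_apply x' (J + I) = blinfun_apply x' (R t *\<^sub>R \<Phi> t)" .
  qed
  then show "bi1_integral ?Lt \<Psi> + bi1_integral ?Lt (\<lambda>s. R s *\<^sub>R ?\<phi> s) = R t *\<^sub>R \<Phi> t"
    using bi1_integral_eqI[OF I(1)] bi1_integral_eqI[OF J(1)] by simp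
qed

section \<open>The path integral as a strongly measurable random variable\<close>

lemma has_bi1_integral_norm_le:
  fixes f :: "'a \<Rightarrow> 'x::banach"
  assumes M: "finite_measure M" and f: "scalarly_ui M f" and sf: "smeas M f" and I: "has_bi1_integral M f I"
    and K: "K \<ge> 0" "\<And>x' :: 'x \<Rightarrow>\<^sub>L real. norm x' \<le> 1 \<Longrightarrow> (\<integral>\<^sup>+x. ennreal \<bar>blinfun_apply x' (f x)\<bar> \<partial>M) \<le> ennreal K"
  shows "norm I \<le> K"
proof (rule norm_le_by_functionals)
  fix x' :: "'x \<Rightarrow>\<^sub>L real" assume x': "norm x' \<le> 1"
  from scalarly_ui_imp_has_bi1_integral[OF M f sf] obtain J where J: "has_bi1_integral M f J"
    "\<forall>x' :: 'x \<Rightarrow>\<^sub>L real. blinfun_apply x' J = (\<integral>x. blinfun_apply x' (f x) \<partial>M)" by (elim exE conjE)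
  have "I = J" by (rule has_bi1_integral_unique[OF I J(1)])
  have "ennreal \<bar>blinfun_apply x' I\<bar> \<le> (\<integral>\<^sup>+x. ennreal \<bar>blinfun_apply x' (f x)\<bar> \<partial>M)"
    using integral_norm_bound_ennreal[OF scalarly_ui_integrable[OF M f sf, of x']] J(2) \<open>I = J\<close> by simp
  also have "\<dots> \<le> ennreal K" by (rule K(2)[OF x'])
  finally show "\<bar>blinfun_apply x' I\<bar> \<le> K" using K(1) by simp
qed

text \<open>
  The measure, the filtration and the Brownian motion are parameters, because the martingale property
  is needed for the shifted process under the new measure.
\<close>

locale brownian_integrand = brownian M F T w for M :: "'w measure" and F T w +
  fixes \<Phi> :: "real \<Rightarrow> 'x::banach"
  assumes T: "0 < T" and diff: "\<Phi> differentiable_on {0..T}"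
    and integ: "\<And>\<omega>. \<omega> \<in> space M \<Longrightarrow> bi1_integrable (lebesgue_on {0..T}) (\<lambda>s. w s \<omega> *\<^sub>R frechet_deriv_on T \<Phi> s)"
begin

abbreviation \<phi> where "\<phi> \<equiv> frechet_deriv_on T \<Phi>"

abbreviation L where "L \<equiv> lebesgue_on {0..T}"

sublocale L: finite_measure L by (rule finite_lebesgue_on)

text \<open>
  The paths on which the integrals below are meaningful. This set need not be measurable; it contains
  almost every path.
\<close>

definition regular_paths where "regular_paths = {\<omega>\<in>space M. continuous_on {0..T} (\<lambda>t. w t \<omega>) \<and> w 0 \<omega> = 0}"

lemma AE_regular_paths: "AE \<omega> in M. \<omega> \<in> regular_paths"
  using continuous_paths starts_at_0 AE_space by eventually_elim (simp add: regular_paths_def)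

lemma idL: "(\<lambda>s. s) \<in> borel_measurable L"
  using id_borel_measurable_lebesgue_on[of "{0..T}"] by (simp add: id_def)

lemma smeas_\<phi>: "smeas L \<phi>" by (rule smeas_frechet_deriv_on[OF diff])

lemma smeas_sqrt: "smeas L (\<lambda>s. sqrt s *\<^sub>R \<phi> s)"
  using idL by (intro smeas_scaleR smeas_\<phi>) measurable

lemma path_measurable: "\<omega> \<in> regular_paths \<Longrightarrow> (\<lambda>s. w s \<omega>) \<in> borel_measurable L"
  by (rule smeasD(1)[OF smeas_lebesgue_on_continuous]) (simp add: regular_paths_def)

lemma path_smeas: "\<omega> \<in> regular_paths \<Longrightarrow> smeas L (\<lambda>s. w s \<omega> *\<^sub>R \<phi> s)"
  by (intro smeas_scaleR smeas_\<phi> path_measurable)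

lemma path_ui: "\<omega> \<in> regular_paths \<Longrightarrow> scalarly_ui L (\<lambda>s. w s \<omega> *\<^sub>R \<phi> s)"
  using integ[of \<omega>] has_bi1_integral_imp_scalarly_ui[OF L.finite_measure_axioms path_smeas]
  unfolding bi1_integrable_def by (auto simp: regular_paths_def)

lemma sqrt_ui: "scalarly_ui L (\<lambda>s. sqrt s *\<^sub>R \<phi> s)"
  using AE_regular_paths by (intro path_ui_imp_sqrt_ui T smeas_\<phi>) (auto elim!: eventually_mono intro: path_ui)

lemma initial_subset: "t \<in> {0..T} \<Longrightarrow> {0..t} \<subseteq> {0..T}" by auto

lemma initial_sets: "t \<in> {0..T} \<Longrightarrow> {0..t} \<in> sets L" by (auto simp: sets_restrict_space_iff)

lemma restrict_initial:
  assumes "t \<in> {0..T}"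
  shows "smeas L f \<Longrightarrow> smeas (lebesgue_on {0..t}) f" "scalarly_ui L f \<Longrightarrow> scalarly_ui (lebesgue_on {0..t}) f"
  unfolding lebesgue_on_subinterval[OF initial_subset[OF assms]]
  using initial_sets[OF assms] by (auto intro: smeas_restrict_space scalarly_ui_restrict_space)

definition path_integral where "path_integral t \<omega> = bi1_integral (lebesgue_on {0..t}) (\<lambda>s. w s \<omega> *\<^sub>R \<phi> s)"

lemma has_bi1_path_integral:
  assumes "\<omega> \<in> regular_paths" "t \<in> {0..T}"
  shows "has_bi1_integral (lebesgue_on {0..t}) (\<lambda>s. w s \<omega> *\<^sub>R \<phi> s) (path_integral t \<omega>)"
    and "blinfun_apply x' (path_integral t \<omega>) = (\<integral>s. indicator {0<..t} s * (w s \<omega> * blinfun_apply x' (\<phi> s)) \<partial>L)"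
proof -
  from scalarly_ui_imp_has_bi1_integral[OF finite_lebesgue_on restrict_initial(2)[OF assms(2) path_ui[OF assms(1)]] restrict_initial(1)[OF assms(2) path_smeas[OF assms(1)]]]
  obtain I where I: "has_bi1_integral (lebesgue_on {0..t}) (\<lambda>s. w s \<omega> *\<^sub>R \<phi> s) I"
    "\<forall>x' :: 'x \<Rightarrow>\<^sub>L real. blinfun_apply x' I = (\<integral>s. blinfun_apply x' (w s \<omega> *\<^sub>R \<phi> s) \<partial>lebesgue_on {0..t})" by (elim exE conjE)
  have XI: "path_integral t \<omega> = I" unfolding path_integral_def by (rule bi1_integral_eqI[OF I(1)])
  show "has_bi1_integral (lebesgue_on {0..t}) (\<lambda>s. w s \<omega> *\<^sub>R \<phi> s) (path_integral t \<omega>)" using I(1) XI by simp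
  have int: "integrable L (\<lambda>s. blinfun_apply x' (w s \<omega> *\<^sub>R \<phi> s))"
    by (rule scalarly_ui_integrable[OF L.finite_measure_axioms path_ui[OF assms(1)] path_smeas[OF assms(1)]])
  show "blinfun_apply x' (path_integral t \<omega>) = (\<integral>s. indicator {0<..t} s * (w s \<omega> * blinfun_apply x' (\<phi> s)) \<partial>L)"
    using integral_lebesgue_on_increment[OF int, of 0 t, unfolded integral_lebesgue_on_0] assms(2) I(2) XI
    by (simp add: blinfun.scaleR_right)
qed

text \<open>
  Away from \<open>0\<close> the weight \<open>sqrt s\<close> is bounded below, so every bounded multiplier that vanishes near
  \<open>0\<close> gives an integrable product with \<open>\<phi>\<close>.
\<close>

lemma cut_integrand:
  assumes t: "t \<in> {0..T}" and h: "h \<in> borel_measurable L" "\<forall>s\<in>{0..T}. \<bar>h s\<bar> \<le> B * indicator {\<delta>..} s" and "\<delta> > 0" "B \<ge> 0"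
  shows "scalarly_ui (lebesgue_on {0..t}) (\<lambda>s. h s *\<^sub>R \<phi> s)" "smeas (lebesgue_on {0..t}) (\<lambda>s. h s *\<^sub>R \<phi> s)"
proof -
  show "smeas (lebesgue_on {0..t}) (\<lambda>s. h s *\<^sub>R \<phi> s)" by (intro restrict_initial[OF t] smeas_scaleR h smeas_\<phi>)
  have "scalarly_ui L (\<lambda>s. h s *\<^sub>R \<phi> s)"
  proof (rule scalarly_ui_dominated[OF sqrt_ui smeas_sqrt])
    show "0 \<le> B / sqrt \<delta>" using assms by simp
    fix s and x' :: "'x \<Rightarrow>\<^sub>L real" assume "s \<in> space L"
    then have s: "s \<in> {0..T}" by simp
    have "\<bar>h s\<bar> \<le> B / sqrt \<delta> * sqrt s"
    proof (cases "\<delta> \<le> s")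
      case True
      then have "B * sqrt \<delta> \<le> B * sqrt s" using assms by (intro mult_left_mono) auto
      then have "B \<le> B / sqrt \<delta> * sqrt s" using \<open>\<delta> > 0\<close> by (simp add: field_simps)
      then show ?thesis using h(2)[rule_format, OF s] True by simp
    next
      case False
      then show ?thesis using h(2)[rule_format, OF s] assms s by simp
    qed
    then have "\<bar>h s\<bar> * \<bar>blinfun_apply x' (\<phi> s)\<bar> \<le> (B / sqrt \<delta> * sqrt s) * \<bar>blinfun_apply x' (\<phi> s)\<bar>" by (rule mult_right_mono) simp
    then show "\<bar>blinfun_apply x' (h s *\<^sub>R \<phi> s)\<bar> \<le> B / sqrt \<delta> * \<bar>blinfun_apply x' (sqrt s *\<^sub>R \<phi> s)\<bar>"
      using s by (simp add: blinfun.scaleR_right abs_mult mult_ac)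
  qed
  then show "scalarly_ui (lebesgue_on {0..t}) (\<lambda>s. h s *\<^sub>R \<phi> s)" by (rule restrict_initial[OF t])
qed

lemma cut_has_integral:
  assumes t: "t \<in> {0..T}" and h: "h \<in> borel_measurable L" "\<forall>s\<in>{0..T}. \<bar>h s\<bar> \<le> B * indicator {\<delta>..} s" and "\<delta> > 0" "B \<ge> 0"
  shows "has_bi1_integral (lebesgue_on {0..t}) (\<lambda>s. h s *\<^sub>R \<phi> s) (bi1_integral (lebesgue_on {0..t}) (\<lambda>s. h s *\<^sub>R \<phi> s))"
  using scalarly_ui_imp_has_bi1_integral[OF finite_lebesgue_on cut_integrand[OF assms]]
  by (intro has_bi1_integral_integral) (auto simp: bi1_integrable_def)

text \<open>
  On multipliers that vanish below \<open>\<delta>\<close>, integration against \<open>\<phi>\<close> is bounded with respect to the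
  supremum norm.
\<close>

lemma cut_norm_bound:
  assumes t: "t \<in> {0..T}" and "\<delta> > 0"
  shows "\<exists>K\<ge>0. \<forall>h B. h \<in> borel_measurable L \<longrightarrow> B \<ge> 0 \<longrightarrow> (\<forall>s\<in>{0..T}. \<bar>h s\<bar> \<le> B * indicator {\<delta>..} s) \<longrightarrow>
     norm (bi1_integral (lebesgue_on {0..t}) (\<lambda>s. h s *\<^sub>R \<phi> s)) \<le> B * K"
proof -
  let ?Lt = "lebesgue_on {0..t}"
  have i: "(indicator {\<delta>..} :: real \<Rightarrow> real) \<in> borel_measurable L" by (rule measurable_compose[OF idL]) simp
  have "\<forall>s\<in>{0..T}. \<bar>indicator {\<delta>..} s :: real\<bar> \<le> 1 * indicator {\<delta>..} s" by simp
  note cut = cut_integrand[OF t i this assms(2) zero_le_one]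
  from scalarly_ui_bounded_integrals[OF finite_lebesgue_on cut] obtain K where K: "K \<ge> 0"
    "\<forall>x' :: 'x \<Rightarrow>\<^sub>L real. norm x' \<le> 1 \<longrightarrow> (\<integral>\<^sup>+s. ennreal \<bar>blinfun_apply x' (indicator {\<delta>..} s *\<^sub>R \<phi> s)\<bar> \<partial>?Lt) \<le> ennreal K" by (elim exE conjE)
  show ?thesis
  proof (intro exI[of _ K] conjI allI impI K(1))
    fix h :: "real \<Rightarrow> real" and B :: real assume h: "h \<in> borel_measurable L" "B \<ge> 0" "\<forall>s\<in>{0..T}. \<bar>h s\<bar> \<le> B * indicator {\<delta>..} s"
    note hb = h(3)
    show "norm (bi1_integral ?Lt (\<lambda>s. h s *\<^sub>R \<phi> s)) \<le> B * K"
    proof (rule has_bi1_integral_norm_le[OF finite_lebesgue_on cut_integrand[OF t h(1) hb assms(2) h(2)] cut_has_integral[OF t h(1) hb assms(2) h(2)]])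
      show "B * K \<ge> 0" using K h by simp
      fix x' :: "'x \<Rightarrow>\<^sub>L real" assume x': "norm x' \<le> 1"
      have "(\<integral>\<^sup>+s. ennreal \<bar>blinfun_apply x' (h s *\<^sub>R \<phi> s)\<bar> \<partial>?Lt) \<le> (\<integral>\<^sup>+s. ennreal B * ennreal \<bar>blinfun_apply x' (indicator {\<delta>..} s *\<^sub>R \<phi> s)\<bar> \<partial>?Lt)"
      proof (rule nn_integral_mono)
        fix s assume "s \<in> space ?Lt"
        then have "s \<in> {0..T}" using t by auto
        from mult_right_mono[OF hb[rule_format, OF this], of "\<bar>blinfun_apply x' (\<phi> s)\<bar>"]
        show "ennreal \<bar>blinfun_apply x' (h s *\<^sub>R \<phi> s)\<bar> \<le> ennreal B * ennreal \<bar>blinfun_apply x' (indicator {\<delta>..} s *\<^sub>R \<phi> s)\<bar>"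
          using h(2) by (simp add: ennreal_mult[symmetric] blinfun.scaleR_right abs_mult mult_ac ennreal_leI)
      qed
      also have "\<dots> = ennreal B * (\<integral>\<^sup>+s. ennreal \<bar>blinfun_apply x' (indicator {\<delta>..} s *\<^sub>R \<phi> s)\<bar> \<partial>?Lt)"
        using smeas_functional[OF cut(2), of x'] by (intro nn_integral_cmult) measurable
      also have "\<dots> \<le> ennreal B * ennreal K" using K(2) x' by (intro mult_left_mono) auto
      finally show "(\<integral>\<^sup>+s. ennreal \<bar>blinfun_apply x' (h s *\<^sub>R \<phi> s)\<bar> \<partial>?Lt) \<le> ennreal (B * K)"
        using K h by (simp add: ennreal_mult)
    qed
  qed
qed

text \<open>
  The path is first cut off below \<open>1 / (j + 1)\<close>. On what remains it is replaced by a step function in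
  time; the integral of a step function against \<open>\<phi>\<close> is a finite combination of values of the path with
  deterministic vectors, hence adapted. Uniform continuity of the path and the bound for cut integrands
  let the mesh tend to \<open>0\<close>, and uniform integrability along the path then lets \<open>j\<close> tend to infinity.
  Each limit is taken on the set where it exists, so the result is measurable for \<open>F t\<close> itself.
\<close>

lemma path_integral_adapted:
  assumes t: "t \<in> {0..T}"
  shows "\<exists>g. smeas (F t) g \<and> (\<forall>\<omega>\<in>regular_paths. g \<omega> = path_integral t \<omega>)"
proof -
  let ?Lt = "lebesgue_on {0..t}"
  define cell where "cell j m k = {s::real. 1 / real (Suc j) \<le> s \<and> \<lfloor>real (Suc m) * s\<rfloor> = int k}" for j m k :: nat
  have cellm: "(\<lambda>s. indicator (cell j m k) s :: real) \<in> borel_measurable L" for j m k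
    unfolding cell_def by (rule measurable_compose[OF idL]) measurable
  have cellb: "\<forall>s\<in>{0..T}. \<bar>indicator (cell j m k) s :: real\<bar> \<le> 1 * indicator {1 / real (Suc j)..} s" for j m k
    by (auto simp: cell_def indicator_def)
  define V where "V j m k = bi1_integral ?Lt (\<lambda>s. (indicator (cell j m k) s :: real) *\<^sub>R \<phi> s)" for j m k
  have V: "has_bi1_integral ?Lt (\<lambda>s. (indicator (cell j m k) s :: real) *\<^sub>R \<phi> s) (V j m k)" for j m k
    unfolding V_def by (rule cut_has_integral[OF t cellm cellb]) auto
  define n where "n m = nat \<lfloor>real (Suc m) * t\<rfloor>" for m
  have nt: "real k / real (Suc m) \<le> t" if "k \<le> n m" for k m
  proof -
    have "int k \<le> \<lfloor>real (Suc m) * t\<rfloor>" using that t unfolding n_def by (simp add: le_nat_iff)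
    then have "real k \<le> real (Suc m) * t" by (simp add: le_floor_iff)
    then show ?thesis by (simp add: pos_divide_le_eq mult.commute)
  qed
  define Y where "Y j m \<omega> = (\<Sum>k\<le>n m. w (real k / real (Suc m)) \<omega> *\<^sub>R V j m k)" for j m \<omega>
  have Ym: "smeas (F t) (Y j m)" for j m
    unfolding Y_def using t nt by (intro smeas_sum smeas_scaleR smeas_const adapted_later) auto
  define Z where "Z j \<omega> = bi1_integral ?Lt (\<lambda>s. (indicator {1 / real (Suc j)..} s * w s \<omega>) *\<^sub>R \<phi> s)" for j \<omega>
  have indm: "(\<lambda>s. indicator {1 / real (Suc j)..} s :: real) \<in> borel_measurable L" for j
    by (rule measurable_compose[OF idL]) simp
  have YZ: "(\<lambda>m. Y j m \<omega>) \<longlonglongrightarrow> Z j \<omega>" if g: "\<omega> \<in> regular_paths" for j \<omega>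
  proof -
    have wc: "continuous_on {0..T} (\<lambda>t. w t \<omega>)" using g by (simp add: regular_paths_def)
    have "bounded ((\<lambda>t. w t \<omega>) ` {0..T})" by (rule compact_imp_bounded[OF compact_continuous_image[OF wc]]) simp
    then obtain B where B: "\<forall>s\<in>{0..T}. \<bar>w s \<omega>\<bar> \<le> B" by (auto simp: bounded_iff)
    then have B0: "B \<ge> 0" using T by (auto dest!: bspec[of _ _ 0])
    have Zi: "has_bi1_integral ?Lt (\<lambda>s. (indicator {1 / real (Suc j)..} s * w s \<omega>) *\<^sub>R \<phi> s) (Z j \<omega>)"
      unfolding Z_def by (rule cut_has_integral[OF t _ _ _ B0, where \<delta> = "1 / real (Suc j)"])
        (use B indm path_measurable[OF g] in \<open>auto simp: indicator_def intro!: borel_measurable_times\<close>)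
    have Yi: "has_bi1_integral ?Lt (\<lambda>s. \<Sum>k\<le>n m. w (real k / real (Suc m)) \<omega> *\<^sub>R ((indicator (cell j m k) s :: real) *\<^sub>R \<phi> s)) (Y j m \<omega>)" for m
      unfolding Y_def by (intro has_bi1_integral_sum has_bi1_integral_scaleR V) simp
    define h where "h m s = (\<Sum>k\<le>n m. w (real k / real (Suc m)) \<omega> * indicator (cell j m k) s) - indicator {1 / real (Suc j)..} s * w s \<omega>" for m s
    have YZi: "has_bi1_integral ?Lt (\<lambda>s. h m s *\<^sub>R \<phi> s) (Y j m \<omega> - Z j \<omega>)" for m
      using has_bi1_integral_diff[OF Yi Zi] unfolding h_def scaleR_diff_left scaleR_sum_left
      by (simp only: scaleR_scaleR)
    have "1 / real (Suc j) > 0" by simp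
    from cut_norm_bound[OF t this] obtain K where K: "K \<ge> 0" "\<forall>h B. h \<in> borel_measurable L \<longrightarrow> B \<ge> 0 \<longrightarrow> (\<forall>s\<in>{0..T}. \<bar>h s\<bar> \<le> B * indicator {1 / real (Suc j)..} s) \<longrightarrow>
       norm (bi1_integral ?Lt (\<lambda>s. h s *\<^sub>R \<phi> s)) \<le> B * K" by (elim exE conjE)
    show ?thesis
    proof (rule LIMSEQ_I)
      fix e :: real assume e: "e > 0"
      define \<eta> where "\<eta> = e / (K + 1)"
      have \<eta>: "\<eta> > 0" "\<eta> * K < e" using e K(1) by (auto simp: \<eta>_def field_simps)
      have "uniformly_continuous_on {0..T} (\<lambda>t. w t \<omega>)" by (rule compact_uniformly_continuous[OF wc]) simp
      then obtain d where d: "d > 0" "\<forall>x\<in>{0..T}. \<forall>x'\<in>{0..T}. dist x' x < d \<longrightarrow> dist (w x' \<omega>) (w x \<omega>) < \<eta>"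
        using \<eta>(1) unfolding uniformly_continuous_on_def by meson
      obtain m0 where m0: "inverse (real (Suc m0)) < d" using reals_Archimedean d(1) by blast
      have "norm (Y j m \<omega> - Z j \<omega>) < e" if m: "m \<ge> m0" for m
      proof -
        define h' where "h' s = indicator {0..t} s * h m s" for s
        have tb: "(indicator {0..t} :: real \<Rightarrow> real) \<in> borel_measurable L" by (rule measurable_compose[OF idL]) simp
        have h'm: "h' \<in> borel_measurable L"
          unfolding h'_def h_def using cellm indm path_measurable[OF g] tb
          by (intro borel_measurable_times borel_measurable_diff borel_measurable_sum) auto
        have h'b: "\<bar>h' s\<bar> \<le> \<eta> * indicator {1 / real (Suc j)..} s" if s: "s \<in> {0..T}" for s
        proof (cases "s \<le> t \<and> 1 / real (Suc j) \<le> s")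
          case False
          then have "h' s = 0" by (auto simp: h'_def h_def cell_def)
          then show ?thesis using \<eta>(1) by simp
        next
          case True
          define k where "k = nat \<lfloor>real (Suc m) * s\<rfloor>"
          have ik: "int k = \<lfloor>real (Suc m) * s\<rfloor>" unfolding k_def using s by simp
          have kn: "k \<le> n m" unfolding k_def n_def using True by (intro nat_mono floor_mono mult_left_mono) auto
          have "(\<Sum>i\<le>n m. w (real i / real (Suc m)) \<omega> * indicator (cell j m i) s) = (\<Sum>i\<le>n m. if i = k then w (real k / real (Suc m)) \<omega> else 0)"
            using True ik by (intro sum.cong) (auto simp: cell_def)
          also have "\<dots> = w (real k / real (Suc m)) \<omega>" using kn by simp
          finally have hs: "h' s = w (real k / real (Suc m)) \<omega> - w s \<omega>" using True s by (simp add: h'_def h_def)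
          have "real k \<le> real (Suc m) * s" "real (Suc m) * s < real k + 1" using ik by linarith+
          then have "real k / real (Suc m) \<le> s" "s < (real k + 1) / real (Suc m)"
            by (simp_all add: pos_less_divide_eq pos_divide_le_eq mult.commute del: of_nat_Suc)
          then have q: "real k / real (Suc m) \<le> s" "s - real k / real (Suc m) < 1 / real (Suc m)"
            by (simp_all add: add_divide_distrib del: of_nat_Suc)
          have "1 / real (Suc m) \<le> 1 / real (Suc m0)" using m by (intro divide_left_mono) auto
          then have "dist (real k / real (Suc m)) s < d" using q m0 by (simp add: dist_real_def inverse_eq_divide)
          moreover have "real k / real (Suc m) \<in> {0..T}" using q s by auto
          ultimately have "dist (w (real k / real (Suc m)) \<omega>) (w s \<omega>) < \<eta>" using d(2) s by blast
          then show ?thesis using True hs by (simp add: dist_real_def)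
        qed
        have "bi1_integral ?Lt (\<lambda>s. h' s *\<^sub>R \<phi> s) = Y j m \<omega> - Z j \<omega>"
          by (rule bi1_integral_eqI, rule has_bi1_integral_cong_null[OF YZi, of "{}"]) (auto simp: h'_def)
        then have "norm (Y j m \<omega> - Z j \<omega>) \<le> \<eta> * K" using K(2)[rule_format, OF h'm less_imp_le[OF \<eta>(1)], OF h'b] by simp
        then show ?thesis using \<eta>(2) by simp
      qed
      then show "\<exists>no. \<forall>m\<ge>no. norm (Y j m \<omega> - Z j \<omega>) < e" by blast
    qed
  qed
  have ZX: "(\<lambda>j. Z j \<omega>) \<longlonglongrightarrow> path_integral t \<omega>" if g: "\<omega> \<in> regular_paths" for \<omega>
  proof (rule LIMSEQ_I)
    fix e :: real assume e: "e > 0"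
    then have e2: "e / 2 > 0" by simp
    note ut = restrict_initial(2)[OF t path_ui[OF g]] and st = restrict_initial(1)[OF t path_smeas[OF g]]
    from scalarly_uiD[OF ut e2] obtain d where d: "d > 0" "\<forall>A\<in>sets ?Lt. \<forall>x' :: 'x \<Rightarrow>\<^sub>L real. measure ?Lt A < d \<longrightarrow> norm x' \<le> 1 \<longrightarrow>
       (\<integral>\<^sup>+s\<in>A. ennreal \<bar>blinfun_apply x' (w s \<omega> *\<^sub>R \<phi> s)\<bar> \<partial>?Lt) \<le> ennreal (e / 2)" by (elim exE conjE)
    obtain j0 where j0: "inverse (real (Suc j0)) < d" using reals_Archimedean d(1) by blast
    have wc: "continuous_on {0..T} (\<lambda>t. w t \<omega>)" using g by (simp add: regular_paths_def)
    have "bounded ((\<lambda>t. w t \<omega>) ` {0..T})" by (rule compact_imp_bounded[OF compact_continuous_image[OF wc]]) simp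
    then obtain B where B: "\<forall>s\<in>{0..T}. \<bar>w s \<omega>\<bar> \<le> B" by (auto simp: bounded_iff)
    then have B0: "B \<ge> 0" using T by (auto dest!: bspec[of _ _ 0])
    have "norm (Z j \<omega> - path_integral t \<omega>) < e" if j: "j \<ge> j0" for j
    proof -
      let ?\<delta> = "1 / real (Suc j)"
      have Zi: "has_bi1_integral ?Lt (\<lambda>s. (indicator {?\<delta>..} s * w s \<omega>) *\<^sub>R \<phi> s) (Z j \<omega>)"
        unfolding Z_def by (rule cut_has_integral[OF t _ _ _ B0, where \<delta> = "?\<delta>"])
          (use B indm path_measurable[OF g] in \<open>auto simp: indicator_def intro!: borel_measurable_times\<close>)
      have Di: "has_bi1_integral ?Lt (\<lambda>s. indicator {..<?\<delta>} s *\<^sub>R (w s \<omega> *\<^sub>R \<phi> s)) (path_integral t \<omega> - Z j \<omega>)"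
        by (rule has_bi1_integral_cong_null[OF has_bi1_integral_diff[OF has_bi1_path_integral(1)[OF g t] Zi], of "{}"]) (auto simp: indicator_def)
      have im: "(\<lambda>s. indicator {..<?\<delta>} s :: real) \<in> borel_measurable ?Lt"
      proof -
        have "(\<lambda>s. s) \<in> borel_measurable ?Lt" using id_borel_measurable_lebesgue_on[of "{0..t}"] by (simp add: id_def)
        then show ?thesis by (rule measurable_compose) simp
      qed
      have Ds: "smeas ?Lt (\<lambda>s. indicator {..<?\<delta>} s *\<^sub>R (w s \<omega> *\<^sub>R \<phi> s))" by (intro smeas_scaleR im st)
      have Du: "scalarly_ui ?Lt (\<lambda>s. indicator {..<?\<delta>} s *\<^sub>R (w s \<omega> *\<^sub>R \<phi> s))"
        by (rule scalarly_ui_dominated[OF ut st zero_le_one]) (auto simp: indicator_def blinfun.scaleR_right)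
      have "norm (path_integral t \<omega> - Z j \<omega>) \<le> e / 2"
      proof (rule has_bi1_integral_norm_le[OF finite_lebesgue_on Du Ds Di])
        show "0 \<le> e / 2" using e by simp
        fix x' :: "'x \<Rightarrow>\<^sub>L real" assume x': "norm x' \<le> 1"
        let ?A = "{..<?\<delta>} \<inter> {0..t}"
        have Am: "?A \<in> sets ?Lt" by (auto simp: sets_restrict_space)
        have "measure ?Lt ?A = measure lebesgue ?A" by (intro measure_restrict_space) auto
        also have "\<dots> \<le> measure lebesgue {0..?\<delta>}" by (intro measure_mono_fmeasurable) auto
        also have "\<dots> = ?\<delta>" by simp
        also have "\<dots> \<le> 1 / real (Suc j0)" using j by (intro divide_left_mono) auto
        also have "\<dots> < d" using j0 by (simp add: inverse_eq_divide)
        finally have "(\<integral>\<^sup>+s\<in>?A. ennreal \<bar>blinfun_apply x' (w s \<omega> *\<^sub>R \<phi> s)\<bar> \<partial>?Lt) \<le> ennreal (e / 2)"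
          using d(2) Am x' by blast
        moreover have "(\<integral>\<^sup>+s. ennreal \<bar>blinfun_apply x' (indicator {..<?\<delta>} s *\<^sub>R (w s \<omega> *\<^sub>R \<phi> s))\<bar> \<partial>?Lt)
           = (\<integral>\<^sup>+s\<in>?A. ennreal \<bar>blinfun_apply x' (w s \<omega> *\<^sub>R \<phi> s)\<bar> \<partial>?Lt)"
          by (intro nn_integral_cong) (auto simp: indicator_def)
        ultimately show "(\<integral>\<^sup>+s. ennreal \<bar>blinfun_apply x' (indicator {..<?\<delta>} s *\<^sub>R (w s \<omega> *\<^sub>R \<phi> s))\<bar> \<partial>?Lt) \<le> ennreal (e / 2)" by simp
      qed
      then show ?thesis using e by (simp add: norm_minus_commute)
    qed
    then show "\<exists>no. \<forall>j\<ge>no. norm (Z j \<omega> - path_integral t \<omega>) < e" by blast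
  qed
  have spF: "space (F t) = space M" using filtration[OF t] by (simp add: subalgebra_def)
  have "\<forall>j. \<exists>g. smeas (F t) g \<and> (\<forall>\<omega>\<in>regular_paths. g \<omega> = Z j \<omega>)"
  proof
    fix j
    obtain g where g: "smeas (F t) g" "\<And>\<omega>. \<omega> \<in> space (F t) \<Longrightarrow> convergent (\<lambda>m. Y j m \<omega>) \<Longrightarrow> (\<lambda>m. Y j m \<omega>) \<longlonglongrightarrow> g \<omega>"
      using smeas_limit_where_convergent[of "F t" "Y j", OF Ym] by metis
    have "g \<omega> = Z j \<omega>" if "\<omega> \<in> regular_paths" for \<omega>
      using LIMSEQ_unique[OF g(2) YZ[OF that, of j]] YZ[OF that, of j] that spF by (auto simp: convergent_def regular_paths_def)
    then show "\<exists>g. smeas (F t) g \<and> (\<forall>\<omega>\<in>regular_paths. g \<omega> = Z j \<omega>)" using g(1) by blast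
  qed
  from choice[OF this] obtain g where g: "\<forall>j. smeas (F t) (g j) \<and> (\<forall>\<omega>\<in>regular_paths. g j \<omega> = Z j \<omega>)" ..
  obtain G where G: "smeas (F t) G" "\<And>\<omega>. \<omega> \<in> space (F t) \<Longrightarrow> convergent (\<lambda>j. g j \<omega>) \<Longrightarrow> (\<lambda>j. g j \<omega>) \<longlonglongrightarrow> G \<omega>"
    using smeas_limit_where_convergent[of "F t" g] g by metis
  have "G \<omega> = path_integral t \<omega>" if "\<omega> \<in> regular_paths" for \<omega>
  proof -
    have l: "(\<lambda>j. g j \<omega>) \<longlonglongrightarrow> path_integral t \<omega>" using ZX[OF that] g that by simp
    then show ?thesis using LIMSEQ_unique[OF G(2) l] that spF by (auto simp: convergent_def regular_paths_def)
  qed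
  then show ?thesis using G(1) by blast
qed

end

section \<open>The stochastic Birkhoff integral is a martingale\<close>

context brownian begin

text \<open>
  The inequality \<open>\<bar>x\<bar> \<le> \<eta> / sqrt u x\<^sup>2 + sqrt u / \<eta>\<close> is used on \<open>A\<close>, and the second moment of \<open>w u\<close>
  is \<open>u\<close>. For fixed \<open>\<eta>\<close> the bound is small with \<open>prob A\<close>, at a rate that is uniform in \<open>u\<close> after
  division by \<open>sqrt u\<close>.
\<close>

lemma absolute_moment_on_set:
  assumes u: "u \<in> {0..T}" and A: "A \<in> sets M" and \<eta>: "\<eta> > 0"
  shows "(\<integral>\<^sup>+\<omega>\<in>A. ennreal \<bar>w u \<omega>\<bar> \<partial>M) \<le> ennreal (sqrt u * (\<eta> + prob A / \<eta>))"
proof (cases "u = 0")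
  case True
  have "(\<integral>\<^sup>+\<omega>\<in>A. ennreal \<bar>w u \<omega>\<bar> \<partial>M) = (\<integral>\<^sup>+\<omega>. 0 \<partial>M)"
    using starts_at_0 True by (intro nn_integral_cong_AE) (auto elim: eventually_mono)
  then show ?thesis by simp
next
  case False
  then have pos: "0 < u" "u \<le> T" using u by auto
  note [measurable] = A random_variable_w[OF u]
  have pt: "\<bar>x\<bar> \<le> \<eta> / sqrt u * x\<^sup>2 + sqrt u / \<eta>" for x :: real
  proof -
    have "0 \<le> (\<eta> * \<bar>x\<bar> - sqrt u)\<^sup>2 / (\<eta> * sqrt u)" using \<eta> pos by simp
    also have "\<dots> = \<eta> / sqrt u * x\<^sup>2 + sqrt u / \<eta> - 2 * \<bar>x\<bar>"
      using \<eta> pos by (simp add: power2_diff power_mult_distrib field_simps power2_eq_square)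
    finally show ?thesis by simp
  qed
  have iA: "integrable M (\<lambda>\<omega>. indicator A \<omega> :: real)" using A by (simp add: emeasure_eq_measure)
  note int = Bochner_Integration.integrable_mult_right[of "\<eta> / sqrt u", OF second_moment(1)[OF pos]]
    Bochner_Integration.integrable_mult_right[of "sqrt u / \<eta>", OF iA]
  have "(\<integral>\<^sup>+\<omega>\<in>A. ennreal \<bar>w u \<omega>\<bar> \<partial>M) \<le> (\<integral>\<^sup>+\<omega>. ennreal (\<eta> / sqrt u * (w u \<omega>)\<^sup>2 + sqrt u / \<eta> * indicator A \<omega>) \<partial>M)"
  proof (rule nn_integral_mono)
    fix \<omega>
    have "0 \<le> \<eta> / sqrt u * (w u \<omega>)\<^sup>2" using \<eta> pos by simp
    then show "ennreal \<bar>w u \<omega>\<bar> * indicator A \<omega> \<le> ennreal (\<eta> / sqrt u * (w u \<omega>)\<^sup>2 + sqrt u / \<eta> * indicator A \<omega>)"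
      using pt[of "w u \<omega>"] by (auto simp: indicator_def intro: ennreal_leI)
  qed
  also have "\<dots> = ennreal (\<integral>\<omega>. \<eta> / sqrt u * (w u \<omega>)\<^sup>2 + sqrt u / \<eta> * indicator A \<omega> \<partial>M)"
    by (intro nn_integral_eq_integral AE_I2 Bochner_Integration.integrable_add int) (use \<eta> pos in auto)
  also have "(\<integral>\<omega>. \<eta> / sqrt u * (w u \<omega>)\<^sup>2 + sqrt u / \<eta> * indicator A \<omega> \<partial>M) = \<eta> / sqrt u * u + sqrt u / \<eta> * prob A"
    using second_moment(2)[OF pos] sets.sets_into_space[OF A] by (subst Bochner_Integration.integral_add[OF int]) (simp add: Int_absorb2)
  also have "\<dots> = sqrt u * (\<eta> + prob A / \<eta>)"
    using pos arg_cong[OF real_div_sqrt[of u], of "(*) \<eta>"] by (simp add: algebra_simps)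
  finally show ?thesis .
qed

lemma integrable_w: "u \<in> {0..T} \<Longrightarrow> integrable M (w u)"
  using absolute_moment_on_set[of u "space M" 1] random_variable_w[of u]
  by (intro integrableI_bounded) (auto intro: le_less_trans simp: ennreal_less_top)

lemma increment_orthogonal:
  assumes st: "0 \<le> s" "s \<le> u" "u \<le> T" and E: "E \<in> sets (F s)"
  shows "(\<integral>\<omega>. indicator E \<omega> * w u \<omega> \<partial>M) = (\<integral>\<omega>. indicator E \<omega> * w s \<omega> \<partial>M)"
proof (cases "s = u")
  case False
  then have lt: "s < u" using st by simp
  have EM: "E \<in> sets M" using E filtration[of s] st by (auto simp: subalgebra_def)
  let ?D = "density lborel (\<lambda>x. ennreal (normal_density 0 (sqrt (u - s)) x))"
  have pos: "sqrt (u - s) > 0" using lt by simp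
  define h :: "'w \<times> real \<Rightarrow> real" where "h = (\<lambda>(\<omega>, x). indicator E \<omega> * x)"
  have hm: "h \<in> borel_measurable (F s \<Otimes>\<^sub>M borel)" unfolding h_def split_beta' using E by measurable
  have Di: "integrable ?D (\<lambda>x. x)"
    using integrable_normal_moment_nz_1[OF pos, of 0] by (subst integrable_real_density) auto
  have D0: "(\<integral>x. x \<partial>?D) = 0"
    using integral_normal_moment_nz_1[OF pos, of 0] by (subst integral_real_density) auto
  have "(\<integral>\<^sup>+\<omega>. \<integral>\<^sup>+x. norm (h (\<omega>, x)) \<partial>?D \<partial>M) \<le> (\<integral>\<^sup>+\<omega>. (\<integral>\<^sup>+x. norm x \<partial>?D) \<partial>M)"
    by (intro nn_integral_mono) (auto simp: h_def indicator_def)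
  also have "\<dots> < \<infinity>" using Di by (simp add: integrable_iff_bounded emeasure_space_1)
  finally have fin: "(\<integral>\<^sup>+\<omega>. \<integral>\<^sup>+x. norm (h (\<omega>, x)) \<partial>?D \<partial>M) < \<infinity>" .
  have "(\<integral>\<omega>. indicator E \<omega> * (w u \<omega> - w s \<omega>) \<partial>M) = (\<integral>\<omega>. (\<integral>x. h (\<omega>, x) \<partial>?D) \<partial>M)"
    using increment_fubini(2)[OF st(1) lt st(3) hm fin] by (simp add: h_def)
  also have "\<dots> = 0" using D0 by (simp add: h_def)
  finally have "(\<integral>\<omega>. indicator E \<omega> * w u \<omega> - indicator E \<omega> * w s \<omega> \<partial>M) = 0" by (simp add: right_diff_distrib)
  moreover have "integrable M (\<lambda>\<omega>. indicator E \<omega> * w u \<omega>)" "integrable M (\<lambda>\<omega>. indicator E \<omega> * w s \<omega>)"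
    using integrable_mult_indicator[OF EM integrable_w] st by auto
  ultimately show ?thesis by simp
qed simp

end

context brownian_integrand begin

text \<open>
  Tonelli's theorem moves the expectation inside the integral over time, where \<open>\<bar>w s\<bar>\<close> contributes the
  factor \<open>sqrt s\<close>. The same computation on the whole space gives the integrability in time and chance
  that Fubini's theorem needs.
\<close>

lemma path_integral_weak_moment:
  assumes t: "t \<in> {0..T}" and A: "A \<in> sets M" and \<eta>: "\<eta> > 0"
  shows "(\<integral>\<^sup>+\<omega>\<in>A. ennreal \<bar>blinfun_apply x' (path_integral t \<omega>)\<bar> \<partial>M)
     \<le> ennreal (\<eta> + prob A / \<eta>) * (\<integral>\<^sup>+s. ennreal \<bar>blinfun_apply x' (sqrt s *\<^sub>R \<phi> s)\<bar> \<partial>L)"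
    and "\<exists>v N. N \<in> null_sets M \<and> (\<forall>s\<in>{0..T}. \<forall>\<omega>\<in>space M - N. v s \<omega> = w s \<omega>) \<and> (\<forall>s. v s \<in> borel_measurable M) \<and>
       integrable (L \<Otimes>\<^sub>M M) (\<lambda>(s, \<omega>). v s \<omega> * blinfun_apply x' (\<phi> s))"
proof -
  interpret LM: pair_sigma_finite L M by unfold_locales
  obtain N v where N: "N \<in> null_sets M" and vm': "\<forall>s. v s \<in> borel_measurable M"
    and vw: "\<forall>s\<in>{0..T}. \<forall>\<omega>\<in>space M - N. v s \<omega> = w s \<omega>"
    and joint[measurable]: "(\<lambda>z. v (fst z) (snd z)) \<in> borel_measurable (L \<Otimes>\<^sub>M M)"
    using jointly_measurable_version[OF less_imp_le[OF T]] by (elim exE conjE)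
  define a where "a s = blinfun_apply x' (\<phi> s)" for s
  have am[measurable]: "a \<in> borel_measurable L" unfolding a_def[abs_def] by (rule smeas_functional[OF smeas_\<phi>])
  note [measurable] = measurable_compose[OF measurable_fst am]
  have bound: "(\<integral>\<^sup>+\<omega>. (\<integral>\<^sup>+s. ennreal \<bar>v s \<omega> * a s\<bar> * indicator A \<omega> \<partial>L) \<partial>M)
     \<le> ennreal (\<eta> + prob A / \<eta>) * (\<integral>\<^sup>+s. ennreal \<bar>blinfun_apply x' (sqrt s *\<^sub>R \<phi> s)\<bar> \<partial>L)"
    if A: "A \<in> sets M" and \<eta>: "\<eta> > 0" for A \<eta>
  proof -
    note [measurable] = A
    have "(\<integral>\<^sup>+\<omega>. (\<integral>\<^sup>+s. ennreal \<bar>v s \<omega> * a s\<bar> * indicator A \<omega> \<partial>L) \<partial>M) = (\<integral>\<^sup>+s. (\<integral>\<^sup>+\<omega>. ennreal \<bar>v s \<omega> * a s\<bar> * indicator A \<omega> \<partial>M) \<partial>L)"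
      using LM.Fubini[of "\<lambda>z. ennreal \<bar>v (fst z) (snd z) * a (fst z)\<bar> * indicator A (snd z)"] by simp
    also have "\<dots> \<le> (\<integral>\<^sup>+s. ennreal (\<eta> + prob A / \<eta>) * ennreal \<bar>blinfun_apply x' (sqrt s *\<^sub>R \<phi> s)\<bar> \<partial>L)"
    proof (rule nn_integral_mono)
      fix s assume "s \<in> space L"
      then have s: "s \<in> {0..T}" by simp
      have "(\<integral>\<^sup>+\<omega>. ennreal \<bar>v s \<omega> * a s\<bar> * indicator A \<omega> \<partial>M) = (\<integral>\<^sup>+\<omega>. ennreal \<bar>a s\<bar> * (ennreal \<bar>w s \<omega>\<bar> * indicator A \<omega>) \<partial>M)"
      proof (rule nn_integral_cong_AE)
        show "AE \<omega> in M. ennreal \<bar>v s \<omega> * a s\<bar> * indicator A \<omega> = ennreal \<bar>a s\<bar> * (ennreal \<bar>w s \<omega>\<bar> * indicator A \<omega>)"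
          using AE_not_in[OF N] AE_space
        proof eventually_elim
          case (elim \<omega>)
          then have "v s \<omega> = w s \<omega>" using vw s by simp
          then show ?case by (simp add: abs_mult ennreal_mult mult_ac)
        qed
      qed
      also have "\<dots> = ennreal \<bar>a s\<bar> * (\<integral>\<^sup>+\<omega>\<in>A. ennreal \<bar>w s \<omega>\<bar> \<partial>M)"
        using random_variable_w[OF s] A by (intro nn_integral_cmult borel_measurable_times_ennreal) auto
      also have "\<dots> \<le> ennreal \<bar>a s\<bar> * ennreal (sqrt s * (\<eta> + prob A / \<eta>))"
        by (intro mult_left_mono absolute_moment_on_set s A \<eta>) simp
      also have "\<dots> = ennreal (\<eta> + prob A / \<eta>) * ennreal \<bar>blinfun_apply x' (sqrt s *\<^sub>R \<phi> s)\<bar>"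
      proof -
        have "0 \<le> \<eta> + prob A / \<eta>" using \<eta> by simp
        then show ?thesis
          using s by (simp add: ennreal_mult[symmetric] a_def blinfun.scaleR_right abs_mult mult_ac del: ennreal_plus)
      qed
      finally show "(\<integral>\<^sup>+\<omega>. ennreal \<bar>v s \<omega> * a s\<bar> * indicator A \<omega> \<partial>M) \<le> ennreal (\<eta> + prob A / \<eta>) * ennreal \<bar>blinfun_apply x' (sqrt s *\<^sub>R \<phi> s)\<bar>" .
    qed
    also have "\<dots> = ennreal (\<eta> + prob A / \<eta>) * (\<integral>\<^sup>+s. ennreal \<bar>blinfun_apply x' (sqrt s *\<^sub>R \<phi> s)\<bar> \<partial>L)"
      using smeas_functional[OF smeas_sqrt, of x'] by (intro nn_integral_cmult) measurable
    finally show ?thesis .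
  qed
  have "(\<integral>\<^sup>+\<omega>\<in>A. ennreal \<bar>blinfun_apply x' (path_integral t \<omega>)\<bar> \<partial>M) \<le> (\<integral>\<^sup>+\<omega>. (\<integral>\<^sup>+s. ennreal \<bar>v s \<omega> * a s\<bar> * indicator A \<omega> \<partial>L) \<partial>M)"
  proof (rule nn_integral_mono_AE)
    show "AE \<omega> in M. ennreal \<bar>blinfun_apply x' (path_integral t \<omega>)\<bar> * indicator A \<omega> \<le> (\<integral>\<^sup>+s. ennreal \<bar>v s \<omega> * a s\<bar> * indicator A \<omega> \<partial>L)"
      using AE_regular_paths AE_not_in[OF N]
    proof eventually_elim
      case (elim \<omega>)
      have "integrable L (\<lambda>s. blinfun_apply x' (w s \<omega> *\<^sub>R \<phi> s))"
        by (rule scalarly_ui_integrable[OF L.finite_measure_axioms path_ui[OF elim(1)] path_smeas[OF elim(1)]])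
      then have int: "integrable L (\<lambda>s. w s \<omega> * a s)" by (simp add: a_def blinfun.scaleR_right)
      have "{0<..t} \<in> sets L" using t by (intro measure_lebesgue_on_interval(1)) auto
      from integrable_mult_indicator[OF this int] have "integrable L (\<lambda>s. indicator {0<..t} s * (w s \<omega> * a s))" by simp
      from integral_norm_bound_ennreal[OF this]
      have "ennreal \<bar>blinfun_apply x' (path_integral t \<omega>)\<bar> \<le> (\<integral>\<^sup>+s. ennreal (norm (indicator {0<..t} s * (w s \<omega> * a s))) \<partial>L)"
        using has_bi1_path_integral(2)[OF elim(1) t, of x'] by (simp add: a_def)
      also have "\<dots> \<le> (\<integral>\<^sup>+s. ennreal \<bar>v s \<omega> * a s\<bar> \<partial>L)"
        using vw elim by (intro nn_integral_mono ennreal_leI) (auto simp: indicator_def regular_paths_def)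
      finally show ?case by (cases "\<omega> \<in> A") auto
    qed
  qed
  also note bound[OF A \<eta>]
  finally show "(\<integral>\<^sup>+\<omega>\<in>A. ennreal \<bar>blinfun_apply x' (path_integral t \<omega>)\<bar> \<partial>M)
     \<le> ennreal (\<eta> + prob A / \<eta>) * (\<integral>\<^sup>+s. ennreal \<bar>blinfun_apply x' (sqrt s *\<^sub>R \<phi> s)\<bar> \<partial>L)" .
  have "integrable (L \<Otimes>\<^sub>M M) (\<lambda>(s, \<omega>). v s \<omega> * a s)"
  proof (rule integrableI_bounded)
    show "(\<lambda>(s, \<omega>). v s \<omega> * a s) \<in> borel_measurable (L \<Otimes>\<^sub>M M)" unfolding split_beta' by measurable
    have "(\<integral>\<^sup>+z. ennreal (norm (case z of (s, \<omega>) \<Rightarrow> v s \<omega> * a s)) \<partial>(L \<Otimes>\<^sub>M M)) = (\<integral>\<^sup>+\<omega>. (\<integral>\<^sup>+s. ennreal \<bar>v s \<omega> * a s\<bar> \<partial>L) \<partial>M)"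
      by (subst LM.nn_integral_snd[symmetric]) (auto simp: split_beta')
    also have "\<dots> = (\<integral>\<^sup>+\<omega>. (\<integral>\<^sup>+s. ennreal \<bar>v s \<omega> * a s\<bar> * indicator (space M) \<omega> \<partial>L) \<partial>M)"
      by (intro nn_integral_cong) simp
    also have "\<dots> \<le> ennreal (1 + prob (space M) / 1) * (\<integral>\<^sup>+s. ennreal \<bar>blinfun_apply x' (sqrt s *\<^sub>R \<phi> s)\<bar> \<partial>L)"
      by (rule bound) auto
    also have "\<dots> < \<infinity>"
      using scalarly_ui_integrable[OF L.finite_measure_axioms sqrt_ui smeas_sqrt, of x']
      by (auto simp: integrable_iff_bounded ennreal_mult_less_top)
    finally show "(\<integral>\<^sup>+z. ennreal (norm (case z of (s, \<omega>) \<Rightarrow> v s \<omega> * a s)) \<partial>(L \<Otimes>\<^sub>M M)) < \<infinity>" .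
  qed
  then show "\<exists>v N. N \<in> null_sets M \<and> (\<forall>s\<in>{0..T}. \<forall>\<omega>\<in>space M - N. v s \<omega> = w s \<omega>) \<and> (\<forall>s. v s \<in> borel_measurable M) \<and>
       integrable (L \<Otimes>\<^sub>M M) (\<lambda>(s, \<omega>). v s \<omega> * blinfun_apply x' (\<phi> s))"
    using N vw vm' unfolding a_def by (intro exI[of _ v] exI[of _ N]) simp
qed

text \<open>
  The interval starts at a positive time because near \<open>0\<close> only \<open>sqrt u \<phi> u\<close>, and not \<open>\<phi> u\<close>, is
  known to be integrable.
\<close>

lemma weak_fundamental_theorem:
  fixes x' :: "'x \<Rightarrow>\<^sub>L real"
  assumes st: "0 < s" "s \<le> t" "t \<le> T"
  shows "(\<integral>u. indicator {s<..t} u * blinfun_apply x' (\<phi> u) \<partial>L) = blinfun_apply x' (\<Phi> t) - blinfun_apply x' (\<Phi> s)"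
proof -
  define a where "a u = blinfun_apply x' (\<phi> u)" for u
  have sub: "{s..t} \<subseteq> {0..T}" using st by auto
  have stm: "{s..t} \<in> sets L" "{s..t} \<inter> space L \<in> sets L" using sub by (auto simp: sets_restrict_space_iff Int_absorb2)
  have im: "(\<lambda>u. indicator {s..t} u :: real) \<in> borel_measurable L" using stm by simp
  have TT: "T \<in> {0..T}" using T by simp
  have b: "\<forall>u\<in>{0..T}. \<bar>indicator {s..t} u :: real\<bar> \<le> 1 * indicator {s..} u" by (simp add: indicator_def)
  note cut = cut_integrand[OF TT im b st(1) zero_le_one]
  have "integrable L (\<lambda>u. blinfun_apply x' ((indicator {s..t} u :: real) *\<^sub>R \<phi> u))"
    by (rule scalarly_ui_integrable[OF L.finite_measure_axioms cut])
  then have int: "integrable L (\<lambda>u. indicator {s..t} u *\<^sub>R a u)" by (simp add: a_def blinfun.scaleR_right)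
  then have inta: "integrable (lebesgue_on {s..t}) a"
    unfolding lebesgue_on_subinterval[OF sub] integrable_restrict_space[OF stm(2)] .
  have "(\<integral>u. indicator {s<..t} u * a u \<partial>L) = (\<integral>u. indicator {s..t} u *\<^sub>R a u \<partial>L)"
  proof (rule integral_cong_AE)
    have am: "a \<in> borel_measurable L" unfolding a_def[abs_def] by (rule smeas_functional[OF smeas_\<phi>])
    have "{s<..t} \<in> sets L" using st by (intro measure_lebesgue_on_interval(1)) auto
    then show "(\<lambda>u. indicator {s<..t} u * a u) \<in> borel_measurable L" using am by simp
    show "(\<lambda>u. indicator {s..t} u *\<^sub>R a u) \<in> borel_measurable L" using int by simp
    have "{s} \<in> null_sets L" using st by (auto simp: null_sets_restrict_space)
    then show "AE u in L. indicator {s<..t} u * a u = indicator {s..t} u *\<^sub>R a u"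
      by (rule AE_not_in[THEN eventually_mono]) (auto simp: indicator_def)
  qed
  also have "\<dots> = (\<integral>u. a u \<partial>lebesgue_on {s..t})"
    unfolding lebesgue_on_subinterval[OF sub] by (subst integral_restrict_space[OF stm(2)]) simp
  also have "\<dots> = integral {s..t} a" by (rule lebesgue_integral_eq_integral[OF inta]) simp
  also have "\<dots> = blinfun_apply x' (\<Phi> t) - blinfun_apply x' (\<Phi> s)"
  proof (rule integral_unique, rule fundamental_theorem_of_calculus[OF st(2)])
    fix u assume u: "u \<in> {s..t}"
    then have "(\<Phi> has_vector_derivative \<phi> u) (at u within {0..T})" using st by (intro has_vector_derivative_frechet_deriv_on[OF diff]) auto
    then have "(\<Phi> has_vector_derivative \<phi> u) (at u within {s..t})" by (rule has_vector_derivative_within_subset[OF _ sub])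
    then show "((\<lambda>u. blinfun_apply x' (\<Phi> u)) has_vector_derivative a u) (at u within {s..t})"
      unfolding a_def by (rule bounded_linear.has_vector_derivative[OF blinfun.bounded_linear_right])
  qed
  finally show ?thesis by (simp add: a_def)
qed

text \<open>
  By Fubini's theorem the left side is the integral over \<open>{s<..t}\<close> of \<open>x' (\<phi> u)\<close> times the mean of \<open>w u\<close>
  on \<open>E\<close>. This mean equals that of \<open>w s\<close>, as the increments have mean zero on \<open>E\<close>, so it comes out of
  the integral; for \<open>s = 0\<close> it is zero.
\<close>

lemma path_integral_weak_increment:
  assumes st: "0 \<le> s" "s \<le> t" "t \<le> T" and E: "E \<in> sets (F s)"
    and g: "smeas M g" "\<And>\<omega>. \<omega> \<in> regular_paths \<Longrightarrow> g \<omega> = path_integral t \<omega>" and g': "smeas M g'" "\<And>\<omega>. \<omega> \<in> regular_paths \<Longrightarrow> g' \<omega> = path_integral s \<omega>"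
  shows "(\<integral>\<omega>. indicator E \<omega> * blinfun_apply x' (g \<omega>) \<partial>M) - (\<integral>\<omega>. indicator E \<omega> * blinfun_apply x' (g' \<omega>) \<partial>M)
    = (\<integral>\<omega>. indicator E \<omega> * w s \<omega> \<partial>M) * (blinfun_apply x' (\<Phi> t) - blinfun_apply x' (\<Phi> s))"
proof -
  interpret LM: pair_sigma_finite L M by unfold_locales
  have EM[measurable]: "E \<in> sets M" using E filtration[of s] st by (auto simp: subalgebra_def)
  have tT: "t \<in> {0..T}" using st by simp
  from path_integral_weak_moment(2)[OF tT sets.empty_sets zero_less_one, of x']
  obtain v N where N: "N \<in> null_sets M" and vw: "\<forall>s\<in>{0..T}. \<forall>\<omega>\<in>space M - N. v s \<omega> = w s \<omega>"
    and vm: "\<forall>s. v s \<in> borel_measurable M" and int: "integrable (L \<Otimes>\<^sub>M M) (\<lambda>(s, \<omega>). v s \<omega> * blinfun_apply x' (\<phi> s))" by (elim exE conjE)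
  define a where "a u = blinfun_apply x' (\<phi> u)" for u
  have intJ: "integrable (L \<Otimes>\<^sub>M M) (\<lambda>(s, \<omega>). v s \<omega> * a s)" using int by (simp add: a_def)
  define e where "e u = (\<integral>\<omega>. indicator E \<omega> * v u \<omega> \<partial>M)" for u
  have eu: "e u = (\<integral>\<omega>. indicator E \<omega> * w u \<omega> \<partial>M)" if u: "u \<in> {0..T}" for u
    unfolding e_def
  proof (rule integral_cong_AE)
    show "AE \<omega> in M. indicator E \<omega> * v u \<omega> = indicator E \<omega> * w u \<omega>"
      using AE_not_in[OF N] AE_space by eventually_elim (use vw u in auto)
    have "v u \<in> borel_measurable M" using vm by simp
    then show "(\<lambda>\<omega>. indicator E \<omega> * v u \<omega>) \<in> borel_measurable M" using EM by simp
    show "(\<lambda>\<omega>. indicator E \<omega> * w u \<omega>) \<in> borel_measurable M" using EM random_variable_w[OF u] by simp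
  qed
  have key: "(\<integral>\<omega>. indicator E \<omega> * blinfun_apply x' (f \<omega>) \<partial>M) = (\<integral>u. indicator {0<..p} u * (a u * e u) \<partial>L) \<and>
      integrable L (\<lambda>u. indicator {0<..p} u * (a u * e u))"
    if p: "p \<in> {0..T}" and f: "smeas M f" "\<And>\<omega>. \<omega> \<in> regular_paths \<Longrightarrow> f \<omega> = path_integral p \<omega>" for p f
  proof -
    define H where "H u \<omega> = indicator E \<omega> * (indicator {0<..p} u * (v u \<omega> * a u))" for u \<omega>
    have pm: "{0<..p} \<in> sets L" using p by (intro measure_lebesgue_on_interval(1)) auto
    have Hint: "integrable (L \<Otimes>\<^sub>M M) (\<lambda>(u, \<omega>). H u \<omega>)"
    proof -
      have "integrable (L \<Otimes>\<^sub>M M) (\<lambda>z. indicator ({0<..p} \<times> E) z *\<^sub>R (case z of (s, \<omega>) \<Rightarrow> v s \<omega> * a s))"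
        by (intro integrable_mult_indicator intJ pair_measureI pm EM)
      moreover have "indicator ({0<..p} \<times> E) z *\<^sub>R (case z of (s, \<omega>) \<Rightarrow> v s \<omega> * a s) = (case z of (u, \<omega>) \<Rightarrow> H u \<omega>)" for z
        by (cases z) (simp add: H_def indicator_times)
      ultimately show ?thesis by simp
    qed
    have "(\<integral>\<omega>. indicator E \<omega> * blinfun_apply x' (f \<omega>) \<partial>M) = (\<integral>\<omega>. (\<integral>u. H u \<omega> \<partial>L) \<partial>M)"
    proof (rule integral_cong_AE)
      show "(\<lambda>\<omega>. indicator E \<omega> * blinfun_apply x' (f \<omega>)) \<in> borel_measurable M"
        using smeas_functional[OF f(1), of x'] by measurable
      show "(\<lambda>\<omega>. \<integral>u. H u \<omega> \<partial>L) \<in> borel_measurable M"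
        using LM.integrable_snd[OF Hint] by (rule borel_measurable_integrable)
      show "AE \<omega> in M. indicator E \<omega> * blinfun_apply x' (f \<omega>) = (\<integral>u. H u \<omega> \<partial>L)"
        using AE_regular_paths AE_not_in[OF N]
      proof eventually_elim
        case (elim \<omega>)
        have "(\<integral>u. H u \<omega> \<partial>L) = indicator E \<omega> * (\<integral>u. indicator {0<..p} u * (v u \<omega> * a u) \<partial>L)" by (simp add: H_def)
        also have "(\<integral>u. indicator {0<..p} u * (v u \<omega> * a u) \<partial>L) = (\<integral>u. indicator {0<..p} u * (w u \<omega> * a u) \<partial>L)"
          using vw elim by (intro Bochner_Integration.integral_cong) (auto simp: regular_paths_def)
        also have "\<dots> = blinfun_apply x' (f \<omega>)" using has_bi1_path_integral(2)[OF elim(1) p, of x'] f(2)[OF elim(1)] by (simp add: a_def)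
        finally show ?case by simp
      qed
    qed
    also have "\<dots> = (\<integral>u. (\<integral>\<omega>. H u \<omega> \<partial>M) \<partial>L)" by (rule LM.Fubini_integral[OF Hint])
    finally have 1: "(\<integral>\<omega>. indicator E \<omega> * blinfun_apply x' (f \<omega>) \<partial>M) = (\<integral>u. (\<integral>\<omega>. H u \<omega> \<partial>M) \<partial>L)" .
    have 2: "(\<integral>\<omega>. H u \<omega> \<partial>M) = indicator {0<..p} u * (a u * e u)" for u
    proof -
      have "(\<integral>\<omega>. H u \<omega> \<partial>M) = (\<integral>\<omega>. (indicator {0<..p} u * a u) * (indicator E \<omega> * v u \<omega>) \<partial>M)"
        by (intro Bochner_Integration.integral_cong refl) (simp add: H_def mult_ac)
      also have "\<dots> = (indicator {0<..p} u * a u) * e u" unfolding e_def by (rule integral_mult_right_zero)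
      finally show ?thesis by (simp add: mult.assoc)
    qed
    show ?thesis using 1 LM.integrable_fst[OF Hint] unfolding 2 by simp
  qed
  have sT: "s \<in> {0..T}" using st by simp
  have "(\<integral>\<omega>. indicator E \<omega> * blinfun_apply x' (g \<omega>) \<partial>M) - (\<integral>\<omega>. indicator E \<omega> * blinfun_apply x' (g' \<omega>) \<partial>M)
    = (\<integral>u. indicator {0<..t} u * (a u * e u) - indicator {0<..s} u * (a u * e u) \<partial>L)"
    using key[OF tT g] key[OF sT g'] by simp
  also have "\<dots> = (\<integral>u. e s * (indicator {s<..t} u * a u) \<partial>L)"
  proof (rule Bochner_Integration.integral_cong[OF refl])
    fix u assume "u \<in> space L"
    have "e u = e s" if "u \<in> {s<..t}"
      using increment_orthogonal[OF st(1) _ _ E, of u] eu[of u] eu[OF sT] that st by simp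
    then show "indicator {0<..t} u * (a u * e u) - indicator {0<..s} u * (a u * e u) = e s * (indicator {s<..t} u * a u)"
      using st by (auto simp: indicator_def)
  qed
  also have "\<dots> = e s * (\<integral>u. indicator {s<..t} u * a u \<partial>L)" by simp
  also have "\<dots> = e s * (blinfun_apply x' (\<Phi> t) - blinfun_apply x' (\<Phi> s))"
  proof (cases "s = 0")
    case True
    have "e s = (\<integral>\<omega>. 0 \<partial>M)"
      unfolding eu[OF sT] using starts_at_0 True random_variable_w[OF sT] by (intro integral_cong_AE) (auto elim: eventually_mono)
    then show ?thesis by simp
  next
    case False
    then show ?thesis using weak_fundamental_theorem[of s t x'] st by (simp add: a_def)
  qed
  finally show ?thesis using eu[OF sT] by simp
qed

text \<open>
  Almost surely the stochastic integral agrees with an adapted function. Its scalar uniform integrability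
  holds with the modulus \<open>\<eta>\<^sup>2\<close>: on an event of smaller probability, \<open>\<eta> + prob A / \<eta>\<close> is below \<open>2 \<eta>\<close>,
  and both the boundary term and the path integral are bounded by a constant times this number.
\<close>

lemma bi1_star_integral_version:
  assumes t: "t \<in> {0..T}"
  shows "\<exists>c g. smeas (F t) c \<and> scalarly_ui M c \<and> smeas M g \<and> (\<forall>\<omega>\<in>regular_paths. g \<omega> = path_integral t \<omega>) \<and>
    (\<forall>\<omega>\<in>regular_paths. c \<omega> = bi1_star_integral T w \<Phi> 0 t \<omega>) \<and> (\<forall>\<omega>. c \<omega> = w t \<omega> *\<^sub>R \<Phi> t - w 0 \<omega> *\<^sub>R \<Phi> 0 - g \<omega>)"
proof -
  from path_integral_adapted[OF t] obtain g where g: "smeas (F t) g" "\<forall>\<omega>\<in>regular_paths. g \<omega> = path_integral t \<omega>" by (elim exE conjE)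
  define c where "c \<omega> = w t \<omega> *\<^sub>R \<Phi> t - w 0 \<omega> *\<^sub>R \<Phi> 0 - g \<omega>" for \<omega>
  have w0: "w 0 \<in> borel_measurable (F t)" using adapted_later[of 0 t] t by simp
  have c: "smeas (F t) c" unfolding c_def by (intro smeas_diff smeas_scaleR smeas_const g adapted[OF t] w0)
  have gM: "smeas M g" by (rule smeas_subalgebra[OF filtration[OF t] g(1)])
  from scalarly_ui_bounded_integrals[OF L.finite_measure_axioms sqrt_ui smeas_sqrt] obtain K where K: "K \<ge> 0"
    "\<forall>x' :: 'x \<Rightarrow>\<^sub>L real. norm x' \<le> 1 \<longrightarrow> (\<integral>\<^sup>+s. ennreal \<bar>blinfun_apply x' (sqrt s *\<^sub>R \<phi> s)\<bar> \<partial>L) \<le> ennreal K" by (elim exE conjE)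
  define B where "B = norm (\<Phi> t) * sqrt t + K + 1"
  have B: "B > 0" unfolding B_def using K t by (intro add_nonneg_pos add_nonneg_nonneg) auto
  have "scalarly_ui M c"
    unfolding scalarly_ui_def
  proof (intro allI impI)
    fix \<epsilon> :: real assume \<epsilon>: "\<epsilon> > 0"
    define \<eta> where "\<eta> = \<epsilon> / (2 * B)"
    have \<eta>: "\<eta> > 0" using \<epsilon> B by (simp add: \<eta>_def)
    show "\<exists>\<delta>>0. \<forall>A\<in>sets M. measure M A < \<delta> \<longrightarrow> (\<forall>x' :: 'x \<Rightarrow>\<^sub>L real. norm x' \<le> 1 \<longrightarrow>
       (\<integral>\<^sup>+\<omega>\<in>A. ennreal \<bar>blinfun_apply x' (c \<omega>)\<bar> \<partial>M) \<le> ennreal \<epsilon>)"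
    proof (intro exI[of _ "\<eta>\<^sup>2"] conjI ballI impI allI)
      show "\<eta>\<^sup>2 > 0" using \<eta> by simp
      fix A and x' :: "'x \<Rightarrow>\<^sub>L real" assume A: "A \<in> sets M" "measure M A < \<eta>\<^sup>2" and x': "norm x' \<le> 1"
      let ?q = "\<eta> + prob A / \<eta>"
      have q: "?q \<le> 2 * \<eta>" "0 \<le> ?q" using A(2) \<eta> by (auto simp: field_simps power2_eq_square)
      have [measurable]: "w t \<in> borel_measurable M" "A \<in> sets M" using random_variable_w[OF t] A by auto
      have gx[measurable]: "(\<lambda>\<omega>. blinfun_apply x' (g \<omega>)) \<in> borel_measurable M" by (rule smeas_functional[OF gM])
      have "(\<integral>\<^sup>+\<omega>\<in>A. ennreal \<bar>blinfun_apply x' (c \<omega>)\<bar> \<partial>M)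
        \<le> (\<integral>\<^sup>+\<omega>. ennreal (norm (\<Phi> t)) * (ennreal \<bar>w t \<omega>\<bar> * indicator A \<omega>) + ennreal \<bar>blinfun_apply x' (g \<omega>)\<bar> * indicator A \<omega> \<partial>M)"
      proof (rule nn_integral_mono_AE)
        show "AE \<omega> in M. ennreal \<bar>blinfun_apply x' (c \<omega>)\<bar> * indicator A \<omega>
          \<le> ennreal (norm (\<Phi> t)) * (ennreal \<bar>w t \<omega>\<bar> * indicator A \<omega>) + ennreal \<bar>blinfun_apply x' (g \<omega>)\<bar> * indicator A \<omega>"
          using AE_regular_paths
        proof eventually_elim
          case (elim \<omega>)
          then have "blinfun_apply x' (c \<omega>) = w t \<omega> * blinfun_apply x' (\<Phi> t) - blinfun_apply x' (g \<omega>)"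
            by (simp add: c_def regular_paths_def blinfun.diff_right blinfun.scaleR_right)
          then have "\<bar>blinfun_apply x' (c \<omega>)\<bar> \<le> \<bar>w t \<omega>\<bar> * \<bar>blinfun_apply x' (\<Phi> t)\<bar> + \<bar>blinfun_apply x' (g \<omega>)\<bar>"
            using abs_triangle_ineq4[of "w t \<omega> * blinfun_apply x' (\<Phi> t)" "blinfun_apply x' (g \<omega>)"] by (simp add: abs_mult)
          also have "\<dots> \<le> norm (\<Phi> t) * \<bar>w t \<omega>\<bar> + \<bar>blinfun_apply x' (g \<omega>)\<bar>"
            using mult_left_mono[OF functional_le_norm[OF x', of "\<Phi> t"], of "\<bar>w t \<omega>\<bar>"] by (simp add: mult.commute)
          finally have "ennreal \<bar>blinfun_apply x' (c \<omega>)\<bar> \<le> ennreal (norm (\<Phi> t)) * ennreal \<bar>w t \<omega>\<bar> + ennreal \<bar>blinfun_apply x' (g \<omega>)\<bar>"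
            by (simp add: ennreal_mult[symmetric] ennreal_plus[symmetric] ennreal_leI del: ennreal_plus)
          then show ?case by (cases "\<omega> \<in> A") auto
        qed
      qed
      also have "\<dots> = ennreal (norm (\<Phi> t)) * (\<integral>\<^sup>+\<omega>\<in>A. ennreal \<bar>w t \<omega>\<bar> \<partial>M) + (\<integral>\<^sup>+\<omega>\<in>A. ennreal \<bar>blinfun_apply x' (g \<omega>)\<bar> \<partial>M)"
        by (simp add: nn_integral_add nn_integral_cmult)
      also have "(\<integral>\<^sup>+\<omega>\<in>A. ennreal \<bar>blinfun_apply x' (g \<omega>)\<bar> \<partial>M) = (\<integral>\<^sup>+\<omega>\<in>A. ennreal \<bar>blinfun_apply x' (path_integral t \<omega>)\<bar> \<partial>M)"
        using AE_regular_paths g(2) by (intro nn_integral_cong_AE) (auto elim!: eventually_mono)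
      also have "ennreal (norm (\<Phi> t)) * (\<integral>\<^sup>+\<omega>\<in>A. ennreal \<bar>w t \<omega>\<bar> \<partial>M) + (\<integral>\<^sup>+\<omega>\<in>A. ennreal \<bar>blinfun_apply x' (path_integral t \<omega>)\<bar> \<partial>M)
        \<le> ennreal (norm (\<Phi> t)) * ennreal (sqrt t * ?q) + ennreal ?q * ennreal K"
      proof (intro add_mono mult_left_mono)
        show "(\<integral>\<^sup>+\<omega>\<in>A. ennreal \<bar>w t \<omega>\<bar> \<partial>M) \<le> ennreal (sqrt t * ?q)" by (rule absolute_moment_on_set[OF t A(1) \<eta>])
        have "(\<integral>\<^sup>+\<omega>\<in>A. ennreal \<bar>blinfun_apply x' (path_integral t \<omega>)\<bar> \<partial>M) \<le> ennreal ?q * (\<integral>\<^sup>+s. ennreal \<bar>blinfun_apply x' (sqrt s *\<^sub>R \<phi> s)\<bar> \<partial>L)"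
          by (rule path_integral_weak_moment(1)[OF t A(1) \<eta>])
        also have "\<dots> \<le> ennreal ?q * ennreal K" using K(2) x' by (intro mult_left_mono) auto
        finally show "(\<integral>\<^sup>+\<omega>\<in>A. ennreal \<bar>blinfun_apply x' (path_integral t \<omega>)\<bar> \<partial>M) \<le> ennreal ?q * ennreal K" .
      qed simp
      also have "\<dots> = ennreal ((norm (\<Phi> t) * sqrt t + K) * ?q)"
      proof -
        have "0 \<le> sqrt t * ?q" using q t by simp
        then show ?thesis using q(2) K(1)
          by (simp only: ennreal_mult[symmetric] ennreal_plus[symmetric] norm_ge_zero mult_nonneg_nonneg) (simp add: algebra_simps)
      qed
      also have "\<dots> \<le> ennreal \<epsilon>"
      proof (rule ennreal_leI)
        have "(norm (\<Phi> t) * sqrt t + K) * ?q \<le> B * (2 * \<eta>)"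
          using q K(1) t B unfolding B_def by (intro mult_mono) auto
        also have "\<dots> = \<epsilon>" using B by (simp add: \<eta>_def)
        finally show "(norm (\<Phi> t) * sqrt t + K) * ?q \<le> \<epsilon>" .
      qed
      finally show "(\<integral>\<^sup>+\<omega>\<in>A. ennreal \<bar>blinfun_apply x' (c \<omega>)\<bar> \<partial>M) \<le> ennreal \<epsilon>" .
    qed
  qed
  moreover have "\<forall>\<omega>\<in>regular_paths. c \<omega> = bi1_star_integral T w \<Phi> 0 t \<omega>"
    using g(2) by (simp add: c_def bi1_star_integral_def path_integral_def)
  ultimately show ?thesis using c g(2) gM by (intro exI[of _ c] exI[of _ g]) (simp add: c_def)
qed

text \<open>
  On an event \<open>E\<close> of the past and after application of \<open>x'\<close>, the boundary term at \<open>t\<close> exceeds the one at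
  \<open>s\<close> by the mean of \<open>w s\<close> on \<open>E\<close> times \<open>x' (\<Phi> t) - x' (\<Phi> s)\<close>, which is exactly the increment of the
  path integral.
\<close>

theorem bi1_star_integral_martingale:
  assumes C: "\<And>t \<omega>. t \<in> {0..T} \<Longrightarrow> \<omega> \<in> space M \<Longrightarrow> C t \<omega> = bi1_star_integral T w \<Phi> 0 t \<omega>"
  shows "bi1_martingale M F T C"
  unfolding bi1_martingale_def
proof (intro allI impI)
  fix s t assume "0 \<le> s \<and> s \<le> t \<and> t \<le> T"
  then have st: "0 \<le> s" "s \<le> t" "t \<le> T" and tT: "t \<in> {0..T}" and sT: "s \<in> {0..T}" by auto
  have fM: "finite_measure M" by unfold_locales
  obtain N where N: "{\<omega>\<in>space M. \<omega> \<notin> regular_paths} \<subseteq> N" "emeasure M N = 0" "N \<in> sets M"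
    by (rule AE_E[OF AE_regular_paths])
  then have Nn: "N \<in> null_sets M" by (auto intro: null_setsI)
  have gN: "\<omega> \<in> regular_paths" if "\<omega> \<in> space M" "\<omega> \<notin> N" for \<omega> using N(1) that by auto
  from bi1_star_integral_version[OF tT] obtain c g where c: "smeas (F t) c" "scalarly_ui M c" and g: "smeas M g" "\<forall>\<omega>\<in>regular_paths. g \<omega> = path_integral t \<omega>"
    and cC: "\<forall>\<omega>\<in>regular_paths. c \<omega> = bi1_star_integral T w \<Phi> 0 t \<omega>" and cg: "\<forall>\<omega>. c \<omega> = w t \<omega> *\<^sub>R \<Phi> t - w 0 \<omega> *\<^sub>R \<Phi> 0 - g \<omega>" by (elim exE conjE)
  from bi1_star_integral_version[OF sT] obtain c' g' where c': "smeas (F s) c'" "scalarly_ui M c'" and g': "smeas M g'" "\<forall>\<omega>\<in>regular_paths. g' \<omega> = path_integral s \<omega>"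
    and c'C: "\<forall>\<omega>\<in>regular_paths. c' \<omega> = bi1_star_integral T w \<Phi> 0 s \<omega>" and c'g: "\<forall>\<omega>. c' \<omega> = w s \<omega> *\<^sub>R \<Phi> s - w 0 \<omega> *\<^sub>R \<Phi> 0 - g' \<omega>" by (elim exE conjE)
  have cM: "smeas M c" and c'M: "smeas M c'"
    using smeas_subalgebra[OF filtration[OF tT] c(1)] smeas_subalgebra[OF filtration[OF sT] c'(1)] .
  have cCt: "c \<omega> = C t \<omega>" "c' \<omega> = C s \<omega>" if "\<omega> \<in> space M" "\<omega> \<notin> N" for \<omega>
    using gN[OF that] cC c'C C[OF tT that(1)] C[OF sT that(1)] by auto
  have integrable: "bi1_integrable M (C u)" if "smeas M d" "scalarly_ui M d" "\<And>\<omega>. \<omega> \<in> space M \<Longrightarrow> \<omega> \<notin> N \<Longrightarrow> d \<omega> = C u \<omega>" for d u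
    using scalarly_ui_imp_has_bi1_integral[OF fM that(2,1)] has_bi1_integral_cong_null[OF _ Nn that(3)]
    unfolding bi1_integrable_def by (elim exE conjE) (rule exI)
  show "is_bi1_cond_exp M (F s) (C t) (C s)"
    unfolding is_bi1_cond_exp_def
  proof (intro conjI ballI)
    show "bi1_integrable M (C t)" using cM c(2) cCt(1) by (rule integrable)
    show "bi1_integrable M (C s)" using c'M c'(2) cCt(2) by (rule integrable)
    from c'(1) obtain a where a: "\<forall>n. simple_function (F s) (a n)" "\<forall>\<omega>\<in>space (F s). (\<lambda>n. a n \<omega>) \<longlonglongrightarrow> c' \<omega>"
      unfolding smeas_def by (elim exE conjE)
    have "AE \<omega> in M. (\<lambda>n. a n \<omega>) \<longlonglongrightarrow> C s \<omega>"
      using AE_not_in[OF Nn] AE_space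
    proof eventually_elim
      case (elim \<omega>)
      then have "(\<lambda>n. a n \<omega>) \<longlonglongrightarrow> c' \<omega>" using a(2) filtration[OF sT] by (simp add: subalgebra_def)
      then show ?case using cCt(2) elim by simp
    qed
    then show "strongly_measurable M (F s) (C s)" unfolding strongly_measurable_def using a(1) by blast
    fix E assume E: "E \<in> sets (F s)"
    have EM: "E \<in> sets M" using E filtration[OF sT] by (auto simp: subalgebra_def)
    have EM': "E \<inter> space M \<in> sets M" "E \<subseteq> space M" using EM sets.sets_into_space by auto
    let ?R = "restrict_space M E"
    have fR: "finite_measure ?R" by (rule finite_measure_restrict_space[OF fM]) (rule EM)
    have NR: "N \<inter> E \<in> null_sets ?R"
      using EM' EM N Nn by (auto simp: null_sets_restrict_space intro: null_set_Int2)
    from scalarly_ui_imp_has_bi1_integral[OF fR scalarly_ui_restrict_space[OF c(2) EM] smeas_restrict_space[OF cM]]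
    obtain I where I: "has_bi1_integral ?R c I" "\<forall>x' :: 'x \<Rightarrow>\<^sub>L real. blinfun_apply x' I = (\<integral>\<omega>. blinfun_apply x' (c \<omega>) \<partial>?R)" by (elim exE conjE)
    from scalarly_ui_imp_has_bi1_integral[OF fR scalarly_ui_restrict_space[OF c'(2) EM] smeas_restrict_space[OF c'M]]
    obtain I' where I': "has_bi1_integral ?R c' I'" "\<forall>x' :: 'x \<Rightarrow>\<^sub>L real. blinfun_apply x' I' = (\<integral>\<omega>. blinfun_apply x' (c' \<omega>) \<partial>?R)" by (elim exE conjE)
    have C1: "has_bi1_integral ?R (C t) I" "has_bi1_integral ?R (C s) I'"
      by (rule has_bi1_integral_cong_null[OF I(1) NR] has_bi1_integral_cong_null[OF I'(1) NR],
          use cCt EM' in \<open>auto simp: space_restrict_space\<close>)+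
    have "I = I'"
    proof (rule eq_by_functionals)
      fix x' :: "'x \<Rightarrow>\<^sub>L real"
      have iw: "integrable M (\<lambda>\<omega>. indicator E \<omega> * w u \<omega>)" if "u \<in> {0..T}" for u
        using integrable_mult_indicator[OF EM integrable_w[OF that]] by simp
      have expand: "blinfun_apply x' K = (\<integral>\<omega>. indicator E \<omega> * w u \<omega> \<partial>M) * blinfun_apply x' (\<Phi> u) - (\<integral>\<omega>. indicator E \<omega> * w 0 \<omega> \<partial>M) * blinfun_apply x' (\<Phi> 0)
          - (\<integral>\<omega>. indicator E \<omega> * blinfun_apply x' (h \<omega>) \<partial>M)"
        if u: "u \<in> {0..T}" and d: "smeas M d" "scalarly_ui M d" and dh: "\<forall>\<omega>. d \<omega> = w u \<omega> *\<^sub>R \<Phi> u - w 0 \<omega> *\<^sub>R \<Phi> 0 - h \<omega>"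
          and K: "\<forall>x' :: 'x \<Rightarrow>\<^sub>L real. blinfun_apply x' K = (\<integral>\<omega>. blinfun_apply x' (d \<omega>) \<partial>?R)" for u d h K
      proof -
        have z: "0 \<in> {0..T}" using T by simp
        have id: "integrable M (\<lambda>\<omega>. indicator E \<omega> * blinfun_apply x' (d \<omega>))"
          using integrable_mult_indicator[OF EM scalarly_ui_integrable[OF fM d(2,1), of x']] by simp
        have h: "indicator E \<omega> * blinfun_apply x' (h \<omega>) = (indicator E \<omega> * w u \<omega>) * blinfun_apply x' (\<Phi> u) - (indicator E \<omega> * w 0 \<omega>) * blinfun_apply x' (\<Phi> 0)
           - indicator E \<omega> * blinfun_apply x' (d \<omega>)" for \<omega>
        proof -
          have "blinfun_apply x' (h \<omega>) = w u \<omega> * blinfun_apply x' (\<Phi> u) - w 0 \<omega> * blinfun_apply x' (\<Phi> 0) - blinfun_apply x' (d \<omega>)"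
            unfolding dh[rule_format, of \<omega>] by (simp add: blinfun.diff_right blinfun.scaleR_right)
          then show ?thesis by (simp add: right_diff_distrib mult.assoc)
        qed
        note i1 = integrable_mult_left[OF iw[OF u], of "blinfun_apply x' (\<Phi> u)"] and i2 = integrable_mult_left[OF iw[OF z], of "blinfun_apply x' (\<Phi> 0)"]
        have "(\<integral>\<omega>. indicator E \<omega> * blinfun_apply x' (h \<omega>) \<partial>M) = (\<integral>\<omega>. indicator E \<omega> * w u \<omega> \<partial>M) * blinfun_apply x' (\<Phi> u) - (\<integral>\<omega>. indicator E \<omega> * w 0 \<omega> \<partial>M) * blinfun_apply x' (\<Phi> 0)
          - (\<integral>\<omega>. indicator E \<omega> * blinfun_apply x' (d \<omega>) \<partial>M)"
          unfolding h using i1 i2 id by (simp only: Bochner_Integration.integral_diff Bochner_Integration.integrable_diff integral_mult_left_zero)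
        moreover have "blinfun_apply x' K = (\<integral>\<omega>. indicator E \<omega> * blinfun_apply x' (d \<omega>) \<partial>M)"
          using K by (simp add: integral_restrict_space[OF EM'(1)])
        ultimately show ?thesis by simp
      qed
      have eq: "(\<integral>\<omega>. indicator E \<omega> * w t \<omega> \<partial>M) = (\<integral>\<omega>. indicator E \<omega> * w s \<omega> \<partial>M)" by (rule increment_orthogonal[OF st E])
      have "(\<integral>\<omega>. indicator E \<omega> * blinfun_apply x' (g \<omega>) \<partial>M) - (\<integral>\<omega>. indicator E \<omega> * blinfun_apply x' (g' \<omega>) \<partial>M)
         = (\<integral>\<omega>. indicator E \<omega> * w s \<omega> \<partial>M) * (blinfun_apply x' (\<Phi> t) - blinfun_apply x' (\<Phi> s))"
        by (rule path_integral_weak_increment[OF st E g(1) _ g'(1)]) (use g(2) g'(2) in auto)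
      then show "blinfun_apply x' I = blinfun_apply x' I'"
        unfolding expand[OF tT cM c(2) cg I(2)] expand[OF sT c'M c'(2) c'g I'(2)] eq by (simp add: algebra_simps)
    qed
    then show "bi1_integral ?R (C t) = bi1_integral ?R (C s)" using bi1_integral_eqI[OF C1(1)] bi1_integral_eqI[OF C1(2)] by simp
  qed
qed

end

section \<open>The change of measure\<close>

text \<open>
  Over the interval \<open>{0..0}\<close> all elementary integrals vanish identically, so their limit in mean square
  does too.
\<close>

lemma ito_integral_at_0:
  assumes "is_ito_integral M F w 0 H I"
  shows "AE \<omega> in M. I \<omega> = 0"
proof -
  from assms obtain n \<tau> \<xi> where el: "\<forall>k. elementary_data F 0 (n k) (\<tau> k) (\<xi> k)" and Im: "I \<in> borel_measurable M"
    and lim: "(\<lambda>k. \<integral>\<^sup>+\<omega>. ennreal ((elementary_ito_integral w (n k) (\<tau> k) (\<xi> k) \<omega> - I \<omega>)\<^sup>2) \<partial>M) \<longlonglongrightarrow> 0"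
    unfolding is_ito_integral_def by (elim exE conjE)
  have "elementary_ito_integral w (n k) (\<tau> k) (\<xi> k) \<omega> = 0" for k \<omega>
    unfolding elementary_ito_integral_def
  proof (rule sum.neutral, rule ballI)
    fix i assume "i \<in> {..<n k}"
    then have "\<tau> k (Suc i) = 0" "\<tau> k i = 0"
      using el[rule_format, of k] by (auto simp: elementary_data_def intro!: antisym)
    then show "\<xi> k i \<omega> * (w (\<tau> k (Suc i)) \<omega> - w (\<tau> k i) \<omega>) = 0" by simp
  qed
  then have "(\<integral>\<^sup>+\<omega>. ennreal ((I \<omega>)\<^sup>2) \<partial>M) = 0" using lim by (simp add: LIMSEQ_const_iff)
  then show ?thesis using Im by (subst (asm) nn_integral_0_iff_AE) auto
qed

context brownian begin

lemma martingale_expectation: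
  assumes "real_martingale M F T Y" "0 \<le> T"
  shows "(\<integral>\<omega>. Y T \<omega> \<partial>M) = (\<integral>\<omega>. Y 0 \<omega> \<partial>M)"
proof -
  have Y: "integrable M (Y T)" "Y 0 \<in> borel_measurable (F 0)" and ce: "AE \<omega> in M. real_cond_exp M (F 0) (Y T) \<omega> = Y 0 \<omega>"
    using assms unfolding real_martingale_def by auto
  have sub: "subalgebra M (F 0)" using filtration[of 0] assms(2) by simp
  interpret S: finite_measure_subalgebra M "F 0" by unfold_locales (rule sub)
  have "(\<integral>\<omega>. Y T \<omega> \<partial>M) = (\<integral>\<omega>. real_cond_exp M (F 0) (Y T) \<omega> \<partial>M)" by (rule S.real_cond_exp_int(2)[OF Y(1), symmetric])
  also have "\<dots> = (\<integral>\<omega>. Y 0 \<omega> \<partial>M)"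
    by (rule integral_cong_AE[OF _ measurable_from_subalg[OF sub Y(2)] ce]) simp
  finally show ?thesis .
qed

end

theorem theorem4p8:
  fixes T :: real
    and P :: "'w measure"
    and F :: "real \<Rightarrow> 'w measure"
    and w W :: "real \<Rightarrow> 'w \<Rightarrow> real"
    and \<Phi> \<Psi> :: "real \<Rightarrow> 'x::banach"
    and C :: "real \<Rightarrow> 'w \<Rightarrow> 'x"
    and r :: "real \<Rightarrow> real"
    and J y :: "real \<Rightarrow> 'w \<Rightarrow> real"
    and Q :: "'w measure"
  assumes "T > 0"
    and "brownian_motion P F T w"
    and "bi1_star_integrable P T w \<Phi>" and "bi1_star_integrable P T w \<Psi>"
    and "weakly_regular T \<Phi>" and "weakly_regular T \<Psi>"
    and C: "\<And>t \<omega>. t \<in> {0..T} \<Longrightarrow> \<omega> \<in> space P \<Longrightarrow>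
              C t \<omega> = bi1_integral (lebesgue_on {0..t}) \<Psi> + bi1_star_integral T w \<Phi> 0 t \<omega>"
    and "square_integrable (lebesgue_on {0..T}) r"
    and "\<And>t. t \<in> {0..T} \<Longrightarrow> \<Psi> t = r t *\<^sub>R \<Phi> t"
    and J: "\<And>t. t \<in> {0..T} \<Longrightarrow> is_ito_integral P F w t (\<lambda>s \<omega>. r s) (J t)"
    and y: "\<And>t \<omega>. t \<in> {0..T} \<Longrightarrow> \<omega> \<in> space P \<Longrightarrow>
              y t \<omega> = exp (- (1/2) * (\<integral>s. (r s)\<^sup>2 \<partial>lebesgue_on {0..t}) - J t \<omega>)"
    and "real_martingale P F T y"
    and Q: "Q = density P (\<lambda>\<omega>. ennreal (y T \<omega>))"
    and W: "\<And>t \<omega>. t \<in> {0..T} \<Longrightarrow> \<omega> \<in> space P \<Longrightarrow>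
              W t \<omega> = w t \<omega> + (\<integral>s. r s \<partial>lebesgue_on {0..t})"
  shows "brownian_motion Q (natural_filtration Q W) T W \<and>
         bi1_star_integrable Q T W \<Phi> \<and>
         (\<forall>t\<in>{0..T}. \<forall>\<omega>\<in>space Q. C t \<omega> = bi1_star_integral T W \<Phi> 0 t \<omega>) \<and>
         bi1_martingale Q (natural_filtration Q W) T C"
proof -
  let ?L = "lebesgue_on {0..T}" and ?\<phi> = "frechet_deriv_on T \<Phi>"
  let ?R = "\<lambda>t. \<integral>s. r s \<partial>lebesgue_on {0..t}"
  have T0: "0 \<le> T" "0 \<in> {0..T}" "T \<in> {0..T}" using \<open>T > 0\<close> by auto
  interpret brownian P F T w by unfold_locales (rule assms(2))
  have diff: "\<Phi> differentiable_on {0..T}" and integ: "\<forall>\<omega>\<in>space P. bi1_integrable ?L (\<lambda>s. w s \<omega> *\<^sub>R ?\<phi> s)"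
    using assms(3) by (auto simp: bi1_star_integrable_def)
  interpret w: brownian_integrand P F T w \<Phi> by unfold_locales (use \<open>T > 0\<close> diff integ in auto)

  \<comment> \<open>As a martingale, \<open>y\<close> keeps the mean of \<open>y 0\<close>, which is one because the Ito integral over
    \<open>{0..0}\<close> vanishes.\<close>
  have yT: "integrable P (y T)" using assms(12) T0 by (simp add: real_martingale_def)
  have "(\<integral>\<omega>. y T \<omega> \<partial>P) = (\<integral>\<omega>. y 0 \<omega> \<partial>P)" by (rule martingale_expectation[OF assms(12) T0(1)])
  also have "\<dots> = (\<integral>\<omega>. 1 \<partial>P)"
  proof (rule integral_cong_AE)
    have "integrable P (y 0)" using assms(12) T0 by (simp add: real_martingale_def)
    then show "y 0 \<in> borel_measurable P" by simp
    show "AE \<omega> in P. y 0 \<omega> = 1"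
      using ito_integral_at_0[OF J[OF T0(2)]] AE_space
    proof eventually_elim
      case (elim \<omega>)
      then show ?case using y[OF T0(2) elim(2)] integral_lebesgue_on_0[of "\<lambda>s. (r s)\<^sup>2"] by simp
    qed
  qed simp
  finally have y1: "(\<integral>\<omega>. y T \<omega> \<partial>P) = 1" by (simp add: prob_space)
  have BQ: "brownian_motion Q (natural_filtration Q W) T W"
    unfolding Q by (rule girsanov[OF T0(1) assms(8) J[OF T0(3)] y[OF T0(3)] yT y1 W])
  have spQ: "space Q = space P" by (simp add: Q)

  have cont: "continuous_on {0..T} \<Psi>" using assms(4) differentiable_imp_continuous_on by (auto simp: bi1_star_integrable_def)
  have parts: "bi1_integrable ?L (\<lambda>s. ?R s *\<^sub>R ?\<phi> s)"
    "\<And>t. t \<in> {0..T} \<Longrightarrow> bi1_integral (lebesgue_on {0..t}) \<Psi> + bi1_integral (lebesgue_on {0..t}) (\<lambda>s. ?R s *\<^sub>R ?\<phi> s) = ?R t *\<^sub>R \<Phi> t"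
    by (rule bi1_integral_by_parts[OF diff cont _ assms(8) w.sqrt_ui]; simp add: assms(9))+
  have restrict: "has_bi1_integral (lebesgue_on {0..t}) f (bi1_integral (lebesgue_on {0..t}) f)"
    if "t \<in> {0..T}" "bi1_integrable ?L f" for t and f :: "real \<Rightarrow> 'x"
    unfolding lebesgue_on_subinterval[OF w.initial_subset[OF that(1)]]
    by (rule has_bi1_integral_integral[OF bi1_integrable_restrict_space[OF that(2) w.initial_sets[OF that(1)]]])
  \<comment> \<open>On \<open>{0..T}\<close> the integrand for \<open>W\<close> is the sum of those for \<open>w\<close> and for its drift.\<close>
  have sum: "has_bi1_integral (lebesgue_on {0..t}) (\<lambda>s. W s \<omega> *\<^sub>R ?\<phi> s)
      (bi1_integral (lebesgue_on {0..t}) (\<lambda>s. w s \<omega> *\<^sub>R ?\<phi> s) + bi1_integral (lebesgue_on {0..t}) (\<lambda>s. ?R s *\<^sub>R ?\<phi> s))"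
    if t: "t \<in> {0..T}" and \<omega>: "\<omega> \<in> space P" for t \<omega>
  proof (rule has_bi1_integral_cong_null[OF has_bi1_integral_add[OF restrict[OF t] restrict[OF t parts(1)]], where N = "{}"])
    show "bi1_integrable ?L (\<lambda>s. w s \<omega> *\<^sub>R ?\<phi> s)" using integ \<omega> by simp
    fix s assume "s \<in> space (lebesgue_on {0..t})"
    then have "s \<in> {0..T}" using t by auto
    then show "w s \<omega> *\<^sub>R ?\<phi> s + ?R s *\<^sub>R ?\<phi> s = W s \<omega> *\<^sub>R ?\<phi> s" by (simp add: W[OF _ \<omega>] scaleR_add_left)
  qed simp_all
  have iW: "bi1_star_integrable Q T W \<Phi>"
    unfolding bi1_star_integrable_def spQ bi1_integrable_def using diff sum[OF T0(3)] by blast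
  have CW: "C t \<omega> = bi1_star_integral T W \<Phi> 0 t \<omega>" if t: "t \<in> {0..T}" and \<omega>: "\<omega> \<in> space Q" for t \<omega>
  proof -
    have \<omega>P: "\<omega> \<in> space P" using \<omega> spQ by simp
    have W0: "W 0 \<omega> = w 0 \<omega>" using W[OF T0(2) \<omega>P] integral_lebesgue_on_0[of r] by simp
    have \<Psi>: "bi1_integral (lebesgue_on {0..t}) \<Psi> = ?R t *\<^sub>R \<Phi> t - bi1_integral (lebesgue_on {0..t}) (\<lambda>s. ?R s *\<^sub>R ?\<phi> s)"
      using parts(2)[OF t] by (simp add: eq_diff_eq)
    show ?thesis
      unfolding C[OF t \<omega>P] \<Psi> bi1_star_integral_def bi1_integral_eqI[OF sum[OF t \<omega>P]] W0 W[OF t \<omega>P]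
      by (simp add: scaleR_add_left algebra_simps)
  qed
  interpret W: brownian_integrand Q "natural_filtration Q W" T W \<Phi>
    by unfold_locales (use BQ iW \<open>T > 0\<close> in \<open>auto simp: bi1_star_integrable_def\<close>)
  have "bi1_martingale Q (natural_filtration Q W) T C" by (rule W.bi1_star_integral_martingale[OF CW])
  then show ?thesis using BQ iW CW by blast
qed

end
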